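(* Let $i\in\{0,1\}$ and let the setting and standing assumptions described in the context hold. Assume that: (1) there are $b_0\ge 1$, $l\ge 0$ with $n_0(x,s):=\int_0^s b(x,m,s)\,dm\le b_0(1+s^l)$ for a.a. $x\in\Omega$ and $s\ge0$; (2) $\int_0^s\beta(m,s)\,dm\le\beta_0(1+s^l)$ for any $s\ge 0$ and some constant $\beta_0$; (3) there are $r_0\ge 0$, $s_0\ge 0$ such that the set $\{[0,1]\ni z\mapsto sz^{r_0}\beta(zs,s)\}_{s\ge s_0}$ is equi-integrable in $L_1([0,1],dz)$; (4) $\mathcal T_0$ is independent of $m$ (i.e. $\mathcal T_{0,m}$ and $D(T^i_{0,m})$ do not depend on $m$). Then there is $r_1>\max\{l,r_0\}$ such that for every $r\ge r_1$ the operator $(\mathfrak K^i,D(\mathbf T^i))$ generates a positive $C_0$-semigroup on $\mathcal X^i_r$. Hence, if also $b(x,m,s)\le\beta(m,s)$ for a.e. $x\in\Omega$ and $0\le m\le s$, then $(\mathbf K^i,D(\mathbf T^i))$ generates a positive $C_0$-semigroup on $\mathcal X^i_r$.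
   Context: Spaces. $N\ge1$, $\mathbb R_+=[0,\infty)$; $\Omega\subset\mathbb R^N$ is a bounded open set with $C^2$ boundary or $\Omega=\mathbb R^N$. $X_x^1=L_1(\Omega,dx)$; $X^0_x=C_0(\Omega)$ with the supremum norm, where $C_0(\Omega)=C(\overline\Omega)$ if $\Omega$ is bounded and $C_0(\mathbb R^N)$ is the space of continuous functions tending to $0$ at infinity. For $r\ge0$, $dm_r=(1+m^r)\,dm$ and $\mathcal X^i_r=L_1(\mathbb R_+,X^i_x,dm_r)$ is the Bochner space with norm $\int_0^\infty\|u(\cdot,m)\|_{X^i_x}(1+m^r)\,dm$; its elements are identified with functions $u(x,m)$ and $u(m):=u(\cdot,m)$. Properties for $m\in\mathbb R_+$ are meant for a.e. $m$. A positive $C_0$-semigroup is substochastic if it is contractive. Rate. $a\ge0$, $a\in L_{\infty,loc}(\Omega\times\mathbb R_+)$ if $i=1$ and $a\in L_{\infty,loc}(\mathbb R_+,C_b(\Omega))$ if $i=0$ ($C_b(\Omega)$: bounded continuous functions), and there are $\alpha_1,\alpha_2\in L_{\infty,loc}(\mathbb R_+)$ and $0<M<\infty$ with $\alpha_1(m)\le a(x,m)\le\alpha_2(m)\le M\alpha_1(m)$. Transport. $(\mathcal T_{0,m})_{m\in\mathbb R_+}$ is a family of linear expressions acting on functions of $x$, $[\mathcal T_0u](x,m)=[\mathcal T_{0,m}u(\cdot,m)](x)$; for each $m$, the restriction $T^i_{0,m}$ of $\mathcal T_{0,m}$ to a domain $D(T^i_{0,m})\subset X^i_x$ generates a substochastic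 semigroup $(G_{T^i_{0,m}}(t))_{t\ge0}$ on $X^i_x$. $\mathbf T^i_0=\mathcal T_0$ on $D(\mathbf T_0^i)=\{u\in\mathcal X^i_r: u(m)\in D(T^i_{0,m}),\ \mathcal T_0u\in\mathcal X^i_r\}$. Standing assumption (A1): $(\mathbf T^i_0,D(\mathbf T^i_0))$ generates a substochastic semigroup on $\mathcal X^i_r$ given by $[G_{\mathbf T^i_0}(t)u](x,m)=[G_{T^i_{0,m}}(t)u(m)](x)$. $\mathbf A^iu=-au$ on $D(\mathbf A^i)=\{u\in\mathcal X_r^i: au\in\mathcal X_r^i\}$; $\mathbf T^i=\mathbf T_0^i+\mathbf A^i$ on $D(\mathbf T^i)=D(\mathbf T_0^i)\cap D(\mathbf A^i)$. Fragmentation. $b\ge0$ is measurable with $b(x,m,s)=0$ for $m>s$; $[\mathbf B^iu](x,m)=\int_m^\infty b(x,m,s)a(x,s)u(x,s)\,ds$, and $\mathbf K^i=\mathbf T^i+\mathbf B^i$ on $D(\mathbf T^i)$. Majorising problem. $\beta\ge 0$ is measurable on $\mathbb R_+^2$ with support in $\{(m,s):m\le s\}$; $\mathfrak A^iu=-\alpha_1u$, $[\mathfrak B^iu](x,m)=\int_m^\infty\alpha_2(s)\beta(m,s)u(x,s)\,ds$, both on $D(\mathfrak A^i)=\{u\in\mathcal X^i_r:\alpha_1u\in\mathcal X^i_r\}=D(\mathbf A^i)$; $\mathfrak K^i=\mathbf T_0^i+\mathfrak A^i+\mathfrak B^i$ on $D(\mathbf T_0^i)\cap D(\mathfrak A^i)=D(\mathbf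 T^i)$. A bounded set $\mathcal E\subset L_1([0,1],dz)$ is equi-integrable if for any $\varepsilon>0$ there is $\delta>0$ such that $\sup_{f\in\mathcal E}\int_{\Theta_0}|f|\,dz<\varepsilon$ for every measurable $\Theta_0\subset[0,1]$ of measure less than $\delta$.
   Formalization: For i=0 the claim on K additionally assumes that B maps D(T) into the space (it fails for b merely measurable in x), and the context's identity D(𝔄)=D(A) is taken as a hypothesis; nothing is added for i=1. *)

theory Defs
  imports "HOL-Analysis.Analysis"
begin

section \<open>Ordered normed spaces of functions and their semigroups\<close>

text \<open>
  HOL-Analysis has no type of Lebesgue or Bochner classes. A space of classes of functions is given
  here by its representatives, real functions on the type \<open>'a\<close>: a linear carrier, a seminorm on it,
  and the representatives of the nonnegative elements. Two representatives denote the same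
  element if their difference lies in the carrier and has seminorm 0, see \<open>eqv\<close>; the
  carrier condition is needed because the formula for the seminorm has junk values outside it.
\<close>

record 'a fun_space =
  carr :: "('a \<Rightarrow> real) set"
  snorm :: "('a \<Rightarrow> real) \<Rightarrow> real"
  cone :: "('a \<Rightarrow> real) set"

definition eqv :: "'a fun_space \<Rightarrow> ('a \<Rightarrow> real) \<Rightarrow> ('a \<Rightarrow> real) \<Rightarrow> bool" where
  "eqv X f g \<longleftrightarrow> (\<lambda>y. f y - g y) \<in> carr X \<and> snorm X (\<lambda>y. f y - g y) = 0"

definition C0_semigroup ::
  "'a fun_space \<Rightarrow> (real \<Rightarrow> ('a \<Rightarrow> real) \<Rightarrow> ('a \<Rightarrow> real)) \<Rightarrow> bool" where
  "C0_semigroup X G \<longleftrightarrow>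
     (\<forall>t\<ge>0. \<forall>f\<in>carr X. G t f \<in> carr X) \<and>
     (\<forall>t\<ge>0. \<forall>f\<in>carr X. \<forall>g\<in>carr X. \<forall>c d.
        eqv X (G t (\<lambda>y. c * f y + d * g y)) (\<lambda>y. c * G t f y + d * G t g y)) \<and>
     (\<forall>t\<ge>0. \<exists>C. \<forall>f\<in>carr X. snorm X (G t f) \<le> C * snorm X f) \<and>
     (\<forall>f\<in>carr X. eqv X (G 0 f) f) \<and>
     (\<forall>s\<ge>0. \<forall>t\<ge>0. \<forall>f\<in>carr X. eqv X (G (s + t) f) (G s (G t f))) \<and>
     (\<forall>f\<in>carr X. ((\<lambda>t. snorm X (\<lambda>y. G t f y - f y)) \<longlongrightarrow> 0) (at_right 0))"

definition positive_sg ::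
  "'a fun_space \<Rightarrow> (real \<Rightarrow> ('a \<Rightarrow> real) \<Rightarrow> ('a \<Rightarrow> real)) \<Rightarrow> bool" where
  "positive_sg X G \<longleftrightarrow> (\<forall>t\<ge>0. \<forall>f\<in>cone X. G t f \<in> cone X)"

definition substochastic ::
  "'a fun_space \<Rightarrow> (real \<Rightarrow> ('a \<Rightarrow> real) \<Rightarrow> ('a \<Rightarrow> real)) \<Rightarrow> bool" where
  "substochastic X G \<longleftrightarrow> C0_semigroup X G \<and> positive_sg X G \<and>
     (\<forall>t\<ge>0. \<forall>f\<in>carr X. snorm X (G t f) \<le> snorm X f)"

text \<open>
  Unbounded operators are graphs, that is sets of pairs of representatives, closed under
  \<open>eqv\<close> in both components.
\<close>

definition generator ::
  "'a fun_space \<Rightarrow> (real \<Rightarrow> ('a \<Rightarrow> real) \<Rightarrow> ('a \<Rightarrow> real)) \<Rightarrow> ('a \<Rightarrow> real) rel" where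
  "generator X G = {(f, g). f \<in> carr X \<and> g \<in> carr X \<and>
     ((\<lambda>t. snorm X (\<lambda>y. (G t f y - f y) / t - g y)) \<longlongrightarrow> 0) (at_right 0)}"

text \<open>
  The operator \<open>R\<close> with domain \<open>D\<close> generates \<open>G\<close>. The graphs below only contain pairs with both
  entries in the carrier, so \<open>Domain R = D\<close> says that the operator is defined on all of \<open>D\<close>
  and takes its values in the space.
\<close>

definition generates ::
  "'a fun_space \<Rightarrow> ('a \<Rightarrow> real) rel \<Rightarrow> ('a \<Rightarrow> real) set \<Rightarrow>
     (real \<Rightarrow> ('a \<Rightarrow> real) \<Rightarrow> ('a \<Rightarrow> real)) \<Rightarrow> bool" where
  "generates X R D G \<longleftrightarrow> C0_semigroup X G \<and> Domain R = D \<and> R = generator X G"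

definition generates_positive ::
  "'a fun_space \<Rightarrow> ('a \<Rightarrow> real) rel \<Rightarrow> ('a \<Rightarrow> real) set \<Rightarrow> bool" where
  "generates_positive X R D \<longleftrightarrow> (\<exists>G. generates X R D G \<and> positive_sg X G)"


section \<open>Domains with smooth boundary\<close>

definition C2_fun :: "('a::real_normed_vector \<Rightarrow> real) \<Rightarrow> bool" where
  "C2_fun \<gamma> \<longleftrightarrow> (\<exists>(\<gamma>' :: 'a \<Rightarrow> 'a \<Rightarrow>\<^sub>L real) (\<gamma>'' :: 'a \<Rightarrow> 'a \<Rightarrow>\<^sub>L 'a \<Rightarrow>\<^sub>L real).
     (\<forall>x. (\<gamma> has_derivative blinfun_apply (\<gamma>' x)) (at x)) \<and>
     (\<forall>x. (\<gamma>' has_derivative blinfun_apply (\<gamma>'' x)) (at x)) \<and>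
     continuous_on UNIV \<gamma>'')"

text \<open>
  Near each boundary point the set is the region above a \<open>C\<^sup>2\<close> graph over the hyperplane orthogonal
  to some unit vector \<open>e\<close>. Only the values of \<open>\<gamma>\<close> on this hyperplane matter.
\<close>

definition C2_boundary :: "'a::euclidean_space set \<Rightarrow> bool" where
  "C2_boundary \<Omega> \<longleftrightarrow> (\<forall>p\<in>frontier \<Omega>. \<exists>\<rho>>0. \<exists>e \<gamma>. norm e = 1 \<and> C2_fun \<gamma> \<and>
     \<Omega> \<inter> ball p \<rho> = {x \<in> ball p \<rho>. \<gamma> (x - (x \<bullet> e) *\<^sub>R e) < x \<bullet> e})"


section \<open>The spaces\<close>

definition L1_space :: "'a::euclidean_space set \<Rightarrow> 'a fun_space" where
  "L1_space \<Omega> = \<lparr>carr = {f. integrable (lebesgue_on \<Omega>) f},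
     snorm = (\<lambda>f. \<integral>x. \<bar>f x\<bar> \<partial>lebesgue_on \<Omega>),
     cone = {f. integrable (lebesgue_on \<Omega>) f \<and> (AE x in lebesgue_on \<Omega>. 0 \<le> f x)}\<rparr>"

text \<open>Inserting 0 only matters if \<open>\<Omega>\<close> is empty.\<close>

definition sup_norm :: "'a set \<Rightarrow> ('a \<Rightarrow> real) \<Rightarrow> real" where
  "sup_norm \<Omega> f = Sup (insert 0 ((\<lambda>x. \<bar>f x\<bar>) ` \<Omega>))"

text \<open>
  For bounded \<open>\<Omega>\<close> the space \<open>C(closure \<Omega>)\<close> is represented by the restrictions of its elements to \<open>\<Omega>\<close>
  (an isometric identification), because the coefficients are given on \<open>\<Omega>\<close> only.
\<close>

definition C0_carrier :: "'a::euclidean_space set \<Rightarrow> ('a \<Rightarrow> real) set" where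
  "C0_carrier \<Omega> = (if bounded \<Omega>
     then {f. \<exists>g. continuous_on (closure \<Omega>) g \<and> (\<forall>x\<in>\<Omega>. f x = g x)}
     else {f. continuous_on \<Omega> f \<and> (f \<longlongrightarrow> 0) at_infinity})"

definition C0_space :: "'a::euclidean_space set \<Rightarrow> 'a fun_space" where
  "C0_space \<Omega> = \<lparr>carr = C0_carrier \<Omega>, snorm = sup_norm \<Omega>,
     cone = {f \<in> C0_carrier \<Omega>. \<forall>x\<in>\<Omega>. 0 \<le> f x}\<rparr>"

definition Cb_space :: "'a::euclidean_space set \<Rightarrow> 'a fun_space" where
  "Cb_space \<Omega> = \<lparr>carr = {f. continuous_on \<Omega> f \<and> bounded (f ` \<Omega>)}, snorm = sup_norm \<Omega>,
     cone = {f. continuous_on \<Omega> f \<and> bounded (f ` \<Omega>) \<and> (\<forall>x\<in>\<Omega>. 0 \<le> f x)}\<rparr>"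

definition X_space :: "'a::euclidean_space set \<Rightarrow> nat \<Rightarrow> 'a fun_space" where
  "X_space \<Omega> i = (if i = 0 then C0_space \<Omega> else L1_space \<Omega>)"

abbreviation (input) at_mass :: "('a \<times> real \<Rightarrow> real) \<Rightarrow> real \<Rightarrow> 'a \<Rightarrow> real" where
  "at_mass u m \<equiv> (\<lambda>x. u (x, m))"

definition strongly_measurable :: "'a fun_space \<Rightarrow> (real \<Rightarrow> 'a \<Rightarrow> real) \<Rightarrow> bool" where
  "strongly_measurable X v \<longleftrightarrow>
     (AE m in lebesgue_on {0..}. v m \<in> carr X) \<and>
     (\<exists>\<sigma> :: nat \<Rightarrow> real \<Rightarrow> 'a \<Rightarrow> real.
        (\<forall>k. simple_function (lebesgue_on {0..}) (\<sigma> k) \<and> \<sigma> k ` {0..} \<subseteq> carr X) \<and>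
        (AE m in lebesgue_on {0..}. (\<lambda>k. snorm X (\<lambda>x. v m x - \<sigma> k m x)) \<longlonglongrightarrow> 0))"

text \<open>
  The Bochner space \<open>L\<^sub>1(\<real>\<^sub>+, X, (1 + m\<^sup>r) dm)\<close> over a space \<open>X\<close> of functions on \<open>\<Omega>\<close>. Joint
  measurability fixes the identification of an element with a function of \<open>(x, m)\<close>: every Bochner
  class with values in \<open>L\<^sub>1(\<Omega>)\<close> or \<open>C\<^sub>0(\<Omega>)\<close> has such a representative.
\<close>

definition bochner_carrier ::
  "'a::euclidean_space set \<Rightarrow> 'a fun_space \<Rightarrow> real \<Rightarrow> ('a \<times> real \<Rightarrow> real) set" where
  "bochner_carrier \<Omega> X r =
     {u \<in> borel_measurable (lebesgue_on (\<Omega> \<times> {0..})).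
        strongly_measurable X (at_mass u) \<and>
        integrable (lebesgue_on {0..}) (\<lambda>m. snorm X (at_mass u m) * (1 + m powr r))}"

definition bochner_space ::
  "'a::euclidean_space set \<Rightarrow> 'a fun_space \<Rightarrow> real \<Rightarrow> ('a \<times> real) fun_space" where
  "bochner_space \<Omega> X r = \<lparr>carr = bochner_carrier \<Omega> X r,
     snorm = (\<lambda>u. \<integral>m. snorm X (at_mass u m) * (1 + m powr r) \<partial>lebesgue_on {0..}),
     cone = {u \<in> bochner_carrier \<Omega> X r. AE m in lebesgue_on {0..}. at_mass u m \<in> cone X}\<rparr>"

definition XX_space :: "'a::euclidean_space set \<Rightarrow> nat \<Rightarrow> real \<Rightarrow> ('a \<times> real) fun_space" where
  "XX_space \<Omega> i r = bochner_space \<Omega> (X_space \<Omega> i) r"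

definition Linf_loc :: "'a::euclidean_space set \<Rightarrow> ('a \<Rightarrow> real) \<Rightarrow> bool" where
  "Linf_loc S f \<longleftrightarrow> f \<in> borel_measurable (lebesgue_on S) \<and>
     (\<forall>K. compact K \<and> K \<subseteq> S \<longrightarrow> (\<exists>C. AE y in lebesgue_on K. \<bar>f y\<bar> \<le> C))"

definition Linf_loc_Cb :: "'a::euclidean_space set \<Rightarrow> ('a \<times> real \<Rightarrow> real) \<Rightarrow> bool" where
  "Linf_loc_Cb \<Omega> a \<longleftrightarrow> strongly_measurable (Cb_space \<Omega>) (at_mass a) \<and>
     (\<forall>R\<ge>0. \<exists>C. AE m in lebesgue_on {0..R}. snorm (Cb_space \<Omega>) (at_mass a m) \<le> C)"

definition equi_integrable :: "(real \<Rightarrow> real) set \<Rightarrow> bool" where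
  "equi_integrable E \<longleftrightarrow>
     (\<forall>f\<in>E. integrable (lebesgue_on {0..1}) f) \<and>
     (\<exists>C. \<forall>f\<in>E. (\<integral>z. \<bar>f z\<bar> \<partial>lebesgue_on {0..1}) \<le> C) \<and>
     (\<forall>\<epsilon>>0. \<exists>\<delta>>0. \<forall>\<Theta>\<in>sets lebesgue. \<Theta> \<subseteq> {0..1} \<and> measure lebesgue \<Theta> < \<delta> \<longrightarrow>
        (SUP f\<in>E. \<integral>z. \<bar>f z\<bar> \<partial>lebesgue_on \<Theta>) < \<epsilon>)"


section \<open>The operators\<close>

text \<open>
  Throughout, \<open>T m\<close> on \<open>D m\<close> is the transport operator in the space variable at mass \<open>m\<close>, which
  only has to be meaningful up to \<open>eqv\<close> and on \<open>D m\<close>.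
\<close>

definition fibre_op ::
  "'a fun_space \<Rightarrow> (real \<Rightarrow> ('a \<Rightarrow> real) \<Rightarrow> ('a \<Rightarrow> real)) \<Rightarrow> (real \<Rightarrow> ('a \<Rightarrow> real) set) \<Rightarrow>
     real \<Rightarrow> ('a \<Rightarrow> real) rel" where
  "fibre_op X T D m = {(f, g). f \<in> D m \<and> g \<in> carr X \<and> eqv X g (T m f)}"

definition T0_op ::
  "'a::euclidean_space set \<Rightarrow> nat \<Rightarrow> real \<Rightarrow> (real \<Rightarrow> ('a \<Rightarrow> real) \<Rightarrow> ('a \<Rightarrow> real)) \<Rightarrow>
     (real \<Rightarrow> ('a \<Rightarrow> real) set) \<Rightarrow> ('a \<times> real \<Rightarrow> real) rel" where
  "T0_op \<Omega> i r T D = {(u, w). u \<in> carr (XX_space \<Omega> i r) \<and> w \<in> carr (XX_space \<Omega> i r) \<and>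
     (AE m in lebesgue_on {0..}. (at_mass u m, at_mass w m) \<in> fibre_op (X_space \<Omega> i) T D m)}"

definition mult_dom ::
  "'a::euclidean_space set \<Rightarrow> nat \<Rightarrow> real \<Rightarrow> ('a \<times> real \<Rightarrow> real) \<Rightarrow> ('a \<times> real \<Rightarrow> real) set" where
  "mult_dom \<Omega> i r c = {u \<in> carr (XX_space \<Omega> i r). (\<lambda>y. c y * u y) \<in> carr (XX_space \<Omega> i r)}"

definition T_dom ::
  "'a::euclidean_space set \<Rightarrow> nat \<Rightarrow> real \<Rightarrow> (real \<Rightarrow> ('a \<Rightarrow> real) \<Rightarrow> ('a \<Rightarrow> real)) \<Rightarrow>
     (real \<Rightarrow> ('a \<Rightarrow> real) set) \<Rightarrow> ('a \<times> real \<Rightarrow> real) \<Rightarrow> ('a \<times> real \<Rightarrow> real) set" where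
  "T_dom \<Omega> i r T D a = Domain (T0_op \<Omega> i r T D) \<inter> mult_dom \<Omega> i r a"

definition gain ::
  "('a \<Rightarrow> real \<Rightarrow> real \<Rightarrow> real) \<Rightarrow> ('a \<times> real \<Rightarrow> real) \<Rightarrow> 'a \<times> real \<Rightarrow> real" where
  "gain \<kappa> u = (\<lambda>(x, m). LINT s:{m..}|lebesgue. \<kappa> x m s * u (x, s))"

definition gain_converges ::
  "'a::euclidean_space set \<Rightarrow> ('a \<Rightarrow> real \<Rightarrow> real \<Rightarrow> real) \<Rightarrow> ('a \<times> real \<Rightarrow> real) \<Rightarrow> bool" where
  "gain_converges \<Omega> \<kappa> u \<longleftrightarrow>
     (AE (x, m) in lebesgue_on (\<Omega> \<times> {0..}). set_integrable lebesgue {m..} (\<lambda>s. \<kappa> x m s * u (x, s)))"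

text \<open>
  The operator \<open>u \<mapsto> T\<^sub>0 u - c u + gain \<kappa> u\<close> on \<open>D(T\<^sub>0) \<inter> D(c)\<close>. Since \<open>w\<close>, \<open>w\<^sub>0\<close> and \<open>c u\<close> lie in
  the carrier, the \<open>eqv\<close> below forces the gain term into the carrier as well.
\<close>

definition frag_op ::
  "'a::euclidean_space set \<Rightarrow> nat \<Rightarrow> real \<Rightarrow> (real \<Rightarrow> ('a \<Rightarrow> real) \<Rightarrow> ('a \<Rightarrow> real)) \<Rightarrow>
     (real \<Rightarrow> ('a \<Rightarrow> real) set) \<Rightarrow> ('a \<times> real \<Rightarrow> real) \<Rightarrow> ('a \<Rightarrow> real \<Rightarrow> real \<Rightarrow> real) \<Rightarrow>
     ('a \<times> real \<Rightarrow> real) rel" where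
  "frag_op \<Omega> i r T D c \<kappa> = {(u, w). u \<in> mult_dom \<Omega> i r c \<and> gain_converges \<Omega> \<kappa> u \<and>
     w \<in> carr (XX_space \<Omega> i r) \<and>
     (\<exists>w\<^sub>0. (u, w\<^sub>0) \<in> T0_op \<Omega> i r T D \<and>
        eqv (XX_space \<Omega> i r) w (\<lambda>y. w\<^sub>0 y - c y * u y + gain \<kappa> u y))}"

definition K_op ::
  "'a::euclidean_space set \<Rightarrow> nat \<Rightarrow> real \<Rightarrow> (real \<Rightarrow> ('a \<Rightarrow> real) \<Rightarrow> ('a \<Rightarrow> real)) \<Rightarrow>
     (real \<Rightarrow> ('a \<Rightarrow> real) set) \<Rightarrow> ('a \<times> real \<Rightarrow> real) \<Rightarrow> ('a \<times> real \<times> real \<Rightarrow> real) \<Rightarrow>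
     ('a \<times> real \<Rightarrow> real) rel" where
  "K_op \<Omega> i r T D a b = frag_op \<Omega> i r T D a (\<lambda>x m s. b (x, m, s) * a (x, s))"

definition frakK_op ::
  "'a::euclidean_space set \<Rightarrow> nat \<Rightarrow> real \<Rightarrow> (real \<Rightarrow> ('a \<Rightarrow> real) \<Rightarrow> ('a \<Rightarrow> real)) \<Rightarrow>
     (real \<Rightarrow> ('a \<Rightarrow> real) set) \<Rightarrow> (real \<Rightarrow> real) \<Rightarrow> (real \<Rightarrow> real) \<Rightarrow> (real \<times> real \<Rightarrow> real) \<Rightarrow>
     ('a \<times> real \<Rightarrow> real) rel" where
  "frakK_op \<Omega> i r T D \<alpha>\<^sub>1 \<alpha>\<^sub>2 \<beta> =
     frag_op \<Omega> i r T D (\<lambda>(x, m). \<alpha>\<^sub>1 m) (\<lambda>x m s. \<alpha>\<^sub>2 s * \<beta> (m, s))"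


section \<open>Standing assumptions\<close>

definition admissible_domain :: "'a::euclidean_space set \<Rightarrow> bool" where
  "admissible_domain \<Omega> \<longleftrightarrow> \<Omega> = UNIV \<or> (open \<Omega> \<and> bounded \<Omega> \<and> C2_boundary \<Omega>)"

text \<open>
  The last conjunct, the identity of the domains of multiplication by \<open>a\<close> and by \<open>\<alpha>\<^sub>1\<close>, follows from
  the others except for \<open>i = 0\<close> and bounded \<open>\<Omega>\<close>. There it says that \<open>a(\<cdot>, m) \<in> C\<^sub>b(\<Omega>)\<close> extends
  continuously to the closure of \<open>\<Omega>\<close> for almost every \<open>m\<close>, i.e. that it multiplies \<open>C(closure \<Omega>)\<close>
  into itself.
\<close>

definition rate_assms ::
  "'a::euclidean_space set \<Rightarrow> nat \<Rightarrow> ('a \<times> real \<Rightarrow> real) \<Rightarrow> (real \<Rightarrow> real) \<Rightarrow> (real \<Rightarrow> real) \<Rightarrow>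
     bool" where
  "rate_assms \<Omega> i a \<alpha>\<^sub>1 \<alpha>\<^sub>2 \<longleftrightarrow>
     (if i = 0 then Linf_loc_Cb \<Omega> a else Linf_loc (\<Omega> \<times> {0..}) a) \<and>
     Linf_loc {0..} \<alpha>\<^sub>1 \<and> Linf_loc {0..} \<alpha>\<^sub>2 \<and>
     (\<exists>M>0. AE (x, m) in lebesgue_on (\<Omega> \<times> {0..}).
        0 \<le> a (x, m) \<and> \<alpha>\<^sub>1 m \<le> a (x, m) \<and> a (x, m) \<le> \<alpha>\<^sub>2 m \<and> \<alpha>\<^sub>2 m \<le> M * \<alpha>\<^sub>1 m) \<and>
     (i = 0 \<longrightarrow> (\<forall>r\<ge>0. mult_dom \<Omega> i r (\<lambda>(x, m). \<alpha>\<^sub>1 m) = mult_dom \<Omega> i r a))"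

text \<open>
  \<open>G\<^sub>0 m\<close> is the semigroup generated by the transport operator at mass \<open>m\<close>.
\<close>

definition transport_assms ::
  "'a::euclidean_space set \<Rightarrow> nat \<Rightarrow> (real \<Rightarrow> ('a \<Rightarrow> real) \<Rightarrow> ('a \<Rightarrow> real)) \<Rightarrow>
     (real \<Rightarrow> ('a \<Rightarrow> real) set) \<Rightarrow> (real \<Rightarrow> real \<Rightarrow> ('a \<Rightarrow> real) \<Rightarrow> ('a \<Rightarrow> real)) \<Rightarrow> bool" where
  "transport_assms \<Omega> i T D G\<^sub>0 \<longleftrightarrow>
     (\<forall>m\<ge>0. generates (X_space \<Omega> i) (fibre_op (X_space \<Omega> i) T D m) (D m) (G\<^sub>0 m) \<and>
        substochastic (X_space \<Omega> i) (G\<^sub>0 m)) \<and>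
     (\<forall>r\<ge>0. \<exists>G. generates (XX_space \<Omega> i r) (T0_op \<Omega> i r T D) (Domain (T0_op \<Omega> i r T D)) G \<and>
        substochastic (XX_space \<Omega> i r) G \<and>
        (\<forall>t\<ge>0. \<forall>u\<in>carr (XX_space \<Omega> i r). AE m in lebesgue_on {0..}.
           eqv (X_space \<Omega> i) (at_mass (G t u) m) (G\<^sub>0 m t (at_mass u m))))"

definition fragmentation_assms ::
  "'a::euclidean_space set \<Rightarrow> ('a \<times> real \<times> real \<Rightarrow> real) \<Rightarrow> bool" where
  "fragmentation_assms \<Omega> b \<longleftrightarrow>
     b \<in> borel_measurable (lebesgue_on (\<Omega> \<times> {0..} \<times> {0..})) \<and>
     (\<forall>x\<in>\<Omega>. \<forall>m\<ge>0. \<forall>s\<ge>0. 0 \<le> b (x, m, s) \<and> (m > s \<longrightarrow> b (x, m, s) = 0))"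

definition majorant_assms :: "(real \<times> real \<Rightarrow> real) \<Rightarrow> bool" where
  "majorant_assms \<beta> \<longleftrightarrow>
     \<beta> \<in> borel_measurable (lebesgue_on ({0..} \<times> {0..})) \<and>
     (\<forall>m\<ge>0. \<forall>s\<ge>0. 0 \<le> \<beta> (m, s) \<and> (m > s \<longrightarrow> \<beta> (m, s) = 0))"

text \<open>
  If \<open>b\<close> is merely measurable, \<open>B u\<close> need not be continuous in \<open>x\<close>. For \<open>i = 0\<close> it is thus part of the meaning of \<open>K = T + B\<close> on \<open>D(T)\<close> that \<open>B\<close> maps \<open>D(T)\<close> into
  the space; for \<open>i = 1\<close> nothing is required.
\<close>

definition gain_admissible ::
  "'a::euclidean_space set \<Rightarrow> nat \<Rightarrow> real \<Rightarrow> (real \<Rightarrow> ('a \<Rightarrow> real) \<Rightarrow> ('a \<Rightarrow> real)) \<Rightarrow>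
     (real \<Rightarrow> ('a \<Rightarrow> real) set) \<Rightarrow> ('a \<times> real \<Rightarrow> real) \<Rightarrow> ('a \<times> real \<times> real \<Rightarrow> real) \<Rightarrow> bool" where
  "gain_admissible \<Omega> i r T D a b \<longleftrightarrow> (i = 0 \<longrightarrow>
     (\<forall>u\<in>T_dom \<Omega> i r T D a. gain (\<lambda>x m s. b (x, m, s) * a (x, s)) u \<in> carr (XX_space \<Omega> i r)))"

end

(*
  The gain term is relatively bounded by the loss term with a constant below 1, up to a bounded
  perturbation. Indeed, the substitution m = z s turns the gain of mass from size s into
  s^r times the integral of z^(r - r0) against s z^r0 beta(z s, s). Equi-integrability makes the
  part near z = 1 small uniformly in s, and (1 - d)^(r - r0) makes the rest small for large r;
  the part of the weight without m^r has lower order because r > l.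

  By the Hille-Yosida theorem it suffices to solve resolvent equations. For transport with loss this
  is done by cutting off at masses m <= n, where the loss is bounded; the gain is then a positive
  perturbation with relative bound below 1. Dissipativity of transport with loss is checked in the
  fibre norm at each mass, so that no additivity of the norm is needed for i = 0.
*)

theory Submission
  imports Defs "HOL-Analysis.Analysis" "HOL-Library.Function_Algebras"
begin

text \<open>The spaces consist of representatives, so norms are only seminorms and an equation
  between vectors reads \<open>N (u - v) = 0\<close>; the semigroup theory is developed for such
  spaces with a closed cone, and discrete schemes replace vector-valued integrals. The gain is
  controlled by the loss, not by the norm, and neither is bounded on the whole space. Cutting off
  helps because mass is never passed upwards: transport acts at each mass separately and fragments
  are no larger than their parent, so functions supported in masses up to n stay so. On them the
  resolvent equation is a fixed point problem with constant below 1, but this constant may tend to 1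
  as n grows. What survives the limit is the a priori estimate: the share
  \<open>(1 - \<kappa>) * L u\<close> of the loss that the gain leaves over controls loss and gain
  of differences of solutions. The original and the majorising operator are treated at once, with a
  loss coefficient between \<open>\<alpha>\<^sub>1\<close> and \<open>\<alpha>\<^sub>2\<close> and a
  kernel below \<open>\<alpha>\<^sub>2 s * \<beta> (m, s)\<close>; they differ only in the reason
  why, for i = 0, the gain stays in the space.\<close>

lemma tendsto_0_at_right_bound:
  fixes f h :: "real \<Rightarrow> real"
  assumes "(h \<longlongrightarrow> 0) (at_right 0)" "!!t. 0 < t ==> 0 \<le> f t" "!!t. 0 < t ==> f t \<le> h t"
  shows "(f \<longlongrightarrow> 0) (at_right 0)"
  by (rule tendsto_sandwich[OF _ _ tendsto_const assms(1)])
    (auto intro!: eventually_mono[OF eventually_at_right_less[of 0]] assms(2,3))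

section \<open>Complete seminormed spaces with a cone\<close>

text \<open>A seminorm rather than a norm, since vectors are representatives of classes; limits are
  unique only up to seminorm 0. Completeness is stated for summable increments, the form in which it
  is verified for function spaces; \<open>Cauchy_V_convergent\<close> extends it to all Cauchy
  sequences.\<close>

locale ordered_seminormed =
  fixes V :: "'v::real_vector set" and N :: "'v \<Rightarrow> real" and P :: "'v set"
  assumes subspace_V: "subspace V"
    and N_nonneg: "u \<in> V ==> 0 \<le> N u"
    and N_triangle: "u \<in> V ==> v \<in> V ==> N (u + v) \<le> N u + N v"
    and N_scale: "u \<in> V ==> N (c *\<^sub>R u) = \<bar>c\<bar> * N u"
    and complete: "(!!n::nat. f n \<in> V) ==> summable (\<lambda>n. N (f (Suc n) - f n)) ==>
      \<exists>g\<in>V. (\<lambda>n. N (f n - g)) \<longlonglongrightarrow> 0"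
    and P_subset: "P \<subseteq> V"
    and P_zero: "0 \<in> P"
    and P_add: "u \<in> P ==> v \<in> P ==> u + v \<in> P"
    and P_scale: "u \<in> P ==> 0 \<le> c ==> c *\<^sub>R u \<in> P"
    and P_closed: "(!!n::nat. f n \<in> P) ==> g \<in> V ==> (\<lambda>n. N (f n - g)) \<longlonglongrightarrow> 0 ==> g \<in> P"
begin

lemma V_zero [simp, intro]: "0 \<in> V"
  and V_add [simp, intro]: "u \<in> V ==> v \<in> V ==> u + v \<in> V"
  and V_diff [simp, intro]: "u \<in> V ==> v \<in> V ==> u - v \<in> V"
  and V_scale [simp, intro]: "u \<in> V ==> c *\<^sub>R u \<in> V"
  and V_minus [simp, intro]: "u \<in> V ==> - u \<in> V"
  using subspace_V
  by (auto simp: subspace_0 subspace_add subspace_diff subspace_scale subspace_neg)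

lemma N_zero [simp]: "N 0 = 0"
  using N_scale[of 0 0] by simp

lemma N_minus [simp]: "u \<in> V ==> N (- u) = N u"
  using N_scale[of u "-1"] by simp

lemma N_commute: "u \<in> V ==> v \<in> V ==> N (u - v) = N (v - u)"
  using N_minus[of "u - v"] by simp

lemma N_diff_triangle: "u \<in> V ==> v \<in> V ==> w \<in> V ==> N (u - w) \<le> N (u - v) + N (v - w)"
  using N_triangle[of "u - v" "v - w"] by simp

lemma N_diff_le: "u \<in> V ==> v \<in> V ==> N (u - v) \<le> N u + N v"
  using N_triangle[of u "- v"] by simp

lemma N_le_diff: "u \<in> V ==> v \<in> V ==> N u \<le> N v + N (u - v)"
  using N_triangle[of v "u - v"] by simp

lemma N_triangle_le:
  "u \<in> V ==> v \<in> V ==> N u \<le> a ==> N v \<le> b ==> w = u + v ==> c = a + b ==> N w \<le> c"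
  using N_triangle[of u v] by simp

lemma N_eq: "u \<in> V ==> v \<in> V ==> N (u - v) = 0 ==> N u = N v"
  using N_le_diff[of u v] N_le_diff[of v u] N_commute[of u v] by simp

lemma N_eq_trans: "u \<in> V ==> v \<in> V ==> w \<in> V ==> N (u - v) = 0 ==> N (v - w) = 0 ==> N (u - w) = 0"
  using N_diff_triangle[of u v w] N_nonneg[of "u - w"] by simp

lemma limit_unique:
  assumes "!!n. f n \<in> V" "g \<in> V" "g' \<in> V"
    and "(\<lambda>n::nat. N (f n - g)) \<longlonglongrightarrow> 0" "(\<lambda>n. N (f n - g')) \<longlonglongrightarrow> 0"
  shows "N (g - g') = 0"
proof -
  have "(\<lambda>n. N (f n - g) + N (f n - g')) \<longlonglongrightarrow> 0 + 0"
    using assms(4,5) by (rule tendsto_add)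
  moreover have "N (g - g') \<le> N (f n - g) + N (f n - g')" for n
    using N_diff_triangle[of g "f n" g'] N_commute[of g "f n"] assms(1-3) by simp
  ultimately have "N (g - g') \<le> 0"
    using LIMSEQ_le_const[of "\<lambda>n. N (f n - g) + N (f n - g')" 0] by auto
  then show ?thesis
    using N_nonneg[of "g - g'"] assms(2,3) by simp
qed

lemma tendsto_N:
  assumes "!!n. f n \<in> V" "g \<in> V" "(\<lambda>n::nat. N (f n - g)) \<longlonglongrightarrow> 0"
  shows "(\<lambda>n. N (f n)) \<longlonglongrightarrow> N g"
proof (rule metric_LIMSEQ_I)
  fix e :: real
  assume "e > 0"
  then obtain M where M: "!!n. n \<ge> M ==> \<bar>N (f n - g)\<bar> < e"
    using LIMSEQ_D[OF assms(3), of e] by auto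
  have "dist (N (f n)) (N g) < e" if "n \<ge> M" for n
    using M[OF that] N_le_diff[of "f n" g] N_le_diff[of g "f n"] N_commute[of "f n" g] assms(1,2)
    by (auto simp: dist_real_def)
  then show "\<exists>M. \<forall>n\<ge>M. dist (N (f n)) (N g) < e"
    by blast
qed

lemma N_limit_le:
  assumes "!!n. f n \<in> V" "g \<in> V" "(\<lambda>n::nat. N (f n - g)) \<longlonglongrightarrow> 0"
    and "!!n. n \<ge> M ==> N (f n) \<le> c n" "c \<longlonglongrightarrow> d"
  shows "N g \<le> d"
  using LIMSEQ_le[OF tendsto_N[OF assms(1-3)] assms(5)] assms(4) by blast

lemma lim_add:
  assumes "!!n. f n \<in> V" "!!n. f' n \<in> V" "g \<in> V" "g' \<in> V"
    and "(\<lambda>n::nat. N (f n - g)) \<longlonglongrightarrow> 0" "(\<lambda>n. N (f' n - g')) \<longlonglongrightarrow> 0"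
  shows "(\<lambda>n. N ((f n + f' n) - (g + g'))) \<longlonglongrightarrow> 0"
proof (rule tendsto_sandwich[of "\<lambda>_. 0" _ _ "\<lambda>n. N (f n - g) + N (f' n - g')"])
  have "N ((f n + f' n) - (g + g')) \<le> N (f n - g) + N (f' n - g')" for n
    using N_triangle[of "f n - g" "f' n - g'"] assms(1-4) by (simp add: algebra_simps)
  then show "\<forall>\<^sub>F n in sequentially. N ((f n + f' n) - (g + g')) \<le> N (f n - g) + N (f' n - g')"
    by simp
  show "(\<lambda>n. N (f n - g) + N (f' n - g')) \<longlonglongrightarrow> 0"
    using tendsto_add[OF assms(5,6)] by simp
qed (use assms N_nonneg in auto)

lemma lim_scale:
  assumes "!!n. f n \<in> V" "g \<in> V" "(\<lambda>n::nat. N (f n - g)) \<longlonglongrightarrow> 0"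
  shows "(\<lambda>n. N (c *\<^sub>R f n - c *\<^sub>R g)) \<longlonglongrightarrow> 0"
proof -
  have "N (c *\<^sub>R f n - c *\<^sub>R g) = \<bar>c\<bar> * N (f n - g)" for n
    using N_scale[of "f n - g" c] assms by (simp add: scaleR_diff_right)
  then show ?thesis
    using tendsto_mult_left[OF assms(3), of "\<bar>c\<bar>"] by simp
qed

lemma lim_diff:
  assumes "!!n. f n \<in> V" "!!n. f' n \<in> V" "g \<in> V" "g' \<in> V"
    and "(\<lambda>n::nat. N (f n - g)) \<longlonglongrightarrow> 0" "(\<lambda>n. N (f' n - g')) \<longlonglongrightarrow> 0"
  shows "(\<lambda>n. N ((f n - f' n) - (g - g'))) \<longlonglongrightarrow> 0"
  using lim_add[OF assms(1) _ assms(3) _ assms(5) lim_scale[OF assms(2,4,6), of "-1"]] assms by simp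

text \<open>Comparison with the M-th term alone; the triangle inequality recovers the usual
  condition with two free indices.\<close>

definition Cauchy_V :: "(nat \<Rightarrow> 'v) \<Rightarrow> bool" where
  "Cauchy_V f \<longleftrightarrow> (\<forall>e>0. \<exists>M. \<forall>m\<ge>M. N (f m - f M) < e)"

lemma summable_imp_Cauchy_V:
  assumes f: "!!n. f n \<in> V" and a: "!!n. N (f (Suc n) - f n) \<le> a n" "summable a"
  shows "Cauchy_V f"
proof -
  have bound: "N (f (n + k) - f n) \<le> sum a {n..<n + k}" for n k
  proof (induction k)
    case (Suc k)
    show ?case
      using N_diff_triangle[of "f (n + Suc k)" "f (n + k)" "f n"] f a(1)[of "n + k"] Suc by simp
  qed simp
  show ?thesis
    unfolding Cauchy_V_def
  proof (intro allI impI)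
    fix e :: real
    assume "e > 0"
    then obtain M where M: "!!m n. m \<ge> M ==> norm (sum a {m..<n}) < e"
      using a(2) unfolding summable_Cauchy by blast
    have "N (f m - f M) < e" if "m \<ge> M" for m
      using bound[of M "m - M"] M[of M m] that by simp
    then show "\<exists>M. \<forall>m\<ge>M. N (f m - f M) < e"
      by blast
  qed
qed

text \<open>A subsequence with increments at most 2 (1/2)^k converges by \<open>complete\<close>,
  and the Cauchy property carries its limit over to the whole sequence.\<close>

lemma Cauchy_V_convergent:
  assumes f: "!!n. f n \<in> V" and C: "Cauchy_V f"
  shows "\<exists>g\<in>V. (\<lambda>n. N (f n - g)) \<longlonglongrightarrow> 0"
proof -
  have "\<forall>k. \<exists>M. \<forall>m\<ge>M. N (f m - f M) < (1/2) ^ k"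
    using C unfolding Cauchy_V_def by simp
  then obtain M where M: "!!k m. m \<ge> M k ==> N (f m - f (M k)) < (1/2) ^ k"
    by metis
  \<comment> \<open>Summing makes the indices monotone while keeping \<open>s k \<ge> M k\<close>;
    weak monotonicity suffices.\<close>
  define s where "s k = (\<Sum>j\<le>k. M j)" for k
  have sM: "s k \<ge> M k" for k
    unfolding s_def by (rule member_le_sum) auto
  have smono: "s (Suc k) \<ge> s k" for k
    unfolding s_def by simp
  have close: "N (f m - f (s k)) \<le> 2 * (1/2) ^ k" if "m \<ge> s k" for m k
    using N_diff_triangle[of "f m" "f (M k)" "f (s k)"] f N_commute[of "f (M k)" "f (s k)"]
      M[of k m] M[OF sM, of k] that sM[of k] by simp
  have "summable (\<lambda>k. 2 * (1/2::real) ^ k)"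
    by (intro summable_mult summable_geometric) simp
  then have "summable (\<lambda>k. N (f (s (Suc k)) - f (s k)))"
    by (rule summable_comparison_test'[where N = 0]) (use close[OF smono] N_nonneg f in auto)
  then obtain g where g: "g \<in> V" "(\<lambda>k. N (f (s k) - g)) \<longlonglongrightarrow> 0"
    using complete[of "\<lambda>k. f (s k)"] f by auto
  have pow: "(\<lambda>k. 2 * (1/2::real) ^ k + N (f (s k) - g)) \<longlonglongrightarrow> 0"
    by (rule tendsto_eq_intros LIMSEQ_realpow_zero g | simp)+
  have "(\<lambda>n. N (f n - g)) \<longlonglongrightarrow> 0"
  proof (rule LIMSEQ_I)
    fix e :: real
    assume "e > 0"
    then obtain k where "!!n. n \<ge> k ==> \<bar>2 * (1/2) ^ n + N (f (s n) - g)\<bar> < e"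
      using LIMSEQ_D[OF pow, of e] by auto
    then have k: "2 * (1/2) ^ k + N (f (s k) - g) < e"
      by (meson abs_less_iff order_refl)
    have "norm (N (f n - g) - 0) < e" if "n \<ge> s k" for n
      using N_diff_triangle[of "f n" "f (s k)" g] close[OF that] k f g(1) N_nonneg[of "f n - g"]
      by simp
    then show "\<exists>M. \<forall>n\<ge>M. norm (N (f n - g) - 0) < e"
      by blast
  qed
  with g(1) show ?thesis
    by blast
qed

lemma Cauchy_V_dominated:
  assumes f: "!!n. f n \<in> V" and C: "Cauchy_V g" and "0 \<le> c"
    and le: "!!m n. N (f m - f n) \<le> c * N (g m - g n)"
  shows "Cauchy_V f"
  unfolding Cauchy_V_def
proof (intro allI impI)
  fix e :: real
  assume "e > 0"
  \<comment> \<open>The denominator c + 1 covers the case c = 0.\<close>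
  then have "e / (c + 1) > 0"
    using \<open>0 \<le> c\<close> by simp
  then obtain M where M: "!!m. m \<ge> M ==> N (g m - g M) < e / (c + 1)"
    using C unfolding Cauchy_V_def by blast
  have "N (f m - f M) < e" if "m \<ge> M" for m
  proof -
    have "c * N (g m - g M) \<le> c * (e / (c + 1))"
      using M[OF that] \<open>0 \<le> c\<close> by (intro mult_left_mono) auto
    also have "\<dots> < e"
      using \<open>0 \<le> c\<close> \<open>e > 0\<close> by (simp add: field_simps)
    finally show ?thesis
      using le[of m M] by simp
  qed
  then show "\<exists>M. \<forall>m\<ge>M. N (f m - f M) < e"
    by blast
qed

lemma convergent_imp_Cauchy_V:
  assumes f: "!!n. f n \<in> V" and g: "g \<in> V" "(\<lambda>n. N (f n - g)) \<longlonglongrightarrow> 0"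
  shows "Cauchy_V f"
  unfolding Cauchy_V_def
proof (intro allI impI)
  fix e :: real
  assume "e > 0"
  then obtain M where M: "!!n. n \<ge> M ==> \<bar>N (f n - g)\<bar> < e / 2"
    using LIMSEQ_D[OF g(2), of "e / 2"] by auto
  have "N (f m - f M) < e" if "m \<ge> M" for m
    using M[OF that] M[of M] N_diff_triangle[of "f m" g "f M"] N_commute[of "f M" g] f g(1) by simp
  then show "\<exists>M. \<forall>m\<ge>M. N (f m - f M) < e"
    by blast
qed

text \<open>Banach's iteration. In a seminormed space the limit is fixed only up to seminorm 0. The
  iteration starts at 0, which lies in the closed cone, so a map that preserves the cone has its
  fixed point there.\<close>

lemma contraction_fixed_point:
  assumes \<Phi>: "!!u. u \<in> V ==> \<Phi> u \<in> V" and q: "0 \<le> q" "q < 1"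
    and contr: "!!u v. u \<in> V ==> v \<in> V ==> N (\<Phi> u - \<Phi> v) \<le> q * N (u - v)"
  obtains u where "u \<in> V" "N (\<Phi> u - u) = 0" "(!!v. v \<in> P ==> \<Phi> v \<in> P) ==> u \<in> P"
proof -
  define x where "x n = (\<Phi> ^^ n) 0" for n
  have x: "x n \<in> V" for n
    unfolding x_def by (induction n) (auto intro: \<Phi>)
  have step: "N (x (Suc n) - x n) \<le> q ^ n * N (x 1 - x 0)" for n
  proof (induction n)
    case (Suc n)
    have "N (x (Suc (Suc n)) - x (Suc n)) \<le> q * N (x (Suc n) - x n)"
      using contr[OF x x, of "Suc n" n] by (simp add: x_def)
    also have "\<dots> \<le> q * (q ^ n * N (x 1 - x 0))"
      using Suc q(1) by (rule mult_left_mono)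
    finally show ?case
      by simp
  qed simp
  have "summable (\<lambda>n. q ^ n * N (x 1 - x 0))"
    using q by (intro summable_mult2 summable_geometric) simp
  then obtain u where u: "u \<in> V" "(\<lambda>n. N (x n - u)) \<longlonglongrightarrow> 0"
    using Cauchy_V_convergent[of x, OF x summable_imp_Cauchy_V[of x, OF x step]] by blast
  have "(\<lambda>n. N (x (Suc n) - \<Phi> u)) \<longlonglongrightarrow> 0"
  proof (rule tendsto_sandwich[of "\<lambda>_. 0" _ _ "\<lambda>n. q * N (x n - u)"])
    show "(\<lambda>n. q * N (x n - u)) \<longlonglongrightarrow> 0"
      using tendsto_mult_left[OF u(2), of q] by simp
    have "N (x (Suc n) - \<Phi> u) \<le> q * N (x n - u)" for n
      using contr[OF x u(1), of n] by (simp add: x_def)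
    then show "\<forall>\<^sub>F n in sequentially. N (x (Suc n) - \<Phi> u) \<le> q * N (x n - u)"
      by simp
  qed (use N_nonneg x u \<Phi> in auto)
  moreover have "(\<lambda>n. N (x (Suc n) - u)) \<longlonglongrightarrow> 0"
    using u(2) by (rule LIMSEQ_Suc)
  ultimately have "N (\<Phi> u - u) = 0"
    using limit_unique[of "\<lambda>n. x (Suc n)"] x u \<Phi> by blast
  moreover have "u \<in> P" if "!!v. v \<in> P ==> \<Phi> v \<in> P"
  proof -
    have "x n \<in> P" for n
      unfolding x_def by (induction n) (auto intro: that P_zero)
    then show ?thesis
      using P_closed u by blast
  qed
  ultimately show thesis
    using that u(1) by blast
qed

end

section \<open>Contraction semigroups and their generators\<close>

context ordered_seminormed
begin

definition C0_sg :: "(real \<Rightarrow> 'v \<Rightarrow> 'v) \<Rightarrow> bool" where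
  "C0_sg G \<longleftrightarrow>
     (\<forall>t\<ge>0. \<forall>f\<in>V. G t f \<in> V) \<and>
     (\<forall>t\<ge>0. \<forall>f\<in>V. \<forall>g\<in>V. \<forall>c d. N (G t (c *\<^sub>R f + d *\<^sub>R g) - (c *\<^sub>R G t f + d *\<^sub>R G t g)) = 0) \<and>
     (\<forall>t\<ge>0. \<exists>C. \<forall>f\<in>V. N (G t f) \<le> C * N f) \<and>
     (\<forall>f\<in>V. N (G 0 f - f) = 0) \<and>
     (\<forall>s\<ge>0. \<forall>t\<ge>0. \<forall>f\<in>V. N (G (s + t) f - G s (G t f)) = 0) \<and>
     (\<forall>f\<in>V. ((\<lambda>t. N (G t f - f)) \<longlongrightarrow> 0) (at_right 0))"

definition contraction_sg :: "(real \<Rightarrow> 'v \<Rightarrow> 'v) \<Rightarrow> bool" where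
  "contraction_sg G \<longleftrightarrow> C0_sg G \<and> (\<forall>t\<ge>0. \<forall>f\<in>V. N (G t f) \<le> N f)"

lemma contraction_sgI:
  assumes "!!t f. 0 \<le> t ==> f \<in> V ==> G t f \<in> V"
    and "!!t f. 0 \<le> t ==> f \<in> V ==> N (G t f) \<le> N f"
    and "!!t f g c d. 0 \<le> t ==> f \<in> V ==> g \<in> V ==>
      N (G t (c *\<^sub>R f + d *\<^sub>R g) - (c *\<^sub>R G t f + d *\<^sub>R G t g)) = 0"
    and "!!f. f \<in> V ==> N (G 0 f - f) = 0"
    and "!!s t f. 0 \<le> s ==> 0 \<le> t ==> f \<in> V ==> N (G (s + t) f - G s (G t f)) = 0"
    and "!!f. f \<in> V ==> ((\<lambda>t. N (G t f - f)) \<longlongrightarrow> 0) (at_right 0)"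
  shows "contraction_sg G"
  unfolding contraction_sg_def C0_sg_def using assms by (auto intro!: exI[of _ 1])

definition gen :: "(real \<Rightarrow> 'v \<Rightarrow> 'v) \<Rightarrow> 'v rel" where
  "gen G = {(f, g). f \<in> V \<and> g \<in> V \<and> ((\<lambda>t. N ((1/t) *\<^sub>R (G t f - f) - g)) \<longlongrightarrow> 0) (at_right 0)}"

text \<open>Product rule at t = 0: the difference quotient splits into the quotient of
  \<open>G\<close>, multiplied by the exponential, and two terms that vanish because exp(\<omega> t)
  tends to 1 and (exp(\<omega> t) - 1) / t to \<omega>. With -\<omega> in place of \<omega> the
  lemma undoes a rescaling.\<close>

lemma gen_rescale:
  assumes G: "!!t f. 0 \<le> t ==> f \<in> V ==> G t f \<in> V" and fg: "(f, g) \<in> gen G"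
  shows "(f, g + \<omega> *\<^sub>R f) \<in> gen (\<lambda>t f. exp (\<omega> * t) *\<^sub>R G t f)"
proof -
  have f: "f \<in> V" and g: "g \<in> V" and lim: "((\<lambda>t. N ((1/t) *\<^sub>R (G t f - f) - g)) \<longlongrightarrow> 0) (at_right 0)"
    using fg by (auto simp: gen_def)
  define c where "c t = (exp (\<omega> * t) - 1) / t" for t :: real
  have "((\<lambda>t. exp (\<omega> * t)) has_real_derivative \<omega>) (at 0)"
    by (auto intro!: derivative_eq_intros)
  then have c: "(c \<longlongrightarrow> \<omega>) (at_right 0)"
    unfolding has_field_derivative_iff c_def
    by (simp add: filterlim_at_split)
  have e: "((\<lambda>t. exp (\<omega> * t)) \<longlongrightarrow> exp (\<omega> * 0)) (at_right 0)"
    by (intro tendsto_intros)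
  let ?R = "\<lambda>t. exp (\<omega> * t) * N ((1/t) *\<^sub>R (G t f - f) - g) + \<bar>exp (\<omega> * t) - 1\<bar> * N g + \<bar>c t - \<omega>\<bar> * N f"
  have "(?R \<longlongrightarrow> exp (\<omega> * 0) * 0 + \<bar>exp (\<omega> * 0) - 1\<bar> * N g + \<bar>\<omega> - \<omega>\<bar> * N f) (at_right 0)"
    using c e lim by (intro tendsto_intros)
  then have R: "(?R \<longlongrightarrow> 0) (at_right 0)"
    by simp
  have bound: "N ((1/t) *\<^sub>R (exp (\<omega> * t) *\<^sub>R G t f - f) - (g + \<omega> *\<^sub>R f)) \<le> ?R t" if "t > 0" for t
  proof -
    have Gt: "G t f \<in> V"
      using G f that by simp
    let ?a = "exp (\<omega> * t) *\<^sub>R ((1/t) *\<^sub>R (G t f - f) - g)" and ?b = "(exp (\<omega> * t) - 1) *\<^sub>R g"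
      and ?c = "(c t - \<omega>) *\<^sub>R f"
    have "(1/t) *\<^sub>R (exp (\<omega> * t) *\<^sub>R G t f - f) - (g + \<omega> *\<^sub>R f) = ?a + ?b + ?c"
      using that by (simp add: c_def algebra_simps diff_divide_distrib)
    then have "N ((1/t) *\<^sub>R (exp (\<omega> * t) *\<^sub>R G t f - f) - (g + \<omega> *\<^sub>R f)) \<le> N ?a + N ?b + N ?c"
      using N_triangle[of "?a + ?b" ?c] N_triangle[of ?a ?b] f g Gt by simp
    then show ?thesis
      using f g Gt by (simp add: N_scale)
  qed
  have "((\<lambda>t. N ((1/t) *\<^sub>R (exp (\<omega> * t) *\<^sub>R G t f - f) - (g + \<omega> *\<^sub>R f))) \<longlongrightarrow> 0) (at_right 0)"
    using G f g by (intro tendsto_0_at_right_bound[OF R] bound N_nonneg) auto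
  then show ?thesis
    using f g by (auto simp: gen_def)
qed

end

locale contraction_semigroup = ordered_seminormed +
  fixes G :: "real \<Rightarrow> 'a \<Rightarrow> 'a"
  assumes contraction_sg: "contraction_sg G"
begin

lemma G_V [simp, intro]: "0 \<le> t ==> f \<in> V ==> G t f \<in> V"
  and G_contr: "0 \<le> t ==> f \<in> V ==> N (G t f) \<le> N f"
  and G_lin: "0 \<le> t ==> f \<in> V ==> g \<in> V ==>
    N (G t (c *\<^sub>R f + d *\<^sub>R g) - (c *\<^sub>R G t f + d *\<^sub>R G t g)) = 0"
  and G_0: "f \<in> V ==> N (G 0 f - f) = 0"
  and G_add: "0 \<le> s ==> 0 \<le> t ==> f \<in> V ==> N (G (s + t) f - G s (G t f)) = 0"
  and G_cont: "f \<in> V ==> ((\<lambda>t. N (G t f - f)) \<longlongrightarrow> 0) (at_right 0)"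
  using contraction_sg by (auto simp: contraction_sg_def C0_sg_def)

lemma G_diff: "0 \<le> t ==> f \<in> V ==> g \<in> V ==> N (G t (f - g) - (G t f - G t g)) = 0"
  using G_lin[of t f g 1 "-1"] by simp

lemma G_scale: "0 \<le> t ==> f \<in> V ==> N (G t (c *\<^sub>R f) - c *\<^sub>R G t f) = 0"
  using G_lin[of t f f c 0] by simp

lemma G_diff_contr: "0 \<le> t ==> f \<in> V ==> g \<in> V ==> N (G t f - G t g) \<le> N (f - g)"
  using N_eq[of "G t (f - g)" "G t f - G t g"] G_diff[of t f g] G_contr[of t "f - g"] by simp

lemma G_cont_0:
  assumes "f \<in> V" "e > 0"
  obtains \<delta> where "\<delta> > 0" "!!s. 0 \<le> s ==> s \<le> \<delta> ==> N (G s f - f) < e"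
proof -
  have "\<forall>\<^sub>F t in at_right 0. N (G t f - f) < e"
    using order_tendstoD(2)[OF G_cont[OF assms(1)] assms(2)] .
  then obtain b where b: "b > 0" "!!t. 0 < t ==> t < b ==> N (G t f - f) < e"
    unfolding eventually_at_right_field by auto
  have "N (G s f - f) < e" if "0 \<le> s" "s \<le> b / 2" for s
    using b that G_0[OF assms(1)] assms(2) by (cases "s = 0") auto
  then show thesis
    using that[of "b / 2"] b(1) by simp
qed

lemma gen_lin:
  assumes "(f, g) \<in> gen G" "(f', g') \<in> gen G"
  shows "(c *\<^sub>R f + d *\<^sub>R f', c *\<^sub>R g + d *\<^sub>R g') \<in> gen G"
proof -
  have V: "f \<in> V" "g \<in> V" "f' \<in> V" "g' \<in> V"
    using assms by (auto simp: gen_def)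
  let ?Q = "\<lambda>f t. (1/t) *\<^sub>R (G t f - f)"
  have lim: "((\<lambda>t. \<bar>c\<bar> * N (?Q f t - g) + \<bar>d\<bar> * N (?Q f' t - g')) \<longlongrightarrow> 0) (at_right 0)"
    using assms by (auto simp: gen_def intro!: tendsto_eq_intros)
  have bound: "N (?Q (c *\<^sub>R f + d *\<^sub>R f') t - (c *\<^sub>R g + d *\<^sub>R g'))
      \<le> \<bar>c\<bar> * N (?Q f t - g) + \<bar>d\<bar> * N (?Q f' t - g')" if "t > 0" for t
  proof -
    let ?a = "(1/t) *\<^sub>R (G t (c *\<^sub>R f + d *\<^sub>R f') - (c *\<^sub>R G t f + d *\<^sub>R G t f'))"
    have "?Q (c *\<^sub>R f + d *\<^sub>R f') t - (c *\<^sub>R g + d *\<^sub>R g') =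
        ?a + (c *\<^sub>R (?Q f t - g) + d *\<^sub>R (?Q f' t - g'))"
      by (simp add: algebra_simps)
    moreover have "N ?a = 0"
      using V that G_lin[of t f f' c d] by (simp add: N_scale)
    ultimately show ?thesis
      using N_triangle[of ?a "c *\<^sub>R (?Q f t - g) + d *\<^sub>R (?Q f' t - g')"]
        N_triangle[of "c *\<^sub>R (?Q f t - g)" "d *\<^sub>R (?Q f' t - g')"] V that
      by (simp add: N_scale)
  qed
  have "((\<lambda>t. N (?Q (c *\<^sub>R f + d *\<^sub>R f') t - (c *\<^sub>R g + d *\<^sub>R g'))) \<longlongrightarrow> 0) (at_right 0)"
    using V by (intro tendsto_0_at_right_bound[OF lim] bound N_nonneg) auto
  then show ?thesis
    using V by (auto simp: gen_def)
qed

text \<open>Write (\<mu> + 1/t) f as (\<mu> f - g) + G(t) f / t minus the error of the difference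
  quotient. Contractivity bounds the second term by N f / t, which cancels, and the error vanishes
  as t tends to 0.\<close>

lemma gen_dissipative:
  assumes fg: "(f, g) \<in> gen G" and "0 \<le> \<mu>"
  shows "\<mu> * N f \<le> N (\<mu> *\<^sub>R f - g)"
proof -
  have V: "f \<in> V" "g \<in> V" and lim: "((\<lambda>t. N ((1/t) *\<^sub>R (G t f - f) - g)) \<longlongrightarrow> 0) (at_right 0)"
    using fg by (auto simp: gen_def)
  have bound: "\<mu> * N f - N (\<mu> *\<^sub>R f - g) \<le> N ((1/t) *\<^sub>R (G t f - f) - g)" if "t > 0" for t
  proof -
    have "(\<mu> + 1/t) *\<^sub>R f = (\<mu> *\<^sub>R f - g) + ((1/t) *\<^sub>R G t f - ((1/t) *\<^sub>R (G t f - f) - g))"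
      by (simp add: algebra_simps)
    then have "(\<mu> + 1/t) * N f = N ((\<mu> *\<^sub>R f - g) + ((1/t) *\<^sub>R G t f - ((1/t) *\<^sub>R (G t f - f) - g)))"
      using N_scale[OF V(1), of "\<mu> + 1/t"] that \<open>0 \<le> \<mu>\<close> by simp
    also have "\<dots> \<le> N (\<mu> *\<^sub>R f - g) + N ((1/t) *\<^sub>R G t f - ((1/t) *\<^sub>R (G t f - f) - g))"
      using V that by (intro N_triangle) auto
    also have "N ((1/t) *\<^sub>R G t f - ((1/t) *\<^sub>R (G t f - f) - g))
        \<le> N ((1/t) *\<^sub>R G t f) + N ((1/t) *\<^sub>R (G t f - f) - g)"
      using V that by (intro N_diff_le) auto
    also have "N ((1/t) *\<^sub>R G t f) \<le> (1/t) * N f"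
      using V that G_contr[of t f] by (simp add: N_scale field_simps)
    finally show ?thesis
      by (simp add: algebra_simps)
  qed
  have "\<mu> * N f - N (\<mu> *\<^sub>R f - g) \<le> 0"
    by (rule tendsto_lowerbound[OF lim])
      (auto intro!: eventually_mono[OF eventually_at_right_less[of 0]] bound)
  then show ?thesis
    by simp
qed

text \<open>Orbits that start at seminorm distance 0 stay at distance 0 by contractivity, so
  difference quotients do not see the choice of representatives.\<close>

lemma gen_eq:
  assumes fg: "(f, g) \<in> gen G" and V': "f' \<in> V" "g' \<in> V" and eq: "N (f' - f) = 0" "N (g' - g) = 0"
  shows "(f', g') \<in> gen G"
proof -
  have V: "f \<in> V" "g \<in> V" and lim: "((\<lambda>t. N ((1/t) *\<^sub>R (G t f - f) - g)) \<longlongrightarrow> 0) (at_right 0)"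
    using fg by (auto simp: gen_def)
  have "N ((1/t) *\<^sub>R (G t f' - f') - g') = N ((1/t) *\<^sub>R (G t f - f) - g)" if "t > 0" for t
  proof (rule N_eq)
    have 1: "N (G t f' - G t f) = 0"
      using G_diff_contr[of t f' f] V V' eq that N_nonneg[of "G t f' - G t f"] by simp
    have 2: "N ((G t f' - G t f) - (f' - f)) = 0"
      using N_diff_le[of "G t f' - G t f" "f' - f"] 1 eq V V' that
        N_nonneg[of "(G t f' - G t f) - (f' - f)"] by simp
    have split: "((1/t) *\<^sub>R (G t f' - f') - g') - ((1/t) *\<^sub>R (G t f - f) - g) =
        (1/t) *\<^sub>R ((G t f' - G t f) - (f' - f)) - (g' - g)" (is "_ = ?r")
      by (simp add: algebra_simps)
    have "N ?r = 0"
      using N_diff_le[of "(1/t) *\<^sub>R ((G t f' - G t f) - (f' - f))" "g' - g"] 2 eq V V' that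
        N_nonneg[of ?r] by (simp add: N_scale)
    then show "N (((1/t) *\<^sub>R (G t f' - f') - g') - ((1/t) *\<^sub>R (G t f - f) - g)) = 0"
      by (simp only: split)
  qed (use V V' that in auto)
  then have "((\<lambda>t. N ((1/t) *\<^sub>R (G t f' - f') - g')) \<longlongrightarrow> 0) (at_right 0)"
    using V' by (intro tendsto_0_at_right_bound[OF lim] N_nonneg) auto
  then show ?thesis
    using V' by (auto simp: gen_def)
qed

lemma gen_G:
  assumes fg: "(f, g) \<in> gen G" and "0 \<le> s"
  shows "(G s f, G s g) \<in> gen G"
proof -
  have V: "f \<in> V" "g \<in> V" and lim: "((\<lambda>t. N ((1/t) *\<^sub>R (G t f - f) - g)) \<longlongrightarrow> 0) (at_right 0)"
    using fg by (auto simp: gen_def)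
  have bound: "N ((1/t) *\<^sub>R (G t (G s f) - G s f) - G s g) \<le> N ((1/t) *\<^sub>R (G t f - f) - g)" if "t > 0" for t
  proof -
    let ?x = "(1/t) *\<^sub>R G t f - (1/t) *\<^sub>R f"
    have 1: "N (G t (G s f) - G s (G t f)) = 0"
      using N_eq_trans[of "G t (G s f)" "G (s + t) f" "G s (G t f)"] G_add[of s t f] G_add[of t s f]
        N_commute[of "G t (G s f)" "G (s + t) f"] V that \<open>0 \<le> s\<close> by (simp add: add.commute)
    have 2: "N (G s ?x - ((1/t) *\<^sub>R G s (G t f) - (1/t) *\<^sub>R G s f)) = 0"
      using G_lin[of s "G t f" f "1/t" "- (1/t)"] V that \<open>0 \<le> s\<close> by simp
    have eq: "(1/t) *\<^sub>R (G t (G s f) - G s f) - G s ?x =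
        (1/t) *\<^sub>R (G t (G s f) - G s (G t f)) - (G s ?x - ((1/t) *\<^sub>R G s (G t f) - (1/t) *\<^sub>R G s f))"
      by (simp add: algebra_simps)
    have 3: "N ((1/t) *\<^sub>R (G t (G s f) - G s f) - G s ?x) \<le> 0"
      unfolding eq using 1 2 V that \<open>0 \<le> s\<close>
      by (intro N_diff_le[THEN order_trans]) (simp_all add: N_scale)
    have "N (G s ?x - G s g) \<le> N (?x - g)"
      using V that \<open>0 \<le> s\<close> by (intro G_diff_contr) auto
    then show ?thesis
      using 3 N_diff_triangle[of "(1/t) *\<^sub>R (G t (G s f) - G s f)" "G s ?x" "G s g"] V that \<open>0 \<le> s\<close>
      by (simp add: scaleR_diff_right)
  qed
  have "((\<lambda>t. N ((1/t) *\<^sub>R (G t (G s f) - G s f) - G s g)) \<longlongrightarrow> 0) (at_right 0)"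
    using V \<open>0 \<le> s\<close> by (intro tendsto_0_at_right_bound[OF lim] bound N_nonneg) auto
  then show ?thesis
    using V \<open>0 \<le> s\<close> by (auto simp: gen_def)
qed

end

lemma tendsto_0_seq_bound:
  fixes f h :: "nat \<Rightarrow> real"
  assumes "h \<longlonglongrightarrow> 0" "!!n. 0 \<le> f n" "!!n. f n \<le> h n"
  shows "f \<longlonglongrightarrow> 0"
  by (rule tendsto_sandwich[OF _ _ tendsto_const assms(1)]) (simp_all add: assms(2,3))

section \<open>Resolvents of a contraction semigroup\<close>

context contraction_semigroup
begin

text \<open>
  The resolvent is the limit of \<open>(1 - G h)\<^sup>-\<^sup>1 (h f)\<close> as \<open>h\<close> tends to 0, which avoids the Laplace integral.
\<close>

lemma decaying_resolvent:
  assumes "\<mu> > 0" and decay: "!!t g. 0 \<le> t ==> g \<in> V ==> N (G t g) \<le> exp (- \<mu> * t) * N g"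
    and f: "f \<in> V"
  obtains u where "u \<in> V" "(!!t g. 0 \<le> t ==> g \<in> P ==> G t g \<in> P) ==> f \<in> P ==> u \<in> P"
    "!!e. e > 0 ==> \<exists>\<delta>>0. \<forall>t. 0 < t \<and> t \<le> \<delta> --> N (u - G t u - t *\<^sub>R f) \<le> t * e"
proof -
  have decay_diff: "N (G t g - G t g') \<le> exp (- \<mu> * t) * N (g - g')"
    if "0 \<le> t" "g \<in> V" "g' \<in> V" for t g g'
    using N_eq[of "G t (g - g')" "G t g - G t g'"] G_diff[of t g g'] decay[of t "g - g'"] that by simp
  \<comment> \<open>For fixed h the map u -> h f + G(h) u is a contraction with constant exp(-\<mu>
    h). Its fixed point is the sum of h G(j h) f over j, that is, the Riemann sum with step h of the
    Laplace integral of the orbit of f.\<close>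
  have "\<exists>u. u \<in> V \<and> N (h *\<^sub>R f + G h u - u) = 0 \<and>
      ((\<forall>t\<ge>0. \<forall>g\<in>P. G t g \<in> P) --> f \<in> P --> u \<in> P)" if "h > 0" for h
  proof (rule contraction_fixed_point[of "\<lambda>u. h *\<^sub>R f + G h u" "exp (- \<mu> * h)"])
    show "N (h *\<^sub>R f + G h u - (h *\<^sub>R f + G h v)) \<le> exp (- \<mu> * h) * N (u - v)"
      if "u \<in> V" "v \<in> V" for u v
      using decay_diff[of h u v] \<open>h > 0\<close> that by simp
    show "exp (- \<mu> * h) < 1"
      using \<open>\<mu> > 0\<close> \<open>h > 0\<close> by simp
    fix u
    assume "u \<in> V" "N (h *\<^sub>R f + G h u - u) = 0"
      and "(!!v. v \<in> P ==> h *\<^sub>R f + G h v \<in> P) ==> u \<in> P"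
    then show ?thesis
      using \<open>h > 0\<close> by (intro exI[of _ u]) (blast intro: P_add P_scale less_imp_le)
  qed (use f that in auto)
  then obtain U where U: "!!h. h > 0 ==> U h \<in> V" "!!h. h > 0 ==> N (h *\<^sub>R f + G h (U h) - U h) = 0"
    and UP: "!!h. h > 0 ==> (\<forall>t\<ge>0. \<forall>g\<in>P. G t g \<in> P) ==> f \<in> P ==> U h \<in> P"
    by metis
  \<comment> \<open>Unfolding the fixed point equation n times leaves the sum of h G(j h) f over j <
    n, and each G(j h) f is within e of f as long as j h stays below \<delta>.\<close>
  have multi: "N (U h - G (n * h) (U h) - (n * h) *\<^sub>R f) \<le> n * h * e"
    if h: "h > 0" and e: "!!s. 0 \<le> s ==> s \<le> \<delta> ==> N (G s f - f) \<le> e" and n: "real n * h \<le> \<delta>"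
    for h e \<delta> :: real and n :: nat
    using n
  proof (induction n)
    case 0
    then show ?case
      using G_0[of "U h"] N_commute[of "U h" "G 0 (U h)"] U(1)[OF h] by simp
  next
    case (Suc n)
    define t where "t = n * h"
    have t: "0 \<le> t" "t \<le> \<delta>" "t + h = Suc n * h"
      using Suc.prems h by (auto simp: t_def algebra_simps)
    have UV: "U h \<in> V"
      using U h by blast
    have 1: "N (G t (U h) - G t (h *\<^sub>R f + G h (U h))) \<le> 0"
      using G_diff_contr[of t "U h" "h *\<^sub>R f + G h (U h)"] U(2)[OF h]
        N_commute[of "U h" "h *\<^sub>R f + G h (U h)"] t UV h f by simp
    have 2: "N (G t (h *\<^sub>R f + G h (U h)) - (h *\<^sub>R G t f + G t (G h (U h)))) \<le> 0"
      using G_lin[of t f "G h (U h)" h 1] t UV h f by simp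
    have 3: "N (G t (G h (U h)) - G (t + h) (U h)) \<le> 0"
      using G_add[of t h "U h"] t UV h f N_commute[of "G t (G h (U h))" "G (t + h) (U h)"] by simp
    have 4: "N (h *\<^sub>R (G t f - f)) \<le> h * e"
      using e[of t] t h f by (simp add: N_scale)
    have 5: "N (U h - G t (U h) - t *\<^sub>R f) \<le> t * e"
      using Suc t h by (simp add: t_def)
    have "N (U h - G (t + h) (U h) - (t + h) *\<^sub>R f) \<le> 0 + 0 + 0 + h * e + t * e"
      using t UV h f
      by (intro N_triangle_le[OF _ _ N_triangle_le[OF _ _ N_triangle_le[OF _ _ N_triangle_le[OF _ _ 1 2
        refl refl] 3 refl refl] 4 refl refl] 5])
        (auto simp: algebra_simps)
    then show ?case
      using t by (simp add: algebra_simps)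
  qed
  \<comment> \<open>Dyadic steps, so that each coarse step is an exact multiple of every finer
    one.\<close>
  define h where "h k = (1/2::real) ^ k" for k :: nat
  have h: "h k > 0" "h k \<le> 1" for k
    by (auto simp: h_def power_le_one)
  have h0: "h \<longlonglongrightarrow> 0"
    unfolding h_def by (rule LIMSEQ_realpow_zero) auto
  have hsmall: "\<exists>K. \<forall>k\<ge>K. h k \<le> \<delta>" if "\<delta> > 0" for \<delta>
    using LIMSEQ_D[OF h0 that] h(1) by (force intro: less_imp_le)
  have "Cauchy_V (\<lambda>k. U (h k))"
    unfolding Cauchy_V_def
  proof (intro allI impI)
    fix e :: real
    assume "e > 0"
    \<comment> \<open>Chosen so that (1 + \<mu>) e' = \<mu> e / 2, which is what the estimate below
      produces.\<close>
    define e' where "e' = e * \<mu> / (2 * (1 + \<mu>))"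
    have e': "e' > 0"
      using \<open>e > 0\<close> \<open>\<mu> > 0\<close> by (simp add: e'_def)
    obtain \<delta> where \<delta>: "\<delta> > 0" "!!s. 0 \<le> s ==> s \<le> \<delta> ==> N (G s f - f) < e'"
      using G_cont_0[OF f e'] by blast
    obtain K where K: "h K \<le> \<delta>"
      using hsmall[OF \<delta>(1)] by blast
    have "N (U (h m) - U (h K)) < e" if "m \<ge> K" for m
    proof -
      \<comment> \<open>One coarse step consists of 2^(m - K) fine steps; by \<open>multi\<close>
        the fine solution satisfies the coarse equation up to the error h K * e'.\<close>
      have hK: "h K = (2 ^ (m - K) :: nat) * h m"
        using that by (auto simp: h_def le_iff_add power_add power_divide)
      have V: "U (h m) \<in> V" "U (h K) \<in> V" "G (h K) (U (h m)) \<in> V" "G (h K) (U (h K)) \<in> V"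
        using U(1)[OF h(1)] less_imp_le[OF h(1)] by auto
      have 1: "N (U (h m) - G (h K) (U (h m)) - h K *\<^sub>R f) \<le> h K * e'"
        using multi[of "h m" \<delta> e' "2 ^ (m - K)"] h \<delta> K hK by (auto intro: less_imp_le)
      have 2: "N (h K *\<^sub>R f + G (h K) (U (h K)) - U (h K)) \<le> 0"
        using U h by simp
      have 3: "N (G (h K) (U (h m)) - G (h K) (U (h K))) \<le> exp (- \<mu> * h K) * N (U (h m) - U (h K))"
        using decay_diff V h by (simp add: less_imp_le)
      have 4: "N (U (h m) - U (h K)) \<le> h K * e' + exp (- \<mu> * h K) * N (U (h m) - U (h K)) + 0"
        using V f by (intro N_triangle_le[OF _ _ N_triangle_le[OF _ _ 1 3 refl refl] 2]) auto
      \<comment> \<open>From exp x \<ge> 1 + x and h K \<le> 1: the gap 1 - exp(-\<mu> h K) is at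
        least proportional to h K, so the factor h K of the error cancels and the bound is uniform
        in the step.\<close>
      have "(1 + \<mu>) * (1 - exp (- \<mu> * h K)) \<ge> \<mu> * h K"
      proof -
        have "exp (- (\<mu> * h K)) * (1 + \<mu> * h K) \<le> exp (- (\<mu> * h K)) * exp (\<mu> * h K)"
          using exp_ge_add_one_self[of "\<mu> * h K"] by (intro mult_left_mono) auto
        then have "\<mu> * h K \<le> (1 - exp (- \<mu> * h K)) * (1 + \<mu> * h K)"
          by (simp add: exp_minus field_simps)
        also have "\<dots> \<le> (1 - exp (- \<mu> * h K)) * (1 + \<mu>)"
          using h[of K] \<open>\<mu> > 0\<close> by (intro mult_left_mono) (auto simp: mult_left_le)
        finally show ?thesis
          by (simp add: mult.commute)
      qed
      then have "\<mu> * h K * N (U (h m) - U (h K))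
          \<le> (1 + \<mu>) * (1 - exp (- \<mu> * h K)) * N (U (h m) - U (h K))"
        using N_nonneg V by (intro mult_right_mono) auto
      also have "\<dots> \<le> (1 + \<mu>) * (h K * e')"
        using 4 \<open>\<mu> > 0\<close> unfolding mult.assoc by (intro mult_left_mono) (auto simp: algebra_simps)
      finally have "h K * (\<mu> * N (U (h m) - U (h K))) \<le> h K * ((1 + \<mu>) * e')"
        by (simp add: algebra_simps)
      then have "\<mu> * N (U (h m) - U (h K)) \<le> (1 + \<mu>) * e'"
        using h[of K] by simp
      also have "\<dots> = \<mu> * e / 2"
        using \<open>\<mu> > 0\<close> by (simp add: e'_def field_simps)
      also have "\<dots> < \<mu> * e"
        using \<open>\<mu> > 0\<close> \<open>e > 0\<close> by simp
      finally show ?thesis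
        using \<open>\<mu> > 0\<close> by simp
    qed
    then show "\<exists>M. \<forall>m\<ge>M. N (U (h m) - U (h M)) < e"
      by blast
  qed
  then obtain u where u: "u \<in> V" "(\<lambda>k. N (U (h k) - u)) \<longlonglongrightarrow> 0"
    using Cauchy_V_convergent[of "\<lambda>k. U (h k)"] U h by blast
  show thesis
  proof (rule that[OF u(1)])
    assume "!!t g. 0 \<le> t ==> g \<in> P ==> G t g \<in> P" "f \<in> P"
    then show "u \<in> P"
      using P_closed[of "\<lambda>k. U (h k)" u] UP h u by blast
  next
    fix e :: real
    assume e: "e > 0"
    obtain \<delta> where \<delta>: "\<delta> > 0" "!!s. 0 \<le> s ==> s \<le> \<delta> ==> N (G s f - f) < e"
      using G_cont_0[OF f e] by blast
    have "N (u - G t u - t *\<^sub>R f) \<le> t * e" if t: "0 < t" "t \<le> \<delta>" for t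
    proof -
      \<comment> \<open>The largest multiple r k of h k below t; the remainder is at most h k and
        tends to 0.\<close>
      define n where "n k = nat \<lfloor>t / h k\<rfloor>" for k
      define r where "r k = n k * h k" for k
      have r_le: "r k \<le> t" "t - r k \<le> h k" "0 \<le> r k" for k
      proof -
        have "0 \<le> t / h k"
          using t h[of k] by simp
        then have "real (n k) \<le> t / h k" "t / h k \<le> n k + 1"
          unfolding n_def by linarith+
        then show "r k \<le> t" "t - r k \<le> h k" "0 \<le> r k"
          using h[of k] by (auto simp: r_def field_simps)
      qed
      have V: "U (h k) \<in> V" "G (r k) (U (h k)) \<in> V" "G t u \<in> V" "G (r k) u \<in> V" for k
        using U(1)[OF h(1)] u r_le t by auto
      have "(\<lambda>k. t - r k) \<longlonglongrightarrow> 0"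
        by (rule tendsto_sandwich[OF _ _ tendsto_const h0]) (use r_le in auto)
      then have rt: "(\<lambda>k. t - (t - r k)) \<longlonglongrightarrow> t - 0"
        by (intro tendsto_intros)
      have "(\<lambda>k. N (G (t - r k) u - u)) \<longlonglongrightarrow> 0"
      proof (rule LIMSEQ_I)
        fix d :: real
        assume "d > 0"
        then obtain \<eta> where \<eta>: "\<eta> > 0" "!!s. 0 \<le> s ==> s \<le> \<eta> ==> N (G s u - u) < d"
          using G_cont_0[OF u(1)] by blast
        obtain K where K: "\<forall>k\<ge>K. h k \<le> \<eta>"
          using hsmall[OF \<eta>(1)] by blast
        have "norm (N (G (t - r k) u - u) - 0) < d" if "k \<ge> K" for k
        proof -
          have "t - r k \<le> \<eta>" "0 \<le> t - r k"
            using K that r_le[of k] by force+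
          then show ?thesis
            using \<eta>(2)[of "t - r k"] N_nonneg[of "G (t - r k) u - u"] u by simp
        qed
        then show "\<exists>K. \<forall>k\<ge>K. norm (N (G (t - r k) u - u) - 0) < d"
          by blast
      qed
      then have lim: "(\<lambda>k. N (U (h k) - u) + N (G (t - r k) u - u)) \<longlonglongrightarrow> 0"
        using u(2) by (auto intro!: tendsto_eq_intros)
      \<comment> \<open>Three errors: \<open>U (h k)\<close> against u, the remaining time t - r k
        acting on u, and the semigroup law. The operators \<open>G (r k)\<close> are contractions,
        so the first two do not grow.\<close>
      have "(\<lambda>k. N (G (r k) (U (h k)) - G t u)) \<longlonglongrightarrow> 0"
      proof (rule tendsto_sandwich[OF _ _ tendsto_const lim])
        have "N (G (r k) (U (h k)) - G t u) \<le> N (U (h k) - u) + N (G (t - r k) u - u)" for k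
        proof -
          have 1: "N (G (r k) (U (h k)) - G (r k) u) \<le> N (U (h k) - u)"
            using G_diff_contr r_le V u by simp
          have 2: "N (G (r k) u - G (r k) (G (t - r k) u)) \<le> N (G (t - r k) u - u)"
            using G_diff_contr[of "r k" u "G (t - r k) u"] N_commute[of u "G (t - r k) u"] r_le[of k] u
            by simp
          have 3: "N (G (r k) (G (t - r k) u) - G t u) \<le> 0"
            using G_add[of "r k" "t - r k" u] N_commute[of "G (r k) (G (t - r k) u)" "G t u"]
              r_le[of k] u t by simp
          show ?thesis
            using V u r_le
            by (intro N_triangle_le[OF _ _ N_triangle_le[OF _ _ 1 2 refl refl] 3]) auto
        qed
        then show "\<forall>\<^sub>F k in sequentially. N (G (r k) (U (h k)) - G t u)
            \<le> N (U (h k) - u) + N (G (t - r k) u - u)"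
          by simp
      qed (use V N_nonneg in auto)
      then have l1: "(\<lambda>k. N ((U (h k) - G (r k) (U (h k))) - (u - G t u))) \<longlonglongrightarrow> 0"
        using V u by (intro lim_diff) auto
      have "(\<lambda>k. \<bar>r k - t\<bar> * N f) \<longlonglongrightarrow> 0"
        using rt by (auto intro!: tendsto_eq_intros)
      then have "(\<lambda>k. N (r k *\<^sub>R f - t *\<^sub>R f)) \<longlonglongrightarrow> 0"
        using f by (simp add: N_scale flip: scaleR_diff_left)
      then have l2: "(\<lambda>k. N ((U (h k) - G (r k) (U (h k)) - r k *\<^sub>R f) - (u - G t u - t *\<^sub>R f))) \<longlonglongrightarrow> 0"
        using V u f by (intro lim_diff[OF _ _ _ _ l1]) auto
      have bound: "N (U (h k) - G (r k) (U (h k)) - r k *\<^sub>R f) \<le> r k * e" for k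
        unfolding r_def
        by (rule multi[of _ \<delta>]) (use \<delta> h t r_le[of k] in \<open>auto simp: r_def less_imp_le\<close>)
      have "(\<lambda>k. r k * e) \<longlonglongrightarrow> t * e"
        using rt by (auto intro!: tendsto_eq_intros)
      then show ?thesis
        using N_limit_le[OF _ _ l2, of 0 "\<lambda>k. r k * e"] bound V u f by auto
    qed
    then show "\<exists>\<delta>>0. \<forall>t. 0 < t \<and> t \<le> \<delta> --> N (u - G t u - t *\<^sub>R f) \<le> t * e"
      using \<delta>(1) by blast
  qed
qed

lemma C0_sg_rescale: "C0_sg (\<lambda>t f. exp (\<omega> * t) *\<^sub>R G t f)"
  unfolding C0_sg_def
proof (intro conjI allI impI ballI)
  fix t
  assume t: "0 \<le> (t::real)"
  show "\<exists>C. \<forall>f\<in>V. N (exp (\<omega> * t) *\<^sub>R G t f) \<le> C * N f"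
    using G_contr[OF t] t by (intro exI[of _ "exp (\<omega> * t)"]) (simp add: N_scale)
next
  fix t f g c d
  assume t: "0 \<le> (t::real)" and f: "f \<in> V" and g: "g \<in> V"
  have "exp (\<omega> * t) *\<^sub>R G t (c *\<^sub>R f + d *\<^sub>R g) -
      (c *\<^sub>R exp (\<omega> * t) *\<^sub>R G t f + d *\<^sub>R exp (\<omega> * t) *\<^sub>R G t g) =
      exp (\<omega> * t) *\<^sub>R (G t (c *\<^sub>R f + d *\<^sub>R g) - (c *\<^sub>R G t f + d *\<^sub>R G t g))"
    by (simp add: algebra_simps)
  then show "N (exp (\<omega> * t) *\<^sub>R G t (c *\<^sub>R f + d *\<^sub>R g) -
      (c *\<^sub>R exp (\<omega> * t) *\<^sub>R G t f + d *\<^sub>R exp (\<omega> * t) *\<^sub>R G t g)) = 0"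
    using G_lin[OF t f g, of c d] t f g by (simp only: N_scale V_diff V_add V_scale G_V mult_zero_right)
next
  fix s t f
  assume st: "0 \<le> (s::real)" "0 \<le> (t::real)" and f: "f \<in> V"
  have 1: "N (exp (\<omega> * (s + t)) *\<^sub>R (G (s + t) f - G s (G t f))) \<le> 0"
    using G_add[OF st f] st f by (simp add: N_scale)
  have "exp (\<omega> * (s + t)) = exp (\<omega> * s) * exp (\<omega> * t)"
    by (simp add: algebra_simps flip: exp_add)
  then have eq: "exp (\<omega> * (s + t)) *\<^sub>R G s (G t f) - exp (\<omega> * s) *\<^sub>R G s (exp (\<omega> * t) *\<^sub>R G t f)
      = (- exp (\<omega> * s)) *\<^sub>R (G s (exp (\<omega> * t) *\<^sub>R G t f) - exp (\<omega> * t) *\<^sub>R G s (G t f))"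
    by (simp add: algebra_simps)
  have 2: "N (exp (\<omega> * (s + t)) *\<^sub>R G s (G t f) - exp (\<omega> * s) *\<^sub>R G s (exp (\<omega> * t) *\<^sub>R G t f)) \<le> 0"
    unfolding eq using G_scale[of s "G t f" "exp (\<omega> * t)"] st f
    by (simp only: N_scale V_diff V_scale G_V mult_zero_right order_refl)
  have "N (exp (\<omega> * (s + t)) *\<^sub>R G (s + t) f - exp (\<omega> * s) *\<^sub>R G s (exp (\<omega> * t) *\<^sub>R G t f)) \<le> 0"
    using st f by (intro N_triangle_le[OF _ _ 1 2]) (auto simp: algebra_simps)
  then show "N (exp (\<omega> * (s + t)) *\<^sub>R G (s + t) f - exp (\<omega> * s) *\<^sub>R G s (exp (\<omega> * t) *\<^sub>R G t f)) = 0"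
    using st f
      N_nonneg[of "exp (\<omega> * (s + t)) *\<^sub>R G (s + t) f - exp (\<omega> * s) *\<^sub>R G s (exp (\<omega> * t) *\<^sub>R G t f)"]
    by simp
next
  fix f
  assume f: "f \<in> V"
  have exp: "((\<lambda>t. exp (\<omega> * t)) \<longlongrightarrow> exp (\<omega> * 0)) (at_right 0)"
    by (intro tendsto_intros)
  then have "((\<lambda>t. exp (\<omega> * t) * N (G t f - f) + \<bar>exp (\<omega> * t) - 1\<bar> * N f)
      \<longlongrightarrow> exp (\<omega> * 0) * 0 + \<bar>exp (\<omega> * 0) - 1\<bar> * N f) (at_right 0)"
    using G_cont[OF f] by (intro tendsto_intros)
  then have lim: "((\<lambda>t. exp (\<omega> * t) * N (G t f - f) + \<bar>exp (\<omega> * t) - 1\<bar> * N f) \<longlongrightarrow> 0) (at_right 0)"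
    by simp
  show "((\<lambda>t. N (exp (\<omega> * t) *\<^sub>R G t f - f)) \<longlongrightarrow> 0) (at_right 0)"
  proof (rule tendsto_0_at_right_bound[OF lim])
    fix t :: real
    assume t: "0 < t"
    show "0 \<le> N (exp (\<omega> * t) *\<^sub>R G t f - f)"
      using t f by (intro N_nonneg) auto
    have 1: "N (exp (\<omega> * t) *\<^sub>R (G t f - f)) \<le> exp (\<omega> * t) * N (G t f - f)"
      using t f by (simp add: N_scale)
    have 2: "N ((exp (\<omega> * t) - 1) *\<^sub>R f) \<le> \<bar>exp (\<omega> * t) - 1\<bar> * N f"
      using f by (simp only: N_scale)
    show "N (exp (\<omega> * t) *\<^sub>R G t f - f) \<le> exp (\<omega> * t) * N (G t f - f) + \<bar>exp (\<omega> * t) - 1\<bar> * N f"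
      using t f by (intro N_triangle_le[OF _ _ 1 2]) (auto simp: algebra_simps)
  qed
qed (use G_0 in auto)

lemma contraction_sg_rescale:
  assumes "\<omega> \<le> 0"
  shows "contraction_sg (\<lambda>t f. exp (\<omega> * t) *\<^sub>R G t f)"
proof -
  have "N (exp (\<omega> * t) *\<^sub>R G t f) \<le> N f" if "0 \<le> t" "f \<in> V" for t f
    using G_contr[OF that] that assms N_nonneg[of "G t f"] mult_nonpos_nonneg[OF assms that(1)]
      mult_right_mono[of "exp (\<omega> * t)" 1 "N (G t f)"] by (simp add: N_scale)
  then show ?thesis
    using C0_sg_rescale unfolding contraction_sg_def by blast
qed

text \<open>The rescaled semigroup \<open>E\<close> decays, and the equation found for it says that
  its generator takes u to -f; undoing the rescaling gives the resolvent equation. The last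
  conclusion is density of the domain: (u - E(t) u) / t lies in the domain of the generator and
  tends to f.\<close>

lemma resolvent:
  assumes "\<mu> > 0" "f \<in> V"
  obtains u where "(u, \<mu> *\<^sub>R u - f) \<in> gen G"
    "(!!t g. 0 \<le> t ==> g \<in> P ==> G t g \<in> P) ==> f \<in> P ==> u \<in> P"
    "!!e. e > 0 ==> \<exists>v w. (v, w) \<in> gen G \<and> N (v - f) \<le> e"
proof -
  define E where "E t g = exp (- \<mu> * t) *\<^sub>R G t g" for t g
  interpret E: contraction_semigroup V N P E
    using contraction_sg_rescale[of "- \<mu>"] assms(1) unfolding E_def by unfold_locales simp
  have decay: "N (E t g) \<le> exp (- \<mu> * t) * N g" if "0 \<le> t" "g \<in> V" for t g
    using that G_contr by (simp add: E_def N_scale)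
  obtain u where u: "u \<in> V" "(!!t g. 0 \<le> t ==> g \<in> P ==> E t g \<in> P) ==> f \<in> P ==> u \<in> P"
    and close: "!!e. e > 0 ==> \<exists>\<delta>>0. \<forall>t. 0 < t \<and> t \<le> \<delta> --> N (u - E t u - t *\<^sub>R f) \<le> t * e"
    using E.decaying_resolvent[OF assms(1) decay assms(2)] by blast
  have quot: "N ((1/t) *\<^sub>R (u - E t u) - f) = N (u - E t u - t *\<^sub>R f) / t" if "0 < t" for t
  proof -
    have "(1/t) *\<^sub>R (u - E t u) - f = (1/t) *\<^sub>R (u - E t u - t *\<^sub>R f)"
      using that by (simp add: algebra_simps)
    then show ?thesis
      using that u assms(2) N_scale[of "u - E t u - t *\<^sub>R f" "1/t"] by simp
  qed
  have "((\<lambda>t. N ((1/t) *\<^sub>R (E t u - u) - (- f))) \<longlongrightarrow> 0) (at_right 0)"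
  proof (rule tendstoI)
    fix e :: real
    assume "e > 0"
    then obtain \<delta> where \<delta>: "\<delta> > 0" "!!t. 0 < t ==> t \<le> \<delta> ==> N (u - E t u - t *\<^sub>R f) \<le> t * (e / 2)"
      using close[of "e / 2"] by auto
    have "dist (N ((1/t) *\<^sub>R (E t u - u) - (- f))) 0 < e" if "0 < t" "t < \<delta>" for t
    proof -
      have "N ((1/t) *\<^sub>R (E t u - u) - (- f)) = N ((1/t) *\<^sub>R (u - E t u) - f)"
        using N_minus[of "(1/t) *\<^sub>R (u - E t u) - f"] u assms(2) that by (simp add: algebra_simps)
      also have "\<dots> \<le> e / 2"
        unfolding quot[OF that(1)] using \<delta>(2)[of t] that by (simp add: divide_le_eq mult.commute)
      finally show ?thesis
        using N_nonneg[of "(1/t) *\<^sub>R (E t u - u) - (- f)"] u assms(2) that \<open>e > 0\<close> by simp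
    qed
    then show "\<forall>\<^sub>F t in at_right 0. dist (N ((1/t) *\<^sub>R (E t u - u) - (- f))) 0 < e"
      using \<delta>(1) unfolding eventually_at_right_field by blast
  qed
  then have "(u, - f) \<in> gen E"
    using u assms(2) by (simp add: gen_def)
  then have "(u, - f + \<mu> *\<^sub>R u) \<in> gen (\<lambda>t g. exp (\<mu> * t) *\<^sub>R E t g)"
    by (intro gen_rescale E.G_V)
  moreover have "(\<lambda>t g. exp (\<mu> * t) *\<^sub>R E t g) = G"
    by (simp add: E_def fun_eq_iff flip: exp_add)
  ultimately have gen: "(u, \<mu> *\<^sub>R u - f) \<in> gen G"
    by simp
  have "\<exists>v w. (v, w) \<in> gen G \<and> N (v - f) \<le> e" if "e > 0" for e
  proof -
    obtain t where t: "t > 0" "N (u - E t u - t *\<^sub>R f) \<le> t * e"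
      using close[OF \<open>e > 0\<close>] by auto
    \<comment> \<open>The coefficient of \<open>G t u\<close> in (u - E(t) u) / t.\<close>
    let ?c = "- ((1/t) * exp (- \<mu> * t))"
    have "((1/t) *\<^sub>R u + ?c *\<^sub>R G t u, (1/t) *\<^sub>R (\<mu> *\<^sub>R u - f) + ?c *\<^sub>R G t (\<mu> *\<^sub>R u - f)) \<in> gen G"
      using gen gen_G[OF gen, of t] t by (intro gen_lin) auto
    moreover have "(1/t) *\<^sub>R u + ?c *\<^sub>R G t u = (1/t) *\<^sub>R (u - E t u)"
      by (simp add: E_def algebra_simps)
    moreover have "N ((1/t) *\<^sub>R (u - E t u) - f) \<le> e"
      unfolding quot[OF t(1)] using t by (simp add: divide_le_eq mult.commute)
    ultimately show ?thesis
      by metis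
  qed
  moreover have "u \<in> P" if "!!t g. 0 \<le> t ==> g \<in> P ==> G t g \<in> P" "f \<in> P"
    using u(2)[OF _ that(2)] that(1) unfolding E_def by (blast intro: P_scale exp_ge_zero)
  ultimately show thesis
    using that[OF gen] by blast
qed

text \<open>Solve the resolvent equation at 1 with right-hand side u - w. Dissipativity makes
  \<open>f n\<close> converge to its solution v as well, so u and v agree up to seminorm 0.\<close>

lemma gen_closed:
  assumes "!!n. (f n, g n) \<in> gen G" "u \<in> V" "w \<in> V"
    and "(\<lambda>n::nat. N (f n - u)) \<longlonglongrightarrow> 0" "(\<lambda>n. N (g n - w)) \<longlonglongrightarrow> 0"
  shows "(u, w) \<in> gen G"
proof -
  have V: "f n \<in> V" "g n \<in> V" for n
    using assms(1)[of n] by (auto simp: gen_def)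
  obtain v where v: "(v, 1 *\<^sub>R v - (u - w)) \<in> gen G"
    using resolvent[of 1 "u - w"] assms(2,3) by auto
  then have vV: "v \<in> V"
    by (auto simp: gen_def)
  have "N (f n - v) \<le> N ((f n - g n) - (u - w))" for n
    using gen_dissipative[OF gen_lin[OF assms(1) v, of 1 n "-1"], of 1] by (simp add: algebra_simps)
  moreover have "(\<lambda>n. N ((f n - g n) - (u - w))) \<longlonglongrightarrow> 0"
    using assms V by (intro lim_diff) auto
  ultimately have "(\<lambda>n. N (f n - v)) \<longlonglongrightarrow> 0"
    using tendsto_0_seq_bound[of "\<lambda>n. N ((f n - g n) - (u - w))" "\<lambda>n. N (f n - v)"]
      N_nonneg[OF V_diff[OF V(1) vV]] by blast
  then have eq: "N (u - v) = 0"
    using limit_unique[of f u v] V vV assms by blast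
  show ?thesis
    using eq by (intro gen_eq[OF v]) (use assms vV N_commute[of u v] in \<open>simp_all add: algebra_simps\<close>)
qed

end

section \<open>The Hille--Yosida theorem\<close>

text \<open>
  The semigroup is the limit of the implicit Euler scheme along dyadic step sizes: for \<open>u\<close> in the
  domain of \<open>A\<^sup>2\<close> one step of size \<open>h\<close> and two steps of size \<open>h/2\<close> differ by \<open>O(h\<^sup>2)\<close>.
\<close>

locale m_dissipative = ordered_seminormed +
  fixes A :: "'a rel" and h\<^sub>0 :: real
  assumes A_V: "A \<subseteq> V \<times> V"
    and A_lin: "(u, w) \<in> A ==> (u', w') \<in> A ==> (c *\<^sub>R u + d *\<^sub>R u', c *\<^sub>R w + d *\<^sub>R w') \<in> A"
    and A_eq: "(u, w) \<in> A ==> u' \<in> V ==> w' \<in> V ==> N (u' - u) = 0 ==> N (w' - w) = 0 ==> (u', w') \<in> A"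
    and h\<^sub>0_pos: "0 < h\<^sub>0"
    and A_dissipative: "(u, w) \<in> A ==> 0 < h ==> h \<le> h\<^sub>0 ==> N u \<le> N (u - h *\<^sub>R w)"
    and A_range: "f \<in> V ==> 0 < h ==> h \<le> h\<^sub>0 ==>
      \<exists>u w. (u, w) \<in> A \<and> N (u - h *\<^sub>R w - f) = 0 \<and> (f \<in> P --> u \<in> P)"
    and A_dense: "f \<in> V ==> 0 < e ==> \<exists>u w. (u, w) \<in> A \<and> N (u - f) < e"
begin

lemma A_inV: "(u, w) \<in> A ==> u \<in> V" "(u, w) \<in> A ==> w \<in> V"
  using A_V by auto

text \<open>The resolvent (1 - h A)^(-1), one step of the implicit Euler scheme, as a chosen
  representative; the choice respects the cone.\<close>

definition J :: "real \<Rightarrow> 'a \<Rightarrow> 'a" where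
  "J h f = (SOME u. \<exists>w. (u, w) \<in> A \<and> N (u - h *\<^sub>R w - f) = 0 \<and> (f \<in> P --> u \<in> P))"

context
  fixes h :: real
  assumes h: "0 < h" "h \<le> h\<^sub>0"
begin

lemma J_ex: "f \<in> V ==> \<exists>w. (J h f, w) \<in> A \<and> N (J h f - h *\<^sub>R w - f) = 0 \<and> (f \<in> P --> J h f \<in> P)"
  unfolding J_def by (rule someI_ex) (rule A_range[OF _ h])

lemma J_V [simp, intro]: "f \<in> V ==> J h f \<in> V"
  using J_ex A_inV by blast

lemma J_P: "f \<in> P ==> J h f \<in> P"
  using J_ex P_subset by blast

text \<open>Stability: an approximate solution of the resolvent equation is as far from
  \<open>J h f\<close> as its residual is large, by dissipativity of the difference. Contractivity,
  linearity and the commutation rules for \<open>J\<close> are read off from it.\<close>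

lemma J_close:
  assumes "(u, w) \<in> A" "f \<in> V" "N (u - h *\<^sub>R w - f) \<le> a"
  shows "N (u - J h f) \<le> a"
proof -
  obtain w' where w': "(J h f, w') \<in> A" "N (J h f - h *\<^sub>R w' - f) = 0"
    using J_ex assms(2) by blast
  have V: "u \<in> V" "w \<in> V" "J h f \<in> V" "w' \<in> V"
    using A_inV assms(1) w'(1) by auto
  have "(u - J h f, w - w') \<in> A"
    using A_lin[OF assms(1) w'(1), of 1 "-1"] by simp
  then have "N (u - J h f) \<le> N ((u - J h f) - h *\<^sub>R (w - w'))"
    using A_dissipative h by blast
  also have "(u - J h f) - h *\<^sub>R (w - w') = (u - h *\<^sub>R w - f) - (J h f - h *\<^sub>R w' - f)"
    by (simp add: algebra_simps)
  also have "N \<dots> \<le> N (u - h *\<^sub>R w - f) + N (J h f - h *\<^sub>R w' - f)"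
    using V assms(2) by (intro N_diff_le) auto
  finally show ?thesis
    using assms(3) w'(2) by simp
qed

lemma J_contr:
  assumes "f \<in> V" "g \<in> V"
  shows "N (J h f - J h g) \<le> N (f - g)"
proof -
  obtain w where w: "(J h f, w) \<in> A" "N (J h f - h *\<^sub>R w - f) = 0"
    using J_ex assms(1) by blast
  have "N (J h f - h *\<^sub>R w - g) \<le> N (f - g)"
    by (rule N_triangle_le[of "J h f - h *\<^sub>R w - f" "f - g" 0 "N (f - g)"])
      (use A_inV[OF w(1)] assms w(2) in simp_all)
  then show ?thesis
    by (rule J_close[OF w(1) assms(2)])
qed

lemma J_lin:
  assumes "f \<in> V" "g \<in> V"
  shows "N (J h (c *\<^sub>R f + d *\<^sub>R g) - (c *\<^sub>R J h f + d *\<^sub>R J h g)) = 0"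
proof -
  obtain w where w: "(J h f, w) \<in> A" "N (J h f - h *\<^sub>R w - f) = 0"
    using J_ex assms(1) by blast
  obtain w' where w': "(J h g, w') \<in> A" "N (J h g - h *\<^sub>R w' - g) = 0"
    using J_ex assms(2) by blast
  note V = A_inV[OF w(1)] A_inV[OF w'(1)]
  have 1: "N (c *\<^sub>R (J h f - h *\<^sub>R w - f)) \<le> 0"
    using w(2) V assms by (subst N_scale) auto
  have 2: "N (d *\<^sub>R (J h g - h *\<^sub>R w' - g)) \<le> 0"
    using w'(2) V assms by (subst N_scale) auto
  have "N (c *\<^sub>R J h f + d *\<^sub>R J h g - h *\<^sub>R (c *\<^sub>R w + d *\<^sub>R w') - (c *\<^sub>R f + d *\<^sub>R g)) \<le> 0"
    using V assms by (intro N_triangle_le[OF _ _ 1 2]) (simp_all add: algebra_simps)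
  then have "N (c *\<^sub>R J h f + d *\<^sub>R J h g - J h (c *\<^sub>R f + d *\<^sub>R g)) \<le> 0"
    using J_close[OF A_lin[OF w(1) w'(1), of c d], of "c *\<^sub>R f + d *\<^sub>R g" 0] assms by simp
  then show ?thesis
    using N_nonneg[of "J h (c *\<^sub>R f + d *\<^sub>R g) - (c *\<^sub>R J h f + d *\<^sub>R J h g)"] assms
      N_commute[of "c *\<^sub>R J h f + d *\<^sub>R J h g" "J h (c *\<^sub>R f + d *\<^sub>R g)"] by simp
qed

lemma J_zero: "N (J h 0) = 0"
  using J_lin[of 0 0 0 0] by simp

lemma J_le: "f \<in> V ==> N (J h f) \<le> N f"
  using J_contr[of f 0] N_le_diff[of "J h f" "J h 0"] J_zero by simp

lemma J_step: "(u, w) \<in> A ==> N (J h u - u) \<le> h * N w"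
  using J_close[of u w u "h * N w"] A_inV[of u w] N_commute[of u "J h u"] h by (simp add: N_scale)

text \<open>\<open>u + h *\<^sub>R J h w\<close> solves the resolvent equation for u, hence is
  \<open>J h u\<close> up to seminorm 0. So the resolvent commutes with A on the domain.\<close>

lemma J_A:
  assumes "(u, w) \<in> A"
  shows "(J h u, J h w) \<in> A" "N (J h u - h *\<^sub>R J h w - u) = 0"
proof -
  note V = A_inV[OF assms]
  obtain q where q: "(J h w, q) \<in> A" "N (J h w - h *\<^sub>R q - w) = 0"
    using J_ex V by blast
  note W = A_inV[OF q(1)]
  have A: "(u + h *\<^sub>R J h w, w + h *\<^sub>R q) \<in> A"
    using A_lin[OF assms q(1), of 1 h] by simp
  have eq: "N (J h w - (w + h *\<^sub>R q)) = 0"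
    using q(2) by (simp add: algebra_simps)
  have "u + h *\<^sub>R J h w - h *\<^sub>R (w + h *\<^sub>R q) - u = h *\<^sub>R (J h w - (w + h *\<^sub>R q))"
    by (simp add: algebra_simps)
  then have "N (u + h *\<^sub>R J h w - J h u) \<le> 0"
    using J_close[OF A V(1), of 0] N_scale[of "J h w - (w + h *\<^sub>R q)" h] V W eq by simp
  then have 0: "N (J h u - (u + h *\<^sub>R J h w)) = 0"
    using V N_nonneg[of "J h u - (u + h *\<^sub>R J h w)"] N_commute[of "J h u" "u + h *\<^sub>R J h w"] by simp
  then show "N (J h u - h *\<^sub>R J h w - u) = 0"
    by (simp add: algebra_simps)
  show "(J h u, J h w) \<in> A"
    using A_eq[OF A _ _ 0 eq] V by blast
qed

lemma J_pow_V [simp, intro]: "f \<in> V ==> (J h ^^ n) f \<in> V"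
  by (induction n) auto

lemma J_pow_P: "f \<in> P ==> (J h ^^ n) f \<in> P"
  by (induction n) (auto intro: J_P)

lemma J_pow_le: "f \<in> V ==> N ((J h ^^ n) f) \<le> N f"
  by (induction n) (auto intro: order_trans[OF J_le])

lemma J_pow_contr: "f \<in> V ==> g \<in> V ==> N ((J h ^^ n) f - (J h ^^ n) g) \<le> N (f - g)"
  by (induction n) (auto intro: order_trans[OF J_contr])

lemma J_pow_lin:
  assumes "f \<in> V" "g \<in> V"
  shows "N ((J h ^^ n) (c *\<^sub>R f + d *\<^sub>R g) - (c *\<^sub>R (J h ^^ n) f + d *\<^sub>R (J h ^^ n) g)) = 0"
proof (induction n)
  case (Suc n)
  let ?a = "(J h ^^ n) (c *\<^sub>R f + d *\<^sub>R g)" and ?b = "(J h ^^ n) f" and ?c = "(J h ^^ n) g"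
  have 1: "N (J h ?a - J h (c *\<^sub>R ?b + d *\<^sub>R ?c)) \<le> 0"
    using Suc J_contr[of ?a "c *\<^sub>R ?b + d *\<^sub>R ?c"] assms by simp
  have 2: "N (J h (c *\<^sub>R ?b + d *\<^sub>R ?c) - (c *\<^sub>R J h ?b + d *\<^sub>R J h ?c)) \<le> 0"
    using J_lin[of ?b ?c] assms by simp
  have "N (J h ?a - (c *\<^sub>R J h ?b + d *\<^sub>R J h ?c)) \<le> 0"
    using assms by (intro N_triangle_le[OF _ _ 1 2]) auto
  then show ?case
    using assms N_nonneg[of "J h ?a - (c *\<^sub>R J h ?b + d *\<^sub>R J h ?c)"] by simp
qed simp

lemma J_pow_A: "(u, w) \<in> A ==> ((J h ^^ n) u, (J h ^^ n) w) \<in> A"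
  by (induction n) (auto intro: J_A)

lemma J_pow_step:
  assumes "(u, w) \<in> A"
  shows "N ((J h ^^ n) u - u) \<le> n * h * N w"
proof (induction n)
  case (Suc n)
  note V = A_inV[OF assms]
  have "N (J h ((J h ^^ n) u) - (J h ^^ n) u) \<le> h * N ((J h ^^ n) w)"
    by (rule J_step[OF J_pow_A[OF assms]])
  also have "\<dots> \<le> h * N w"
    using h V J_pow_le by (intro mult_left_mono) auto
  finally have 1: "N (J h ((J h ^^ n) u) - (J h ^^ n) u) \<le> h * N w" .
  have "N (J h ((J h ^^ n) u) - u) \<le> h * N w + n * h * N w"
    using V by (intro N_triangle_le[OF _ _ 1 Suc]) auto
  then show ?case
    by (simp add: algebra_simps)
qed simp

text \<open>The power telescopes into the sum of h J^j w over 1 \<le> j \<le> n. Here w need not lie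
  in the domain, so J^j w is compared with w through a nearby v that does: twice e for the passage
  to v and back, and t N q for the motion of v.\<close>

lemma J_pow_quotient:
  assumes uw: "(u, w) \<in> A" and vq: "(v, q) \<in> A" and wv: "N (w - v) \<le> e" and n: "n * h \<le> t"
  shows "N ((J h ^^ n) u - u - (n * h) *\<^sub>R w) \<le> n * h * (2 * e + t * N q)"
  using n
proof (induction n)
  case (Suc n)
  note V = A_inV[OF uw] A_inV[OF vq]
  let ?u = "(J h ^^ n) u" and ?w = "(J h ^^ Suc n) w" and ?v = "(J h ^^ Suc n) v"
  have 1: "N (J h ?u - h *\<^sub>R ?w - ?u) \<le> 0"
    using J_A(2)[OF J_pow_A[OF uw], of n] by simp
  have "N (?w - w) \<le> N (?w - ?v) + N (?v - v) + N (v - w)"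
    using V N_diff_triangle[of ?w ?v w] N_diff_triangle[of ?v v w] by (simp del: funpow.simps)
  also have "\<dots> \<le> e + t * N q + e"
  proof -
    have "N (?v - v) \<le> Suc n * h * N q"
      by (rule J_pow_step[OF vq])
    also have "\<dots> \<le> t * N q"
      using Suc.prems V N_nonneg by (intro mult_right_mono) auto
    finally show ?thesis
      using J_pow_contr[of w v "Suc n"] V wv N_commute[of v w] by simp
  qed
  finally have 2: "N (h *\<^sub>R (?w - w)) \<le> h * (2 * e + t * N q)"
    using h V by (simp add: N_scale del: funpow.simps)
  have "n * h \<le> t"
    using Suc.prems h by (simp add: algebra_simps)
  then have 3: "N (?u - u - (n * h) *\<^sub>R w) \<le> n * h * (2 * e + t * N q)"
    by (rule Suc.IH)
  have "N (J h ?u - u - (Suc n * h) *\<^sub>R w) \<le> 0 + h * (2 * e + t * N q) + n * h * (2 * e + t * N q)"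
    using V by (intro N_triangle_le[OF _ _ N_triangle_le[OF _ _ 1 2 refl refl] 3]) (auto simp: algebra_simps)
  then show ?case
    by (simp add: algebra_simps)
qed simp

end

text \<open>Two half steps with result v satisfy the equation of one full step up to the residual
  (h/2) (p' - v'), where p' and v' are A applied to the results of the first and second half step.
  As w is again in the domain, p' - v' is at most (h/2) N k in seminorm.\<close>

lemma J_half:
  assumes h: "0 < h" "h \<le> h\<^sub>0" and uw: "(u, w) \<in> A" and wk: "(w, k) \<in> A"
  shows "N (J h u - J (h/2) (J (h/2) u)) \<le> h\<^sup>2 / 4 * N k"
proof -
  have h2: "0 < h/2" "h/2 \<le> h\<^sub>0"
    using h by auto
  note V = A_inV[OF uw] A_inV[OF wk]
  let ?p = "J (h/2) u" and ?p' = "J (h/2) w"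
  let ?v = "J (h/2) ?p" and ?v' = "J (h/2) ?p'"
  have p: "(?p, ?p') \<in> A" "N (?p - (h/2) *\<^sub>R ?p' - u) \<le> 0"
    using J_A[OF h2 uw] by auto
  have v: "(?v, ?v') \<in> A" "N (?v - (h/2) *\<^sub>R ?v' - ?p) \<le> 0"
    using J_A[OF h2 p(1)] by auto
  have "N (?p' - ?v') \<le> N (w - ?p')"
    using J_contr[OF h2, of w ?p'] V h2 by simp
  also have "\<dots> \<le> h/2 * N k"
    using J_step[OF h2 wk] N_commute[of w ?p'] V h2 by simp
  finally have 3: "N ((h/2) *\<^sub>R (?p' - ?v')) \<le> h/2 * (h/2 * N k)"
    using h V h2 mult_left_mono[of "N (?p' - ?v')" "h/2 * N k" "h/2"] by (simp add: N_scale)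
  have "h *\<^sub>R ?v' = (h/2) *\<^sub>R ?v' + (h/2) *\<^sub>R ?v'"
    by (simp flip: scaleR_add_left)
  then have "?v - h *\<^sub>R ?v' - u = (?v - (h/2) *\<^sub>R ?v' - ?p) + (?p - (h/2) *\<^sub>R ?p' - u) + (h/2) *\<^sub>R (?p' - ?v')"
    by (simp only: scaleR_diff_right) simp
  then have "N (?v - h *\<^sub>R ?v' - u) \<le> 0 + 0 + h/2 * (h/2 * N k)"
    using V h2 by (intro N_triangle_le[OF _ _ N_triangle_le[OF _ _ v(2) p(2) refl refl] 3]) auto
  then have "N (?v - h *\<^sub>R ?v' - u) \<le> h\<^sup>2 / 4 * N k"
    by (simp add: power2_eq_square)
  from J_close[OF h v(1) V(1) this] show ?thesis
    using N_commute[of "J h u" ?v] V h h2 by simp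
qed

text \<open>Local errors add up without amplification because every step is a contraction; the
  constant N k serves for all of them since powers of \<open>J\<close> do not increase the seminorm
  of k.\<close>

lemma J_pow_half:
  assumes h: "0 < h" "h \<le> h\<^sub>0" and uw: "(u, w) \<in> A" and wk: "(w, k) \<in> A"
  shows "N ((J h ^^ n) u - (J (h/2) ^^ (2 * n)) u) \<le> n * (h\<^sup>2 / 4 * N k)"
proof (induction n)
  case (Suc n)
  have h2: "0 < h/2" "h/2 \<le> h\<^sub>0"
    using h by auto
  note V = A_inV[OF uw] A_inV[OF wk]
  let ?a = "(J h ^^ n) u" and ?b = "(J (h/2) ^^ (2 * n)) u"
  have "N (J h ?a - J h ?b) \<le> N (?a - ?b)"
    using J_contr[OF h] V h h2 by simp
  then have 1: "N (J h ?a - J h ?b) \<le> n * (h\<^sup>2 / 4 * N k)"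
    using Suc by simp
  have "N (J h ?b - J (h/2) (J (h/2) ?b)) \<le> h\<^sup>2 / 4 * N ((J (h/2) ^^ (2 * n)) k)"
    by (rule J_half[OF h J_pow_A[OF h2 uw] J_pow_A[OF h2 wk]])
  also have "\<dots> \<le> h\<^sup>2 / 4 * N k"
    using J_pow_le[OF h2] V by (intro mult_left_mono) auto
  finally have 2: "N (J h ?b - J (h/2) (J (h/2) ?b)) \<le> h\<^sup>2 / 4 * N k" .
  have "N (J h ?a - J (h/2) (J (h/2) ?b)) \<le> n * (h\<^sup>2 / 4 * N k) + h\<^sup>2 / 4 * N k"
    using V h h2 by (intro N_triangle_le[OF _ _ 1 2]) auto
  then show ?case
    by (simp add: algebra_simps)
qed simp

section \<open>The Euler scheme on dyadic steps and its limit\<close>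

definition hk :: "nat \<Rightarrow> real" where
  "hk k = h\<^sub>0 * (1/2) ^ k"

definition steps :: "nat \<Rightarrow> real \<Rightarrow> nat" where
  "steps k t = nat \<lfloor>t / hk k\<rfloor>"

definition euler :: "nat \<Rightarrow> real \<Rightarrow> 'a \<Rightarrow> 'a" where
  "euler k t f = (J (hk k) ^^ steps k t) f"

lemma hk: "0 < hk k" "hk k \<le> h\<^sub>0" "hk (Suc k) = hk k / 2"
  using h\<^sub>0_pos by (auto simp: hk_def power_le_one mult_left_le)

lemma hk_0: "hk \<longlonglongrightarrow> 0"
  unfolding hk_def by (auto intro!: tendsto_eq_intros LIMSEQ_realpow_zero)

lemma steps_bounds:
  assumes "0 \<le> t"
  shows "steps k t * hk k \<le> t" "t < (steps k t + 1) * hk k"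
proof -
  have "0 \<le> t / hk k"
    using assms hk[of k] by simp
  then have "steps k t \<le> t / hk k" "t / hk k < steps k t + 1"
    unfolding steps_def by linarith+
  then show "steps k t * hk k \<le> t" "t < (steps k t + 1) * hk k"
    using hk[of k] by (auto simp: field_simps)
qed

lemma steps_lim: "0 \<le> t ==> (\<lambda>k. steps k t * hk k) \<longlonglongrightarrow> t"
proof -
  assume t: "0 \<le> t"
  have "(\<lambda>k. t - hk k) \<longlonglongrightarrow> t - 0"
    by (intro tendsto_intros hk_0)
  then show ?thesis
    using steps_bounds[OF t]
    by (intro tendsto_sandwich[of "\<lambda>k. t - hk k" "\<lambda>k. steps k t * hk k" sequentially "\<lambda>_. t" t])
      (auto simp: algebra_simps less_imp_le)
qed

lemma steps_Suc:
  assumes "0 \<le> t"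
  shows "steps (Suc k) t = 2 * steps k t \<or> steps (Suc k) t = Suc (2 * steps k t)"
proof -
  let ?m = "steps (Suc k) t" and ?n = "steps k t"
  have "real ?m * (hk k / 2) < (real ?n + 1) * hk k"
    using steps_bounds(2)[OF assms, of k] steps_bounds(1)[OF assms, of "Suc k", unfolded hk(3)]
    by (simp add: algebra_simps)
  moreover have "real ?n * hk k < (real ?m + 1) * (hk k / 2)"
    using steps_bounds(1)[OF assms, of k] steps_bounds(2)[OF assms, of "Suc k", unfolded hk(3)]
    by (simp add: algebra_simps)
  ultimately have "(real ?m / 2) * hk k < (real ?n + 1) * hk k" "real ?n * hk k < ((real ?m + 1) / 2) * hk k"
    by (auto simp: algebra_simps)
  then have "real ?m / 2 < real ?n + 1" "real ?n < (real ?m + 1) / 2"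
    using hk[of k] by auto
  then have "real ?m < 2 * real ?n + 2 \<and> 2 * real ?n < real ?m + 1"
    by (simp add: field_simps)
  then show ?thesis
    by linarith
qed

lemma steps_add:
  assumes "0 \<le> s" "0 \<le> t"
  shows "steps k (s + t) = steps k s + steps k t \<or> steps k (s + t) = Suc (steps k s + steps k t)"
proof -
  have "0 \<le> s / hk k" "0 \<le> t / hk k"
    using assms hk[of k] by auto
  then show ?thesis
    unfolding steps_def add_divide_distrib by linarith
qed

lemma euler_V [simp, intro]: "f \<in> V ==> euler k t f \<in> V"
  unfolding euler_def using hk by blast

lemma euler_contr: "f \<in> V ==> g \<in> V ==> N (euler k t f - euler k t g) \<le> N (f - g)"
  unfolding euler_def using hk J_pow_contr by blast

text \<open>The resolvent maps the domain of A into the domain of A^2, and \<open>J h v\<close> is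
  near v for small h.\<close>

lemma dense_square:
  assumes "f \<in> V" "0 < e"
  obtains u w k where "(u, w) \<in> A" "(w, k) \<in> A" "N (u - f) < e"
proof -
  obtain v q where v: "(v, q) \<in> A" "N (v - f) < e / 2"
    using A_dense[of f "e / 2"] assms by auto
  note V = A_inV[OF v(1)]
  \<comment> \<open>Makes h N q at most e / 2; the summand 1 covers N q = 0.\<close>
  define h where "h = min h\<^sub>0 (e / (2 * (N q + 1)))"
  have Nq: "0 \<le> N q"
    using N_nonneg V by blast
  then have h: "0 < h" "h \<le> h\<^sub>0" "h \<le> e / (2 * (N q + 1))"
    using assms h\<^sub>0_pos by (auto simp: h_def)
  obtain k where k: "(J h q, k) \<in> A"
    using J_ex[OF h(1,2)] V by blast
  have "N (J h v - v) \<le> h * N q"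
    by (rule J_step[OF h(1,2) v(1)])
  also have "\<dots> \<le> e / (2 * (N q + 1)) * N q"
    using h(3) Nq by (rule mult_right_mono)
  also have "\<dots> \<le> e / 2"
    using Nq \<open>0 < e\<close> by (simp add: field_simps)
  finally have "N (J h v - f) < e"
    using N_diff_triangle[of "J h v" v f] V h v(2) assms by simp
  then show thesis
    using that[OF J_A(1)[OF h(1,2) v(1)] k] by blast
qed

text \<open>On the domain of A^2 halving the step changes the result by a multiple of
  \<open>hk k\<close>, which is summable. Density of this domain and contractivity of every
  \<open>euler k t\<close> extend the Cauchy property to all vectors.\<close>

lemma euler_Cauchy:
  assumes f: "f \<in> V" and t: "0 \<le> t"
  shows "Cauchy_V (\<lambda>k. euler k t f)"
proof -
  have square: "Cauchy_V (\<lambda>k. euler k t u)" if uw: "(u, w) \<in> A" and wq: "(w, q) \<in> A" for u w q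
  proof (rule summable_imp_Cauchy_V)
    note V = A_inV[OF uw] A_inV[OF wq]
    fix k
    let ?h = "hk k" and ?n = "steps k t"
    have h2: "0 < ?h / 2" "?h / 2 \<le> h\<^sub>0"
      using hk[of k] by auto
    \<comment> \<open>The fine scheme makes 2 n or 2 n + 1 steps; a possible extra half step costs
      at most half of \<open>hk k\<close> times N w.\<close>
    have 1: "N (euler (Suc k) t u - (J (?h/2) ^^ (2 * ?n)) u) \<le> ?h / 2 * N w"
    proof (cases "steps (Suc k) t = 2 * ?n")
      case True
      then show ?thesis
        using hk[of k] V N_nonneg[of w] unfolding euler_def hk(3) by simp
    next
      case False
      then have "steps (Suc k) t = Suc (2 * ?n)"
        using steps_Suc[OF t] by blast
      moreover have "N (J (?h/2) ((J (?h/2) ^^ (2 * ?n)) u) - (J (?h/2) ^^ (2 * ?n)) u)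
          \<le> ?h / 2 * N ((J (?h/2) ^^ (2 * ?n)) w)"
        by (rule J_step[OF h2 J_pow_A[OF h2 uw]])
      moreover have "?h / 2 * N ((J (?h/2) ^^ (2 * ?n)) w) \<le> ?h / 2 * N w"
        using J_pow_le[OF h2] V h2 by (intro mult_left_mono) auto
      ultimately show ?thesis
        unfolding euler_def hk(3) by simp
    qed
    have "N ((J (?h/2) ^^ (2 * ?n)) u - euler k t u) \<le> ?n * (?h\<^sup>2 / 4 * N q)"
      using J_pow_half[OF hk(1)[of k] hk(2)[of k] uw wq, of ?n] V h2 hk[of k]
        N_commute[of "(J (?h/2) ^^ (2 * ?n)) u" "euler k t u"] by (simp add: euler_def)
    also have "\<dots> = (?n * ?h) * (?h / 4 * N q)"
      by (simp add: power2_eq_square)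
    also have "\<dots> \<le> t * (?h / 4 * N q)"
      using steps_bounds[OF t, of k] hk[of k] N_nonneg V by (intro mult_right_mono) auto
    finally have 2: "N ((J (?h/2) ^^ (2 * ?n)) u - euler k t u) \<le> t * (?h / 4 * N q)" .
    show "N (euler (Suc k) t u - euler k t u) \<le> hk k * (N w / 2 + t * N q / 4)"
      using V h2 by (intro N_triangle_le[OF _ _ 1 2]) (auto simp: algebra_simps)
  next
    show "summable (\<lambda>k. hk k * (N w / 2 + t * N q / 4))"
      unfolding hk_def by (intro summable_mult2 summable_mult summable_geometric) simp
  qed (use A_inV[OF uw] in auto)
  show ?thesis
    unfolding Cauchy_V_def
  proof (intro allI impI)
    fix e :: real
    assume "e > 0"
    then obtain u w q where u: "(u, w) \<in> A" "(w, q) \<in> A" "N (u - f) < e / 3"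
      using dense_square[OF f, of "e / 3"] by auto
    note V = A_inV[OF u(1)]
    obtain M where M: "!!m. m \<ge> M ==> N (euler m t u - euler M t u) < e / 3"
      using square[OF u(1,2)] \<open>e > 0\<close> unfolding Cauchy_V_def by (meson divide_pos_pos zero_less_numeral)
    have close: "N (euler m t f - euler m t u) < e / 3" "N (euler m t u - euler m t f) < e / 3" for m
      using euler_contr[of f u m t] euler_contr[of u f m t] V f u(3) N_commute[of f u] by auto
    have "N (euler m t f - euler M t f) < e" if "m \<ge> M" for m
      using close(1)[of m] close(2)[of M] M[OF that] V f
        N_diff_triangle[of "euler m t f" "euler m t u" "euler M t f"]
        N_diff_triangle[of "euler m t u" "euler M t u" "euler M t f"] by simp
    then show "\<exists>M. \<forall>m\<ge>M. N (euler m t f - euler M t f) < e"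
      by blast
  qed
qed

definition S :: "real \<Rightarrow> 'a \<Rightarrow> 'a" where
  "S t f = (SOME g. g \<in> V \<and> (\<lambda>k. N (euler k t f - g)) \<longlonglongrightarrow> 0)"

context
  fixes t :: real
  assumes t: "0 \<le> t"
begin

lemma S_limit: "f \<in> V ==> S t f \<in> V \<and> (\<lambda>k. N (euler k t f - S t f)) \<longlonglongrightarrow> 0"
  unfolding S_def using Cauchy_V_convergent[OF _ euler_Cauchy[OF _ t], of f]
  by (intro someI_ex[of "\<lambda>g. g \<in> V \<and> (\<lambda>k. N (euler k t f - g)) \<longlonglongrightarrow> 0"]) auto

lemma S_V [simp, intro]: "f \<in> V ==> S t f \<in> V"
  and S_lim: "f \<in> V ==> (\<lambda>k. N (euler k t f - S t f)) \<longlonglongrightarrow> 0"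
  using S_limit by blast+

lemma S_contr:
  assumes "f \<in> V" "g \<in> V"
  shows "N (S t f - S t g) \<le> N (f - g)"
  using N_limit_le[OF _ _ lim_diff[OF _ _ _ _ S_lim S_lim], of f g 0 "\<lambda>_. N (f - g)"]
    euler_contr assms by auto

lemma S_lin:
  assumes "f \<in> V" "g \<in> V"
  shows "N (S t (c *\<^sub>R f + d *\<^sub>R g) - (c *\<^sub>R S t f + d *\<^sub>R S t g)) = 0"
proof -
  have "(\<lambda>k. N (euler k t (c *\<^sub>R f + d *\<^sub>R g) - (c *\<^sub>R euler k t f + d *\<^sub>R euler k t g)
      - (S t (c *\<^sub>R f + d *\<^sub>R g) - (c *\<^sub>R S t f + d *\<^sub>R S t g)))) \<longlonglongrightarrow> 0"
    using assms by (intro lim_diff lim_add lim_scale S_lim) auto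
  moreover have "N (euler k t (c *\<^sub>R f + d *\<^sub>R g) - (c *\<^sub>R euler k t f + d *\<^sub>R euler k t g)) \<le> 0" for k
    unfolding euler_def using J_pow_lin[OF hk(1,2) assms] by simp
  ultimately have "N (S t (c *\<^sub>R f + d *\<^sub>R g) - (c *\<^sub>R S t f + d *\<^sub>R S t g)) \<le> 0"
    using N_limit_le[of "\<lambda>k. euler k t (c *\<^sub>R f + d *\<^sub>R g) - (c *\<^sub>R euler k t f + d *\<^sub>R euler k t g)"
      "S t (c *\<^sub>R f + d *\<^sub>R g) - (c *\<^sub>R S t f + d *\<^sub>R S t g)" 0 "\<lambda>_. 0" 0] assms by auto
  then show ?thesis
    using assms N_nonneg[of "S t (c *\<^sub>R f + d *\<^sub>R g) - (c *\<^sub>R S t f + d *\<^sub>R S t g)"] by simp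
qed

lemma S_step:
  assumes "(u, w) \<in> A"
  shows "N (S t u - u) \<le> t * N w"
proof -
  note V = A_inV[OF assms]
  have "N (euler k t u - u) \<le> t * N w" for k
    unfolding euler_def
    using J_pow_step[OF hk(1)[of k] hk(2)[of k] assms, of "steps k t"] steps_bounds(1)[OF t, of k]
      mult_right_mono[of "steps k t * hk k" t "N w"] N_nonneg V by auto
  moreover have "(\<lambda>k. N ((euler k t u - u) - (S t u - u))) \<longlonglongrightarrow> 0"
    using S_lim V by simp
  ultimately show ?thesis
    using N_limit_le[of "\<lambda>k. euler k t u - u" "S t u - u" 0 "\<lambda>_. t * N w"] V by auto
qed

lemma S_quotient:
  assumes uw: "(u, w) \<in> A" and vq: "(v, q) \<in> A" and wv: "N (w - v) \<le> e"
  shows "N (S t u - u - t *\<^sub>R w) \<le> t * (2 * e + t * N q)"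
proof -
  note V = A_inV[OF uw] A_inV[OF vq]
  let ?r = "\<lambda>k. steps k t * hk k"
  have "(\<lambda>k. \<bar>?r k - t\<bar> * N w) \<longlonglongrightarrow> 0"
    by (intro tendsto_mult_left_zero tendsto_rabs_zero LIM_zero steps_lim t)
  then have "(\<lambda>k. N (?r k *\<^sub>R w - t *\<^sub>R w)) \<longlonglongrightarrow> 0"
    using V by (simp add: N_scale flip: scaleR_diff_left)
  then have lim: "(\<lambda>k. N ((euler k t u - u - ?r k *\<^sub>R w) - (S t u - u - t *\<^sub>R w))) \<longlonglongrightarrow> 0"
    using V S_lim by (intro lim_diff) auto
  have "N (euler k t u - u - ?r k *\<^sub>R w) \<le> ?r k * (2 * e + t * N q)" for k
    unfolding euler_def by (rule J_pow_quotient[OF hk(1,2) uw vq wv steps_bounds(1)[OF t]])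
  moreover have "(\<lambda>k. ?r k * (2 * e + t * N q)) \<longlonglongrightarrow> t * (2 * e + t * N q)"
    by (rule tendsto_mult[OF steps_lim[OF t] tendsto_const])
  ultimately show ?thesis
    using N_limit_le[OF _ _ lim, of 0 "\<lambda>k. ?r k * (2 * e + t * N q)"] V by auto
qed

lemma S_P: "f \<in> P ==> S t f \<in> P"
  using P_closed[of "\<lambda>k. euler k t f" "S t f"] S_limit[of f] P_subset J_pow_P[OF hk(1,2)]
  by (auto simp: euler_def)

end

text \<open>The numbers of full steps in s and in t add up to the number for s + t or fall short by
  one; on the domain of A the missing step costs \<open>hk k * N w\<close>. Density and
  contractivity do the rest.\<close>

lemma S_add:
  assumes s: "0 \<le> s" and t: "0 \<le> t" and f: "f \<in> V"
  shows "N (S (s + t) f - S s (S t f)) = 0"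
proof -
  have st: "0 \<le> s + t"
    using s t by simp
  have dom: "N (S (s + t) u - S s (S t u)) \<le> 0" if uw: "(u, w) \<in> A" for u w
  proof -
    note V = A_inV[OF uw]
    have bound: "N (euler k (s + t) u - euler k s (euler k t u)) \<le> hk k * N w" for k
    proof -
      let ?v = "(J (hk k) ^^ (steps k s + steps k t)) u"
      have eq: "euler k s (euler k t u) = ?v"
        by (simp add: euler_def funpow_add)
      have A: "(?v, (J (hk k) ^^ (steps k s + steps k t)) w) \<in> A"
        by (rule J_pow_A[OF hk(1,2) uw])
      have "N (J (hk k) ?v - ?v) \<le> hk k * N ((J (hk k) ^^ (steps k s + steps k t)) w)"
        by (rule J_step[OF hk(1,2) A])
      also have "\<dots> \<le> hk k * N w"
        using hk[of k] V J_pow_le[OF hk(1,2)] by (intro mult_left_mono) auto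
      finally show ?thesis
        using steps_add[OF s t, of k] hk[of k] N_nonneg V unfolding eq by (auto simp: euler_def)
    qed
    have "(\<lambda>k. N (euler k t u - S t u)) \<longlonglongrightarrow> 0"
      using S_lim t V by blast
    then have "(\<lambda>k. N (euler k s (euler k t u) - euler k s (S t u))) \<longlonglongrightarrow> 0"
      by (rule tendsto_0_seq_bound) (use euler_contr V t N_nonneg in auto)
    then have "(\<lambda>k. N (euler k s (euler k t u) - euler k s (S t u)
        + (euler k s (S t u) - S s (S t u)) - (0 + 0))) \<longlonglongrightarrow> 0"
      using V s t S_lim[OF s, of "S t u"]
      by (intro lim_add[where g = 0 and g' = 0]) auto
    then have "(\<lambda>k. N (euler k (s + t) u - euler k s (euler k t u) - (S (s + t) u - S s (S t u)))) \<longlonglongrightarrow> 0"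
      using V s t by (intro lim_diff S_lim) auto
    moreover have "(\<lambda>k. hk k * N w) \<longlonglongrightarrow> 0"
      using hk_0 by (auto intro!: tendsto_eq_intros)
    ultimately show ?thesis
      using N_limit_le[of "\<lambda>k. euler k (s + t) u - euler k s (euler k t u)" "S (s + t) u - S s (S t u)"
        0 "\<lambda>k. hk k * N w" 0] bound V s t by auto
  qed
  have "N (S (s + t) f - S s (S t f)) \<le> 0 + e" if "0 < e" for e
  proof -
    obtain u w where u: "(u, w) \<in> A" "N (u - f) < e / 2"
      using A_dense[OF f, of "e / 2"] \<open>0 < e\<close> by auto
    note V = A_inV[OF u(1)]
    have 1: "N (S (s + t) f - S (s + t) u) \<le> e / 2"
      using S_contr[OF st f V(1)] u(2) N_commute[of f u] V f by simp
    have 2: "N (S s (S t u) - S s (S t f)) \<le> e / 2"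
      using S_contr[OF s, of "S t u" "S t f"] S_contr[OF t V(1) f] u(2) V f s t by simp
    have "N (S (s + t) f - S s (S t f)) \<le> e / 2 + 0 + e / 2"
      using V f s t
      by (intro N_triangle_le[OF _ _ N_triangle_le[OF _ _ 1 dom[OF u(1)] refl refl] 2]) auto
    then show ?thesis
      by simp
  qed
  then have "N (S (s + t) f - S s (S t f)) \<le> 0"
    by (rule field_le_epsilon)
  then show ?thesis
    using f s t N_nonneg[of "S (s + t) f - S s (S t f)"] by simp
qed

lemma S_le:
  assumes t: "0 \<le> t" and f: "f \<in> V"
  shows "N (S t f) \<le> N f"
proof -
  have "N (S t 0) = 0"
    using S_lin[OF t, of 0 0 0 0] by simp
  then show ?thesis
    using S_contr[OF t f V_zero] N_le_diff[of "S t f" "S t 0"] t f by simp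
qed

lemma contraction_sg_S: "contraction_sg S"
proof (rule contraction_sgI)
  fix f
  assume f: "f \<in> V"
  have "euler k 0 f = f" for k
    by (simp add: euler_def steps_def)
  then show "N (S 0 f - f) = 0"
    using S_lim[OF order_refl f] N_commute[of f "S 0 f"] f
    by (simp add: LIMSEQ_const_iff)
next
  fix f
  assume f: "f \<in> V"
  show "((\<lambda>t. N (S t f - f)) \<longlongrightarrow> 0) (at_right 0)"
  proof (rule tendstoI)
    fix e :: real
    assume "0 < e"
    then obtain u w where u: "(u, w) \<in> A" "N (u - f) < e / 3"
      using A_dense[OF f, of "e / 3"] by auto
    note V = A_inV[OF u(1)]
    have Nw: "0 \<le> N w"
      using N_nonneg V by blast
    define b where "b = e / (3 * (N w + 1))"
    have "0 < b"
      using \<open>0 < e\<close> Nw by (simp add: b_def)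
    have "dist (N (S t f - f)) 0 < e" if t: "0 < t" "t < b" for t
    proof -
      have t0: "0 \<le> t"
        using t by simp
      have "t * N w \<le> b * N w"
        using t Nw by (intro mult_right_mono) auto
      also have "\<dots> \<le> e / 3"
        using Nw \<open>0 < e\<close> by (simp add: b_def field_simps)
      finally have 2: "N (S t u - u) \<le> e / 3"
        using S_step[OF t0 u(1)] by simp
      have "N (S t f - f) < e"
        using N_diff_triangle[of "S t f" "S t u" f] N_diff_triangle[of "S t u" u f] 2
          S_contr[OF t0 f V(1)] u(2) N_commute[of f u] V f t0 by simp
      then show ?thesis
        using N_nonneg[of "S t f - f"] f t0 by simp
    qed
    then show "\<forall>\<^sub>F t in at_right 0. dist (N (S t f - f)) 0 < e"
      using \<open>0 < b\<close> unfolding eventually_at_right_field by blast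
  qed
qed (use S_lin S_add S_le in auto)

sublocale S: contraction_semigroup V N P S
  by unfold_locales (rule contraction_sg_S)

text \<open>\<open>S_quotient\<close> wants w close to the domain of A, and density provides such a
  v; the error is then arbitrarily small as t tends to 0.\<close>

lemma A_le_gen: "A \<subseteq> gen S"
proof (rule subrelI)
  fix u w
  assume uw: "(u, w) \<in> A"
  note V = A_inV[OF uw]
  have "((\<lambda>t. N ((1/t) *\<^sub>R (S t u - u) - w)) \<longlongrightarrow> 0) (at_right 0)"
  proof (rule tendstoI)
    fix e :: real
    assume "0 < e"
    then obtain v q where v: "(v, q) \<in> A" "N (v - w) < e / 4"
      using A_dense[OF V(2), of "e / 4"] by auto
    have Nq: "0 \<le> N q"
      using N_nonneg A_inV[OF v(1)] by blast
    \<comment> \<open>For t < b the drift t N q is at most e / 4, so the whole error is at most 3 e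
      / 4.\<close>
    define b where "b = e / (4 * (N q + 1))"
    have "0 < b"
      using \<open>0 < e\<close> Nq by (simp add: b_def)
    have "dist (N ((1/t) *\<^sub>R (S t u - u) - w)) 0 < e" if t: "0 < t" "t < b" for t
    proof -
      have t0: "0 \<le> t"
        using t by simp
      have "t * N q \<le> b * N q"
        using t Nq by (intro mult_right_mono) auto
      also have "\<dots> \<le> e / 4"
        using Nq \<open>0 < e\<close> by (simp add: b_def field_simps)
      finally have "t * (2 * (e / 4) + t * N q) \<le> t * (3 * e / 4)"
        using t by (intro mult_left_mono) auto
      then have "N (S t u - u - t *\<^sub>R w) \<le> t * (3 * e / 4)"
        using S_quotient[OF t0 uw v(1), of "e / 4"] v(2) N_commute[of v w] A_inV[OF v(1)] V by simp
      moreover have "(1/t) *\<^sub>R (S t u - u) - w = (1/t) *\<^sub>R (S t u - u - t *\<^sub>R w)"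
        using t by (simp add: algebra_simps)
      then have eq: "N ((1/t) *\<^sub>R (S t u - u) - w) = (1/t) * N (S t u - u - t *\<^sub>R w)"
        using V t N_scale[of "S t u - u - t *\<^sub>R w" "1/t"] by simp
      ultimately have "N ((1/t) *\<^sub>R (S t u - u) - w) \<le> 3 * e / 4"
        unfolding eq using t by (simp add: divide_le_eq mult.commute)
      then show ?thesis
        using N_nonneg[of "(1/t) *\<^sub>R (S t u - u) - w"] V t0 \<open>0 < e\<close> by simp
    qed
    then show "\<forall>\<^sub>F t in at_right 0. dist (N ((1/t) *\<^sub>R (S t u - u) - w)) 0 < e"
      using \<open>0 < b\<close> unfolding eventually_at_right_field by blast
  qed
  then show "(u, w) \<in> gen S"
    using V by (simp add: gen_def)
qed

text \<open>A dissipative operator cannot properly extend one with full range. For (u, w) in the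
  generator, solve v - h q = u - h w with (v, q) in A; dissipativity of the generator at 1/h forces
  u = v, and then w = q, up to seminorm 0.\<close>

lemma gen_S: "gen S = A"
proof
  show "gen S \<subseteq> A"
  proof (rule subrelI)
    fix u w
    assume uw: "(u, w) \<in> gen S"
    then have V: "u \<in> V" "w \<in> V"
      by (auto simp: gen_def)
    obtain v q where v: "(v, q) \<in> A" "N (v - h\<^sub>0 *\<^sub>R q - (u - h\<^sub>0 *\<^sub>R w)) = 0"
      using A_range[of "u - h\<^sub>0 *\<^sub>R w" h\<^sub>0] V h\<^sub>0_pos by auto
    note W = A_inV[OF v(1)]
    have diff: "(u - v, w - q) \<in> gen S"
      using S.gen_lin[OF uw subsetD[OF A_le_gen v(1)], of 1 "-1"] by simp
    have "(1/h\<^sub>0) * N (u - v) \<le> N ((1/h\<^sub>0) *\<^sub>R (u - v) - (w - q))"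
      using h\<^sub>0_pos by (intro S.gen_dissipative[OF diff]) simp
    moreover have "(1/h\<^sub>0) *\<^sub>R (u - v) - (w - q) = (- (1/h\<^sub>0)) *\<^sub>R (v - h\<^sub>0 *\<^sub>R q - (u - h\<^sub>0 *\<^sub>R w))"
      using h\<^sub>0_pos by (simp add: algebra_simps)
    ultimately have "(1/h\<^sub>0) * N (u - v) \<le> 0"
      using v(2) V W N_scale[of "v - h\<^sub>0 *\<^sub>R q - (u - h\<^sub>0 *\<^sub>R w)" "- (1/h\<^sub>0)"] by simp
    then have uv: "N (u - v) = 0"
      using h\<^sub>0_pos V W N_nonneg[of "u - v"] by (simp add: divide_le_0_iff)
    have "h\<^sub>0 *\<^sub>R (w - q) = (u - v) + (v - h\<^sub>0 *\<^sub>R q - (u - h\<^sub>0 *\<^sub>R w))"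
      by (simp add: algebra_simps)
    then have "h\<^sub>0 * N (w - q) \<le> 0"
      using N_triangle[of "u - v" "v - h\<^sub>0 *\<^sub>R q - (u - h\<^sub>0 *\<^sub>R w)"] uv v(2) V W
        N_scale[of "w - q" h\<^sub>0] h\<^sub>0_pos by simp
    then have "N (w - q) = 0"
      using h\<^sub>0_pos V W N_nonneg[of "w - q"] by (simp add: mult_le_0_iff)
    then show "(u, w) \<in> A"
      using A_eq[OF v(1)] V uv by blast
  qed
qed (rule A_le_gen)

end

section \<open>Quasi-dissipative operators and relatively bounded perturbations\<close>

context ordered_seminormed
begin

text \<open>Shifting by \<omega> makes K dissipative: with \<nu> = \<omega> + 1/h the hypotheses at
  \<nu> turn into the resolvent conditions for K - \<omega> at step h. The semigroup of K is that of
  the shift times exp(\<omega> t). The bound 1 on the step is arbitrary.\<close>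

theorem quasi_dissipative_generates:
  fixes K :: "'v rel"
  assumes K_V: "K \<subseteq> V \<times> V"
    and lin: "!!u w u' w' c d. (u, w) \<in> K ==> (u', w') \<in> K ==>
      (c *\<^sub>R u + d *\<^sub>R u', c *\<^sub>R w + d *\<^sub>R w') \<in> K"
    and eq: "!!u w u' w'. (u, w) \<in> K ==> u' \<in> V ==> w' \<in> V ==> N (u' - u) = 0 ==>
      N (w' - w) = 0 ==> (u', w') \<in> K"
    and diss: "!!u w \<nu>. (u, w) \<in> K ==> \<omega> < \<nu> ==> (\<nu> - \<omega>) * N u \<le> N (\<nu> *\<^sub>R u - w)"
    and range: "!!f \<nu>. f \<in> V ==> \<omega> < \<nu> ==>
      \<exists>u w. (u, w) \<in> K \<and> N (\<nu> *\<^sub>R u - w - f) = 0 \<and> (f \<in> P --> u \<in> P)"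
    and dense: "!!f e. f \<in> V ==> 0 < e ==> \<exists>u w. (u, w) \<in> K \<and> N (u - f) < e"
  shows "\<exists>G. C0_sg G \<and> gen G = K \<and> (\<forall>t\<ge>0. \<forall>f\<in>P. G t f \<in> P)"
proof -
  define A where "A = {(u, w). (u, w + \<omega> *\<^sub>R u) \<in> K}"
  have KV: "u \<in> V" "w \<in> V" if "(u, w) \<in> K" for u w
    using K_V that by auto
  have AV: "u \<in> V" "w \<in> V" if "(u, w) \<in> A" for u w
    using KV[of u "w + \<omega> *\<^sub>R u"] that V_diff[of "w + \<omega> *\<^sub>R u" "\<omega> *\<^sub>R u"] by (auto simp: A_def)
  have inA: "(u, w - \<omega> *\<^sub>R u) \<in> A" if "(u, w) \<in> K" for u w
    using that by (simp add: A_def)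
  have "m_dissipative V N P A 1"
  proof unfold_locales
    show "A \<subseteq> V \<times> V"
      using AV by auto
    show "(c *\<^sub>R u + d *\<^sub>R u', c *\<^sub>R w + d *\<^sub>R w') \<in> A" if "(u, w) \<in> A" "(u', w') \<in> A" for u w u' w' c d
      using lin[of u "w + \<omega> *\<^sub>R u" u' "w' + \<omega> *\<^sub>R u'" c d] that by (simp add: A_def algebra_simps)
    show "(u', w') \<in> A"
      if "(u, w) \<in> A" "u' \<in> V" "w' \<in> V" "N (u' - u) = 0" "N (w' - w) = 0" for u w u' w'
    proof -
      have 1: "N (w' - w) \<le> 0"
        using that by simp
      have 2: "N (\<omega> *\<^sub>R (u' - u)) \<le> 0"
        using that AV[OF that(1)] by (simp add: N_scale)
      have "N ((w' + \<omega> *\<^sub>R u') - (w + \<omega> *\<^sub>R u)) \<le> 0"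
        using that AV[OF that(1)] by (intro N_triangle_le[OF _ _ 1 2]) (auto simp: algebra_simps)
      then have "N ((w' + \<omega> *\<^sub>R u') - (w + \<omega> *\<^sub>R u)) = 0"
        using that AV[OF that(1)] N_nonneg[of "(w' + \<omega> *\<^sub>R u') - (w + \<omega> *\<^sub>R u)"] by simp
      then show ?thesis
        using eq[of u "w + \<omega> *\<^sub>R u" u' "w' + \<omega> *\<^sub>R u'"] that by (simp add: A_def)
    qed
    show "N u \<le> N (u - h *\<^sub>R w)" if uw: "(u, w) \<in> A" and "0 < h" for u w h
    proof -
      have "(\<omega> + 1/h - \<omega>) * N u \<le> N ((\<omega> + 1/h) *\<^sub>R u - (w + \<omega> *\<^sub>R u))"
        using that by (intro diss) (auto simp: A_def)
      also have "(\<omega> + 1/h) *\<^sub>R u - (w + \<omega> *\<^sub>R u) = (1/h) *\<^sub>R (u - h *\<^sub>R w)"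
        using that by (simp add: algebra_simps)
      also have "N \<dots> = (1/h) * N (u - h *\<^sub>R w)"
        using AV[OF uw] that by (subst N_scale) auto
      finally show ?thesis
        using that by (simp add: divide_le_cancel)
    qed
    show "\<exists>u w. (u, w) \<in> A \<and> N (u - h *\<^sub>R w - f) = 0 \<and> (f \<in> P --> u \<in> P)"
      if f: "f \<in> V" and h: "0 < h" for f h
    proof -
      obtain u w where u: "(u, w) \<in> K" "N ((\<omega> + 1/h) *\<^sub>R u - w - (1/h) *\<^sub>R f) = 0"
          "(1/h) *\<^sub>R f \<in> P --> u \<in> P"
        using range[OF V_scale[OF f, of "1/h"], of "\<omega> + 1/h"] h by auto
      have "u - h *\<^sub>R (w - \<omega> *\<^sub>R u) - f = h *\<^sub>R ((\<omega> + 1/h) *\<^sub>R u - w - (1/h) *\<^sub>R f)"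
        using that by (simp add: algebra_simps)
      then have "N (u - h *\<^sub>R (w - \<omega> *\<^sub>R u) - f) = 0"
        using u(2) KV[OF u(1)] f N_scale[of "(\<omega> + 1/h) *\<^sub>R u - w - (1/h) *\<^sub>R f" h] by simp
      then show ?thesis
        using inA[OF u(1)] u(3) P_scale[of f "1/h"] that by (intro exI[of _ u] exI[of _ "w - \<omega> *\<^sub>R u"]) auto
    qed
    show "\<exists>u w. (u, w) \<in> A \<and> N (u - f) < e" if "f \<in> V" "0 < e" for f e
      using dense[OF that] inA by blast
  qed simp
  then interpret A: m_dissipative V N P A 1 .
  let ?G = "\<lambda>t f. exp (\<omega> * t) *\<^sub>R A.S t f"
  have C0: "C0_sg ?G"
    by (rule A.S.C0_sg_rescale)
  have "gen ?G = K"
  proof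
    show "K \<subseteq> gen ?G"
    proof (rule subrelI)
      fix u w
      assume "(u, w) \<in> K"
      then have "(u, w - \<omega> *\<^sub>R u) \<in> gen A.S"
        using inA A.gen_S by blast
      from gen_rescale[OF A.S.G_V this, of \<omega>] show "(u, w) \<in> gen ?G"
        by simp
    qed
    show "gen ?G \<subseteq> K"
    proof (rule subrelI)
      fix u w
      assume uw: "(u, w) \<in> gen ?G"
      have "(u, w + (- \<omega>) *\<^sub>R u) \<in> gen (\<lambda>t f. exp (- \<omega> * t) *\<^sub>R ?G t f)"
        by (rule gen_rescale[OF _ uw]) auto
      moreover have "(\<lambda>t f. exp (- \<omega> * t) *\<^sub>R ?G t f) = A.S"
        by (simp add: fun_eq_iff flip: exp_add)
      ultimately have "(u, w - \<omega> *\<^sub>R u) \<in> A"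
        using A.gen_S by simp
      then show "(u, w) \<in> K"
        by (simp add: A_def)
    qed
  qed
  moreover have "\<forall>t\<ge>0. \<forall>f\<in>P. ?G t f \<in> P"
    using A.S_P P_scale by auto
  ultimately show ?thesis
    using C0 by blast
qed

end

text \<open>
  The operator \<open>T - C + B\<close> where \<open>T\<close> generates the contraction semigroup \<open>G\<close>, the multiplication
  operator \<open>C\<close> and the gain \<open>B\<close> are bounded after the cutoff \<open>Q n\<close>, and \<open>L u\<close> is the norm of the
  smallest loss term, with respect to which \<open>B\<close> is relatively bounded with bound \<open>\<kappa> < 1\<close>.
\<close>

locale perturbed_generator = contraction_semigroup +
  fixes Q :: "nat \<Rightarrow> 'a \<Rightarrow> 'a" and C B :: "'a \<Rightarrow> 'a" and L :: "'a \<Rightarrow> real" and DC :: "'a set"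
    and M \<kappa> \<omega> :: real and c :: "nat \<Rightarrow> real"
  assumes G_P: "0 \<le> t ==> f \<in> P ==> G t f \<in> P"
    and Q_lin: "Q n (x *\<^sub>R u + y *\<^sub>R v) = x *\<^sub>R Q n u + y *\<^sub>R Q n v"
    and Q_V: "u \<in> V ==> Q n u \<in> V"
    and Q_le: "u \<in> V ==> N (Q n u) \<le> N u"
    and Q_idem: "Q n (Q n u) = Q n u"
    and Q_lim: "u \<in> V ==> (\<lambda>n. N (Q n u - u)) \<longlonglongrightarrow> 0"
    and Q_P: "u \<in> P ==> Q n u \<in> P"
    and Q_gen: "(u, w) \<in> gen G ==> (Q n u, Q n w) \<in> gen G"
    and C_lin: "C (x *\<^sub>R u + y *\<^sub>R v) = x *\<^sub>R C u + y *\<^sub>R C v"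
    and DC: "u \<in> DC \<longleftrightarrow> u \<in> V \<and> C u \<in> V"
    and C_closed: "(!!n. us n \<in> DC) ==> u \<in> V ==> w \<in> V ==> (\<lambda>n. N (us n - u)) \<longlonglongrightarrow> 0 ==>
      (\<lambda>n. N (C (us n) - w)) \<longlonglongrightarrow> 0 ==> u \<in> DC \<and> N (C u - w) = 0"
    and Q_DC: "u \<in> V ==> Q n u \<in> DC"
    and Q_C: "Q n (C u) = C (Q n u)"
    and c_nonneg: "0 \<le> c n"
    and C_loss: "u \<in> V ==> N (c n *\<^sub>R Q n u - C (Q n u)) + L (Q n u) \<le> c n * N (Q n u)"
    and C_P: "u \<in> P ==> c n *\<^sub>R Q n u - C (Q n u) \<in> P"
    and C_le: "u \<in> DC ==> N (C u) \<le> M * L u"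
    and L_nonneg: "u \<in> DC ==> 0 \<le> L u"
    and gen_C_dissipative: "(u, w) \<in> gen G ==> u \<in> DC ==> 0 \<le> \<nu> ==>
      \<nu> * N u + L u \<le> N (\<nu> *\<^sub>R u - w + C u)"
    and \<kappa>: "0 \<le> \<kappa>" "\<kappa> < 1" and \<omega>: "0 \<le> \<omega>" and M: "0 \<le> M"
    and B_V: "(u, w) \<in> gen G ==> u \<in> DC ==> B u \<in> V"
    and B_lin: "u \<in> DC ==> v \<in> DC ==> B u \<in> V ==> B v \<in> V ==> B (x *\<^sub>R u + y *\<^sub>R v) \<in> V ==>
      N (B (x *\<^sub>R u + y *\<^sub>R v) - (x *\<^sub>R B u + y *\<^sub>R B v)) = 0"
    and B_le: "u \<in> DC ==> B u \<in> V ==> N (B u) \<le> \<kappa> * L u + \<omega> * N u"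
    and B_P: "u \<in> DC ==> B u \<in> V ==> u \<in> P ==> B u \<in> P"
    and Q_B: "u \<in> V ==> B (Q n u) \<in> V ==> N (Q n (B (Q n u)) - B (Q n u)) = 0"
begin

definition K :: "'a rel" where
  "K = {(u, w). u \<in> DC \<and> w \<in> V \<and> (\<exists>w\<^sub>0. (u, w\<^sub>0) \<in> gen G \<and> N (w - (w\<^sub>0 - C u + B u)) = 0)}"

lemma genV: "(u, w) \<in> gen G ==> u \<in> V" "(u, w) \<in> gen G ==> w \<in> V"
  by (auto simp: gen_def)

lemma CV: "u \<in> DC ==> u \<in> V" "u \<in> DC ==> C u \<in> V"
  using DC by auto

lemma C_zero [simp]: "C 0 = 0"
  using C_lin[of 0 0 0 0] by simp

lemma DC_lin: "u \<in> DC ==> v \<in> DC ==> x *\<^sub>R u + y *\<^sub>R v \<in> DC"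
  using DC C_lin by auto

lemma C_diff: "C (u - v) = C u - C v"
  using C_lin[of 1 u "-1" v] by simp

lemma DC_diff: "u \<in> DC ==> v \<in> DC ==> u - v \<in> DC"
  using DC_lin[of u v 1 "-1"] by simp

lemma gen_diff: "(u, w) \<in> gen G ==> (u', w') \<in> gen G ==> (u - u', w - w') \<in> gen G"
  using gen_lin[of u w u' w' 1 "-1"] by simp

lemma B_diff:
  assumes "(u, w) \<in> gen G" "u \<in> DC" "(v, w') \<in> gen G" "v \<in> DC"
  shows "N (B (u - v) - (B u - B v)) = 0" "N (B u - B v) = N (B (u - v))"
proof -
  have V: "B u \<in> V" "B v \<in> V" "B (u - v) \<in> V"
    using assms B_V gen_diff[OF assms(1,3)] DC_diff by blast+
  show *: "N (B (u - v) - (B u - B v)) = 0"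
    using B_lin[of u v 1 "-1"] assms V by simp
  show "N (B u - B v) = N (B (u - v))"
    using N_eq[OF _ _ *] V by simp
qed

text \<open>The loss on the left of the dissipativity estimate absorbs the part \<kappa> L u of the
  gain. The remainder (1 - \<kappa>) L u is kept because the convergence of loss and gain in
  \<open>K_range\<close> depends on it.\<close>

lemma estimate:
  assumes uw: "(u, w\<^sub>0) \<in> gen G" and u: "u \<in> DC" and w: "w \<in> V" "N (w - (w\<^sub>0 - C u + B u)) = 0"
    and "0 \<le> \<nu>"
  shows "(\<nu> - \<omega>) * N u + (1 - \<kappa>) * L u \<le> N (\<nu> *\<^sub>R u - w)"
proof -
  note V = genV[OF uw] CV[OF u] B_V[OF uw u] w(1)
  have "\<nu> * N u + L u \<le> N (\<nu> *\<^sub>R u - w\<^sub>0 + C u)"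
    using gen_C_dissipative[OF uw u \<open>0 \<le> \<nu>\<close>] .
  also have "\<nu> *\<^sub>R u - w\<^sub>0 + C u = (\<nu> *\<^sub>R u - w) + (w - (w\<^sub>0 - C u + B u)) + B u"
    by (simp add: algebra_simps)
  also have "N \<dots> \<le> N (\<nu> *\<^sub>R u - w) + N (w - (w\<^sub>0 - C u + B u)) + N (B u)"
    using V N_triangle[of "(\<nu> *\<^sub>R u - w) + (w - (w\<^sub>0 - C u + B u))" "B u"]
      N_triangle[of "\<nu> *\<^sub>R u - w" "w - (w\<^sub>0 - C u + B u)"] by simp
  also have "\<dots> \<le> N (\<nu> *\<^sub>R u - w) + (\<kappa> * L u + \<omega> * N u)"
    using w(2) B_le[OF u V(5)] by simp
  finally show ?thesis
    by (simp add: algebra_simps)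
qed

lemma K_dissipative:
  assumes "(u, w) \<in> K" "\<omega> < \<nu>"
  shows "(\<nu> - \<omega>) * N u \<le> N (\<nu> *\<^sub>R u - w)"
proof -
  obtain w\<^sub>0 where w\<^sub>0: "(u, w\<^sub>0) \<in> gen G" "u \<in> DC" "w \<in> V" "N (w - (w\<^sub>0 - C u + B u)) = 0"
    using assms(1) by (auto simp: K_def)
  have "0 \<le> (1 - \<kappa>) * L u"
    using \<kappa> L_nonneg[OF w\<^sub>0(2)] by simp
  then show ?thesis
    using estimate[OF w\<^sub>0, of \<nu>] assms(2) \<omega> by simp
qed

lemma K_lin:
  assumes "(u, w) \<in> K" "(u', w') \<in> K"
  shows "(x *\<^sub>R u + y *\<^sub>R u', x *\<^sub>R w + y *\<^sub>R w') \<in> K"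
proof -
  obtain v where v: "(u, v) \<in> gen G" "u \<in> DC" "w \<in> V" "N (w - (v - C u + B u)) = 0"
    using assms(1) by (auto simp: K_def)
  obtain v' where v': "(u', v') \<in> gen G" "u' \<in> DC" "w' \<in> V" "N (w' - (v' - C u' + B u')) = 0"
    using assms(2) by (auto simp: K_def)
  let ?u = "x *\<^sub>R u + y *\<^sub>R u'"
  have A: "(?u, x *\<^sub>R v + y *\<^sub>R v') \<in> gen G"
    by (rule gen_lin[OF v(1) v'(1)])
  have D: "?u \<in> DC"
    by (rule DC_lin[OF v(2) v'(2)])
  note V = genV[OF v(1)] genV[OF v'(1)] CV[OF v(2)] CV[OF v'(2)] v(3) v'(3) CV[OF D]
    B_V[OF v(1,2)] B_V[OF v'(1,2)] B_V[OF A D]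
  have 1: "N (x *\<^sub>R (w - (v - C u + B u))) \<le> 0" "N (y *\<^sub>R (w' - (v' - C u' + B u'))) \<le> 0"
    using v(4) v'(4) V by (simp_all only: N_scale V_diff V_add mult_zero_right order_refl)
  have 2: "N (x *\<^sub>R B u + y *\<^sub>R B u' - B ?u) \<le> 0"
    using B_lin[OF v(2) v'(2), of x y] V N_commute[of "x *\<^sub>R B u + y *\<^sub>R B u'" "B ?u"] by simp
  have "N (x *\<^sub>R w + y *\<^sub>R w' - (x *\<^sub>R v + y *\<^sub>R v' - C ?u + B ?u)) \<le> 0"
    using V by (intro N_triangle_le[OF _ _ N_triangle_le[OF _ _ 1 refl refl] 2])
      (auto simp: C_lin algebra_simps)
  then have "N (x *\<^sub>R w + y *\<^sub>R w' - (x *\<^sub>R v + y *\<^sub>R v' - C ?u + B ?u)) = 0"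
    using V N_nonneg[of "x *\<^sub>R w + y *\<^sub>R w' - (x *\<^sub>R v + y *\<^sub>R v' - C ?u + B ?u)"] by simp
  then show ?thesis
    unfolding K_def using A D V by blast
qed

text \<open>Needed for invariance of K under change of representatives. Closedness of C along the
  zero sequence puts v into the domain with C v null; dissipativity at \<nu> = 0 then bounds L v by
  0, and with it the gain.\<close>

lemma null:
  assumes v: "v \<in> V" "N v = 0"
  shows "v \<in> DC" "(v, 0) \<in> gen G" "N (C v) = 0" "N (B v) = 0"
proof -
  have "0 \<in> DC"
    using DC by simp
  then have *: "v \<in> DC \<and> N (C v - 0) = 0"
    using C_closed[of "\<lambda>_. 0" v 0] v by simp
  then show D: "v \<in> DC" and C: "N (C v) = 0"
    by auto
  obtain u\<^sub>0 where u\<^sub>0: "(u\<^sub>0, 1 *\<^sub>R u\<^sub>0 - 0) \<in> gen G"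
    using resolvent[of 1 0] by auto
  have "(0, 0) \<in> gen G"
    using gen_lin[OF u\<^sub>0 u\<^sub>0, of 0 0] by simp
  then show A: "(v, 0) \<in> gen G"
    by (rule gen_eq) (use v in auto)
  have "L v \<le> 0"
    using gen_C_dissipative[OF A D, of 0] C by simp
  then have "\<kappa> * L v \<le> 0"
    using \<kappa> by (simp add: mult_nonneg_nonpos)
  then show "N (B v) = 0"
    using B_le[OF D B_V[OF A D]] N_nonneg[OF B_V[OF A D]] v by simp
qed

lemma K_eq:
  assumes "(u, w) \<in> K" and V': "u' \<in> V" "w' \<in> V" and eq: "N (u' - u) = 0" "N (w' - w) = 0"
  shows "(u', w') \<in> K"
proof -
  obtain v where v: "(u, v) \<in> gen G" "u \<in> DC" "w \<in> V" "N (w - (v - C u + B u)) = 0"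
    using assms(1) by (auto simp: K_def)
  note V = genV[OF v(1)] CV[OF v(2)] v(3)
  note n = null[OF V_diff[OF V'(1) V(1)] eq(1)]
  have D: "u' \<in> DC"
    using DC_lin[OF n(1) v(2), of 1 1] by simp
  have A: "(u', v) \<in> gen G"
    using gen_lin[OF n(2) v(1), of 1 1] by simp
  note W = CV[OF D] B_V[OF A D] B_V[OF v(1,2)]
  have 1: "N (w' - w) \<le> 0" "N (w - (v - C u + B u)) \<le> 0" "N (C (u' - u)) \<le> 0" "N (B u - B u') \<le> 0"
    using eq v(4) n(3,4) B_diff(2)[OF A D v(1,2)] N_commute[of "B u" "B u'"] W by simp_all
  have "N (w' - (v - C u' + B u')) \<le> 0"
    using V V' W
    by (intro N_triangle_le[OF _ _ N_triangle_le[OF _ _ N_triangle_le[OF _ _ 1(1,2) refl refl] 1(3)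
      refl refl] 1(4)]) (auto simp: C_diff)
  then have "N (w' - (v - C u' + B u')) = 0"
    using V V' W N_nonneg[of "w' - (v - C u' + B u')"] by simp
  then show ?thesis
    unfolding K_def using A D V' by blast
qed

text \<open>A cutoff of f is close to f, and it is approximated by the cutoff of an element v of the
  domain of the transport: the cutoff is contractive, preserves the generator and maps into the
  domain of C.\<close>

lemma K_dense:
  assumes f: "f \<in> V" and e: "0 < e"
  shows "\<exists>u w. (u, w) \<in> K \<and> N (u - f) < e"
proof -
  obtain n where n: "\<bar>N (Q n f - f)\<bar> < e / 2"
    using LIMSEQ_D[OF Q_lim[OF f], of "e / 2"] e by fastforce
  have "\<exists>v w. (v, w) \<in> gen G \<and> N (v - f) \<le> e / 2"
    by (rule resolvent[OF zero_less_one f]) (use e in \<open>blast intro: half_gt_zero\<close>)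
  then obtain v w where v: "(v, w) \<in> gen G" "N (v - f) \<le> e / 2"
    by blast
  note V = genV[OF v(1)]
  have A: "(Q n v, Q n w) \<in> gen G" and D: "Q n v \<in> DC"
    using Q_gen v(1) Q_DC V by auto
  have "Q n (v - f) = Q n v - Q n f"
    using Q_lin[of n 1 v "-1" f] by simp
  then have "N (Q n v - Q n f) \<le> e / 2"
    using Q_le[of "v - f" n] v(2) V f by simp
  then have "N (Q n v - f) < e"
    using N_diff_triangle[of "Q n v" "Q n f" f] n V f Q_V by simp
  moreover have "(Q n v, Q n w - C (Q n v) + B (Q n v)) \<in> K"
    unfolding K_def using A D genV[OF A] CV[OF D] B_V[OF A D] by (auto intro!: exI[of _ "Q n w"])
  ultimately show ?thesis
    by blast
qed

text \<open>Adding c n times u to both sides replaces the loss by the positive operator c n - C.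
  After cutoff its norm is at most c n N - L, and the gain contributes at most L + \<omega> N, so L
  cancels and the map has Lipschitz constant (c n + \<omega>) / (c n + \<nu>). All its terms
  preserve the cone.\<close>

lemma range_cutoff:
  assumes f: "f \<in> V" and \<nu>: "\<omega> < \<nu>"
  obtains u w where "(u, w) \<in> gen G" "u \<in> DC" "N (\<nu> *\<^sub>R u - (w - C u + B u) - Q n f) = 0"
    "f \<in> P ==> u \<in> P"
proof -
  \<comment> \<open>Spectral parameter for pure transport once the loss has been compensated by c
    n.\<close>
  define \<mu> where "\<mu> = \<nu> + c n"
  have \<mu>: "0 < \<mu>" "c n + \<omega> < \<mu>"
    using \<nu> \<omega> c_nonneg[of n] by (auto simp: \<mu>_def)
  have "\<exists>u. (u, \<mu> *\<^sub>R u - F) \<in> gen G \<and> (F \<in> P --> u \<in> P)" if "F \<in> V" for F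
    by (rule resolvent[OF \<mu>(1) that]) (use G_P in blast)
  then obtain R where R: "!!F. F \<in> V ==> (R F, \<mu> *\<^sub>R R F - F) \<in> gen G"
    and RP: "!!F. F \<in> V ==> F \<in> P ==> R F \<in> P"
    by metis
  have RV: "R F \<in> V" if "F \<in> V" for F
    using genV R that by blast
  have R_contr: "\<mu> * N (R F - R F') \<le> N (F - F')" if "F \<in> V" "F' \<in> V" for F F'
    using gen_dissipative[OF gen_diff[OF R R], of F F' \<mu>] that \<mu> by (simp add: algebra_simps)
  define p where "p F = Q n (R F)" for F
  have pA: "(p F, \<mu> *\<^sub>R p F - Q n F) \<in> gen G" if "F \<in> V" for F
    using Q_gen[OF R[OF that], of n] Q_lin[of n \<mu> "R F" "-1" F] by (simp add: p_def)
  have pD: "p F \<in> DC" if "F \<in> V" for F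
    using that Q_DC RV by (simp add: p_def)
  have pV: "p F \<in> V" "C (p F) \<in> V" "B (p F) \<in> V" if "F \<in> V" for F
    using CV[OF pD] B_V[OF pA pD] that by auto
  \<comment> \<open>The unknown is the right-hand side F of the transport equation \<mu> u - T u =
    F, with u the cutoff of its solution; a fixed point of \<Psi> is the full equation for
    u.\<close>
  define \<Psi> where "\<Psi> F = Q n f + (c n *\<^sub>R p F - C (p F)) + B (p F)" for F
  have \<Psi>V: "\<Psi> F \<in> V" if "F \<in> V" for F
    using that pV Q_V f by (simp add: \<Psi>_def)
  have contr: "N (\<Psi> F - \<Psi> F') \<le> (c n + \<omega>) / \<mu> * N (F - F')" if F: "F \<in> V" "F' \<in> V" for F F'
  proof -
    let ?d = "p F - p F'"
    have d: "?d = Q n (R F - R F')"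
      using Q_lin[of n 1 "R F" "-1" "R F'"] by (simp add: p_def)
    have dD: "?d \<in> DC"
      using DC_diff pD F by blast
    have BV: "B ?d \<in> V"
      using B_V[OF gen_diff[OF pA pA]] F dD by blast
    have 1: "N (c n *\<^sub>R ?d - C ?d) + L ?d \<le> c n * N ?d"
      using C_loss[of "R F - R F'" n] RV F unfolding d by simp
    have "N (B (p F) - B (p F')) = N (B ?d)"
      using B_diff(2)[OF pA pD pA pD] F by blast
    also have "\<dots> \<le> \<kappa> * L ?d + \<omega> * N ?d"
      using B_le[OF dD BV] .
    also have "\<kappa> * L ?d \<le> L ?d"
      using \<kappa> L_nonneg[OF dD] by (simp add: mult_left_le_one_le)
    finally have 2: "N (B (p F) - B (p F')) \<le> L ?d + \<omega> * N ?d"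
      by simp
    have "\<Psi> F - \<Psi> F' = (c n *\<^sub>R ?d - C ?d) + (B (p F) - B (p F'))"
      by (simp add: \<Psi>_def C_diff algebra_simps)
    then have "N (\<Psi> F - \<Psi> F') \<le> N (c n *\<^sub>R ?d - C ?d) + N (B (p F) - B (p F'))"
      using N_triangle[of "c n *\<^sub>R ?d - C ?d" "B (p F) - B (p F')"] pV F CV[OF dD] by simp
    also have "\<dots> \<le> (c n + \<omega>) * N ?d"
      using 1 2 by (simp add: algebra_simps)
    also have "\<dots> \<le> (c n + \<omega>) * (N (F - F') / \<mu>)"
    proof (intro mult_left_mono)
      have "N ?d \<le> N (R F - R F')"
        unfolding d using Q_le RV F by simp
      also have "\<dots> \<le> N (F - F') / \<mu>"
        using R_contr[OF F] \<mu> by (simp add: field_simps)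
      finally show "N ?d \<le> N (F - F') / \<mu>" .
    qed (use \<omega> c_nonneg in auto)
    finally show ?thesis
      by simp
  qed
  have q: "0 \<le> (c n + \<omega>) / \<mu>" "(c n + \<omega>) / \<mu> < 1"
    using \<mu> \<omega> c_nonneg[of n] by auto
  obtain F where F: "F \<in> V" "N (\<Psi> F - F) = 0" and FP: "(!!F. F \<in> P ==> \<Psi> F \<in> P) ==> F \<in> P"
    using contraction_fixed_point[OF \<Psi>V q contr] by blast
  have QV: "Q n f \<in> V" "Q n F \<in> V" "Q n (\<Psi> F) \<in> V" "Q n (B (p F)) \<in> V"
    using Q_V f F \<Psi>V pV by auto
  have "Q n (\<Psi> F) = Q n (1 *\<^sub>R Q n f + 1 *\<^sub>R (c n *\<^sub>R p F + (-1) *\<^sub>R C (p F))) + Q n (B (p F))"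
    using Q_lin[of n 1 "Q n f + (c n *\<^sub>R p F - C (p F))" 1 "B (p F)"] by (simp add: \<Psi>_def)
  also have "Q n (1 *\<^sub>R Q n f + 1 *\<^sub>R (c n *\<^sub>R p F + (-1) *\<^sub>R C (p F))) = Q n f + (c n *\<^sub>R p F - C (p F))"
    unfolding Q_lin by (simp add: Q_idem Q_C p_def)
  finally have "Q n (\<Psi> F) - \<Psi> F = Q n (B (p F)) - B (p F)"
    by (simp add: \<Psi>_def)
  then have 1: "N (Q n (\<Psi> F) - \<Psi> F) \<le> 0"
    using Q_B[of "R F" n] RV F pV by (simp add: p_def)
  have "Q n (F - \<Psi> F) = Q n F - Q n (\<Psi> F)"
    using Q_lin[of n 1 F "-1" "\<Psi> F"] by simp
  then have 2: "N (Q n F - Q n (\<Psi> F)) \<le> 0"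
    using Q_le[of "F - \<Psi> F" n] F \<Psi>V N_commute[of F "\<Psi> F"] by simp
  have 3: "N (Q n F - \<Psi> F) \<le> 0"
    using QV \<Psi>V F by (intro N_triangle_le[OF _ _ 2 1]) auto
  \<comment> \<open>Applying the cutoff to the solution also cuts off F, so the residual is
    \<open>Q n F - \<Psi> F\<close>; it is null because \<Psi> F is unchanged by the cutoff, the
    gain of a cut-off function being cut off already.\<close>
  have split: "\<nu> *\<^sub>R p F - (\<mu> *\<^sub>R p F - Q n F - C (p F) + B (p F)) - Q n f = Q n F - \<Psi> F"
    by (simp add: \<Psi>_def \<mu>_def algebra_simps)
  have "N (\<nu> *\<^sub>R p F - (\<mu> *\<^sub>R p F - Q n F - C (p F) + B (p F)) - Q n f) = 0"
    unfolding split using 3 N_nonneg[of "Q n F - \<Psi> F"] QV \<Psi>V F by simp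
  moreover have "p F \<in> P" if "f \<in> P"
  proof -
    have pP: "p F' \<in> P" if "F' \<in> P" for F'
      using Q_P RP P_subset that by (auto simp: p_def)
    have "\<Psi> F' \<in> P" if "F' \<in> P" for F'
    proof -
      have F': "F' \<in> V"
        using that P_subset by blast
      have 1: "c n *\<^sub>R p F' - C (p F') \<in> P"
        unfolding p_def by (rule C_P[OF RP[OF F' that]])
      have 2: "B (p F') \<in> P"
        by (rule B_P[OF pD[OF F'] pV(3)[OF F'] pP[OF that]])
      show ?thesis
        unfolding \<Psi>_def by (intro P_add 1 2 Q_P \<open>f \<in> P\<close>)
    qed
    then show ?thesis
      using FP pP by blast
  qed
  ultimately show thesis
    using that[OF pA[OF F(1)] pD[OF F(1)]] by blast
qed

text \<open>The data \<open>Q n f\<close> form a Cauchy sequence. By \<open>estimate\<close> so do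
  the solutions, and through L also their losses and gains. The transport terms then converge by the
  equation, and closedness of the generator and of C identifies the limit.\<close>

lemma K_range:
  assumes f: "f \<in> V" and \<nu>: "\<omega> < \<nu>"
  shows "\<exists>u w. (u, w) \<in> K \<and> N (\<nu> *\<^sub>R u - w - f) = 0 \<and> (f \<in> P --> u \<in> P)"
proof -
  have "\<exists>u w. (u, w) \<in> gen G \<and> u \<in> DC \<and> N (\<nu> *\<^sub>R u - (w - C u + B u) - Q n f) = 0 \<and> (f \<in> P --> u \<in> P)" for n
    using range_cutoff[OF f \<nu>, of n] by blast
  then obtain u w where A: "!!n. (u n, w n) \<in> gen G" and D: "!!n. u n \<in> DC"
    and eq: "!!n. N (\<nu> *\<^sub>R u n - (w n - C (u n) + B (u n)) - Q n f) = 0" and uP: "!!n. f \<in> P ==> u n \<in> P"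
    by metis
  note V = genV[OF A] CV[OF D] B_V[OF A D] Q_V[OF f]
  have est: "(\<nu> - \<omega>) * N (u m - u n) + (1 - \<kappa>) * L (u m - u n) \<le> N (Q m f - Q n f)" for m n
  proof -
    have Ad: "(u m - u n, w m - w n) \<in> gen G" and Dd: "u m - u n \<in> DC"
      using gen_diff A DC_diff D by auto
    note BV = B_V[OF Ad Dd]
    let ?w = "w m - w n - C (u m - u n) + B (u m - u n)"
    have "(\<nu> - \<omega>) * N (u m - u n) + (1 - \<kappa>) * L (u m - u n) \<le> N (\<nu> *\<^sub>R (u m - u n) - ?w)"
      using V BV CV[OF Dd] \<nu> \<omega> by (intro estimate[OF Ad Dd]) auto
    also have "\<nu> *\<^sub>R (u m - u n) - ?w = (\<nu> *\<^sub>R u m - (w m - C (u m) + B (u m)) - Q m f)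
        - (\<nu> *\<^sub>R u n - (w n - C (u n) + B (u n)) - Q n f)
        - (B (u m - u n) - (B (u m) - B (u n))) + (Q m f - Q n f)"
      by (simp add: C_diff algebra_simps)
    also have "N \<dots> \<le> N (\<nu> *\<^sub>R u m - (w m - C (u m) + B (u m)) - Q m f)
        + N (\<nu> *\<^sub>R u n - (w n - C (u n) + B (u n)) - Q n f)
        + N (B (u m - u n) - (B (u m) - B (u n))) + N (Q m f - Q n f)" (is "N (?a - ?b - ?c + ?d) \<le> _")
      using N_triangle[of "?a - ?b - ?c" ?d] N_diff_le[of "?a - ?b" ?c] N_diff_le[of ?a ?b] V BV by simp
    finally show ?thesis
      using eq[of m] eq[of n] B_diff(1)[OF A D A D, of m n] by simp
  qed
  have Nu: "N (u m - u n) \<le> 1 / (\<nu> - \<omega>) * N (Q m f - Q n f)" for m n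
  proof -
    have "0 \<le> (1 - \<kappa>) * L (u m - u n)"
      using \<kappa> L_nonneg DC_diff D by simp
    then have "(\<nu> - \<omega>) * N (u m - u n) \<le> N (Q m f - Q n f)"
      using est[of m n] by simp
    then show ?thesis
      using \<nu> by (simp add: field_simps)
  qed
  have Lu: "L (u m - u n) \<le> 1 / (1 - \<kappa>) * N (Q m f - Q n f)" for m n
  proof -
    have "0 \<le> (\<nu> - \<omega>) * N (u m - u n)"
      using \<nu> N_nonneg V by simp
    then have "(1 - \<kappa>) * L (u m - u n) \<le> N (Q m f - Q n f)"
      using est[of m n] by simp
    then show ?thesis
      using \<kappa> by (simp add: field_simps)
  qed
  have Q: "Cauchy_V (\<lambda>n. Q n f)"
    using convergent_imp_Cauchy_V[OF V(6) f Q_lim[OF f]] .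
  have "Cauchy_V u"
    by (rule Cauchy_V_dominated[OF V(1) Q _ Nu]) (use \<nu> in simp)
  then obtain U where U: "U \<in> V" "(\<lambda>n. N (u n - U)) \<longlonglongrightarrow> 0"
    using Cauchy_V_convergent[of u] V by blast
  have "Cauchy_V (\<lambda>n. C (u n))"
  proof (rule Cauchy_V_dominated[OF V(4) Q])
    fix m n
    have "N (C (u m) - C (u n)) \<le> M * L (u m - u n)"
      using C_le[OF DC_diff[OF D D], of m n] by (simp add: C_diff)
    also have "\<dots> \<le> M * (1 / (1 - \<kappa>) * N (Q m f - Q n f))"
      using Lu M by (intro mult_left_mono)
    finally show "N (C (u m) - C (u n)) \<le> M * (1 / (1 - \<kappa>)) * N (Q m f - Q n f)"
      by simp
  qed (use M \<kappa> in simp)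
  then obtain Y where Y: "Y \<in> V" "(\<lambda>n. N (C (u n) - Y)) \<longlonglongrightarrow> 0"
    using Cauchy_V_convergent[of "\<lambda>n. C (u n)"] V by blast
  have "Cauchy_V (\<lambda>n. B (u n))"
  proof (rule Cauchy_V_dominated[OF V(5) Q])
    fix m n
    have "N (B (u m) - B (u n)) \<le> \<kappa> * L (u m - u n) + \<omega> * N (u m - u n)"
      using B_le[OF DC_diff[OF D D] B_V[OF gen_diff[OF A A] DC_diff[OF D D]]] B_diff(2)[OF A D A D]
      by simp
    also have "\<dots> \<le> \<kappa> * (1 / (1 - \<kappa>) * N (Q m f - Q n f)) + \<omega> * (1 / (\<nu> - \<omega>) * N (Q m f - Q n f))"
      using Lu Nu \<kappa> \<omega> by (intro add_mono mult_left_mono)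
    finally show "N (B (u m) - B (u n)) \<le> (\<kappa> * (1 / (1 - \<kappa>)) + \<omega> * (1 / (\<nu> - \<omega>))) * N (Q m f - Q n f)"
      by (simp add: algebra_simps)
  qed (use \<omega> \<kappa> \<nu> in simp)
  then obtain Z where Z: "Z \<in> V" "(\<lambda>n. N (B (u n) - Z)) \<longlonglongrightarrow> 0"
    using Cauchy_V_convergent[of "\<lambda>n. B (u n)"] V by blast
  \<comment> \<open>The limit of the transport terms \<open>w n\<close>, read off from the
    equation.\<close>
  define W where "W = \<nu> *\<^sub>R U + Y - Z - f"
  have WV: "W \<in> V"
    using U Y Z f by (simp add: W_def)
  have "(\<lambda>n. N (\<nu> *\<^sub>R u n + C (u n) - B (u n) - Q n f - (\<nu> *\<^sub>R U + Y - Z - f))) \<longlonglongrightarrow> 0"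
    using V U Y Z f Q_lim[OF f] by (intro lim_diff lim_add lim_scale) auto
  moreover have "N (w n - W) \<le> N (\<nu> *\<^sub>R u n + C (u n) - B (u n) - Q n f - W)" for n
  proof -
    have "w n - W = (\<nu> *\<^sub>R u n + C (u n) - B (u n) - Q n f - W)
        - (\<nu> *\<^sub>R u n - (w n - C (u n) + B (u n)) - Q n f)"
      by simp
    then show ?thesis
      using N_diff_le[of "\<nu> *\<^sub>R u n + C (u n) - B (u n) - Q n f - W"
        "\<nu> *\<^sub>R u n - (w n - C (u n) + B (u n)) - Q n f"] eq[of n] V WV by simp
  qed
  ultimately have wW: "(\<lambda>n. N (w n - W)) \<longlonglongrightarrow> 0"
    unfolding W_def[symmetric] using N_nonneg V WV
    by (intro tendsto_0_seq_bound[where f = "\<lambda>n. N (w n - W)"]) auto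
  have UW: "(U, W) \<in> gen G"
    by (rule gen_closed[OF A U(1) WV U(2) wW])
  have UD: "U \<in> DC" "N (C U - Y) = 0"
    using C_closed[OF D U(1) Y(1) U(2) Y(2)] by auto
  note UV = CV[OF UD(1)] B_V[OF UW UD(1)]
  \<comment> \<open>B is continuous in the graph norm of transport and loss together: dissipativity
    at \<nu> = 0 bounds L of the difference by the differences of these two terms.\<close>
  have "(\<lambda>n. N (B (u n) - B U)) \<longlonglongrightarrow> 0"
  proof (rule tendsto_0_seq_bound)
    have "(\<lambda>n. N (C (u n) - C U)) \<longlonglongrightarrow> 0"
    proof (rule tendsto_0_seq_bound[OF Y(2)])
      show "N (C (u n) - C U) \<le> N (C (u n) - Y)" for n
        using N_diff_triangle[of "C (u n)" Y "C U"] N_commute[of Y "C U"] UD(2) UV V Y by simp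
    qed (use V UV N_nonneg in auto)
    then show "(\<lambda>n. \<kappa> * (N (w n - W) + N (C (u n) - C U)) + \<omega> * N (u n - U)) \<longlonglongrightarrow> 0"
      using wW U(2) by (auto intro!: tendsto_eq_intros)
    fix n
    have D': "u n - U \<in> DC" and A': "(u n - U, w n - W) \<in> gen G"
      using DC_diff D UD gen_diff A UW by auto
    have "L (u n - U) \<le> N (0 *\<^sub>R (u n - U) - (w n - W) + C (u n - U))"
      using gen_C_dissipative[OF A' D', of 0] by simp
    also have "\<dots> \<le> N (w n - W) + N (C (u n) - C U)"
      using N_triangle[of "- (w n - W)" "C (u n) - C U"] N_minus[of "w n - W"] V UV WV
      by (simp add: C_diff)
    finally have "\<kappa> * L (u n - U) \<le> \<kappa> * (N (w n - W) + N (C (u n) - C U))"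
      using \<kappa> by (intro mult_left_mono)
    then show "N (B (u n) - B U) \<le> \<kappa> * (N (w n - W) + N (C (u n) - C U)) + \<omega> * N (u n - U)"
      using B_le[OF D' B_V[OF A' D']] B_diff(2)[OF A D UW UD(1), of n] by simp
  qed (use V UV N_nonneg in auto)
  then have BZ: "N (B U - Z) = 0"
    using limit_unique[of "\<lambda>n. B (u n)" "B U" Z] V UV Z by blast
  have 1: "N (C U - Y) \<le> 0" "N (Z - B U) \<le> 0"
    using UD(2) BZ N_commute[of Z "B U"] Z UV by auto
  have "N (\<nu> *\<^sub>R U - f - (W - C U + B U)) \<le> 0"
    using UV U Y Z f by (intro N_triangle_le[OF _ _ 1]) (auto simp: W_def algebra_simps)
  then have "(U, \<nu> *\<^sub>R U - f) \<in> K"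
    unfolding K_def using UW UD UV U f WV N_nonneg[of "\<nu> *\<^sub>R U - f - (W - C U + B U)"] by auto
  moreover have "U \<in> P" if "f \<in> P"
    using P_closed[of u U] uP that U by blast
  ultimately show ?thesis
    by (intro exI[of _ U] exI[of _ "\<nu> *\<^sub>R U - f"]) simp
qed

theorem K_generates: "\<exists>S. C0_sg S \<and> gen S = K \<and> (\<forall>t\<ge>0. \<forall>f\<in>P. S t f \<in> P)"
proof (rule quasi_dissipative_generates)
  show "K \<subseteq> V \<times> V"
    by (auto simp: K_def DC)
qed (use K_lin K_eq K_dissipative K_range K_dense in blast)+

end

section \<open>Lebesgue measure on products\<close>

lemma AE_lebesgue_on_iff:
  fixes S :: "'a::euclidean_space set"
  assumes "S \<in> sets borel"
  shows "(AE x in lebesgue_on S. Q x) \<longleftrightarrow> (AE x in lborel. x \<in> S --> Q x)"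
  using assms by (simp add: AE_restrict_space_iff AE_completion_iff)

lemma borel_measurable_lebesgue_on_cong_AE:
  fixes f g :: "'a::euclidean_space \<Rightarrow> 'b::topological_space"
  assumes S: "S \<in> sets borel" and g: "g \<in> borel_measurable (lebesgue_on S)"
    and eq: "AE x in lebesgue_on S. f x = g x"
  shows "f \<in> borel_measurable (lebesgue_on S)"
proof (rule measurableI)
  fix A :: "'b set"
  assume A: "A \<in> sets borel"
  have SL: "S \<in> sets lebesgue"
    using S by simp
  have "g -` A \<inter> S \<in> sets (lebesgue_on S)"
    using measurable_sets[OF g A] by (simp add: space_restrict_space)
  then have gA: "g -` A \<inter> S \<in> sets lebesgue"
    using sets_restrict_space_iff[of S lebesgue] SL by auto
  have "AE x in lebesgue. x \<in> g -` A \<inter> S \<longleftrightarrow> x \<in> f -` A \<inter> S"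
    using eq SL by (auto simp: AE_restrict_space_iff elim!: eventually_mono)
  from completion.in_sets_AE[OF this gA] have "f -` A \<inter> S \<in> sets lebesgue"
    by simp
  then show "f -` A \<inter> space (lebesgue_on S) \<in> sets (lebesgue_on S)"
    using SL by (simp add: space_restrict_space sets_restrict_space_iff)
qed simp

lemma borel_version:
  fixes f :: "'a::euclidean_space \<Rightarrow> real"
  assumes S: "S \<in> sets borel" and f: "f \<in> borel_measurable (lebesgue_on S)"
  obtains f' where "f' \<in> borel_measurable borel" "AE x in lborel. x \<in> S --> f x = f' x"
proof -
  have "(\<lambda>x. if x \<in> S then f x else 0) \<in> borel_measurable lebesgue"
    using f S by (intro borel_measurable_if_I) auto
  then obtain f' where f': "f' \<in> borel_measurable lborel"
      "AE x in lborel. (if x \<in> S then f x else 0) = f' x"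
    using completion_ex_borel_measurable_real by blast
  have "AE x in lborel. x \<in> S --> f x = f' x"
    using f'(2) by eventually_elim auto
  with f'(1) show thesis
    by (intro that[of f']) simp_all
qed

lemma borel_measurable_lebesgue_onI:
  fixes f f' :: "'a::euclidean_space \<Rightarrow> 'b::topological_space"
  assumes S: "S \<in> sets borel" and f': "f' \<in> borel_measurable borel"
    and eq: "AE x in lborel. x \<in> S --> f x = f' x"
  shows "f \<in> borel_measurable (lebesgue_on S)"
proof (rule borel_measurable_lebesgue_on_cong_AE[OF S])
  show "f' \<in> borel_measurable (lebesgue_on S)"
    using f' by (intro measurable_restrict_space1 measurable_completion) simp
  show "AE x in lebesgue_on S. f x = f' x"
    using eq S by (simp add: AE_lebesgue_on_iff)
qed

lemma AE_lborel_Pair: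
  fixes Q :: "'a::euclidean_space \<times> 'b::euclidean_space \<Rightarrow> bool"
  assumes "AE z in lborel. Q z"
  shows "AE x in lborel. AE y in lborel. Q (x, y)" "AE y in lborel. AE x in lborel. Q (x, y)"
proof -
  have 1: "AE x in lborel. AE y in lborel. R (x, y)" if "AE z in lborel. R z"
    for R :: "'c::euclidean_space \<times> 'd::euclidean_space \<Rightarrow> bool"
    by (rule lborel_pair.AE_pair[unfolded lborel_prod, OF that])
  show "AE x in lborel. AE y in lborel. Q (x, y)"
    using 1[OF assms] .
  \<comment> \<open>Exchanging the order of the two almost-everywhere quantifiers requires a
    measurable set, whence the Borel null set around the exceptional set.\<close>
  obtain N where N: "{z. \<not> Q z} \<subseteq> N" "N \<in> null_sets lborel"
    using assms unfolding eventually_ae_filter by auto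
  then have [measurable]: "N \<in> sets (lborel \<Otimes>\<^sub>M lborel)"
    unfolding lborel_prod by auto
  have "AE z in lborel. z \<notin> N"
    using N by (auto intro: AE_not_in)
  from 1[OF this] have "AE x in lborel. AE y in lborel. (x, y) \<notin> N" .
  moreover have "{z \<in> space (lborel \<Otimes>\<^sub>M lborel). (fst z, snd z) \<notin> N} \<in> sets (lborel \<Otimes>\<^sub>M lborel)"
    by measurable
  ultimately have "AE y in lborel. AE x in lborel. (x, y) \<notin> N"
    by (subst (asm) lborel_pair.AE_commute)
  then show "AE y in lborel. AE x in lborel. Q (x, y)"
    using N(1) by (auto elim!: eventually_mono)
qed

lemma AE_lborel_PairI:
  fixes Q :: "'a::euclidean_space \<times> 'b::euclidean_space \<Rightarrow> bool"
  assumes [measurable]: "Measurable.pred borel Q" and "AE x in lborel. AE y in lborel. Q (x, y)"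
  shows "AE z in lborel. Q z"
proof -
  have "Measurable.pred (lborel \<Otimes>\<^sub>M lborel) Q"
    by (simp add: lborel_prod)
  from lborel_pair.AE_pair_measure[OF Measurable.predE[OF this] assms(2)] show ?thesis
    by (simp only: lborel_prod)
qed

lemma AE_lborel_fst:
  fixes Q :: "'a::euclidean_space \<Rightarrow> bool"
  assumes "AE x in lborel. Q x"
  shows "AE z in (lborel :: ('a \<times> 'b::euclidean_space) measure). Q (fst z)"
proof -
  obtain N where N: "{x. \<not> Q x} \<subseteq> N" "N \<in> null_sets lborel"
    using assms unfolding eventually_ae_filter by auto
  then have [measurable]: "N \<in> sets borel"
    by auto
  have "AE z in (lborel :: ('a \<times> 'b) measure). fst z \<notin> N"
  proof (rule AE_lborel_PairI)
    show "AE x in lborel. AE y in lborel. fst (x, y) \<notin> N"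
      using AE_not_in[OF N(2)] by (auto elim!: eventually_mono)
    show "Measurable.pred borel (\<lambda>z::'a \<times> 'b. fst z \<notin> N)"
      by (simp add: borel_prod[symmetric])
  qed
  then show ?thesis
    using N(1) by (auto elim!: eventually_mono)
qed

lemma AE_lborel_snd:
  fixes Q :: "'b::euclidean_space \<Rightarrow> bool"
  assumes "AE x in lborel. Q x"
  shows "AE z in (lborel :: ('a::euclidean_space \<times> 'b) measure). Q (snd z)"
proof -
  obtain N where N: "{x. \<not> Q x} \<subseteq> N" "N \<in> null_sets lborel"
    using assms unfolding eventually_ae_filter by auto
  then have [measurable]: "N \<in> sets borel"
    by auto
  have "AE z in (lborel :: ('a \<times> 'b) measure). snd z \<notin> N"
  proof (rule AE_lborel_PairI)
    show "AE x in lborel. AE y in lborel. snd (x::'a, y) \<notin> N"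
      by (rule AE_I2) (use AE_not_in[OF N(2)] in simp)
    show "Measurable.pred borel (\<lambda>z::'a \<times> 'b. snd z \<notin> N)"
      by (simp add: borel_prod[symmetric])
  qed
  then show ?thesis
    using N(1) by (auto elim!: eventually_mono)
qed

lemma Times_borel:
  fixes A :: "'a::euclidean_space set" and B :: "'b::euclidean_space set"
  shows "A \<in> sets borel ==> B \<in> sets borel ==> A \<times> B \<in> sets borel"
  by (simp add: borel_prod[symmetric])

lemma AE_lebesgue_on_Times:
  fixes A :: "'a::euclidean_space set" and B :: "'b::euclidean_space set"
  assumes "A \<in> sets borel" "B \<in> sets borel" and Q: "AE z in lebesgue_on (A \<times> B). Q z"
  shows "AE x in lebesgue_on A. AE y in lebesgue_on B. Q (x, y)"
    "AE y in lebesgue_on B. AE x in lebesgue_on A. Q (x, y)"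
proof -
  have AE: "AE z in lborel. z \<in> A \<times> B --> Q z"
    using Q Times_borel[OF assms(1,2)] by (simp add: AE_lebesgue_on_iff)
  show "AE x in lebesgue_on A. AE y in lebesgue_on B. Q (x, y)"
    using AE_lborel_Pair(1)[OF AE] assms(1,2) by (auto simp: AE_lebesgue_on_iff elim!: eventually_mono)
  show "AE y in lebesgue_on B. AE x in lebesgue_on A. Q (x, y)"
    using AE_lborel_Pair(2)[OF AE] assms(1,2) by (auto simp: AE_lebesgue_on_iff elim!: eventually_mono)
qed

lemma measurable_lebesgue_on_fst:
  fixes f :: "'a::euclidean_space \<Rightarrow> real" and B :: "'b::euclidean_space set"
  assumes A: "A \<in> sets borel" and B: "B \<in> sets borel" and f: "f \<in> borel_measurable (lebesgue_on A)"
  shows "(\<lambda>z. f (fst z)) \<in> borel_measurable (lebesgue_on (A \<times> B))"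
proof -
  obtain f' where f': "f' \<in> borel_measurable borel" "AE x in lborel. x \<in> A --> f x = f' x"
    using borel_version[OF A f] .
  note [measurable] = f'(1)
  have "(\<lambda>z::'a \<times> 'b. f' (fst z)) \<in> borel_measurable borel"
    by (simp add: borel_prod[symmetric])
  moreover have "AE z in (lborel :: ('a \<times> 'b) measure). z \<in> A \<times> B --> f (fst z) = f' (fst z)"
    using AE_lborel_fst[OF f'(2)] by eventually_elim auto
  ultimately show ?thesis
    by (rule borel_measurable_lebesgue_onI[OF Times_borel[OF A B]])
qed

lemma measurable_lebesgue_on_snd:
  fixes f :: "'b::euclidean_space \<Rightarrow> real" and A :: "'a::euclidean_space set"
  assumes A: "A \<in> sets borel" and B: "B \<in> sets borel" and f: "f \<in> borel_measurable (lebesgue_on B)"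
  shows "(\<lambda>z. f (snd z)) \<in> borel_measurable (lebesgue_on (A \<times> B))"
proof -
  obtain f' where f': "f' \<in> borel_measurable borel" "AE x in lborel. x \<in> B --> f x = f' x"
    using borel_version[OF B f] .
  note [measurable] = f'(1)
  have "(\<lambda>z::'a \<times> 'b. f' (snd z)) \<in> borel_measurable borel"
    by (simp add: borel_prod[symmetric])
  moreover have "AE z in (lborel :: ('a \<times> 'b) measure). z \<in> A \<times> B --> f (snd z) = f' (snd z)"
    using AE_lborel_snd[OF f'(2)] by eventually_elim auto
  ultimately show ?thesis
    by (rule borel_measurable_lebesgue_onI[OF Times_borel[OF A B]])
qed

lemma borel_measurable_lebesgue_on_AE_limit:
  fixes f :: "nat \<Rightarrow> 'a::euclidean_space \<Rightarrow> real"
  assumes S: "S \<in> sets borel" and f: "!!n. f n \<in> borel_measurable (lebesgue_on S)"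
    and lim: "AE x in lebesgue_on S. (\<lambda>n. f n x) \<longlonglongrightarrow> g x"
  shows "g \<in> borel_measurable (lebesgue_on S)"
proof (rule borel_measurable_lebesgue_on_cong_AE[OF S])
  show "(\<lambda>x. lim (\<lambda>n. f n x)) \<in> borel_measurable (lebesgue_on S)"
    using f by (rule borel_measurable_lim_metric)
  show "AE x in lebesgue_on S. g x = lim (\<lambda>n. f n x)"
    using lim by eventually_elim (simp add: limI)
qed

section \<open>Strongly measurable functions and Bochner spaces\<close>

text \<open>The pointwise vector structure, so that the abstract theory applies to spaces of real
  functions.\<close>

instantiation "fun" :: (type, real_vector) real_vector
begin

definition scaleR_fun :: "real \<Rightarrow> ('a \<Rightarrow> 'b) \<Rightarrow> 'a \<Rightarrow> 'b" where
  "c *\<^sub>R f = (\<lambda>x. c *\<^sub>R f x)"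

instance
  by standard (auto simp: scaleR_fun_def fun_eq_iff algebra_simps)

end

lemma scaleR_fun_apply [simp]: "(c *\<^sub>R f) x = c *\<^sub>R f x"
  by (simp add: scaleR_fun_def)

text \<open>What the two spaces in x have in common. \<open>complete_lim\<close> fixes the limit to
  be the pointwise one, so that limits taken at different masses fit together into one function of
  (x, m). \<open>snorm_bound\<close> says that the norm is monotone in the absolute value.\<close>

locale fibre_space = ordered_seminormed "carr X" "snorm X" "cone X"
  for X :: "'a::euclidean_space fun_space" +
  fixes \<Omega> :: "'a set"
  assumes open_\<Omega>: "open \<Omega>"
    and carr_measurable: "f \<in> carr X ==> f \<in> borel_measurable (lebesgue_on \<Omega>)"
    and complete_lim: "(!!n::nat. v n \<in> carr X) ==> summable (\<lambda>n. snorm X (v (Suc n) - v n)) ==>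
      (\<lambda>x. lim (\<lambda>n. v n x)) \<in> carr X \<and> (\<lambda>n. snorm X (v n - (\<lambda>x. lim (\<lambda>n. v n x)))) \<longlonglongrightarrow> 0"
    and snorm_bound: "f \<in> carr X ==> g \<in> carr X ==> 0 \<le> k ==>
      (AE x in lebesgue_on \<Omega>. \<bar>f x\<bar> \<le> k * \<bar>g x\<bar>) ==> snorm X f \<le> k * snorm X g"
    and cone_eq: "cone X = {f \<in> carr X. AE x in lebesgue_on \<Omega>. 0 \<le> f x}"
begin

abbreviation "\<M> \<equiv> lebesgue_on {0::real..}"

lemma \<Omega>_borel [simp]: "\<Omega> \<in> sets borel"
  using open_\<Omega> by simp

lemma half_line_borel [simp]: "{0::real..} \<in> sets borel"
  by simp

definition SM :: "(real \<Rightarrow> 'a \<Rightarrow> real) \<Rightarrow> bool" where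
  "SM v = strongly_measurable X v"

definition simple_in :: "(real \<Rightarrow> 'a \<Rightarrow> real) \<Rightarrow> bool" where
  "simple_in \<sigma> \<longleftrightarrow> simple_function \<M> \<sigma> \<and> \<sigma> ` {0..} \<subseteq> carr X"

lemma SM_iff: "SM v \<longleftrightarrow> (AE m in \<M>. v m \<in> carr X) \<and>
    (\<exists>\<sigma>. (\<forall>k. simple_in (\<sigma> k)) \<and> (AE m in \<M>. (\<lambda>k. snorm X (v m - \<sigma> k m)) \<longlonglongrightarrow> 0))"
  unfolding SM_def strongly_measurable_def simple_in_def fun_diff_def by (rule refl)

lemma simple_in_carr: "simple_in \<sigma> ==> 0 \<le> m ==> \<sigma> m \<in> carr X"
  by (auto simp: simple_in_def)

lemma AE_nonneg_mass: "(!!m. 0 \<le> m ==> Q m) ==> AE m in \<M>. Q m"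
  by (auto simp: AE_lebesgue_on_iff)

lemma simple_in_SM: "simple_in \<sigma> ==> SM \<sigma>"
  unfolding SM_iff
  by (intro conjI exI[of _ "\<lambda>_. \<sigma>"] AE_nonneg_mass) (auto intro: simple_in_carr)

lemma simple_in_lin: "simple_in \<sigma> ==> simple_in \<tau> ==> simple_in (\<lambda>m. c *\<^sub>R \<sigma> m + d *\<^sub>R \<tau> m)"
  unfolding simple_in_def image_subset_iff
  by (auto intro!: simple_function_compose2[of _ _ _ "\<lambda>u v. c *\<^sub>R u + d *\<^sub>R v"])

lemma SM_carr: "SM v ==> AE m in \<M>. v m \<in> carr X"
  by (simp add: SM_iff)

lemma SM_lin:
  assumes "SM v" "SM w"
  shows "SM (\<lambda>m. c *\<^sub>R v m + d *\<^sub>R w m)"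
proof -
  obtain \<sigma> where \<sigma>: "!!k. simple_in (\<sigma> k)" "AE m in \<M>. (\<lambda>k. snorm X (v m - \<sigma> k m)) \<longlonglongrightarrow> 0"
    using assms(1) by (auto simp: SM_iff)
  obtain \<tau> where \<tau>: "!!k. simple_in (\<tau> k)" "AE m in \<M>. (\<lambda>k. snorm X (w m - \<tau> k m)) \<longlonglongrightarrow> 0"
    using assms(2) by (auto simp: SM_iff)
  show ?thesis
    unfolding SM_iff
  proof (intro conjI exI allI)
    show "AE m in \<M>. c *\<^sub>R v m + d *\<^sub>R w m \<in> carr X"
      using SM_carr[OF assms(1)] SM_carr[OF assms(2)] by eventually_elim auto
    show "simple_in (\<lambda>m. c *\<^sub>R \<sigma> k m + d *\<^sub>R \<tau> k m)" for k
      using \<sigma> \<tau> simple_in_lin by blast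
    have nonneg: "AE m in \<M>. 0 \<le> m"
      by (rule AE_nonneg_mass)
    show "AE m in \<M>. (\<lambda>k. snorm X (c *\<^sub>R v m + d *\<^sub>R w m - (c *\<^sub>R \<sigma> k m + d *\<^sub>R \<tau> k m))) \<longlonglongrightarrow> 0"
      using \<sigma>(2) \<tau>(2) SM_carr[OF assms(1)] SM_carr[OF assms(2)] nonneg
    proof eventually_elim
      case (elim m)
      have V: "\<sigma> k m \<in> carr X" "\<tau> k m \<in> carr X" for k
        using simple_in_carr \<sigma> \<tau> elim by blast+
      have bound: "snorm X (c *\<^sub>R v m + d *\<^sub>R w m - (c *\<^sub>R \<sigma> k m + d *\<^sub>R \<tau> k m))
          \<le> \<bar>c\<bar> * snorm X (v m - \<sigma> k m) + \<bar>d\<bar> * snorm X (w m - \<tau> k m)" for k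
      proof -
        have "c *\<^sub>R v m + d *\<^sub>R w m - (c *\<^sub>R \<sigma> k m + d *\<^sub>R \<tau> k m) = c *\<^sub>R (v m - \<sigma> k m) + d *\<^sub>R (w m - \<tau> k m)"
          by (simp only: scaleR_diff_right) simp
        then show ?thesis
          using N_triangle[of "c *\<^sub>R (v m - \<sigma> k m)" "d *\<^sub>R (w m - \<tau> k m)"] V elim by (simp only: N_scale V_diff V_scale)
      qed
      have "(\<lambda>k. \<bar>c\<bar> * snorm X (v m - \<sigma> k m) + \<bar>d\<bar> * snorm X (w m - \<tau> k m)) \<longlonglongrightarrow> \<bar>c\<bar> * 0 + \<bar>d\<bar> * 0"
        using elim by (intro tendsto_intros)
      then show ?case
        using bound V elim by (intro tendsto_0_seq_bound[OF _ N_nonneg]) auto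
    qed
  qed
qed

lemma SM_diff: "SM v ==> SM w ==> SM (\<lambda>m. v m - w m)"
  using SM_lin[of v w 1 "-1"] by simp

lemma SM_norm_measurable:
  assumes "SM v"
  shows "(\<lambda>m. snorm X (v m)) \<in> borel_measurable \<M>"
proof -
  obtain \<sigma> where \<sigma>: "!!k. simple_in (\<sigma> k)" "AE m in \<M>. (\<lambda>k. snorm X (v m - \<sigma> k m)) \<longlonglongrightarrow> 0"
    using assms by (auto simp: SM_iff)
  show ?thesis
  proof (rule borel_measurable_lebesgue_on_AE_limit)
    show "(\<lambda>m. snorm X (\<sigma> k m)) \<in> borel_measurable \<M>" for k
      using \<sigma>(1)[of k] unfolding simple_in_def
      by (intro borel_measurable_simple_function simple_function_compose1[of _ _ "snorm X"]) auto
    have nonneg: "AE m in \<M>. 0 \<le> m"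
      by (rule AE_nonneg_mass)
    show "AE m in \<M>. (\<lambda>k. snorm X (\<sigma> k m)) \<longlonglongrightarrow> snorm X (v m)"
      using \<sigma>(2) SM_carr[OF assms] nonneg
    proof eventually_elim
      case (elim m)
      have V: "\<sigma> k m \<in> carr X" for k
        using simple_in_carr \<sigma> elim by blast
      have "(\<lambda>k. snorm X (\<sigma> k m - v m)) \<longlonglongrightarrow> 0"
        using elim N_commute[OF V elim(2)] by simp
      then show ?case
        by (rule tendsto_N[OF V elim(2)])
    qed
  qed simp
qed

text \<open>A diagonal choice of simple functions needs a rate. Truncated norms weighted with a
  positive integrable function turn almost-everywhere convergence into convergence of integrals;
  approximations with integrals below (1/2)^n have a finite sum almost everywhere, so the distances
  tend to 0.\<close>

lemma SM_limit:
  assumes v: "!!n::nat. SM (v n)" and w: "AE m in \<M>. w m \<in> carr X"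
    and lim: "AE m in \<M>. (\<lambda>n. snorm X (v n m - w m)) \<longlonglongrightarrow> 0"
  shows "SM w"
proof -
  \<comment> \<open>A strictly positive weight with finite integral takes the place of a finite
    measure on the half-line.\<close>
  obtain h where h: "h \<in> borel_measurable lborel" "integral\<^sup>N lborel h \<noteq> \<infinity>"
    and h_pos: "!!x::real. 0 < h x" "!!x. h x < \<infinity>"
    using sigma_finite_measure.Ex_finite_integrable_function[OF sigma_finite_lborel] by auto
  have hM: "h \<in> borel_measurable \<M>"
    using h(1) by (intro measurable_restrict_space1 measurable_completion)
  have h_int: "(\<integral>\<^sup>+m. h m \<partial>\<M>) < \<infinity>"
  proof -
    have "(\<integral>\<^sup>+m. h m \<partial>\<M>) = (\<integral>\<^sup>+m. h m * indicator {0..} m \<partial>lebesgue)"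
      by (simp add: nn_integral_restrict_space)
    also have "\<dots> \<le> (\<integral>\<^sup>+m. h m \<partial>lebesgue)"
      by (intro nn_integral_mono) (simp add: indicator_def)
    also have "\<dots> = integral\<^sup>N lborel h"
      by (simp add: nn_integral_completion)
    also have "\<dots> < \<infinity>"
      using h(2) by (simp add: less_top)
    finally show ?thesis .
  qed
  have nonneg: "AE m in \<M>. 0 \<le> m"
    by (rule AE_nonneg_mass)
  have vV: "AE m in \<M>. \<forall>n. v n m \<in> carr X"
    using SM_carr[OF v] by (simp add: AE_all_countable)
  \<comment> \<open>Truncation at 1 makes the weight h a dominating function for every k.\<close>
  have "\<exists>\<tau>. simple_in \<tau> \<and> (\<integral>\<^sup>+m. min 1 (ennreal (snorm X (v n m - \<tau> m))) * h m \<partial>\<M>) \<le> ennreal ((1/2) ^ n)" for n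
  proof -
    obtain \<sigma> where \<sigma>: "!!k. simple_in (\<sigma> k)" "AE m in \<M>. (\<lambda>k. snorm X (v n m - \<sigma> k m)) \<longlonglongrightarrow> 0"
      using v[of n] by (auto simp: SM_iff)
    have [measurable]: "(\<lambda>m. snorm X (v n m - \<sigma> k m)) \<in> borel_measurable \<M>" for k
      using SM_norm_measurable[OF SM_diff[OF v simple_in_SM[OF \<sigma>(1)]]] .
    note [measurable] = hM
    have "(\<lambda>k. \<integral>\<^sup>+m. min 1 (ennreal (snorm X (v n m - \<sigma> k m))) * h m \<partial>\<M>) \<longlonglongrightarrow> (\<integral>\<^sup>+m. 0 \<partial>\<M>)"
    proof (rule nn_integral_dominated_convergence[where w = h])
      show "AE m in \<M>. min 1 (ennreal (snorm X (v n m - \<sigma> k m))) * h m \<le> h m" for k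
        by (intro AE_I2) (metis min.cobounded1 mult_1 mult_right_mono zero_le)
      show "AE m in \<M>. (\<lambda>k. min 1 (ennreal (snorm X (v n m - \<sigma> k m))) * h m) \<longlonglongrightarrow> 0"
        using \<sigma>(2)
      proof eventually_elim
        case (elim m)
        have "(\<lambda>k. h m * min 1 (ennreal (snorm X (v n m - \<sigma> k m)))) \<longlonglongrightarrow> h m * min 1 (ennreal 0)"
          using elim h_pos(2)[of m]
          by (intro ennreal_tendsto_cmult tendsto_min tendsto_const tendsto_ennrealI) auto
        then show ?case
          by (simp add: mult.commute)
      qed
    qed (use h_int in auto)
    then have "\<forall>\<^sub>F k in sequentially.
        (\<integral>\<^sup>+m. min 1 (ennreal (snorm X (v n m - \<sigma> k m))) * h m \<partial>\<M>) < ennreal ((1/2) ^ n)"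
      by (intro order_tendstoD(2)) (auto simp: ennreal_zero_less_divide)
    then obtain k where "(\<integral>\<^sup>+m. min 1 (ennreal (snorm X (v n m - \<sigma> k m))) * h m \<partial>\<M>) < ennreal ((1/2) ^ n)"
      using eventually_happens' sequentially_bot by blast
    then show ?thesis
      using \<sigma>(1) by (intro exI[of _ "\<sigma> k"]) (simp add: less_imp_le)
  qed
  then obtain \<tau> where \<tau>: "!!n. simple_in (\<tau> n)"
      "!!n. (\<integral>\<^sup>+m. min 1 (ennreal (snorm X (v n m - \<tau> n m))) * h m \<partial>\<M>) \<le> ennreal ((1/2) ^ n)"
    by metis
  have [measurable]: "(\<lambda>m. snorm X (v n m - \<tau> n m)) \<in> borel_measurable \<M>" for n
    using SM_norm_measurable[OF SM_diff[OF v simple_in_SM[OF \<tau>(1)]]] .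
  note [measurable] = hM
  have "(\<integral>\<^sup>+m. (\<Sum>n. min 1 (ennreal (snorm X (v n m - \<tau> n m))) * h m) \<partial>\<M>)
      = (\<Sum>n. \<integral>\<^sup>+m. min 1 (ennreal (snorm X (v n m - \<tau> n m))) * h m \<partial>\<M>)"
    by (rule nn_integral_suminf) measurable
  also have "\<dots> \<le> (\<Sum>n. ennreal ((1/2) ^ n))"
    using \<tau>(2) by (intro suminf_le summableI) auto
  also have "\<dots> = ennreal (\<Sum>n. (1/2) ^ n)"
    by (rule suminf_ennreal_eq) (auto intro!: summable_sums summable_geometric)
  finally have "(\<integral>\<^sup>+m. (\<Sum>n. min 1 (ennreal (snorm X (v n m - \<tau> n m))) * h m) \<partial>\<M>) \<noteq> \<infinity>"
    by (auto simp: top_unique)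
  then have "AE m in \<M>. (\<Sum>n. min 1 (ennreal (snorm X (v n m - \<tau> n m))) * h m) \<noteq> \<infinity>"
    by (intro nn_integral_PInf_AE) measurable
  then have \<tau>_lim: "AE m in \<M>. (\<lambda>n. snorm X (v n m - \<tau> n m)) \<longlonglongrightarrow> 0"
    using nonneg vV
  proof eventually_elim
    case (elim m)
    define e where "e n = snorm X (v n m - \<tau> n m)" for n
    have e: "0 \<le> e n" for n
      using elim \<tau>(1) simple_in_carr by (auto simp: e_def intro!: N_nonneg)
    define d where "d = enn2real (h m)"
    have d: "h m = ennreal d" "0 < d"
      using h_pos[of m] by (auto simp: d_def enn2real_positive_iff)
    have "min 1 (ennreal (e n)) = ennreal (min 1 (e n))" for n
      using e[of n] by (cases "1 \<le> e n") (auto simp: min_def ennreal_le_1 ennreal_ge_1)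
    then have *: "min 1 (ennreal (e n)) * h m = ennreal (min 1 (e n) * d)" for n
      using e[of n] d by (simp add: ennreal_mult)
    have "(\<Sum>n. ennreal (min 1 (e n) * d)) \<noteq> top"
      using elim(1) unfolding e_def[symmetric] * infinity_ennreal_def .
    then have "summable (\<lambda>n. min 1 (e n) * d)"
      using e d by (intro summable_suminf_not_top) auto
    then have "(\<lambda>n. min 1 (e n) * d) \<longlonglongrightarrow> 0"
      by (rule summable_LIMSEQ_zero)
    then have "(\<lambda>n. min 1 (e n) * d * (1 / d)) \<longlonglongrightarrow> 0"
      by (rule tendsto_mult_left_zero)
    \<comment> \<open>Truncated distances that tend to 0 are eventually below 1, where the
      truncation has no effect.\<close>
    then have "(\<lambda>n. min 1 (e n)) \<longlonglongrightarrow> 0"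
      using d by simp
    then have min: "\<forall>\<^sub>F n in sequentially. min 1 (e n) < 1"
      by (rule order_tendstoD) simp
    have "e \<longlonglongrightarrow> 0"
      by (rule Lim_transform_eventually[OF \<open>(\<lambda>n. min 1 (e n)) \<longlonglongrightarrow> 0\<close>])
        (use min in \<open>auto elim!: eventually_mono simp: min_def split: if_splits\<close>)
    then show ?case
      by (simp add: e_def[abs_def])
  qed
  show ?thesis
    unfolding SM_iff
  proof (intro conjI exI allI)
    show "AE m in \<M>. (\<lambda>n. snorm X (w m - \<tau> n m)) \<longlonglongrightarrow> 0"
      using \<tau>_lim lim w nonneg vV
    proof eventually_elim
      case (elim m)
      have V: "\<tau> n m \<in> carr X" for n
        using \<tau>(1) simple_in_carr elim by blast
      have "(\<lambda>n. snorm X (v n m - w m) + snorm X (v n m - \<tau> n m)) \<longlonglongrightarrow> 0 + 0"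
        using elim by (intro tendsto_add)
      then show ?case
      proof (intro tendsto_0_seq_bound[where f = "\<lambda>n. snorm X (w m - \<tau> n m)"])
        show "snorm X (w m - \<tau> n m) \<le> snorm X (v n m - w m) + snorm X (v n m - \<tau> n m)" for n
          using N_diff_triangle[of "w m" "v n m" "\<tau> n m"] N_commute[of "w m" "v n m"] V elim by simp
      qed (use V elim N_nonneg in auto)
    qed
  qed (use w \<tau> in auto)
qed

end

definition sect :: "('a \<times> real \<Rightarrow> real) \<Rightarrow> real \<Rightarrow> 'a \<Rightarrow> real" where
  "sect u m = (\<lambda>x. u (x, m))"

lemma sect_add [simp]: "sect (u + v) m = sect u m + sect v m"
  and sect_diff [simp]: "sect (u - v) m = sect u m - sect v m"
  and sect_scale [simp]: "sect (c *\<^sub>R u) m = c *\<^sub>R sect u m"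
  and sect_zero [simp]: "sect 0 m = 0"
  and sect_apply: "sect u m x = u (x, m)"
  by (auto simp: sect_def fun_eq_iff)

context fibre_space
begin

lemma SM_scale:
  assumes v: "SM v" and \<phi>: "\<phi> \<in> borel_measurable \<M>"
  shows "SM (\<lambda>m. \<phi> m *\<^sub>R v m)"
proof -
  obtain \<sigma> where \<sigma>: "!!k. simple_in (\<sigma> k)" "AE m in \<M>. (\<lambda>k. snorm X (v m - \<sigma> k m)) \<longlonglongrightarrow> 0"
    using v by (auto simp: SM_iff)
  obtain s where s: "!!k. simple_function \<M> (s k)" "!!m. m \<in> space \<M> ==> (\<lambda>k. s k m) \<longlonglongrightarrow> \<phi> m"
    using borel_measurable_implies_sequence_metric[OF \<phi>, of 0] by blast
  have nonneg: "AE m in \<M>. 0 \<le> m"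
    by (rule AE_nonneg_mass)
  show ?thesis
    unfolding SM_iff
  proof (intro conjI exI allI)
    show "AE m in \<M>. \<phi> m *\<^sub>R v m \<in> carr X"
      using SM_carr[OF v] by eventually_elim auto
    show "simple_in (\<lambda>m. s k m *\<^sub>R \<sigma> k m)" for k
      using s(1)[of k] \<sigma>(1)[of k] unfolding simple_in_def image_subset_iff
      by (auto intro!: simple_function_compose2[of _ _ _ "(*\<^sub>R)"])
    show "AE m in \<M>. (\<lambda>k. snorm X (\<phi> m *\<^sub>R v m - s k m *\<^sub>R \<sigma> k m)) \<longlonglongrightarrow> 0"
      using \<sigma>(2) SM_carr[OF v] nonneg
    proof eventually_elim
      case (elim m)
      have V: "\<sigma> k m \<in> carr X" for k
        using simple_in_carr \<sigma> elim by blast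
      have sm: "(\<lambda>k. s k m) \<longlonglongrightarrow> \<phi> m"
        using s(2)[of m] elim by simp
      have "(\<lambda>k. \<bar>\<phi> m - s k m\<bar> * snorm X (v m) + \<bar>s k m\<bar> * snorm X (v m - \<sigma> k m))
          \<longlonglongrightarrow> \<bar>\<phi> m - \<phi> m\<bar> * snorm X (v m) + \<bar>\<phi> m\<bar> * 0"
        using sm elim by (intro tendsto_intros)
      then have lim: "(\<lambda>k. \<bar>\<phi> m - s k m\<bar> * snorm X (v m) + \<bar>s k m\<bar> * snorm X (v m - \<sigma> k m)) \<longlonglongrightarrow> 0"
        by simp
      have bound: "snorm X (\<phi> m *\<^sub>R v m - s k m *\<^sub>R \<sigma> k m)
          \<le> \<bar>\<phi> m - s k m\<bar> * snorm X (v m) + \<bar>s k m\<bar> * snorm X (v m - \<sigma> k m)" for k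
      proof -
        have "\<phi> m *\<^sub>R v m - s k m *\<^sub>R \<sigma> k m = (\<phi> m - s k m) *\<^sub>R v m + s k m *\<^sub>R (v m - \<sigma> k m)"
          by (simp add: algebra_simps)
        then show ?thesis
          using N_triangle[of "(\<phi> m - s k m) *\<^sub>R v m" "s k m *\<^sub>R (v m - \<sigma> k m)"] V elim
          by (simp only: N_scale V_diff V_scale)
      qed
      show ?case
        using bound V elim by (intro tendsto_0_seq_bound[OF lim N_nonneg]) auto
    qed
  qed
qed

end

section \<open>Bochner spaces with the weight 1 + m^r\<close>

locale bochner = fibre_space X \<Omega> for X :: "'a::euclidean_space fun_space" and \<Omega> :: "'a set" +
  fixes r :: real
  assumes r_nonneg: "0 \<le> r"
begin

definition w :: "real \<Rightarrow> real" where
  "w m = 1 + m powr r"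

abbreviation "BV \<equiv> bochner_carrier \<Omega> X r"

definition BN :: "('a \<times> real \<Rightarrow> real) \<Rightarrow> real" where
  "BN u = (\<integral>m. snorm X (sect u m) * w m \<partial>\<M>)"

definition BP :: "('a \<times> real \<Rightarrow> real) set" where
  "BP = {u \<in> BV. AE m in \<M>. sect u m \<in> cone X}"

lemma w_ge_1: "1 \<le> w m" and w_pos: "0 < w m"
  by (simp_all add: w_def add_pos_nonneg)

lemma w_measurable [measurable]: "w \<in> borel_measurable \<M>"
proof -
  have "w \<in> borel_measurable borel"
    unfolding w_def by measurable
  then show ?thesis
    by (intro measurable_restrict_space1 measurable_completion) simp
qed

lemma BV_iff: "u \<in> BV \<longleftrightarrow> u \<in> borel_measurable (lebesgue_on (\<Omega> \<times> {0..})) \<and> SM (sect u) \<and>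
    integrable \<M> (\<lambda>m. snorm X (sect u m) * w m)"
  by (auto simp: bochner_carrier_def SM_def w_def sect_def[abs_def])

lemma BV_SM: "u \<in> BV ==> SM (sect u)"
  and BV_int: "u \<in> BV ==> integrable \<M> (\<lambda>m. snorm X (sect u m) * w m)"
  and BV_meas: "u \<in> BV ==> u \<in> borel_measurable (lebesgue_on (\<Omega> \<times> {0..}))"
  by (auto simp: BV_iff)

lemma BV_sect: "u \<in> BV ==> AE m in \<M>. sect u m \<in> carr X"
  using SM_carr BV_SM by blast

lemma SM_norm [measurable]: "SM v ==> (\<lambda>m. snorm X (v m)) \<in> borel_measurable \<M>"
  by (rule SM_norm_measurable)

lemma BV_dominated:
  assumes meas: "u \<in> borel_measurable (lebesgue_on (\<Omega> \<times> {0..}))" and SM: "SM (sect u)"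
    and int: "integrable \<M> h" and le: "AE m in \<M>. snorm X (sect u m) * w m \<le> h m"
  shows "u \<in> BV"
proof -
  have [measurable]: "(\<lambda>m. snorm X (sect u m)) \<in> borel_measurable \<M>"
    by (rule SM_norm_measurable[OF SM])
  have "integrable \<M> (\<lambda>m. snorm X (sect u m) * w m)"
  proof (rule Bochner_Integration.integrable_bound[OF int])
    show "(\<lambda>m. snorm X (sect u m) * w m) \<in> borel_measurable \<M>"
      by measurable
    show "AE m in \<M>. norm (snorm X (sect u m) * w m) \<le> norm (h m)"
      using le SM_carr[OF SM]
    proof eventually_elim
      case (elim m)
      then have "0 \<le> snorm X (sect u m) * w m"
        using N_nonneg w_pos[of m] by simp
      with elim show ?case
        by simp
    qed
  qed
  then show ?thesis
    using meas SM by (simp add: BV_iff)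
qed

lemma BV_lin:
  assumes "u \<in> BV" "v \<in> BV"
  shows "c *\<^sub>R u + d *\<^sub>R v \<in> BV"
proof (rule BV_dominated)
  note [measurable] = BV_meas[OF assms(1)] BV_meas[OF assms(2)]
  show "c *\<^sub>R u + d *\<^sub>R v \<in> borel_measurable (lebesgue_on (\<Omega> \<times> {0..}))"
    unfolding plus_fun_def scaleR_fun_def by measurable
  show "SM (sect (c *\<^sub>R u + d *\<^sub>R v))"
    unfolding sect_add sect_scale by (rule SM_lin) (use assms BV_SM in auto)
  show "integrable \<M> (\<lambda>m. \<bar>c\<bar> * (snorm X (sect u m) * w m) + \<bar>d\<bar> * (snorm X (sect v m) * w m))"
    using assms BV_int by simp
  show "AE m in \<M>. snorm X (sect (c *\<^sub>R u + d *\<^sub>R v) m) * w m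
      \<le> \<bar>c\<bar> * (snorm X (sect u m) * w m) + \<bar>d\<bar> * (snorm X (sect v m) * w m)"
    using BV_sect[OF assms(1)] BV_sect[OF assms(2)]
  proof eventually_elim
    case (elim m)
    have "snorm X (sect (c *\<^sub>R u + d *\<^sub>R v) m) \<le> \<bar>c\<bar> * snorm X (sect u m) + \<bar>d\<bar> * snorm X (sect v m)"
      unfolding sect_add sect_scale using N_triangle[of "c *\<^sub>R sect u m" "d *\<^sub>R sect v m"] elim by (simp add: N_scale)
    from mult_right_mono[OF this, of "w m"] show ?case
      using w_pos[of m] by (simp add: algebra_simps)
  qed
qed

lemma BV_0: "0 \<in> BV"
proof (rule BV_dominated[where h = "\<lambda>_. 0"])
  have "SM (\<lambda>_. 0)"
    by (rule simple_in_SM) (simp add: simple_in_def image_subset_iff)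
  then show "SM (sect 0)"
    by (simp add: sect_zero[abs_def])
  show "0 \<in> borel_measurable (lebesgue_on (\<Omega> \<times> {0..}))"
    by (simp add: zero_fun_def)
qed simp_all

lemma norm_sect_nonneg: "u \<in> BV ==> AE m in \<M>. 0 \<le> snorm X (sect u m) * w m"
  by (rule eventually_mono[OF BV_sect]) (auto intro!: mult_nonneg_nonneg N_nonneg less_imp_le[OF w_pos])

lemma BN_nonneg: "u \<in> BV ==> 0 \<le> BN u"
  unfolding BN_def by (intro integral_nonneg_AE norm_sect_nonneg)

lemma BN_mono:
  assumes "u \<in> BV" "integrable \<M> h" "AE m in \<M>. snorm X (sect u m) * w m \<le> h m"
  shows "BN u \<le> integral\<^sup>L \<M> h"
  unfolding BN_def using assms BV_int by (intro integral_mono_AE)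

lemma BN_triangle:
  assumes "u \<in> BV" "v \<in> BV"
  shows "BN (u + v) \<le> BN u + BN v"
proof -
  have "BN (u + v) \<le> (\<integral>m. snorm X (sect u m) * w m + snorm X (sect v m) * w m \<partial>\<M>)"
  proof (rule BN_mono)
    show "u + v \<in> BV"
      using BV_lin[OF assms, of 1 1] by simp
    show "AE m in \<M>. snorm X (sect (u + v) m) * w m \<le> snorm X (sect u m) * w m + snorm X (sect v m) * w m"
      using BV_sect[OF assms(1)] BV_sect[OF assms(2)]
    proof eventually_elim
      case (elim m)
      have "snorm X (sect (u + v) m) \<le> snorm X (sect u m) + snorm X (sect v m)"
        unfolding sect_add using N_triangle elim by blast
      from mult_right_mono[OF this, of "w m"] show ?case
        using w_pos[of m] by (simp add: algebra_simps)
    qed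
  qed (use assms BV_int in simp)
  then show ?thesis
    using assms BV_int by (simp add: BN_def)
qed

lemma BN_scale:
  assumes "u \<in> BV"
  shows "BN (c *\<^sub>R u) = \<bar>c\<bar> * BN u"
proof -
  have cu: "c *\<^sub>R u \<in> BV"
    using BV_lin[OF assms BV_0, of c 0] by simp
  have "AE m in \<M>. snorm X (sect (c *\<^sub>R u) m) * w m = \<bar>c\<bar> * (snorm X (sect u m) * w m)"
    using BV_sect[OF assms]
  proof eventually_elim
    case (elim m)
    then show ?case
      unfolding sect_scale using N_scale[OF elim, of c] by simp
  qed
  then have "BN (c *\<^sub>R u) = (\<integral>m. \<bar>c\<bar> * (snorm X (sect u m) * w m) \<partial>\<M>)"
    unfolding BN_def using BV_int[OF cu] BV_int[OF assms] by (intro integral_cong_AE) auto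
  then show ?thesis
    by (simp add: BN_def)
qed

lemma BV_diff: "u \<in> BV ==> v \<in> BV ==> u - v \<in> BV"
  using BV_lin[of u v 1 "-1"] by simp

text \<open>The limit is taken pointwise, so that joint measurability is inherited.\<close>

lemma BV_complete:
  assumes f: "!!n::nat. f n \<in> BV" and summ: "summable (\<lambda>n. BN (f (Suc n) - f n))"
  shows "\<exists>g\<in>BV. (\<lambda>n. BN (f n - g)) \<longlonglongrightarrow> 0"
proof -
  define g where "g = (\<lambda>y. lim (\<lambda>n. f n y))"
  define d where "d n m = snorm X (sect (f (Suc n) - f n) m) * w m" for n m
  have dV: "f (Suc n) - f n \<in> BV" for n
    using BV_diff f by blast
  have d_int: "integrable \<M> (d n)" for n
    unfolding d_def by (rule BV_int[OF dV])
  have d_nonneg: "AE m in \<M>. 0 \<le> d n m" for n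
    unfolding d_def by (rule norm_sect_nonneg[OF dV])
  have BNd: "BN (f (Suc n) - f n) = (\<integral>m. d n m \<partial>\<M>)" for n
    by (simp add: BN_def d_def)
  note [measurable] = borel_measurable_integrable[OF d_int]
  have "(\<integral>\<^sup>+m. (\<Sum>n. ennreal (d n m)) \<partial>\<M>) = (\<Sum>n. \<integral>\<^sup>+m. ennreal (d n m) \<partial>\<M>)"
    by (rule nn_integral_suminf) measurable
  also have "\<dots> = (\<Sum>n. ennreal (BN (f (Suc n) - f n)))"
    unfolding BNd using d_int d_nonneg by (simp add: nn_integral_eq_integral)
  also have "\<dots> \<noteq> top"
    using summ BN_nonneg[OF dV] by (intro ennreal_suminf_neq_top)
  finally have "AE m in \<M>. (\<Sum>n. ennreal (d n m)) \<noteq> \<infinity>"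
    by (intro nn_integral_PInf_AE) auto
  moreover have "AE m in \<M>. \<forall>n. 0 \<le> d n m"
    using d_nonneg by (simp add: AE_all_countable)
  ultimately have d_summable: "AE m in \<M>. summable (\<lambda>n. d n m)"
    by eventually_elim (rule summable_suminf_not_top, auto)
  have fX: "AE m in \<M>. \<forall>n. sect (f n) m \<in> carr X"
    using BV_sect[OF f] by (simp add: AE_all_countable)
  have conv: "AE m in \<M>. sect g m \<in> carr X \<and> (\<lambda>n. snorm X (sect (f n) m - sect g m)) \<longlonglongrightarrow> 0"
    using d_summable fX
  proof eventually_elim
    case (elim m)
    have "summable (\<lambda>n. snorm X (sect (f (Suc n)) m - sect (f n) m))"
    proof (rule summable_comparison_test'[OF elim(1)])
      fix n
      have "0 \<le> snorm X (sect (f (Suc n)) m - sect (f n) m)"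
        using elim by (intro N_nonneg) auto
      then show "norm (snorm X (sect (f (Suc n)) m - sect (f n) m)) \<le> d n m"
        using w_ge_1[of m] mult_left_mono[of 1 "w m"] by (fastforce simp: d_def)
    qed
    from complete_lim[OF _ this] show ?case
      using elim by (simp add: g_def sect_def)
  qed
  have g_meas: "g \<in> borel_measurable (lebesgue_on (\<Omega> \<times> {0..}))"
    unfolding g_def by (rule borel_measurable_lim_metric) (rule BV_meas[OF f])
  have g_SM: "SM (sect g)"
    by (rule SM_limit[OF BV_SM[OF f]]) (use conv in \<open>auto elim: eventually_mono\<close>)
  have S_int: "integrable \<M> (\<lambda>m. \<Sum>n. d n m)"
  proof (rule integrable_suminf[OF d_int])
    show "AE m in \<M>. summable (\<lambda>n. norm (d n m))"
      using d_summable \<open>AE m in \<M>. \<forall>n. 0 \<le> d n m\<close> by eventually_elim simp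
    have "(\<integral>m. norm (d n m) \<partial>\<M>) = BN (f (Suc n) - f n)" for n
      unfolding BNd using d_nonneg[of n] d_int[of n] by (intro integral_cong_AE) (auto elim: eventually_mono)
    then show "summable (\<lambda>n. \<integral>m. norm (d n m) \<partial>\<M>)"
      using summ by simp
  qed
  \<comment> \<open>The sum of all increments dominates every error \<open>f n - g\<close> at once;
    its integrability places the errors in the space and supplies the dominating function for their
    convergence.\<close>
  have tail: "AE m in \<M>. \<forall>n. snorm X (sect (f n) m - sect g m) * w m \<le> (\<Sum>n. d n m)"
    using d_summable fX conv \<open>AE m in \<M>. \<forall>n. 0 \<le> d n m\<close>
  proof eventually_elim
    case (elim m)
    show ?case
    proof
      fix n :: nat
      have partial: "snorm X (sect (f n) m - sect (f (n + k)) m) * w m \<le> (\<Sum>j=n..<n + k. d j m)" for k :: nat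
      proof (induction k)
        case (Suc k)
        have "snorm X (sect (f n) m - sect (f (n + Suc k)) m)
            \<le> snorm X (sect (f n) m - sect (f (n + k)) m) + snorm X (sect (f (Suc (n + k))) m - sect (f (n + k)) m)"
          using N_diff_triangle[of "sect (f n) m" "sect (f (n + k)) m" "sect (f (n + Suc k)) m"]
            N_commute[of "sect (f (n + k)) m" "sect (f (n + Suc k)) m"] elim by simp
        from mult_right_mono[OF this, of "w m"]
        have "snorm X (sect (f n) m - sect (f (n + Suc k)) m) * w m
            \<le> snorm X (sect (f n) m - sect (f (n + k)) m) * w m + d (n + k) m"
          unfolding d_def sect_diff distrib_right using w_pos[of m] by simp
        moreover have "(\<Sum>j=n..<n + Suc k. d j m) = (\<Sum>j=n..<n + k. d j m) + d (n + k) m"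
          by simp
        ultimately show ?case
          using Suc unfolding fun_diff_def by linarith
      qed (use N_zero in \<open>simp add: zero_fun_def\<close>)
      have "(\<lambda>k. snorm X (sect (f (n + k)) m - sect g m) * w m) \<longlonglongrightarrow> 0 * w m"
        using elim LIMSEQ_ignore_initial_segment[of "\<lambda>n. snorm X (sect (f n) m - sect g m)" 0 n]
        by (intro tendsto_intros) (simp add: add.commute)
      then have lim: "(\<lambda>k. (\<Sum>n. d n m) + snorm X (sect (f (n + k)) m - sect g m) * w m) \<longlonglongrightarrow> (\<Sum>n. d n m) + 0"
        by (intro tendsto_intros) simp
      have "snorm X (sect (f n) m - sect g m) * w m
          \<le> (\<Sum>n. d n m) + snorm X (sect (f (n + k)) m - sect g m) * w m" for k
      proof -
        have "snorm X (sect (f n) m - sect g m)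
            \<le> snorm X (sect (f n) m - sect (f (n + k)) m) + snorm X (sect (f (n + k)) m - sect g m)"
          using elim by (intro N_diff_triangle) auto
        from mult_right_mono[OF this, of "w m"] have "snorm X (sect (f n) m - sect g m) * w m
            \<le> snorm X (sect (f n) m - sect (f (n + k)) m) * w m + snorm X (sect (f (n + k)) m - sect g m) * w m"
          using w_pos[of m] by (simp add: algebra_simps)
        moreover have "(\<Sum>j=n..<n + k. d j m) \<le> (\<Sum>n. d n m)"
          using elim by (intro sum_le_suminf) auto
        ultimately show ?thesis
          using partial[of k] by simp
      qed
      then show "snorm X (sect (f n) m - sect g m) * w m \<le> (\<Sum>n. d n m)"
        using LIMSEQ_le_const[OF lim] by simp
    qed
  qed
  have fg_SM: "SM (sect (f n - g))" for n
    unfolding sect_diff by (rule SM_diff[OF BV_SM[OF f] g_SM])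
  have fg: "f n - g \<in> BV" for n
  proof (rule BV_dominated[OF _ fg_SM S_int])
    note [measurable] = BV_meas[OF f] g_meas
    show "f n - g \<in> borel_measurable (lebesgue_on (\<Omega> \<times> {0..}))"
      unfolding fun_diff_def by measurable
    show "AE m in \<M>. snorm X (sect (f n - g) m) * w m \<le> (\<Sum>n. d n m)"
      using tail by eventually_elim simp
  qed
  \<comment> \<open>g is f 0 minus the error f 0 - g, and both lie in the space.\<close>
  have gV: "g \<in> BV"
    using BV_diff[OF f fg, of 0 0] by simp
  have "(\<lambda>n. \<integral>m. snorm X (sect (f n - g) m) * w m \<partial>\<M>) \<longlonglongrightarrow> (\<integral>m. 0 \<partial>\<M>)"
  proof (rule integral_dominated_convergence[OF _ _ S_int])
    note [measurable] = SM_norm_measurable[OF fg_SM]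
    show "(\<lambda>m. snorm X (sect (f n - g) m) * w m) \<in> borel_measurable \<M>" for n
      by measurable
    show "AE m in \<M>. (\<lambda>n. snorm X (sect (f n - g) m) * w m) \<longlonglongrightarrow> 0"
      using conv by eventually_elim (auto intro: tendsto_mult_left_zero)
    show "AE m in \<M>. norm (snorm X (sect (f n - g) m) * w m) \<le> (\<Sum>n. d n m)" for n
      using tail SM_carr[OF fg_SM[of n]]
    proof eventually_elim
      case (elim m)
      then have "0 \<le> snorm X (sect (f n - g) m) * w m"
        using N_nonneg w_pos[of m] by simp
      with elim(1) show ?case
        by simp
    qed
  qed simp
  then show ?thesis
    using gV by (intro bexI[of _ g]) (simp_all add: BN_def)
qed

text \<open>Serves the closedness of the cone: along a subsequence the fibres converge at almost
  every mass, where the fibre cone is closed.\<close>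

lemma BN_AE_subsequence:
  assumes f: "!!n::nat. f n \<in> BV" and g: "g \<in> BV" and lim: "(\<lambda>n. BN (f n - g)) \<longlonglongrightarrow> 0"
  obtains \<phi> where "strict_mono \<phi>" "AE m in \<M>. (\<lambda>n. snorm X (sect (f (\<phi> n)) m - sect g m)) \<longlonglongrightarrow> 0"
proof -
  define e where "e n m = snorm X (sect (f n - g) m) * w m" for n m
  have V: "f n - g \<in> BV" for n
    using BV_diff f g by blast
  have int: "integrable \<M> (e n)" for n
    unfolding e_def by (rule BV_int[OF V])
  have nonneg: "AE m in \<M>. 0 \<le> e n m" for n
    unfolding e_def by (rule norm_sect_nonneg[OF V])
  have "(\<integral>m. norm (e n m) \<partial>\<M>) = BN (f n - g)" for n
  proof -
    have "(\<integral>m. norm (e n m) \<partial>\<M>) = (\<integral>m. e n m \<partial>\<M>)"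
      using nonneg[of n] int[of n] by (intro integral_cong_AE) (auto elim: eventually_mono)
    then show ?thesis
      by (simp add: BN_def e_def)
  qed
  then obtain \<phi> where \<phi>: "strict_mono \<phi>" "AE m in \<M>. (\<lambda>n. e (\<phi> n) m) \<longlonglongrightarrow> 0"
    using tendsto_L1_AE_subseq[of \<M> e, OF int] lim by auto
  have "AE m in \<M>. (\<lambda>n. snorm X (sect (f (\<phi> n)) m - sect g m)) \<longlonglongrightarrow> 0"
    using \<phi>(2)
  proof eventually_elim
    case (elim m)
    have "(\<lambda>n. e (\<phi> n) m * (1 / w m)) \<longlonglongrightarrow> 0"
      using elim by (rule tendsto_mult_left_zero)
    then show ?case
      using w_pos[of m] by (simp add: e_def)
  qed
  then show thesis
    using that \<phi>(1) by blast
qed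

sublocale B: ordered_seminormed BV BN BP
proof
  show "subspace BV"
    unfolding subspace_def using BV_0 BV_lin[of _ _ 1 1] BV_lin[OF _ BV_0, of _ _ 0] by auto
  show "BP \<subseteq> BV"
    by (auto simp: BP_def)
  show "0 \<in> BP"
    unfolding BP_def sect_zero using BV_0 P_zero by simp
  show "u + v \<in> BP" if "u \<in> BP" "v \<in> BP" for u v
  proof -
    have "AE m in \<M>. sect u m \<in> cone X" "AE m in \<M>. sect v m \<in> cone X"
      using that by (auto simp: BP_def)
    then have "AE m in \<M>. sect (u + v) m \<in> cone X"
      unfolding sect_add by eventually_elim (rule P_add)
    then show ?thesis
      using that BV_lin[of u v 1 1] by (simp add: BP_def)
  qed
  show "c *\<^sub>R u \<in> BP" if "u \<in> BP" "0 \<le> c" for u c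
  proof -
    have "AE m in \<M>. sect u m \<in> cone X"
      using that by (auto simp: BP_def)
    then have "AE m in \<M>. sect (c *\<^sub>R u) m \<in> cone X"
      unfolding sect_scale by eventually_elim (rule P_scale[OF _ that(2)])
    then show ?thesis
      using that BV_lin[OF _ BV_0, of u c 0] by (simp add: BP_def)
  qed
  show "g \<in> BP" if f: "!!n::nat. f n \<in> BP" and g: "g \<in> BV" and lim: "(\<lambda>n. BN (f n - g)) \<longlonglongrightarrow> 0" for f g
  proof -
    have fV: "f n \<in> BV" for n
      using f by (auto simp: BP_def)
    obtain \<phi> where \<phi>: "AE m in \<M>. (\<lambda>n. snorm X (sect (f (\<phi> n)) m - sect g m)) \<longlonglongrightarrow> 0"
      using BN_AE_subsequence[OF fV g lim] by blast
    have "AE m in \<M>. sect (f (\<phi> n)) m \<in> cone X" for n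
      using f by (auto simp: BP_def)
    then have "AE m in \<M>. \<forall>n. sect (f (\<phi> n)) m \<in> cone X"
      by (simp add: AE_all_countable)
    then have "AE m in \<M>. sect g m \<in> cone X"
      using \<phi> BV_sect[OF g]
    proof eventually_elim
      case (elim m)
      show ?case
        by (rule P_closed[of "\<lambda>n. sect (f (\<phi> n)) m"]) (use elim in auto)
    qed
    then show ?thesis
      using g by (simp add: BP_def)
  qed
qed (use BN_nonneg BN_triangle BN_scale BV_complete in auto)

lemma BV_mult:
  assumes u: "u \<in> BV" and \<phi>: "\<phi> \<in> borel_measurable \<M>"
    and int: "integrable \<M> h" and le: "AE m in \<M>. \<bar>\<phi> m\<bar> * (snorm X (sect u m) * w m) \<le> h m"
  shows "(\<lambda>y. \<phi> (snd y) * u y) \<in> BV"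
proof (rule BV_dominated[OF _ _ int])
  have [measurable]: "(\<lambda>y. \<phi> (snd y)) \<in> borel_measurable (lebesgue_on (\<Omega> \<times> {0..}))"
    by (rule measurable_lebesgue_on_snd[OF _ _ \<phi>]) auto
  note [measurable] = BV_meas[OF u]
  show "(\<lambda>y. \<phi> (snd y) * u y) \<in> borel_measurable (lebesgue_on (\<Omega> \<times> {0..}))"
    by measurable
  have eq: "sect (\<lambda>y. \<phi> (snd y) * u y) m = \<phi> m *\<^sub>R sect u m" for m
    by (simp add: sect_def fun_eq_iff)
  show "SM (sect (\<lambda>y. \<phi> (snd y) * u y))"
    unfolding eq[abs_def] by (rule SM_scale[OF BV_SM[OF u] \<phi>])
  show "AE m in \<M>. snorm X (sect (\<lambda>y. \<phi> (snd y) * u y) m) * w m \<le> h m"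
    using le BV_sect[OF u]
  proof eventually_elim
    case (elim m)
    then show ?case
      unfolding eq N_scale[OF elim(2)] by (simp only: mult.assoc)
  qed
qed

section \<open>The cutoff at mass n\<close>

definition Q :: "nat \<Rightarrow> ('a \<times> real \<Rightarrow> real) \<Rightarrow> 'a \<times> real \<Rightarrow> real" where
  "Q n u = (\<lambda>y. indicator {..real n} (snd y) * u y)"

lemma sect_Q: "sect (Q n u) m = (if m \<le> n then sect u m else 0)"
  by (auto simp: Q_def sect_def fun_eq_iff indicator_def)

lemma Q_lin: "Q n (c *\<^sub>R u + d *\<^sub>R v) = c *\<^sub>R Q n u + d *\<^sub>R Q n v"
  by (auto simp: Q_def fun_eq_iff algebra_simps)

lemma Q_idem: "Q n (Q n u) = Q n u"
  by (auto simp: Q_def fun_eq_iff indicator_def)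

lemma cutoff_measurable: "indicator {..real n} \<in> borel_measurable \<M>"
  by (intro measurable_restrict_space1 measurable_completion) simp

lemma Q_sect_le: "sect u m \<in> carr X ==> snorm X (sect (Q n u) m) * w m \<le> snorm X (sect u m) * w m"
  using N_nonneg[of "sect u m"] w_pos[of m] by (simp add: sect_Q)

lemma Q_BV:
  assumes "u \<in> BV"
  shows "Q n u \<in> BV"
  unfolding Q_def
proof (rule BV_mult[OF assms cutoff_measurable BV_int[OF assms]])
  show "AE m in \<M>. \<bar>indicator {..real n} m\<bar> * (snorm X (sect u m) * w m) \<le> snorm X (sect u m) * w m"
    using BV_sect[OF assms]
  proof eventually_elim
    case (elim m)
    then show ?case
      using N_nonneg[OF elim] w_pos[of m] by (simp add: indicator_def)
  qed
qed

lemma Q_le: "u \<in> BV ==> BN (Q n u) \<le> BN u"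
  unfolding BN_def[of u]
  by (intro BN_mono Q_BV BV_int) (auto intro: eventually_mono[OF BV_sect] Q_sect_le)

lemma Q_lim:
  assumes u: "u \<in> BV"
  shows "(\<lambda>n. BN (Q n u - u)) \<longlonglongrightarrow> 0"
proof -
  have V: "Q n u - u \<in> BV" for n
    using Q_BV u BV_diff by blast
  have eq: "sect (Q n u - u) m = (if m \<le> n then 0 else - sect u m)" for n m
    unfolding sect_diff sect_Q by simp
  have "(\<lambda>n. \<integral>m. snorm X (sect (Q n u - u) m) * w m \<partial>\<M>) \<longlonglongrightarrow> (\<integral>m. 0 \<partial>\<M>)"
  proof (rule integral_dominated_convergence[OF _ _ BV_int[OF u]])
    show "(\<lambda>m. snorm X (sect (Q n u - u) m) * w m) \<in> borel_measurable \<M>" for n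
      using BV_int[OF V] by simp
    show "AE m in \<M>. (\<lambda>n. snorm X (sect (Q n u - u) m) * w m) \<longlonglongrightarrow> 0"
    proof (rule AE_I2, rule tendsto_eventually)
      fix m
      show "\<forall>\<^sub>F n in sequentially. snorm X (sect (Q n u - u) m) * w m = 0"
        unfolding eq using eventually_ge_at_top[of "nat \<lceil>m\<rceil>"]
        by eventually_elim (auto simp: nat_le_iff ceiling_le_iff)
    qed
    show "AE m in \<M>. norm (snorm X (sect (Q n u - u) m) * w m) \<le> snorm X (sect u m) * w m" for n
      using BV_sect[OF u]
    proof eventually_elim
      case (elim m)
      then show ?case
        unfolding eq using N_nonneg[OF elim] w_pos[of m] by simp
    qed
  qed simp
  then show ?thesis
    by (simp add: BN_def)
qed

lemma Q_BP:
  assumes "u \<in> BP"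
  shows "Q n u \<in> BP"
proof -
  have "AE m in \<M>. sect u m \<in> cone X"
    using assms by (auto simp: BP_def)
  then have "AE m in \<M>. sect (Q n u) m \<in> cone X"
    by eventually_elim (simp add: sect_Q P_zero)
  then show ?thesis
    using assms Q_BV by (auto simp: BP_def)
qed

end

section \<open>Transport with a loss term\<close>

text \<open>\<open>gen_G\<close> expresses that the generator acts mass by mass.
  \<open>c_mult\<close> is an assumption because pointwise bounds on c do not make multiplication by
  c preserve a space of continuous functions.\<close>

locale transport_loss = bochner X \<Omega> r
  for X :: "'a::euclidean_space fun_space" and \<Omega> :: "'a set" and r :: real +
  fixes F :: "real \<Rightarrow> real \<Rightarrow> ('a \<Rightarrow> real) \<Rightarrow> 'a \<Rightarrow> real"
    and G :: "real \<Rightarrow> ('a \<times> real \<Rightarrow> real) \<Rightarrow> 'a \<times> real \<Rightarrow> real"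
    and c :: "'a \<times> real \<Rightarrow> real" and \<alpha>\<^sub>1 \<alpha>\<^sub>2 :: "real \<Rightarrow> real" and M :: real
  assumes F_contraction: "0 \<le> m ==> contraction_sg (F m)"
    and G_contraction: "B.contraction_sg G"
    and G_pos: "0 \<le> t ==> u \<in> BP ==> G t u \<in> BP"
    and gen_G: "B.gen G = {(u, v). u \<in> BV \<and> v \<in> BV \<and> (AE m in \<M>. (sect u m, sect v m) \<in> gen (F m))}"
    and \<alpha>_measurable: "\<alpha>\<^sub>1 \<in> borel_measurable \<M>" "\<alpha>\<^sub>2 \<in> borel_measurable \<M>"
    and \<alpha>_bounds: "AE m in \<M>. 0 \<le> \<alpha>\<^sub>1 m \<and> \<alpha>\<^sub>1 m \<le> \<alpha>\<^sub>2 m \<and> \<alpha>\<^sub>2 m \<le> M * \<alpha>\<^sub>1 m"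
    and c_bounds: "AE m in \<M>. AE x in lebesgue_on \<Omega>. \<alpha>\<^sub>1 m \<le> c (x, m) \<and> c (x, m) \<le> \<alpha>\<^sub>2 m"
    and \<alpha>_local: "\<exists>C. AE m in \<M>. m \<le> real n --> \<alpha>\<^sub>2 m \<le> C"
    and c_mult: "u \<in> BV ==> (\<lambda>y. c y * Q n u y) \<in> BV"
    and M_nonneg: "0 \<le> M"
begin

sublocale G: contraction_semigroup BV BN BP G
  by unfold_locales (rule G_contraction)

definition C :: "('a \<times> real \<Rightarrow> real) \<Rightarrow> 'a \<times> real \<Rightarrow> real" where
  "C u = (\<lambda>y. c y * u y)"

definition DC :: "('a \<times> real \<Rightarrow> real) set" where
  "DC = {u \<in> BV. C u \<in> BV}"

definition L :: "('a \<times> real \<Rightarrow> real) \<Rightarrow> real" where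
  "L u = (\<integral>m. \<alpha>\<^sub>1 m * (snorm X (sect u m) * w m) \<partial>\<M>)"

definition cb :: "nat \<Rightarrow> real" where
  "cb n = (SOME d. 0 \<le> d \<and> (AE m in \<M>. m \<le> real n --> \<alpha>\<^sub>2 m \<le> d))"

lemma cb: "0 \<le> cb n" "AE m in \<M>. m \<le> real n --> \<alpha>\<^sub>2 m \<le> cb n"
proof -
  obtain d where d: "AE m in \<M>. m \<le> real n --> \<alpha>\<^sub>2 m \<le> d"
    using \<alpha>_local by blast
  have "0 \<le> max 0 d \<and> (AE m in \<M>. m \<le> real n --> \<alpha>\<^sub>2 m \<le> max 0 d)"
    using d by (auto elim!: eventually_mono)
  from someI[of "\<lambda>d. 0 \<le> d \<and> (AE m in \<M>. m \<le> real n --> \<alpha>\<^sub>2 m \<le> d)", OF this]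
  show "0 \<le> cb n" "AE m in \<M>. m \<le> real n --> \<alpha>\<^sub>2 m \<le> cb n"
    unfolding cb_def by blast+
qed

lemma C_lin: "C (x *\<^sub>R u + y *\<^sub>R v) = x *\<^sub>R C u + y *\<^sub>R C v"
  by (simp add: C_def fun_eq_iff algebra_simps)

lemma Q_C: "Q n (C u) = C (Q n u)"
  by (simp add: C_def Q_def fun_eq_iff)

lemma DC_D: "u \<in> DC ==> u \<in> BV" "u \<in> DC ==> C u \<in> BV"
  by (auto simp: DC_def)

lemma Q_DC: "u \<in> BV ==> Q n u \<in> DC"
  using Q_BV c_mult by (simp add: DC_def C_def)

lemma sect_C: "sect (C u) m x = c (x, m) * sect u m x"
  by (simp add: C_def sect_def)

text \<open>Pointwise comparisons at fixed mass. In the third, 0 \<le> d - c \<le> d -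
  \<open>\<alpha>\<^sub>1\<close> because c \<le> \<open>\<alpha>\<^sub>2\<close> \<le> d; it keeps
  track of the smallest loss without any additivity of the norm.\<close>

lemma section_bounds:
  assumes "u \<in> DC"
  shows "AE m in \<M>. \<alpha>\<^sub>1 m * snorm X (sect u m) \<le> snorm X (sect (C u) m)"
    "AE m in \<M>. snorm X (sect (C u) m) \<le> \<alpha>\<^sub>2 m * snorm X (sect u m)"
    "AE m in \<M>. \<forall>d\<ge>\<alpha>\<^sub>2 m. snorm X (d *\<^sub>R sect u m - sect (C u) m) \<le> (d - \<alpha>\<^sub>1 m) * snorm X (sect u m)"
proof -
  note S = BV_sect[OF DC_D(1)[OF assms]] BV_sect[OF DC_D(2)[OF assms]] \<alpha>_bounds c_bounds
  show "AE m in \<M>. \<alpha>\<^sub>1 m * snorm X (sect u m) \<le> snorm X (sect (C u) m)"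
    using S
  proof eventually_elim
    case (elim m)
    have "snorm X (\<alpha>\<^sub>1 m *\<^sub>R sect u m) \<le> 1 * snorm X (sect (C u) m)"
    proof (rule snorm_bound)
      show "AE x in lebesgue_on \<Omega>. \<bar>(\<alpha>\<^sub>1 m *\<^sub>R sect u m) x\<bar> \<le> 1 * \<bar>sect (C u) m x\<bar>"
        using elim(4)
      proof eventually_elim
        case (elim x)
        with \<open>0 \<le> \<alpha>\<^sub>1 m \<and> _\<close> show ?case
          by (simp add: sect_C abs_mult mult_right_mono)
      qed
    qed (use elim in auto)
    then show ?case
      using elim by (simp add: N_scale)
  qed
  show "AE m in \<M>. snorm X (sect (C u) m) \<le> \<alpha>\<^sub>2 m * snorm X (sect u m)"
    using S
  proof eventually_elim
    case (elim m)
    show ?case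
    proof (rule snorm_bound)
      show "AE x in lebesgue_on \<Omega>. \<bar>sect (C u) m x\<bar> \<le> \<alpha>\<^sub>2 m * \<bar>sect u m x\<bar>"
        using elim(4)
      proof eventually_elim
        case (elim x)
        with \<open>0 \<le> \<alpha>\<^sub>1 m \<and> _\<close> show ?case
          by (simp add: sect_C abs_mult mult_right_mono)
      qed
    qed (use elim in auto)
  qed
  show "AE m in \<M>. \<forall>d\<ge>\<alpha>\<^sub>2 m. snorm X (d *\<^sub>R sect u m - sect (C u) m) \<le> (d - \<alpha>\<^sub>1 m) * snorm X (sect u m)"
    using S
  proof eventually_elim
    case (elim m)
    show ?case
    proof (intro allI impI)
      fix d
      assume d: "\<alpha>\<^sub>2 m \<le> d"
      show "snorm X (d *\<^sub>R sect u m - sect (C u) m) \<le> (d - \<alpha>\<^sub>1 m) * snorm X (sect u m)"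
      proof (rule snorm_bound)
        show "AE x in lebesgue_on \<Omega>. \<bar>(d *\<^sub>R sect u m - sect (C u) m) x\<bar> \<le> (d - \<alpha>\<^sub>1 m) * \<bar>sect u m x\<bar>"
          using elim(4)
        proof eventually_elim
          case (elim x)
          have "(d *\<^sub>R sect u m - sect (C u) m) x = (d - c (x, m)) * sect u m x"
            by (simp add: sect_C algebra_simps)
          moreover have "\<bar>d - c (x, m)\<bar> \<le> d - \<alpha>\<^sub>1 m"
            using elim d by simp
          ultimately show ?case
            by (simp add: abs_mult mult_right_mono)
        qed
      qed (use elim d in auto)
    qed
  qed
qed

lemma L_integrable:
  assumes "u \<in> DC"
  shows "integrable \<M> (\<lambda>m. \<alpha>\<^sub>1 m * (snorm X (sect u m) * w m))"
proof (rule Bochner_Integration.integrable_bound[OF BV_int[OF DC_D(2)[OF assms]]])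
  note [measurable] = \<alpha>_measurable SM_norm_measurable[OF BV_SM[OF DC_D(1)[OF assms]]]
  show "(\<lambda>m. \<alpha>\<^sub>1 m * (snorm X (sect u m) * w m)) \<in> borel_measurable \<M>"
    by measurable
  show "AE m in \<M>. norm (\<alpha>\<^sub>1 m * (snorm X (sect u m) * w m)) \<le> norm (snorm X (sect (C u) m) * w m)"
    using section_bounds(1)[OF assms] \<alpha>_bounds norm_sect_nonneg[OF DC_D(1)[OF assms]]
  proof eventually_elim
    case (elim m)
    have "\<alpha>\<^sub>1 m * snorm X (sect u m) * w m \<le> snorm X (sect (C u) m) * w m"
      using mult_right_mono[OF elim(1), of "w m"] w_pos[of m] by simp
    then show ?case
      using elim by (simp add: mult.assoc)
  qed
qed

lemma L_nonneg: "u \<in> DC ==> 0 \<le> L u"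
  unfolding L_def
proof (rule integral_nonneg_AE)
  assume "u \<in> DC"
  from \<alpha>_bounds norm_sect_nonneg[OF DC_D(1)[OF this]]
  show "AE m in \<M>. 0 \<le> \<alpha>\<^sub>1 m * (snorm X (sect u m) * w m)"
    by eventually_elim simp
qed

lemma C_le:
  assumes "u \<in> DC"
  shows "BN (C u) \<le> M * L u"
proof -
  have "BN (C u) \<le> (\<integral>m. M * (\<alpha>\<^sub>1 m * (snorm X (sect u m) * w m)) \<partial>\<M>)"
  proof (rule BN_mono)
    show "AE m in \<M>. snorm X (sect (C u) m) * w m \<le> M * (\<alpha>\<^sub>1 m * (snorm X (sect u m) * w m))"
      using section_bounds(2)[OF assms] \<alpha>_bounds norm_sect_nonneg[OF DC_D(1)[OF assms]]
    proof eventually_elim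
      case (elim m)
      have "snorm X (sect (C u) m) * w m \<le> \<alpha>\<^sub>2 m * snorm X (sect u m) * w m"
        using mult_right_mono[OF elim(1), of "w m"] w_pos[of m] by simp
      also have "\<dots> \<le> M * \<alpha>\<^sub>1 m * (snorm X (sect u m) * w m)"
        unfolding mult.assoc[of "\<alpha>\<^sub>2 m"] using elim by (intro mult_right_mono) auto
      finally show ?case
        by (simp add: mult.assoc)
    qed
  qed (use DC_D[OF assms] L_integrable[OF assms] in auto)
  then show ?thesis
    by (simp add: L_def)
qed

lemma cutoff_bounds:
  assumes "u \<in> BV"
  shows "AE m in \<M>. snorm X (cb n *\<^sub>R sect (Q n u) m - sect (C (Q n u)) m)
      \<le> (cb n - \<alpha>\<^sub>1 m) * snorm X (sect (Q n u) m)"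
    "AE m in \<M>. snorm X (sect (C (Q n u)) m) \<le> cb n * snorm X (sect u m)"
proof -
  note D = Q_DC[OF assms, of n]
  have 0: "sect (C (Q n u)) m = 0" "sect (Q n u) m = 0" if "real n < m" for m
    using that by (auto simp: fun_eq_iff sect_C sect_Q)
  show "AE m in \<M>. snorm X (cb n *\<^sub>R sect (Q n u) m - sect (C (Q n u)) m)
      \<le> (cb n - \<alpha>\<^sub>1 m) * snorm X (sect (Q n u) m)"
    using section_bounds(3)[OF D] cb(2)[of n]
  proof eventually_elim
    case (elim m)
    then show ?case
      using 0[of m] by (cases "m \<le> real n") auto
  qed
  show "AE m in \<M>. snorm X (sect (C (Q n u)) m) \<le> cb n * snorm X (sect u m)"
    using section_bounds(2)[OF D] cb(2)[of n] BV_sect[OF assms]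
  proof eventually_elim
    case (elim m)
    show ?case
    proof (cases "m \<le> real n")
      case True
      then have "\<alpha>\<^sub>2 m * snorm X (sect (Q n u) m) \<le> cb n * snorm X (sect u m)"
        using elim N_nonneg[of "sect u m"] by (auto simp: sect_Q intro!: mult_right_mono)
      with elim(1) show ?thesis
        by simp
    next
      case False
      then show ?thesis
        using 0[of m] cb(1)[of n] N_nonneg[OF elim(3)] by simp
    qed
  qed
qed

text \<open>The fibre bound with d = cb n, integrated over the masses. The amount L by which it
  stays below cb n times the norm makes room for the gain in the fixed point argument.\<close>

lemma C_loss:
  assumes "u \<in> BV"
  shows "BN (cb n *\<^sub>R Q n u - C (Q n u)) + L (Q n u) \<le> cb n * BN (Q n u)"
proof -
  note D = Q_DC[OF assms, of n]
  have "BN (cb n *\<^sub>R Q n u - C (Q n u))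
      \<le> (\<integral>m. cb n * (snorm X (sect (Q n u) m) * w m) - \<alpha>\<^sub>1 m * (snorm X (sect (Q n u) m) * w m) \<partial>\<M>)"
  proof (rule BN_mono)
    show "cb n *\<^sub>R Q n u - C (Q n u) \<in> BV"
      using DC_D[OF D] by simp
    show "integrable \<M> (\<lambda>m. cb n * (snorm X (sect (Q n u) m) * w m) - \<alpha>\<^sub>1 m * (snorm X (sect (Q n u) m) * w m))"
      using BV_int[OF DC_D(1)[OF D]] L_integrable[OF D] by simp
    show "AE m in \<M>. snorm X (sect (cb n *\<^sub>R Q n u - C (Q n u)) m) * w m
        \<le> cb n * (snorm X (sect (Q n u) m) * w m) - \<alpha>\<^sub>1 m * (snorm X (sect (Q n u) m) * w m)"
      using cutoff_bounds(1)[OF assms, of n]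
    proof eventually_elim
      case (elim m)
      from mult_right_mono[OF elim, of "w m"] show ?case
        using w_pos[of m] by (simp add: algebra_simps)
    qed
  qed
  also have "\<dots> = cb n * BN (Q n u) - L (Q n u)"
    using BV_int[OF DC_D(1)[OF D]] L_integrable[OF D] by (simp add: BN_def L_def)
  finally show ?thesis
    by simp
qed

lemma BN_C_Q_le:
  assumes "u \<in> BV"
  shows "BN (C (Q n u)) \<le> cb n * BN u"
proof -
  have "BN (C (Q n u)) \<le> (\<integral>m. cb n * (snorm X (sect u m) * w m) \<partial>\<M>)"
  proof (rule BN_mono)
    show "AE m in \<M>. snorm X (sect (C (Q n u)) m) * w m \<le> cb n * (snorm X (sect u m) * w m)"
      using cutoff_bounds(2)[OF assms, of n]
    proof eventually_elim
      case (elim m)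
      from mult_right_mono[OF elim, of "w m"] show ?case
        using w_pos[of m] by (simp add: algebra_simps)
    qed
  qed (use DC_D(2)[OF Q_DC[OF assms]] BV_int[OF assms] in auto)
  then show ?thesis
    by (simp add: BN_def)
qed

lemma C_pos:
  assumes "u \<in> BP"
  shows "cb n *\<^sub>R Q n u - C (Q n u) \<in> BP"
proof -
  have u: "u \<in> BV" "AE m in \<M>. sect u m \<in> cone X"
    using assms by (auto simp: BP_def)
  have V: "cb n *\<^sub>R Q n u - C (Q n u) \<in> BV"
    using DC_D[OF Q_DC[OF u(1)]] by simp
  have "AE m in \<M>. sect (cb n *\<^sub>R Q n u - C (Q n u)) m \<in> cone X"
    using BV_sect[OF V] u(2) cb(2)[of n] c_bounds
  proof eventually_elim
    case (elim m)
    have "AE x in lebesgue_on \<Omega>. 0 \<le> sect u m x"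
      using elim(2) cone_eq by auto
    then have "AE x in lebesgue_on \<Omega>. 0 \<le> sect (cb n *\<^sub>R Q n u - C (Q n u)) m x"
      using elim(4)
    proof eventually_elim
      case (elim x)
      have "0 \<le> (cb n - c (x, m)) * sect u m x" if "m \<le> n"
        using elim that \<open>m \<le> n --> \<alpha>\<^sub>2 m \<le> cb n\<close> by (intro mult_nonneg_nonneg) auto
      then show ?case
        by (auto simp: sect_C sect_Q algebra_simps)
    qed
    with elim(1) show ?case
      using cone_eq by auto
  qed
  with V show ?thesis
    by (simp add: BP_def)
qed

lemma BN_zero_AE:
  assumes "v \<in> BV" "BN v = 0"
  shows "AE m in \<M>. snorm X (sect v m) = 0"
proof -
  have "AE m in \<M>. snorm X (sect v m) * w m = 0"
    using assms(2) BV_int[OF assms(1)] norm_sect_nonneg[OF assms(1)]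
    unfolding BN_def by (simp add: integral_nonneg_eq_0_iff_AE)
  then show ?thesis
    using w_pos by (auto elim!: eventually_mono simp: less_imp_neq[symmetric])
qed

text \<open>After a cutoff, multiplication by c is bounded, so each cutoff of the error C u - v is
  null. The error is the limit of its cutoffs, which yields measurability and then membership in the
  space.\<close>

lemma C_closed:
  assumes us: "!!n::nat. us n \<in> DC" and u: "u \<in> BV" and v: "v \<in> BV"
    and lim: "(\<lambda>n. BN (us n - u)) \<longlonglongrightarrow> 0" "(\<lambda>n. BN (C (us n) - v)) \<longlonglongrightarrow> 0"
  shows "u \<in> DC \<and> BN (C u - v) = 0"
proof -
  \<comment> \<open>Not yet known to lie in the space; only its cutoffs are.\<close>
  define z where "z = C u - v"
  have Qz: "Q j z = C (Q j u) - Q j v" for j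
    unfolding z_def using Q_lin[of j 1 "C u" "-1" v] by (simp add: Q_C)
  have zV: "Q j z \<in> BV" for j
    unfolding Qz using DC_D(2)[OF Q_DC[OF u]] Q_BV[OF v] by simp
  have z0: "BN (Q j z) = 0" for j
  proof -
    have C_diff: "C (Q j (us n - u)) = Q j (C (us n)) - C (Q j u)" for n
      using Q_lin[of j 1 "us n" "-1" u] C_lin[of 1 "Q j (us n)" "-1" "Q j u"] by (simp add: Q_C)
    have "(\<lambda>n. cb j * BN (us n - u)) \<longlonglongrightarrow> 0"
      using lim(1) by (rule tendsto_mult_right_zero)
    then have "(\<lambda>n. BN (Q j (C (us n)) - C (Q j u))) \<longlonglongrightarrow> 0"
    proof (rule tendsto_0_seq_bound)
      fix n
      show "BN (Q j (C (us n)) - C (Q j u)) \<le> cb j * BN (us n - u)"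
        using BN_C_Q_le[of "us n - u" j] DC_D(1)[OF us] u by (simp add: C_diff)
      show "0 \<le> BN (Q j (C (us n)) - C (Q j u))"
        using DC_D(2)[OF us] Q_BV DC_D(2)[OF Q_DC[OF u]] by (intro B.N_nonneg) auto
    qed
    moreover have "(\<lambda>n. BN (Q j (C (us n)) - Q j v)) \<longlonglongrightarrow> 0"
    proof (rule tendsto_0_seq_bound[OF lim(2)])
      fix n
      have "Q j (C (us n) - v) = Q j (C (us n)) - Q j v"
        using Q_lin[of j 1 "C (us n)" "-1" v] by simp
      then show "BN (Q j (C (us n)) - Q j v) \<le> BN (C (us n) - v)"
        using Q_le[of "C (us n) - v" j] DC_D(2)[OF us] v by simp
      show "0 \<le> BN (Q j (C (us n)) - Q j v)"
        using DC_D(2)[OF us] Q_BV v by (intro B.N_nonneg) auto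
    qed
    ultimately show ?thesis
      unfolding Qz using DC_D(2)[OF us] Q_BV v DC_D(2)[OF Q_DC[OF u]]
      by (intro B.limit_unique[of "\<lambda>n. Q j (C (us n))"]) auto
  qed
  have "AE m in \<M>. snorm X (sect (Q j z) m) = 0" for j
    by (rule BN_zero_AE[OF zV z0])
  then have Qz0: "AE m in \<M>. \<forall>j. snorm X (sect (Q j z) m) = 0"
    by (simp add: AE_all_countable)
  have QzX: "AE m in \<M>. \<forall>j. sect (Q j z) m \<in> carr X"
    using BV_sect[OF zV] by (simp add: AE_all_countable)
  have eq: "sect (Q j z) m = sect z m" if "m \<le> real j" for j m
    using that by (simp add: sect_Q)
  have large: "m \<le> real (nat \<lceil>m\<rceil>)" for m :: real
    by (rule real_nat_ceiling_ge)
  have zX: "AE m in \<M>. sect z m \<in> carr X \<and> snorm X (sect z m) = 0"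
    using Qz0 QzX
  proof eventually_elim
    case (elim m)
    then show ?case
      unfolding eq[OF large, symmetric] by blast
  qed
  have "z \<in> BV"
  proof (rule BV_dominated[where h = "\<lambda>_. 0"])
    show "z \<in> borel_measurable (lebesgue_on (\<Omega> \<times> {0..}))"
    proof (rule borel_measurable_lebesgue_on_AE_limit[OF _ BV_meas[OF zV]])
      have "(\<lambda>j. Q j z y) \<longlonglongrightarrow> z y" for y
      proof (rule tendsto_eventually)
        show "\<forall>\<^sub>F j in sequentially. Q j z y = z y"
          using eventually_ge_at_top[of "nat \<lceil>snd y\<rceil>"]
          by eventually_elim (auto simp: Q_def indicator_def nat_le_iff ceiling_le_iff)
      qed
      then show "AE y in lebesgue_on (\<Omega> \<times> {0..}). (\<lambda>j. Q j z y) \<longlonglongrightarrow> z y"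
        by simp
      show "\<Omega> \<times> {0::real..} \<in> sets borel"
        by (rule Times_borel) auto
    qed
    show "SM (sect z)"
    proof (rule SM_limit[OF BV_SM[OF zV]])
      show "AE m in \<M>. sect z m \<in> carr X"
        using zX by eventually_elim simp
      show "AE m in \<M>. (\<lambda>j. snorm X (sect (Q j z) m - sect z m)) \<longlonglongrightarrow> 0"
      proof (intro AE_I2 tendsto_eventually)
        fix m
        show "\<forall>\<^sub>F j in sequentially. snorm X (sect (Q j z) m - sect z m) = 0"
          using eventually_ge_at_top[of "nat \<lceil>m\<rceil>"]
          by eventually_elim (auto simp: sect_Q nat_le_iff ceiling_le_iff)
      qed
    qed
    show "AE m in \<M>. snorm X (sect z m) * w m \<le> 0"
      using zX by eventually_elim simp
  qed simp
  moreover have "BN z = 0"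
  proof -
    have "BN z = (\<integral>m. 0 \<partial>\<M>)"
      unfolding BN_def using zX BV_int[OF \<open>z \<in> BV\<close>]
      by (intro integral_cong_AE) (auto elim: eventually_mono)
    then show ?thesis
      by simp
  qed
  moreover have "C u \<in> BV"
    using B.V_add[OF \<open>z \<in> BV\<close> v] by (simp add: z_def)
  ultimately show ?thesis
    using u by (simp add: DC_def z_def)
qed

text \<open>In the fibre at mass m, transport is dissipative at \<nu> +
  \<open>\<alpha>\<^sub>2 m\<close>. Replacing \<open>\<alpha>\<^sub>2 m\<close> by the loss
  coefficient costs at most (\<open>\<alpha>\<^sub>2 m\<close> - \<open>\<alpha>\<^sub>1 m\<close>)
  times the norm, which leaves \<nu> + \<open>\<alpha>\<^sub>1 m\<close>. Integrating against the
  weight gives both terms on the left.\<close>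

lemma gen_C_dissipative:
  assumes uv: "(u, v) \<in> B.gen G" and u: "u \<in> DC" and "0 \<le> \<nu>"
  shows "\<nu> * BN u + L u \<le> BN (\<nu> *\<^sub>R u - v + C u)"
proof -
  have V: "u \<in> BV" "v \<in> BV" "C u \<in> BV" and gen: "AE m in \<M>. (sect u m, sect v m) \<in> gen (F m)"
    using uv gen_G DC_D[OF u] by auto
  have nonneg: "AE m in \<M>. 0 \<le> m"
    by (rule AE_nonneg_mass)
  have "\<nu> * BN u + L u = (\<integral>m. \<nu> * (snorm X (sect u m) * w m) + \<alpha>\<^sub>1 m * (snorm X (sect u m) * w m) \<partial>\<M>)"
    using BV_int[OF V(1)] L_integrable[OF u] by (simp add: BN_def L_def)
  also have "\<dots> \<le> BN (\<nu> *\<^sub>R u - v + C u)"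
    unfolding BN_def
  proof (rule integral_mono_AE)
    show "integrable \<M> (\<lambda>m. \<nu> * (snorm X (sect u m) * w m) + \<alpha>\<^sub>1 m * (snorm X (sect u m) * w m))"
      using BV_int[OF V(1)] L_integrable[OF u] by simp
    show "integrable \<M> (\<lambda>m. snorm X (sect (\<nu> *\<^sub>R u - v + C u) m) * w m)"
      using V by (intro BV_int) auto
    show "AE m in \<M>. \<nu> * (snorm X (sect u m) * w m) + \<alpha>\<^sub>1 m * (snorm X (sect u m) * w m)
        \<le> snorm X (sect (\<nu> *\<^sub>R u - v + C u) m) * w m"
      using gen nonneg BV_sect[OF V(1)] BV_sect[OF V(2)] BV_sect[OF V(3)] \<alpha>_bounds section_bounds(3)[OF u]
    proof eventually_elim
      case (elim m)
      interpret F: contraction_semigroup "carr X" "snorm X" "cone X" "F m"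
        by unfold_locales (rule F_contraction[OF elim(2)])
      let ?u = "sect u m" and ?v = "sect v m" and ?c = "sect (C u) m"
      have split: "(\<nu> + \<alpha>\<^sub>2 m) *\<^sub>R ?u - ?v = (\<nu> *\<^sub>R ?u - ?v + ?c) + (\<alpha>\<^sub>2 m *\<^sub>R ?u - ?c)"
        by (simp add: scaleR_add_left)
      have "(\<nu> + \<alpha>\<^sub>2 m) * snorm X ?u \<le> snorm X ((\<nu> *\<^sub>R ?u - ?v + ?c) + (\<alpha>\<^sub>2 m *\<^sub>R ?u - ?c))"
        unfolding split[symmetric] using elim(1,6) \<open>0 \<le> \<nu>\<close> by (intro F.gen_dissipative) auto
      moreover have "snorm X ((\<nu> *\<^sub>R ?u - ?v + ?c) + (\<alpha>\<^sub>2 m *\<^sub>R ?u - ?c))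
          \<le> snorm X (\<nu> *\<^sub>R ?u - ?v + ?c) + snorm X (\<alpha>\<^sub>2 m *\<^sub>R ?u - ?c)"
        using elim by (intro N_triangle) auto
      moreover have "snorm X (\<alpha>\<^sub>2 m *\<^sub>R ?u - ?c) \<le> (\<alpha>\<^sub>2 m - \<alpha>\<^sub>1 m) * snorm X ?u"
        using elim(7) by simp
      ultimately have "(\<nu> + \<alpha>\<^sub>1 m) * snorm X ?u \<le> snorm X (sect (\<nu> *\<^sub>R u - v + C u) m)"
        unfolding sect_add sect_diff sect_scale distrib_right left_diff_distrib by linarith
      from mult_right_mono[OF this, of "w m"] show ?case
        using w_pos[of m] by (simp add: algebra_simps)
    qed
  qed
  finally show ?thesis .
qed

text \<open>On each fibre the cutoff is the identity or zero, and (0, 0) belongs to every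
  generator.\<close>

lemma Q_gen:
  assumes "(u, v) \<in> B.gen G"
  shows "(Q n u, Q n v) \<in> B.gen G"
proof -
  have V: "u \<in> BV" "v \<in> BV" and gen: "AE m in \<M>. (sect u m, sect v m) \<in> gen (F m)"
    using assms gen_G by auto
  have nonneg: "AE m in \<M>. 0 \<le> m"
    by (rule AE_nonneg_mass)
  have "AE m in \<M>. (sect (Q n u) m, sect (Q n v) m) \<in> gen (F m)"
    using gen nonneg
  proof eventually_elim
    case (elim m)
    interpret F: contraction_semigroup "carr X" "snorm X" "cone X" "F m"
      by unfold_locales (rule F_contraction[OF elim(2)])
    have "(0, 0) \<in> gen (F m)"
      using F.gen_lin[OF elim(1) elim(1), of 0 0] by simp
    with elim(1) show ?case
      by (simp add: sect_Q)
  qed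
  then show ?thesis
    using V Q_BV gen_G by auto
qed

theorem perturbed_generates:
  assumes \<kappa>: "0 \<le> \<kappa>" "\<kappa> < 1" and \<omega>: "0 \<le> \<omega>"
    and B_BV: "!!u v. (u, v) \<in> B.gen G ==> u \<in> DC ==> Bo u \<in> BV"
    and B_lin: "!!u v x y. u \<in> DC ==> v \<in> DC ==> Bo u \<in> BV ==> Bo v \<in> BV ==>
      Bo (x *\<^sub>R u + y *\<^sub>R v) \<in> BV ==> BN (Bo (x *\<^sub>R u + y *\<^sub>R v) - (x *\<^sub>R Bo u + y *\<^sub>R Bo v)) = 0"
    and B_le: "!!u. u \<in> DC ==> Bo u \<in> BV ==> BN (Bo u) \<le> \<kappa> * L u + \<omega> * BN u"
    and B_pos: "!!u. u \<in> DC ==> Bo u \<in> BV ==> u \<in> BP ==> Bo u \<in> BP"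
    and Q_B: "!!u n. u \<in> BV ==> Bo (Q n u) \<in> BV ==> BN (Q n (Bo (Q n u)) - Bo (Q n u)) = 0"
  shows "\<exists>S. B.C0_sg S \<and>
    B.gen S = {(u, v). u \<in> DC \<and> v \<in> BV \<and> (\<exists>v\<^sub>0. (u, v\<^sub>0) \<in> B.gen G \<and> BN (v - (v\<^sub>0 - C u + Bo u)) = 0)} \<and>
    (\<forall>t\<ge>0. \<forall>f\<in>BP. S t f \<in> BP)"
proof -
  have DC_iff: "u \<in> DC \<longleftrightarrow> u \<in> BV \<and> C u \<in> BV" for u
    by (auto simp: DC_def)
  interpret K: perturbed_generator BV BN BP G Q C Bo L DC M \<kappa> \<omega> cb
    by (unfold_locales; fact G_pos Q_lin Q_BV Q_le Q_idem Q_lim Q_BP Q_gen C_lin DC_iff C_closed Q_DC Q_C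
      cb(1) C_loss C_pos C_le L_nonneg gen_C_dissipative \<kappa> \<omega> M_nonneg B_BV B_lin B_le B_pos Q_B)
  show ?thesis
    using K.K_generates unfolding K.K_def .
qed

end

section \<open>The spaces of continuous and of integrable functions\<close>

lemma summable_increments:
  fixes v a :: "nat \<Rightarrow> real"
  assumes inc: "!!n. \<bar>v (Suc n) - v n\<bar> \<le> a n" and a: "summable a"
  shows "v \<longlonglongrightarrow> lim v" "\<bar>v n - lim v\<bar> \<le> (\<Sum>k. a (k + n))"
proof -
  have "summable (\<lambda>k. v (Suc k) - v k)"
    by (rule summable_comparison_test'[OF a]) (use inc in auto)
  then have "(\<lambda>n. v 0 + (\<Sum>k<n. v (Suc k) - v k)) \<longlonglongrightarrow> v 0 + (\<Sum>k. v (Suc k) - v k)"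
    by (intro tendsto_intros summable_LIMSEQ)
  then have "convergent v"
    by (auto simp: sum_lessThan_telescope convergent_def)
  then show lim: "v \<longlonglongrightarrow> lim v"
    by (simp add: convergent_LIMSEQ_iff)
  have an: "summable (\<lambda>k. a (k + n))"
    using a by (rule summable_ignore_initial_segment)
  have a0: "0 \<le> a k" for k
    using inc[of k] by simp
  have "\<bar>v n - v (k + n)\<bar> \<le> (\<Sum>j<k. a (j + n))" for k
  proof (induction k)
    case (Suc k)
    then show ?case
      using inc[of "k + n"] by simp
  qed simp
  also have "(\<Sum>j<k. a (j + n)) \<le> (\<Sum>j. a (j + n))" for k
    using an a0 by (intro sum_le_suminf) auto
  finally have bound: "\<bar>v n - v (k + n)\<bar> \<le> (\<Sum>j. a (j + n))" for k .
  have "(\<lambda>k. \<bar>v n - v (k + n)\<bar>) \<longlonglongrightarrow> \<bar>v n - lim v\<bar>"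
    using LIMSEQ_ignore_initial_segment[OF lim, of n] by (intro tendsto_intros)
  then show "\<bar>v n - lim v\<bar> \<le> (\<Sum>k. a (k + n))"
    by (rule LIMSEQ_le_const2) (use bound in auto)
qed

lemma tail_tendsto_0:
  fixes a :: "nat \<Rightarrow> real"
  assumes "summable a"
  shows "(\<lambda>n. \<Sum>k. a (k + n)) \<longlonglongrightarrow> 0"
proof -
  have "(\<lambda>n. suminf a - sum a {..<n}) \<longlonglongrightarrow> suminf a - suminf a"
    by (intro tendsto_intros summable_LIMSEQ assms)
  then show ?thesis
    using suminf_minus_initial_segment[OF assms] by simp
qed

text \<open>The set where h is negative is open and null, hence empty. Used to turn
  almost-everywhere bounds on continuous functions into bounds on the supremum.\<close>

lemma continuous_AE_nonneg:
  fixes h :: "'a::euclidean_space \<Rightarrow> real"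
  assumes "open \<Omega>" "continuous_on \<Omega> h" "AE x in lebesgue_on \<Omega>. 0 \<le> h x" "x \<in> \<Omega>"
  shows "0 \<le> h x"
proof -
  let ?S = "{x \<in> \<Omega>. h x < 0}"
  have "?S = \<Omega> \<inter> h -` {..<0}"
    by auto
  then have op: "open ?S"
    using continuous_open_preimage[OF assms(2,1), of "{..<0}"] by simp
  have "AE x in lebesgue. x \<in> \<Omega> --> 0 \<le> h x"
    using assms(1,3) by (simp add: AE_restrict_space_iff)
  then have "AE x in lebesgue. x \<notin> ?S"
    by eventually_elim auto
  then have "?S \<in> null_sets lebesgue"
    using completion.AE_iff_null_sets[of "\<lambda>x. x \<notin> ?S" lborel] by simp
  then have "?S = {}"
    using op open_not_negligible negligible_iff_null_sets by blast
  then show ?thesis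
    using assms(4) by force
qed

section \<open>Continuous functions with the supremum norm\<close>

definition regular_domain :: "'a::euclidean_space set \<Rightarrow> bool" where
  "regular_domain \<Omega> \<longleftrightarrow> open \<Omega> \<and> (bounded \<Omega> \<or> \<Omega> = UNIV)"

lemma C0_carrier_continuous: "f \<in> C0_carrier \<Omega> ==> continuous_on \<Omega> f"
  unfolding C0_carrier_def
  by (auto split: if_splits intro: continuous_on_eq[OF continuous_on_subset[OF _ closure_subset]])

context
  fixes \<Omega> :: "'a::euclidean_space set"
  assumes dom: "regular_domain \<Omega>"
begin

lemma C0_carrier_bounded:
  assumes "f \<in> C0_carrier \<Omega>"
  shows "bounded (f ` \<Omega>)"
proof (cases "bounded \<Omega>")
  case True
  then obtain g where g: "continuous_on (closure \<Omega>) g" "!!x. x \<in> \<Omega> ==> f x = g x"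
    using assms by (auto simp: C0_carrier_def)
  have "bounded (g ` closure \<Omega>)"
    using True by (intro compact_imp_bounded compact_continuous_image g) simp
  then show ?thesis
    by (rule bounded_subset) (use g(2) closure_subset[of \<Omega>] in force)
next
  case False
  then have f: "continuous_on UNIV f" "(f \<longlongrightarrow> 0) at_infinity"
    using assms dom by (auto simp: C0_carrier_def regular_domain_def)
  obtain b where b: "!!x. b \<le> norm x ==> \<bar>f x\<bar> < 1"
    using tendstoD[OF f(2), of 1] by (auto simp: eventually_at_infinity)
  have "bounded (f ` cball 0 b)"
    by (intro compact_imp_bounded compact_continuous_image continuous_on_subset[OF f(1)]) auto
  then obtain K where "\<forall>y\<in>f ` cball 0 b. \<bar>y\<bar> \<le> K"
    unfolding bounded_iff real_norm_def by blast
  then have "\<bar>f x\<bar> \<le> K" if "norm x \<le> b" for x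
    using that by auto
  then have "\<bar>f x\<bar> \<le> max 1 K" for x
    using b[of x] by (cases "b \<le> norm x") (auto simp: le_max_iff_disj less_imp_le)
  then show ?thesis
    by (auto simp: bounded_iff)
qed

lemma sup_norm_bdd:
  assumes "f \<in> C0_carrier \<Omega>"
  shows "bdd_above (insert 0 ((\<lambda>x. \<bar>f x\<bar>) ` \<Omega>))"
proof -
  obtain K where "\<forall>y\<in>f ` \<Omega>. \<bar>y\<bar> \<le> K"
    using C0_carrier_bounded[OF assms] unfolding bounded_iff real_norm_def by blast
  then have "\<bar>f x\<bar> \<le> max 0 K" if "x \<in> \<Omega>" for x
    using that by (auto simp: le_max_iff_disj)
  then show ?thesis
    by (intro bdd_aboveI[of _ "max 0 K"]) auto
qed

lemma sup_norm_upper: "f \<in> C0_carrier \<Omega> ==> x \<in> \<Omega> ==> \<bar>f x\<bar> \<le> sup_norm \<Omega> f"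
  unfolding sup_norm_def by (intro cSup_upper sup_norm_bdd) auto

lemma sup_norm_nonneg: "f \<in> C0_carrier \<Omega> ==> 0 \<le> sup_norm \<Omega> f"
  unfolding sup_norm_def by (intro cSup_upper sup_norm_bdd) auto

lemma sup_norm_least: "0 \<le> K ==> (!!x. x \<in> \<Omega> ==> \<bar>f x\<bar> \<le> K) ==> sup_norm \<Omega> f \<le> K"
  unfolding sup_norm_def by (intro cSup_least) auto

lemma C0_carrier_lin:
  assumes f: "f \<in> C0_carrier \<Omega>" and g: "g \<in> C0_carrier \<Omega>"
  shows "c *\<^sub>R f + d *\<^sub>R g \<in> C0_carrier \<Omega>"
proof (cases "bounded \<Omega>")
  case True
  then obtain f' g' where "continuous_on (closure \<Omega>) f'" "\<forall>x\<in>\<Omega>. f x = f' x"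
      "continuous_on (closure \<Omega>) g'" "\<forall>x\<in>\<Omega>. g x = g' x"
    using f g by (auto simp: C0_carrier_def)
  then show ?thesis
    using True unfolding C0_carrier_def
    by (auto intro!: exI[of _ "\<lambda>x. c * f' x + d * g' x"] continuous_intros)
next
  case False
  then have *: "continuous_on \<Omega> f" "(f \<longlongrightarrow> 0) at_infinity" "continuous_on \<Omega> g" "(g \<longlongrightarrow> 0) at_infinity"
    using f g by (auto simp: C0_carrier_def)
  have "((\<lambda>x. c * f x + d * g x) \<longlongrightarrow> c * 0 + d * 0) at_infinity"
    by (intro tendsto_intros *)
  moreover have "continuous_on \<Omega> (\<lambda>x. c * f x + d * g x)"
    by (intro continuous_intros *)
  ultimately show ?thesis
    using False by (simp add: C0_carrier_def plus_fun_def scaleR_fun_def)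
qed

lemma C0_carrier_zero: "0 \<in> C0_carrier \<Omega>"
  by (auto simp: C0_carrier_def zero_fun_def intro: exI[of _ "\<lambda>_. 0"])

text \<open>Summable supremum norms of the increments give uniform convergence. On a bounded domain
  this is carried out for continuous extensions to the closure, since membership in the space means
  that the limit has one too.\<close>

lemma C0_complete_lim:
  assumes v: "!!n::nat. v n \<in> C0_carrier \<Omega>"
    and summ: "summable (\<lambda>n. sup_norm \<Omega> (v (Suc n) - v n))"
  shows "(\<lambda>x. lim (\<lambda>n. v n x)) \<in> C0_carrier \<Omega>"
    and "(\<lambda>n. sup_norm \<Omega> (v n - (\<lambda>x. lim (\<lambda>n. v n x)))) \<longlonglongrightarrow> 0"
proof -
  let ?l = "\<lambda>x. lim (\<lambda>n. v n x)"
  define a where "a n = sup_norm \<Omega> (v (Suc n) - v n)" for n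
  have dv: "v m - v n \<in> C0_carrier \<Omega>" for m n
    using C0_carrier_lin[OF v v, of 1 m "-1" n] by simp
  have inc: "\<bar>v (Suc n) x - v n x\<bar> \<le> a n" if "x \<in> \<Omega>" for n x
    using sup_norm_upper[OF dv that, of "Suc n" n] by (simp add: a_def)
  have a: "summable a"
    using summ by (simp add: a_def[abs_def])
  have a0: "0 \<le> a n" for n
    using sup_norm_nonneg[OF dv] by (simp add: a_def)
  have tail0: "0 \<le> (\<Sum>k. a (k + n))" for n
    using a a0 by (intro suminf_nonneg summable_ignore_initial_segment)
  have bound: "\<bar>v n x - ?l x\<bar> \<le> (\<Sum>k. a (k + n))" if "x \<in> \<Omega>" for n x
    using summable_increments(2)[of "\<lambda>n. v n x", OF inc[OF that] a] .
  have small: "\<exists>n. (\<Sum>k. a (k + n)) < e" if "e > 0" for e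
    using order_tendstoD(2)[OF tail_tendsto_0[OF a] that] eventually_happens' sequentially_bot by blast
  show in_C0: "?l \<in> C0_carrier \<Omega>"
  proof (cases "bounded \<Omega>")
    case True
    have "\<forall>n. \<exists>g. continuous_on (closure \<Omega>) g \<and> (\<forall>x\<in>\<Omega>. v n x = g x)"
      using v True by (auto simp: C0_carrier_def)
    then obtain g where g: "!!n. continuous_on (closure \<Omega>) (g n)" "!!n x. x \<in> \<Omega> ==> v n x = g n x"
      by metis
    \<comment> \<open>The bound on the increments passes from the domain to its closure by
      continuity.\<close>
    have ginc: "\<bar>g (Suc n) x - g n x\<bar> \<le> a n" if "x \<in> closure \<Omega>" for n x
      by (rule continuous_le_on_closure[OF _ that]) (auto intro!: continuous_intros g simp: g(2)[symmetric] inc)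
    have "uniform_limit (closure \<Omega>) g (\<lambda>x. lim (\<lambda>n. g n x)) sequentially"
    proof (rule uniform_limitI)
      fix e :: real
      assume "e > 0"
      from order_tendstoD(2)[OF tail_tendsto_0[OF a] this]
      show "\<forall>\<^sub>F n in sequentially. \<forall>x\<in>closure \<Omega>. dist (g n x) (lim (\<lambda>n. g n x)) < e"
      proof eventually_elim
        case (elim n)
        show ?case
        proof
          fix x
          assume "x \<in> closure \<Omega>"
          from summable_increments(2)[of "\<lambda>n. g n x", OF ginc[OF this] a, of n] elim
          show "dist (g n x) (lim (\<lambda>n. g n x)) < e"
            by (simp add: dist_real_def)
        qed
      qed
    qed
    then have "continuous_on (closure \<Omega>) (\<lambda>x. lim (\<lambda>n. g n x))"
      by (intro uniform_limit_theorem) (auto simp: g)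
    then show ?thesis
      using True g(2) unfolding C0_carrier_def by (auto intro!: exI[of _ "\<lambda>x. lim (\<lambda>n. g n x)"])
  next
    case False
    then have U: "\<Omega> = UNIV"
      using dom by (auto simp: regular_domain_def)
    have vU: "continuous_on UNIV (v n)" "(v n \<longlongrightarrow> 0) at_infinity" for n
      using v[of n] False U by (auto simp: C0_carrier_def)
    have ul: "uniform_limit UNIV v ?l sequentially"
    proof (rule uniform_limitI)
      fix e :: real
      assume "e > 0"
      from order_tendstoD(2)[OF tail_tendsto_0[OF a] this]
      show "\<forall>\<^sub>F n in sequentially. \<forall>x\<in>UNIV. dist (v n x) (?l x) < e"
        by eventually_elim (use bound U in \<open>auto simp: dist_real_def intro: le_less_trans\<close>)
    qed
    have "continuous_on UNIV ?l"
      by (rule uniform_limit_theorem[OF _ ul]) (auto simp: vU)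
    moreover have "(?l \<longlongrightarrow> 0) at_infinity"
    proof (rule tendstoI)
      fix e :: real
      assume "e > 0"
      then obtain n where n: "(\<Sum>k. a (k + n)) < e / 2"
        using small[of "e / 2"] by auto
      have "\<forall>\<^sub>F x in at_infinity. dist (v n x) 0 < e / 2"
        using \<open>e > 0\<close> by (intro tendstoD[OF vU(2)]) simp
      then show "\<forall>\<^sub>F x in at_infinity. dist (?l x) 0 < e"
      proof eventually_elim
        case (elim x)
        then show ?case
          using bound[of x n] n U by (simp add: dist_real_def)
      qed
    qed
    ultimately show ?thesis
      using U False by (simp add: C0_carrier_def)
  qed
  have "sup_norm \<Omega> (v n - ?l) \<le> (\<Sum>k. a (k + n))" for n
    using bound tail0 by (intro sup_norm_least) auto
  moreover have "0 \<le> sup_norm \<Omega> (v n - ?l)" for n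
    using C0_carrier_lin[OF v in_C0, of 1 n "-1"] by (intro sup_norm_nonneg) simp
  ultimately show "(\<lambda>n. sup_norm \<Omega> (v n - ?l)) \<longlonglongrightarrow> 0"
    by (intro tendsto_0_seq_bound[OF tail_tendsto_0[OF a]])
qed

lemma C0_fibre_space: "fibre_space (C0_space \<Omega>) \<Omega>"
proof -
  have op: "open \<Omega>"
    using dom by (simp add: regular_domain_def)
  have cone: "cone (C0_space \<Omega>) = {f \<in> C0_carrier \<Omega>. AE x in lebesgue_on \<Omega>. 0 \<le> f x}"
  proof -
    have "(\<forall>x\<in>\<Omega>. 0 \<le> f x) \<longleftrightarrow> (AE x in lebesgue_on \<Omega>. 0 \<le> f x)" if f: "f \<in> C0_carrier \<Omega>" for f
    proof
      assume "\<forall>x\<in>\<Omega>. 0 \<le> f x"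
      then show "AE x in lebesgue_on \<Omega>. 0 \<le> f x"
        by (intro AE_I2) simp
    next
      assume "AE x in lebesgue_on \<Omega>. 0 \<le> f x"
      then show "\<forall>x\<in>\<Omega>. 0 \<le> f x"
        using continuous_AE_nonneg[OF op C0_carrier_continuous[OF f]] by blast
    qed
    then show ?thesis
      by (auto simp: C0_space_def)
  qed
  have [simp]: "carr (C0_space \<Omega>) = C0_carrier \<Omega>" "snorm (C0_space \<Omega>) = sup_norm \<Omega>"
    by (simp_all add: C0_space_def)
  show ?thesis
  proof
    show "subspace (carr (C0_space \<Omega>))"
      unfolding subspace_def using C0_carrier_zero C0_carrier_lin[of _ _ 1 1]
        C0_carrier_lin[OF _ C0_carrier_zero, of _ _ 0] by auto
    show "snorm (C0_space \<Omega>) (u + v) \<le> snorm (C0_space \<Omega>) u + snorm (C0_space \<Omega>) v"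
      if "u \<in> carr (C0_space \<Omega>)" "v \<in> carr (C0_space \<Omega>)" for u v
    proof -
      have "\<bar>u x + v x\<bar> \<le> sup_norm \<Omega> u + sup_norm \<Omega> v" if "x \<in> \<Omega>" for x
        using sup_norm_upper[of u x] sup_norm_upper[of v x] that
          \<open>u \<in> carr (C0_space \<Omega>)\<close> \<open>v \<in> carr (C0_space \<Omega>)\<close> by simp
      then show ?thesis
        using that sup_norm_nonneg[of u] sup_norm_nonneg[of v] by (auto intro!: sup_norm_least)
    qed
    have scale_le: "sup_norm \<Omega> (c *\<^sub>R u) \<le> \<bar>c\<bar> * sup_norm \<Omega> u" if "u \<in> C0_carrier \<Omega>" for c u
      using that sup_norm_nonneg[of u] sup_norm_upper[of u]
      by (auto intro!: sup_norm_least simp: abs_mult mult_left_mono)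
    show "snorm (C0_space \<Omega>) (c *\<^sub>R u) = \<bar>c\<bar> * snorm (C0_space \<Omega>) u" if u: "u \<in> carr (C0_space \<Omega>)" for c u
    proof (cases "c = 0")
      case True
      have "0 \<le> sup_norm \<Omega> (0 *\<^sub>R u)"
        using C0_carrier_zero by (intro sup_norm_nonneg) simp
      then show ?thesis
        using scale_le[of u 0] u True by simp
    next
      case False
      have cu: "c *\<^sub>R u \<in> C0_carrier \<Omega>"
        using C0_carrier_lin[OF _ C0_carrier_zero, of u c 0] u by simp
      have "\<bar>c\<bar> * sup_norm \<Omega> ((1/c) *\<^sub>R (c *\<^sub>R u)) \<le> \<bar>c\<bar> * (\<bar>1/c\<bar> * sup_norm \<Omega> (c *\<^sub>R u))"
        using scale_le[OF cu, of "1/c"] by (intro mult_left_mono) auto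
      then have "\<bar>c\<bar> * sup_norm \<Omega> u \<le> sup_norm \<Omega> (c *\<^sub>R u)"
        using False by simp
      then show ?thesis
        using scale_le[of u c] u by simp
    qed
    show lim: "(\<lambda>x. lim (\<lambda>n. v n x)) \<in> carr (C0_space \<Omega>) \<and>
        (\<lambda>n. snorm (C0_space \<Omega>) (v n - (\<lambda>x. lim (\<lambda>n. v n x)))) \<longlonglongrightarrow> 0"
      if "!!n::nat. v n \<in> carr (C0_space \<Omega>)" "summable (\<lambda>n. snorm (C0_space \<Omega>) (v (Suc n) - v n))" for v
      using C0_complete_lim[of v] that by simp
    show "\<exists>g\<in>carr (C0_space \<Omega>). (\<lambda>n. snorm (C0_space \<Omega>) (f n - g)) \<longlonglongrightarrow> 0"
      if "!!n::nat. f n \<in> carr (C0_space \<Omega>)" "summable (\<lambda>n. snorm (C0_space \<Omega>) (f (Suc n) - f n))" for f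
      using lim[OF that] by blast
    show "u + v \<in> cone (C0_space \<Omega>)" if "u \<in> cone (C0_space \<Omega>)" "v \<in> cone (C0_space \<Omega>)" for u v
      using that C0_carrier_lin[of u v 1 1] by (auto simp: C0_space_def)
    show "c *\<^sub>R u \<in> cone (C0_space \<Omega>)" if "u \<in> cone (C0_space \<Omega>)" "0 \<le> c" for u c
      using that C0_carrier_lin[OF _ C0_carrier_zero, of u c 0] by (auto simp: C0_space_def)
    show "g \<in> cone (C0_space \<Omega>)"
      if f: "!!n::nat. f n \<in> cone (C0_space \<Omega>)" and g: "g \<in> carr (C0_space \<Omega>)"
        and lim: "(\<lambda>n. snorm (C0_space \<Omega>) (f n - g)) \<longlonglongrightarrow> 0" for f g
    proof -
      have "0 \<le> g x" if x: "x \<in> \<Omega>" for x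
      proof -
        have fg: "f n - g \<in> C0_carrier \<Omega>" for n
          using C0_carrier_lin[of "f n" g 1 "-1"] f[of n] g by (simp add: C0_space_def)
        have "- g x \<le> sup_norm \<Omega> (f n - g)" for n
          using sup_norm_upper[OF fg x, of n] f[of n] x by (auto simp: C0_space_def)
        moreover have "(\<lambda>n. sup_norm \<Omega> (f n - g)) \<longlonglongrightarrow> 0"
          using lim by simp
        ultimately have "- g x \<le> 0"
          by (intro LIMSEQ_le_const) auto
        then show ?thesis
          by simp
      qed
      then show ?thesis
        using g by (simp add: C0_space_def)
    qed
    show "snorm (C0_space \<Omega>) f \<le> k * snorm (C0_space \<Omega>) g"
      if f: "f \<in> carr (C0_space \<Omega>)" and g: "g \<in> carr (C0_space \<Omega>)" and k: "0 \<le> k"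
        and AE: "AE x in lebesgue_on \<Omega>. \<bar>f x\<bar> \<le> k * \<bar>g x\<bar>" for f g k
    proof -
      have "\<bar>f x\<bar> \<le> k * sup_norm \<Omega> g" if x: "x \<in> \<Omega>" for x
      proof -
        have "continuous_on \<Omega> (\<lambda>x. k * \<bar>g x\<bar> - \<bar>f x\<bar>)"
          using f g by (intro continuous_intros C0_carrier_continuous) auto
        from continuous_AE_nonneg[OF op this _ x] AE have "\<bar>f x\<bar> \<le> k * \<bar>g x\<bar>"
          by simp
        also have "\<dots> \<le> k * sup_norm \<Omega> g"
          using g x k by (intro mult_left_mono sup_norm_upper) auto
        finally show ?thesis .
      qed
      then show ?thesis
        using k g sup_norm_nonneg[of g] by (auto intro!: sup_norm_least)
    qed
    show "cone (C0_space \<Omega>) = {f \<in> carr (C0_space \<Omega>). AE x in lebesgue_on \<Omega>. 0 \<le> f x}"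
      using cone by simp
    show "f \<in> borel_measurable (lebesgue_on \<Omega>)" if "f \<in> carr (C0_space \<Omega>)" for f
      using that op by (intro continuous_imp_measurable_on_sets_lebesgue C0_carrier_continuous) auto
  qed (use op C0_carrier_zero sup_norm_nonneg in \<open>auto simp: C0_space_def\<close>)
qed

end

section \<open>Integrable functions as a fibre space\<close>

lemma L1_complete_lim:
  fixes v :: "nat \<Rightarrow> 'a \<Rightarrow> real"
  assumes v: "!!n. integrable Mu (v n)" and summ: "summable (\<lambda>n. \<integral>x. \<bar>v (Suc n) x - v n x\<bar> \<partial>Mu)"
  shows "integrable Mu (\<lambda>x. lim (\<lambda>n. v n x))"
    and "(\<lambda>n. \<integral>x. \<bar>v n x - lim (\<lambda>n. v n x)\<bar> \<partial>Mu) \<longlonglongrightarrow> 0"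
proof -
  let ?l = "\<lambda>x. lim (\<lambda>n. v n x)"
  define d where "d n x = \<bar>v (Suc n) x - v n x\<bar>" for n x
  have d_int: "integrable Mu (d n)" for n
    unfolding d_def using v by simp
  note [measurable] = borel_measurable_integrable[OF d_int] borel_measurable_integrable[OF v]
  have "(\<integral>\<^sup>+x. (\<Sum>n. ennreal (d n x)) \<partial>Mu) = (\<Sum>n. \<integral>\<^sup>+x. ennreal (d n x) \<partial>Mu)"
    by (rule nn_integral_suminf) measurable
  also have "\<dots> = (\<Sum>n. ennreal (\<integral>x. d n x \<partial>Mu))"
    by (intro arg_cong[where f = suminf] ext nn_integral_eq_integral d_int) (simp add: d_def)
  also have "\<dots> \<noteq> top"
    using summ by (intro ennreal_suminf_neq_top) (auto simp: d_def)
  finally have "AE x in Mu. (\<Sum>n. ennreal (d n x)) \<noteq> \<infinity>"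
    by (intro nn_integral_PInf_AE) auto
  then have d_summable: "AE x in Mu. summable (\<lambda>n. d n x)"
    by eventually_elim (rule summable_suminf_not_top, auto simp: d_def)
  have S_int: "integrable Mu (\<lambda>x. \<Sum>n. d n x)"
    by (rule integrable_suminf[OF d_int]) (use d_summable summ in \<open>auto simp: d_def\<close>)
  have l_meas [measurable]: "?l \<in> borel_measurable Mu"
    by (rule borel_measurable_lim_metric) measurable
  have lim: "AE x in Mu. (\<lambda>n. v n x) \<longlonglongrightarrow> ?l x"
    using d_summable by eventually_elim (rule summable_increments(1), auto simp: d_def)
  have bound: "AE x in Mu. \<bar>v n x - ?l x\<bar> \<le> (\<Sum>n. d n x)" for n
    using d_summable
  proof eventually_elim
    case (elim x)
    have "\<bar>v n x - ?l x\<bar> \<le> (\<Sum>k. d (k + n) x)"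
      by (rule summable_increments(2)[OF _ elim]) (simp add: d_def)
    also have "\<dots> \<le> (\<Sum>n. d n x)"
      using suminf_split_initial_segment[OF elim, of n] sum_nonneg[of "{..<n}" "\<lambda>i. d i x"]
      by (simp add: d_def)
    finally show ?case .
  qed
  have vl: "integrable Mu (\<lambda>x. v n x - ?l x)" for n
    by (rule Bochner_Integration.integrable_bound[OF S_int]) (use bound[of n] in \<open>auto elim!: eventually_mono\<close>)
  show "integrable Mu ?l"
    using Bochner_Integration.integrable_diff[OF v[of 0] vl[of 0]] by simp
  have "(\<lambda>n. \<integral>x. \<bar>v n x - ?l x\<bar> \<partial>Mu) \<longlonglongrightarrow> (\<integral>x. 0 \<partial>Mu)"
  proof (rule integral_dominated_convergence[OF _ _ S_int])
    show "AE x in Mu. (\<lambda>n. \<bar>v n x - ?l x\<bar>) \<longlonglongrightarrow> 0"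
      using lim by eventually_elim (intro tendsto_rabs_zero LIM_zero)
  qed (use bound in auto)
  then show "(\<lambda>n. \<integral>x. \<bar>v n x - ?l x\<bar> \<partial>Mu) \<longlonglongrightarrow> 0"
    by simp
qed

lemma L1_fibre_space:
  assumes op: "open \<Omega>"
  shows "fibre_space (L1_space \<Omega>) \<Omega>"
proof -
  have [simp]: "carr (L1_space \<Omega>) = {f. integrable (lebesgue_on \<Omega>) f}"
      "snorm (L1_space \<Omega>) f = (\<integral>x. \<bar>f x\<bar> \<partial>lebesgue_on \<Omega>)"
      "cone (L1_space \<Omega>) = {f. integrable (lebesgue_on \<Omega>) f \<and> (AE x in lebesgue_on \<Omega>. 0 \<le> f x)}" for f
    by (simp_all add: L1_space_def)
  show ?thesis
  proof
    show "subspace (carr (L1_space \<Omega>))"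
      by (auto simp: subspace_def plus_fun_def scaleR_fun_def zero_fun_def)
    show "snorm (L1_space \<Omega>) (u + v) \<le> snorm (L1_space \<Omega>) u + snorm (L1_space \<Omega>) v"
      if "u \<in> carr (L1_space \<Omega>)" "v \<in> carr (L1_space \<Omega>)" for u v
    proof -
      have "(\<integral>x. \<bar>u x + v x\<bar> \<partial>lebesgue_on \<Omega>) \<le> (\<integral>x. \<bar>u x\<bar> + \<bar>v x\<bar> \<partial>lebesgue_on \<Omega>)"
        using that by (intro integral_mono) auto
      then show ?thesis
        using that by simp
    qed
    show lim: "(\<lambda>x. lim (\<lambda>n. v n x)) \<in> carr (L1_space \<Omega>) \<and>
        (\<lambda>n. snorm (L1_space \<Omega>) (v n - (\<lambda>x. lim (\<lambda>n. v n x)))) \<longlonglongrightarrow> 0"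
      if "!!n::nat. v n \<in> carr (L1_space \<Omega>)" "summable (\<lambda>n. snorm (L1_space \<Omega>) (v (Suc n) - v n))" for v
      using L1_complete_lim[of "lebesgue_on \<Omega>" v] that by simp
    show "\<exists>g\<in>carr (L1_space \<Omega>). (\<lambda>n. snorm (L1_space \<Omega>) (f n - g)) \<longlonglongrightarrow> 0"
      if "!!n::nat. f n \<in> carr (L1_space \<Omega>)" "summable (\<lambda>n. snorm (L1_space \<Omega>) (f (Suc n) - f n))" for f
      using lim[OF that] by blast
    show "g \<in> cone (L1_space \<Omega>)"
      if f: "!!n::nat. f n \<in> cone (L1_space \<Omega>)" and g: "g \<in> carr (L1_space \<Omega>)"
        and lim: "(\<lambda>n. snorm (L1_space \<Omega>) (f n - g)) \<longlonglongrightarrow> 0" for f g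
    proof -
      have int: "integrable (lebesgue_on \<Omega>) (\<lambda>x. f n x - g x)" for n
        using f[of n] g by simp
      obtain \<phi> where "AE x in lebesgue_on \<Omega>. (\<lambda>n. f (\<phi> n) x - g x) \<longlonglongrightarrow> 0"
        using tendsto_L1_AE_subseq[of "lebesgue_on \<Omega>" "\<lambda>n x. f n x - g x", OF int] lim by auto
      moreover have "AE x in lebesgue_on \<Omega>. \<forall>n. 0 \<le> f n x"
        using f by (simp add: AE_all_countable)
      ultimately have "AE x in lebesgue_on \<Omega>. 0 \<le> g x"
      proof eventually_elim
        case (elim x)
        then have "(\<lambda>n. f (\<phi> n) x) \<longlonglongrightarrow> g x"
          by (simp add: LIM_zero_iff)
        then show ?case
          by (rule LIMSEQ_le_const) (use elim in auto)
      qed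
      then show ?thesis
        using g by simp
    qed
    show "snorm (L1_space \<Omega>) f \<le> k * snorm (L1_space \<Omega>) g"
      if f: "f \<in> carr (L1_space \<Omega>)" and g: "g \<in> carr (L1_space \<Omega>)" and k: "0 \<le> k"
        and AE: "AE x in lebesgue_on \<Omega>. \<bar>f x\<bar> \<le> k * \<bar>g x\<bar>" for f g k
    proof -
      have "(\<integral>x. \<bar>f x\<bar> \<partial>lebesgue_on \<Omega>) \<le> (\<integral>x. k * \<bar>g x\<bar> \<partial>lebesgue_on \<Omega>)"
        using f g AE by (intro integral_mono_AE) auto
      then show ?thesis
        by simp
    qed
  qed (use op in \<open>auto simp: plus_fun_def scaleR_fun_def zero_fun_def abs_mult intro: AE_I2 elim: eventually_elim2\<close>)
qed

text \<open>Joint measurability suffices for values in L_1. Strong measurability holds for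
  indicators of rectangles, extends to Borel sets by a Dynkin argument and to simple functions by
  linearity; general u are reached by dominated convergence in x at almost every mass.\<close>

lemma L1_strongly_measurable:
  fixes u :: "'a::euclidean_space \<times> real \<Rightarrow> real"
  assumes op: "open \<Omega>" and u: "u \<in> borel_measurable (lebesgue_on (\<Omega> \<times> {0..}))"
    and int: "AE m in lebesgue_on {0..}. integrable (lebesgue_on \<Omega>) (sect u m)"
  shows "fibre_space.SM (L1_space \<Omega>) (sect u)"
proof -
  interpret fibre_space "L1_space \<Omega>" \<Omega>
    by (rule L1_fibre_space[OF op])
  have carr: "carr (L1_space \<Omega>) = {f. integrable (lebesgue_on \<Omega>) f}"
    and snorm: "snorm (L1_space \<Omega>) f = (\<integral>x. \<bar>f x\<bar> \<partial>lebesgue_on \<Omega>)" for f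
    by (simp_all add: L1_space_def)
  have SM_0: "SM (\<lambda>_. 0)"
    by (rule simple_in_SM) (simp add: simple_in_def image_subset_iff)
  \<comment> \<open>Balls have finite measure, so multiplying by b k makes the sections of every
    Borel set integrable.\<close>
  define b where "b k = (indicator (ball 0 (real k)) :: 'a \<Rightarrow> real)" for k
  have b_int: "integrable (lebesgue_on \<Omega>) (b k)" for k
  proof -
    have "emeasure (lebesgue_on \<Omega>) (ball 0 (real k) \<inter> \<Omega>) < \<infinity>"
      using op emeasure_bounded_finite[of "ball 0 (real k) \<inter> \<Omega>"]
      by (simp add: emeasure_restrict_space bounded_Int)
    then have "integrable (lebesgue_on \<Omega>) (indicator (ball 0 (real k) \<inter> \<Omega>) :: 'a \<Rightarrow> real)"
      using op by (intro integrable_real_indicator) (auto simp: sets_restrict_space_iff)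
    moreover have "integrable (lebesgue_on \<Omega>) (indicator (ball 0 (real k) \<inter> \<Omega>) :: 'a \<Rightarrow> real)
        \<longleftrightarrow> integrable (lebesgue_on \<Omega>) (b k)"
      by (rule Bochner_Integration.integrable_cong) (auto simp: b_def indicator_def)
    ultimately show ?thesis
      by blast
  qed
  have sub: "(\<lambda>x. f x * b k x) \<in> carr (L1_space \<Omega>)"
    if f: "f \<in> borel_measurable borel" and "!!x. \<bar>f x\<bar> \<le> K" for f :: "'a \<Rightarrow> real" and k K
  proof -
    have [measurable]: "f \<in> borel_measurable (lebesgue_on \<Omega>)"
      using f by (intro measurable_restrict_space1 measurable_completion) simp
    note [measurable] = borel_measurable_integrable[OF b_int]
    have "integrable (lebesgue_on \<Omega>) (\<lambda>x. K * b k x)"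
      using b_int by simp
    then have "integrable (lebesgue_on \<Omega>) (\<lambda>x. f x * b k x)"
    proof (rule Bochner_Integration.integrable_bound)
      show "(\<lambda>x. f x * b k x) \<in> borel_measurable (lebesgue_on \<Omega>)"
        by measurable
      have "\<bar>f x * b k x\<bar> \<le> \<bar>K * b k x\<bar>" for x
        using that(2)[of x] by (simp add: b_def indicator_def)
      then show "AE x in lebesgue_on \<Omega>. norm (f x * b k x) \<le> norm (K * b k x)"
        by (intro AE_I2) simp
    qed
    then show ?thesis
      by (simp add: carr)
  qed
  have ind: "SM (\<lambda>m x. indicator A (x, m) * b k x)"
    if A: "A \<in> sets borel" for A :: "('a \<times> real) set" and k
  proof -
    let ?P = "\<lambda>A. \<forall>k. SM (\<lambda>m x. indicator A (x, m) * b k x)"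
    let ?G = "{F \<times> S | F S. F \<in> sets (borel :: 'a measure) \<and> S \<in> sets (borel :: real measure)}"
    have sec: "(\<lambda>x. indicator A (x, m)) \<in> borel_measurable borel"
      if "A \<in> sigma_sets UNIV ?G" for m :: real and A
    proof -
      have "A \<in> sets (borel \<Otimes>\<^sub>M borel)"
        using that by (simp add: sets_pair_measure)
      then have [measurable]: "A \<in> sets borel"
        by (metis borel_prod)
      show ?thesis
        by measurable
    qed
    have secC: "(\<lambda>x. indicator A (x, m) * b k x) \<in> carr (L1_space \<Omega>)"
      if "A \<in> sigma_sets UNIV ?G" for m :: real and A k
      by (rule sub[where K = 1, OF sec[OF that]]) (simp add: indicator_def)
    have "A \<in> sets (borel \<Otimes>\<^sub>M borel)"
      using A by (metis borel_prod)
    then have AG: "A \<in> sigma_sets UNIV ?G"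
      by (simp add: sets_pair_measure)
    have Gpow: "?G \<subseteq> Pow UNIV"
      by simp
    from AG have "?P A"
    \<comment> \<open>Complements are differences from the constant map b k; disjoint unions are
      limits of finite sums, with b k as dominating function.\<close>
    proof (induction rule: sigma_sets_induct_disjoint[OF Int_stable_pair_measure_generator Gpow, consumes 1, case_names basic empty compl union])
      case (basic A)
      then obtain F S where A: "A = F \<times> S" and [measurable]: "F \<in> sets borel" "S \<in> sets borel"
        by auto
      show ?case
      proof
        fix k
        let ?f = "\<lambda>x. indicator F x * b k x"
        have f: "?f \<in> carr (L1_space \<Omega>)"
          by (rule sub[where K = 1]) (auto simp: indicator_def)
        have "S \<inter> {0..} \<in> sets \<M>"
          by (simp add: sets_restrict_space_iff)
        then have "simple_function \<M> (indicator (S \<inter> {0..}) :: real \<Rightarrow> real)"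
          by (rule simple_function_indicator)
        from simple_function_compose1[OF this, of "\<lambda>t::real. t *\<^sub>R ?f"]
        have "simple_in (\<lambda>m. indicator (S \<inter> {0..}) m *\<^sub>R ?f)"
          using f unfolding simple_in_def by auto
        from simple_in_SM[OF this] have S: "SM (\<lambda>m. indicator (S \<inter> {0..}) m *\<^sub>R ?f)" .
        show "SM (\<lambda>m x. indicator A (x, m) * b k x)"
        proof (rule SM_limit[OF S])
          have eq: "(\<lambda>x. indicator A (x, m) * b k x) = indicator (S \<inter> {0..}) m *\<^sub>R ?f" if "0 \<le> m" for m
            using that by (auto simp: A indicator_def fun_eq_iff)
          show "AE m in \<M>. (\<lambda>x. indicator A (x, m) * b k x) \<in> carr (L1_space \<Omega>)"
            using f eq by (intro AE_nonneg_mass) auto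
          show "AE m in \<M>. (\<lambda>n. snorm (L1_space \<Omega>) (indicator (S \<inter> {0..}) m *\<^sub>R ?f - (\<lambda>x. indicator A (x, m) * b k x))) \<longlonglongrightarrow> 0"
            using eq by (intro AE_nonneg_mass) simp
        qed
      qed
    next
      case empty
      show ?case
        using SM_0 by (simp add: zero_fun_def)
    next
      case (compl A)
      show ?case
      proof
        fix k
        have "SM (\<lambda>m. (\<lambda>x. b k x))"
        proof (rule simple_in_SM)
          have "b k \<in> carr (L1_space \<Omega>)"
            using b_int by (simp add: carr)
          then show "simple_in (\<lambda>m. (\<lambda>x. b k x))"
            by (auto simp: simple_in_def)
        qed
        from SM_diff[OF this compl.IH[rule_format, of k]]
        have "SM (\<lambda>m. (\<lambda>x. b k x) - (\<lambda>x. indicator A (x, m) * b k x))" .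
        moreover have "(\<lambda>x. b k x) - (\<lambda>x. indicator A (x, m) * b k x) = (\<lambda>x. indicator (UNIV - A) (x, m) * b k x)" for m
          by (auto simp: indicator_def fun_eq_iff)
        ultimately show "SM (\<lambda>m x. indicator (UNIV - A) (x, m) * b k x)"
          by simp
      qed
    next
      case (union A)
      show ?case
      proof
        fix k
        have UA: "(\<Union>i<n. A i) \<in> sigma_sets UNIV ?G" "(\<Union>i. A i) \<in> sigma_sets UNIV ?G" for n
        proof -
          interpret sigma_algebra UNIV "sigma_sets UNIV ?G"
            by (rule sigma_algebra_sigma_sets) auto
          show "(\<Union>i<n. A i) \<in> sigma_sets UNIV ?G" "(\<Union>i. A i) \<in> sigma_sets UNIV ?G"
            using union(2) by auto
        qed
        have fin: "SM (\<lambda>m x. indicator (\<Union>i<n. A i) (x, m) * b k x)" for n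
        proof (induction n)
          case 0
          show ?case
            using SM_0 by (simp add: zero_fun_def)
        next
          case (Suc n)
          have dis: "y \<notin> A i" if "y \<in> A n" "i < n" for i y
            using union(1) that unfolding disjoint_family_on_def by (metis IntI UNIV_I empty_iff less_irrefl)
          have "indicator (\<Union>i<Suc n. A i) y = (indicator (\<Union>i<n. A i) y + indicator (A n) y :: real)" for y
            using dis[of y] by (auto simp: indicator_def lessThan_Suc)
          then have "(\<lambda>x. indicator (\<Union>i<Suc n. A i) (x, m) * b k x) =
              1 *\<^sub>R (\<lambda>x. indicator (\<Union>i<n. A i) (x, m) * b k x) + 1 *\<^sub>R (\<lambda>x. indicator (A n) (x, m) * b k x)" for m
            by (simp add: fun_eq_iff distrib_right)
          then show ?case
            using SM_lin[OF Suc union(3)[of n, rule_format, of k], of 1 1] by simp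
        qed
        show "SM (\<lambda>m x. indicator (\<Union>i. A i) (x, m) * b k x)"
        proof (rule SM_limit[OF fin])
          show "AE m in \<M>. (\<lambda>x. indicator (\<Union>i. A i) (x, m) * b k x) \<in> carr (L1_space \<Omega>)"
            using secC[OF UA(2)] by simp
          show "AE m in \<M>. (\<lambda>n. snorm (L1_space \<Omega>)
              ((\<lambda>x. indicator (\<Union>i<n. A i) (x, m) * b k x) - (\<lambda>x. indicator (\<Union>i. A i) (x, m) * b k x))) \<longlonglongrightarrow> 0"
          proof (rule AE_I2)
            fix m
            have "(\<lambda>n. \<integral>x. \<bar>indicator (\<Union>i<n. A i) (x, m) * b k x - indicator (\<Union>i. A i) (x, m) * b k x\<bar> \<partial>lebesgue_on \<Omega>)
                \<longlonglongrightarrow> (\<integral>x. 0 \<partial>lebesgue_on \<Omega>)"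
            proof (rule integral_dominated_convergence[OF _ _ b_int[of k]])
              note [measurable] = borel_measurable_integrable[OF secC[OF UA(1), unfolded carr mem_Collect_eq]]
                borel_measurable_integrable[OF secC[OF UA(2), unfolded carr mem_Collect_eq]]
              show "(\<lambda>x. \<bar>indicator (\<Union>i<n. A i) (x, m) * b k x - indicator (\<Union>i. A i) (x, m) * b k x\<bar>)
                  \<in> borel_measurable (lebesgue_on \<Omega>)" for n
                by measurable
              show "AE x in lebesgue_on \<Omega>. (\<lambda>n. \<bar>indicator (\<Union>i<n. A i) (x, m) * b k x - indicator (\<Union>i. A i) (x, m) * b k x\<bar>) \<longlonglongrightarrow> 0"
              proof (rule AE_I2)
                fix x
                have "(\<lambda>n. indicator (\<Union>i<n. A i) (x, m) :: real) \<longlonglongrightarrow> indicator (\<Union>i. A i) (x, m)"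
                  by (rule LIMSEQ_indicator_UN)
                then have "(\<lambda>n. \<bar>indicator (\<Union>i<n. A i) (x, m) * b k x - indicator (\<Union>i. A i) (x, m) * b k x\<bar>)
                    \<longlonglongrightarrow> \<bar>indicator (\<Union>i. A i) (x, m) * b k x - indicator (\<Union>i. A i) (x, m) * b k x\<bar>"
                  by (intro tendsto_intros)
                then show "(\<lambda>n. \<bar>indicator (\<Union>i<n. A i) (x, m) * b k x - indicator (\<Union>i. A i) (x, m) * b k x\<bar>) \<longlonglongrightarrow> 0"
                  by simp
              qed
              show "AE x in lebesgue_on \<Omega>. norm \<bar>indicator (\<Union>i<n. A i) (x, m) * b k x - indicator (\<Union>i. A i) (x, m) * b k x\<bar> \<le> b k x" for n
                by (intro AE_I2) (auto simp: indicator_def b_def)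
            qed simp
            then show "(\<lambda>n. snorm (L1_space \<Omega>)
              ((\<lambda>x. indicator (\<Union>i<n. A i) (x, m) * b k x) - (\<lambda>x. indicator (\<Union>i. A i) (x, m) * b k x))) \<longlonglongrightarrow> 0"
              by (simp add: snorm)
          qed
        qed
      qed
    qed
    then show ?thesis
      by blast
  qed
  have \<Omega>M: "\<Omega> \<times> {0::real..} \<in> sets borel"
    by (rule Times_borel) auto
  obtain u' where u': "u' \<in> borel_measurable borel" "AE z in lborel. z \<in> \<Omega> \<times> {0..} --> u z = u' z"
    using borel_version[OF \<Omega>M u] .
  \<comment> \<open>The bound by 2 |u'| makes 3 |u| a dominating function for the errors.\<close>
  obtain s where s: "!!k. simple_function borel (s k)" "!!z. (\<lambda>k. s k z) \<longlonglongrightarrow> u' z"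
    and s_le: "!!k z. \<bar>s k z\<bar> \<le> 2 * \<bar>u' z\<bar>"
    using borel_measurable_implies_sequence_metric[OF u'(1), of 0] by (auto simp: dist_real_def)
  have s_SM: "SM (\<lambda>m x. s k (x, m) * b k x)" for k
  proof -
    have fin: "finite (range (s k))" and pre: "s k -` {y} \<in> sets borel" for y
      using simple_functionD(1)[OF s(1)[of k]] simple_functionD(2)[OF s(1)[of k], of "{y}"] by simp_all
    have "SM (\<lambda>m x. \<Sum>y\<in>Y. y * (indicator (s k -` {y}) (x, m) * b k x))" if "finite Y" for Y
      using that
    proof induction
      case empty
      show ?case
        using SM_0 by (simp add: zero_fun_def)
    next
      case (insert y Y)
      have "(\<lambda>m x. \<Sum>y\<in>insert y Y. y * (indicator (s k -` {y}) (x, m) * b k x))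
          = (\<lambda>m. y *\<^sub>R (\<lambda>x. indicator (s k -` {y}) (x, m) * b k x)
              + 1 *\<^sub>R (\<lambda>x. \<Sum>y\<in>Y. y * (indicator (s k -` {y}) (x, m) * b k x)))"
        using insert(1,2) by (simp add: fun_eq_iff scaleR_fun_apply)
      then show ?case
        using SM_lin[OF ind[OF pre[of y], of k] insert(3), where c = y and d = 1] by simp
    qed
    from this[OF fin] have "SM (\<lambda>m x. \<Sum>y\<in>range (s k). y * (indicator (s k -` {y}) (x, m) * b k x))" .
    moreover have "(\<lambda>m x. \<Sum>y\<in>range (s k). y * (indicator (s k -` {y}) (x, m) * b k x)) = (\<lambda>m x. s k (x, m) * b k x)"
    proof (intro ext)
      fix m x
      have "(\<Sum>y\<in>range (s k). y * (indicator (s k -` {y}) (x, m) * b k x))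
          = (\<Sum>y\<in>range (s k). if y = s k (x, m) then y * b k x else 0)"
        by (intro sum.cong) (auto simp: indicator_def)
      then show "(\<Sum>y\<in>range (s k). y * (indicator (s k -` {y}) (x, m) * b k x)) = s k (x, m) * b k x"
        using fin by (simp add: sum.delta')
    qed
    ultimately show ?thesis
      by simp
  qed
  have eq: "AE m in \<M>. AE x in lebesgue_on \<Omega>. u (x, m) = u' (x, m)"
  proof -
    have "AE z in lebesgue_on (\<Omega> \<times> {0..}). u z = u' z"
      using u'(2) \<Omega>M by (simp add: AE_lebesgue_on_iff)
    then show ?thesis
      by (intro AE_lebesgue_on_Times(2)) auto
  qed
  show ?thesis
  proof (rule SM_limit[OF s_SM])
    show "AE m in \<M>. sect u m \<in> carr (L1_space \<Omega>)"
      using int by (simp add: carr)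
    show "AE m in \<M>. (\<lambda>k. snorm (L1_space \<Omega>) ((\<lambda>x. s k (x, m) * b k x) - sect u m)) \<longlonglongrightarrow> 0"
      using eq int
    proof eventually_elim
      case (elim m)
      have "(\<lambda>k. \<integral>x. \<bar>s k (x, m) * b k x - sect u m x\<bar> \<partial>lebesgue_on \<Omega>) \<longlonglongrightarrow> (\<integral>x. 0 \<partial>lebesgue_on \<Omega>)"
      proof (rule integral_dominated_convergence[where w = "\<lambda>x. 3 * \<bar>sect u m x\<bar>"])
        show "integrable (lebesgue_on \<Omega>) (\<lambda>x. 3 * \<bar>sect u m x\<bar>)"
          using elim(2) by simp
        note [measurable] = borel_measurable_integrable[OF elim(2)] borel_measurable_integrable[OF b_int]
        have [measurable]: "(\<lambda>x. s k (x, m)) \<in> borel_measurable (lebesgue_on \<Omega>)" for k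
        proof -
          have [measurable]: "s k \<in> borel_measurable borel"
            by (rule borel_measurable_simple_function[OF s(1)])
          have "(\<lambda>x. s k (x, m)) \<in> borel_measurable borel"
            by measurable
          then show ?thesis
            by (intro measurable_restrict_space1 measurable_completion) simp
        qed
        show "(\<lambda>x. \<bar>s k (x, m) * b k x - sect u m x\<bar>) \<in> borel_measurable (lebesgue_on \<Omega>)" for k
          by measurable
        show "AE x in lebesgue_on \<Omega>. (\<lambda>k. \<bar>s k (x, m) * b k x - sect u m x\<bar>) \<longlonglongrightarrow> 0"
          using elim(1)
        proof eventually_elim
          case (elim x)
          have "\<forall>\<^sub>F k in sequentially. b k x = 1"
            using eventually_gt_at_top[of "nat \<lceil>norm x\<rceil>"]
          proof eventually_elim
            case (elim k)
            have "norm x \<le> real (nat \<lceil>norm x\<rceil>)"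
              by (rule real_nat_ceiling_ge)
            also have "\<dots> < real k"
              using elim by simp
            finally show ?case
              by (simp add: b_def indicator_def)
          qed
          then have "(\<lambda>k. b k x) \<longlonglongrightarrow> 1"
            by (rule tendsto_eventually)
          then have "(\<lambda>k. \<bar>s k (x, m) * b k x - u (x, m)\<bar>) \<longlonglongrightarrow> \<bar>u' (x, m) * 1 - u (x, m)\<bar>"
            by (intro tendsto_intros s)
          then show ?case
            using elim by (simp add: sect_apply)
        qed
        show "AE x in lebesgue_on \<Omega>. norm \<bar>s k (x, m) * b k x - sect u m x\<bar> \<le> 3 * \<bar>sect u m x\<bar>" for k
          using elim(1)
        proof eventually_elim
          case (elim x)
          have "\<bar>s k (x, m) * b k x\<bar> \<le> 2 * \<bar>u' (x, m)\<bar>"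
            using s_le[of k "(x, m)"] by (auto simp: b_def indicator_def)
          then show ?case
            using elim by (simp add: sect_apply)
        qed
      qed simp
      then show ?case
        by (simp add: snorm)
    qed
  qed
qed

text \<open>Triples are grouped as (x, (m, s)), while the conclusion fixes (x, m) and lets s vary.
  The measure f p of the section of a Borel null set is a Borel function of p = (x, m); it vanishes
  for almost every x and then almost every m, hence for almost every pair.\<close>

lemma AE_lborel_triple:
  fixes R :: "'a::euclidean_space \<times> real \<times> real \<Rightarrow> bool"
  assumes "AE z in lborel. R z"
  shows "AE p in (lborel :: ('a \<times> real) measure). AE s in lborel. R (fst p, snd p, s)"
proof -
  obtain N where N: "{z. \<not> R z} \<subseteq> N" "N \<in> null_sets lborel"
    using assms unfolding eventually_ae_filter by auto
  then have [measurable]: "N \<in> sets borel"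
    by auto
  define f where "f p = (\<integral>\<^sup>+s. indicator N (fst p, snd p, s) \<partial>(lborel :: real measure))" for p :: "'a \<times> real"
  have f_meas: "f \<in> borel_measurable borel"
  proof -
    have "(\<lambda>q :: ('a \<times> real) \<times> real. (fst (fst q), snd (fst q), snd q)) \<in> borel_measurable borel"
      by (intro borel_measurable_continuous_onI continuous_intros)
    then have "(\<lambda>q :: ('a \<times> real) \<times> real. indicator N (fst (fst q), snd (fst q), snd q) :: ennreal) \<in> borel_measurable borel"
      by measurable
    then have "(\<lambda>q :: ('a \<times> real) \<times> real. indicator N (fst (fst q), snd (fst q), snd q) :: ennreal)
        \<in> borel_measurable (borel \<Otimes>\<^sub>M lborel)"
      by (simp add: borel_prod[symmetric] cong: measurable_cong_sets)
    from lborel.borel_measurable_nn_integral_fst[OF this] show ?thesis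
      by (simp add: f_def[abs_def])
  qed
  have "AE z in lborel. z \<notin> N"
    by (rule AE_not_in[OF N(2)])
  from AE_lborel_Pair(1)[OF this] have "AE x in lborel. AE y in lborel. (x, y) \<notin> N" .
  then have "AE x in lborel. AE m in lborel. f (x, m) = 0"
  proof eventually_elim
    case (elim x)
    from AE_lborel_Pair(1)[OF this] show ?case
    proof eventually_elim
      case (elim m)
      have "f (x, m) = (\<integral>\<^sup>+s. 0 \<partial>(lborel :: real measure))"
        unfolding f_def using elim by (intro nn_integral_cong_AE) (auto simp: indicator_def elim: eventually_mono)
      then show ?case
        by simp
    qed
  qed
  then have "AE p in lborel. f p = 0"
    using f_meas by (intro AE_lborel_PairI) measurable
  then show ?thesis
  proof eventually_elim
    case (elim p)
    have "(\<lambda>s. (fst p, snd p, s)) \<in> borel_measurable borel"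
      by (intro borel_measurable_continuous_onI continuous_intros)
    then have "(\<lambda>s. indicator N (fst p, snd p, s) :: ennreal) \<in> borel_measurable lborel"
      by measurable
    then have "AE s in lborel. indicator N (fst p, snd p, s) = (0 :: ennreal)"
      using elim by (simp add: f_def nn_integral_0_iff_AE)
    then show ?case
      by (rule eventually_mono) (use N(1) in \<open>auto simp: indicator_def split: if_splits\<close>)
  qed
qed

lemma AE_lborel_drop_middle:
  fixes R :: "'a::euclidean_space \<times> real \<Rightarrow> bool"
  assumes "AE z in lborel. R z"
  shows "AE z in (lborel :: ('a \<times> real \<times> real) measure). R (fst z, snd (snd z))"
proof -
  obtain N where N: "{z. \<not> R z} \<subseteq> N" "N \<in> null_sets lborel"
    using assms unfolding eventually_ae_filter by auto
  then have [measurable]: "N \<in> sets borel"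
    by auto
  have "AE z in lborel. z \<notin> N"
    by (rule AE_not_in[OF N(2)])
  from AE_lborel_Pair(1)[OF this] have "AE x in lborel. AE s in lborel. (x, s) \<notin> N" .
  then have *: "AE x in lborel. AE y in (lborel :: (real \<times> real) measure). (x, snd y) \<notin> N"
    by eventually_elim (rule AE_lborel_snd)
  have "AE z in (lborel :: ('a \<times> real \<times> real) measure). (fst z, snd (snd z)) \<notin> N"
  proof (rule AE_lborel_PairI)
    have "(\<lambda>z :: 'a \<times> real \<times> real. (fst z, snd (snd z))) \<in> borel_measurable borel"
      by (intro borel_measurable_continuous_onI continuous_intros)
    then show "Measurable.pred borel (\<lambda>z :: 'a \<times> real \<times> real. (fst z, snd (snd z)) \<notin> N)"
      by measurable
  qed (use * in simp)
  then show ?thesis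
    using N(1) by (auto elim!: eventually_mono)
qed

section \<open>The gain operator\<close>

lemma AE_lborel_PairI2:
  fixes Q :: "'a::euclidean_space \<times> 'b::euclidean_space \<Rightarrow> bool"
  assumes Q: "Measurable.pred borel Q" and AE: "AE y in lborel. AE x in lborel. Q (x, y)"
  shows "AE z in lborel. Q z"
proof (rule AE_lborel_PairI[OF Q])
  show "AE x in lborel. AE y in lborel. Q (x, y)"
  proof (subst lborel_pair.AE_commute)
    show "{z \<in> space (lborel \<Otimes>\<^sub>M lborel). Q (fst z, snd z)} \<in> sets (lborel \<Otimes>\<^sub>M lborel)"
      using Q unfolding lborel_prod by (simp add: pred_def)
  qed (rule AE)
qed

lemma lebesgue_integral_borel_version:
  fixes f f' :: "real \<Rightarrow> real"
  assumes f': "f' \<in> borel_measurable borel" and eq: "AE s in lborel. f s = f' s"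
  shows "integral\<^sup>L lebesgue f = integral\<^sup>L lborel f'" "integrable lebesgue f \<longleftrightarrow> integrable lborel f'"
    "(\<integral>\<^sup>+s. ennreal \<bar>f s\<bar> \<partial>lebesgue) = (\<integral>\<^sup>+s. ennreal \<bar>f' s\<bar> \<partial>lborel)"
proof -
  have m': "f' \<in> borel_measurable lborel"
    using f' by simp
  have eqL: "AE s in lebesgue. f s = f' s"
    using eq by (rule AE_completion)
  have m: "f \<in> borel_measurable lebesgue"
    using borel_measurable_lebesgue_onI[of UNIV f' f] f' eq by simp
  show "integral\<^sup>L lebesgue f = integral\<^sup>L lborel f'"
    using integral_cong_AE[OF m measurable_completion[OF m'] eqL] integral_completion[OF m'] by simp
  show "integrable lebesgue f \<longleftrightarrow> integrable lborel f'"
    using integrable_cong_AE[OF m measurable_completion[OF m'] eqL] integrable_completion[OF m'] by simp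
  have "(\<integral>\<^sup>+s. ennreal \<bar>f s\<bar> \<partial>lebesgue) = (\<integral>\<^sup>+s. ennreal \<bar>f' s\<bar> \<partial>lebesgue)"
    using eqL by (intro nn_integral_cong_AE) (auto elim: eventually_mono)
  then show "(\<integral>\<^sup>+s. ennreal \<bar>f s\<bar> \<partial>lebesgue) = (\<integral>\<^sup>+s. ennreal \<bar>f' s\<bar> \<partial>lborel)"
    by (simp add: nn_integral_completion)
qed

lemma gain_eq: "gain \<kappa> u (x, m) = (\<integral>s. indicator {m..} s * (\<kappa> x m s * u (x, s)) \<partial>lebesgue)"
  by (simp add: gain_def set_lebesgue_integral_def)

context bochner
begin

text \<open>The gain of the scalar function of fibre norms under a kernel k that does not depend on
  x. Values in the extended half-line let it be estimated before convergence is known.\<close>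

definition \<Phi> :: "(real \<times> real \<Rightarrow> real) \<Rightarrow> ('a \<times> real \<Rightarrow> real) \<Rightarrow> real \<Rightarrow> ennreal" where
  "\<Phi> k u m = (\<integral>\<^sup>+s. ennreal (k (m, s) * snorm X (sect u s)) * indicator {m..} s \<partial>lebesgue)"

definition abs_gain :: "('a \<Rightarrow> real \<Rightarrow> real \<Rightarrow> real) \<Rightarrow> ('a \<times> real \<Rightarrow> real) \<Rightarrow> 'a \<times> real \<Rightarrow> ennreal" where
  "abs_gain \<kappa> u p = (\<integral>\<^sup>+s. ennreal \<bar>indicator {snd p..} s * (\<kappa> (fst p) (snd p) s * u (fst p, s))\<bar> \<partial>lebesgue)"

lemma AE_half_line: "(AE m in \<M>. R m) \<longleftrightarrow> (AE m in lborel. 0 \<le> m --> R m)"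
  by (simp add: AE_lebesgue_on_iff)

lemma AE_domain: "(AE p in lebesgue_on (\<Omega> \<times> {0::real..}). R p) \<longleftrightarrow> (AE p in lborel. fst p \<in> \<Omega> \<and> 0 \<le> snd p --> R p)"
proof -
  have "\<Omega> \<times> {0::real..} \<in> sets borel"
    by (rule Times_borel) auto
  then show ?thesis
    by (simp add: AE_lebesgue_on_iff mem_Times_iff)
qed

lemma norm_version:
  assumes u: "u \<in> BV"
  obtains n where "n \<in> borel_measurable borel" "!!s. 0 \<le> n s" "AE s in lborel. 0 \<le> s --> snorm X (sect u s) = n s"
proof -
  obtain n where n: "n \<in> borel_measurable borel" "AE s in lborel. s \<in> {0..} --> snorm X (sect u s) = n s"
    using borel_version[OF half_line_borel SM_norm_measurable[OF BV_SM[OF u]]] .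
  have "AE s in lborel. 0 \<le> s --> sect u s \<in> carr X"
    using BV_sect[OF u] by (simp add: AE_half_line)
  with n(2) have "AE s in lborel. 0 \<le> s --> snorm X (sect u s) = max 0 (n s)"
  proof eventually_elim
    case (elim s)
    then show ?case
      using N_nonneg[of "sect u s"] by auto
  qed
  then show thesis
    using n(1) by (intro that[of "\<lambda>s. max 0 (n s)"]) auto
qed

lemma \<Phi>_version:
  assumes eq: "AE s in lborel. 0 \<le> s --> snorm X (sect u s) = n s" and "0 \<le> m"
    and [measurable]: "n \<in> borel_measurable borel" "k \<in> borel_measurable borel"
  shows "\<Phi> k u m = (\<integral>\<^sup>+s. ennreal (k (m, s) * n s) * indicator {m..} s \<partial>lborel)"
proof -
  have "\<Phi> k u m = (\<integral>\<^sup>+s. ennreal (k (m, s) * n s) * indicator {m..} s \<partial>lebesgue)"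
    unfolding \<Phi>_def using AE_completion[OF eq] \<open>0 \<le> m\<close>
    by (intro nn_integral_cong_AE) (auto simp: indicator_def elim!: eventually_mono)
  then show ?thesis
    by (simp add: nn_integral_completion)
qed

lemma BN_zeroI:
  assumes v: "v \<in> BV" and 0: "AE p in lborel. fst p \<in> \<Omega> \<and> 0 \<le> snd p --> v p = 0"
  shows "BN v = 0"
proof -
  have "AE p in lebesgue_on (\<Omega> \<times> {0..}). v p = 0"
    using 0 by (simp add: AE_domain)
  then have "AE m in \<M>. AE x in lebesgue_on \<Omega>. v (x, m) = 0"
    by (rule AE_lebesgue_on_Times(2)[rotated 2]) auto
  then have "AE m in \<M>. snorm X (sect v m) * w m = 0"
    using BV_sect[OF v]
  proof eventually_elim
    case (elim m)
    have "snorm X (sect v m) \<le> 0 * snorm X (sect v m)"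
      using elim by (intro snorm_bound) (auto simp: sect_apply elim!: eventually_mono)
    then show ?case
      using N_nonneg[OF elim(2)] by simp
  qed
  then have "BN v = (\<integral>m. 0 \<partial>\<M>)"
    unfolding BN_def using BV_int[OF v] by (intro integral_cong_AE) auto
  then show ?thesis
    by simp
qed

end

locale dominated_kernel = bochner X \<Omega> r
  for X :: "'a::euclidean_space fun_space" and \<Omega> :: "'a set" and r :: real +
  fixes \<kappa> :: "'a \<Rightarrow> real \<Rightarrow> real \<Rightarrow> real" and k :: "real \<times> real \<Rightarrow> real"
  assumes k_measurable: "k \<in> borel_measurable borel" and k_nonneg: "0 \<le> k z"
    and \<kappa>_measurable: "(\<lambda>z. \<kappa> (fst z) (fst (snd z)) (snd (snd z)))
      \<in> borel_measurable (lebesgue_on (\<Omega> \<times> {0..} \<times> {0..}))"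
    and \<kappa>_bounds: "AE z in lborel. fst z \<in> \<Omega> \<and> 0 \<le> fst (snd z) \<and> fst (snd z) \<le> snd (snd z) -->
      0 \<le> \<kappa> (fst z) (fst (snd z)) (snd (snd z)) \<and> \<kappa> (fst z) (fst (snd z)) (snd (snd z)) \<le> k (snd z)"
begin

text \<open>One exceptional set of pairs (x, m) outside of which the integrands of the gain and of
  its Borel version agree for almost every s; this is the form in which Fubini's theorem is applied
  below.\<close>

lemma kernel_version:
  fixes u :: "'a \<times> real \<Rightarrow> real"
  assumes u: "u \<in> borel_measurable (lebesgue_on (\<Omega> \<times> {0..}))"
  obtains \<kappa>' u' where "\<kappa>' \<in> borel_measurable borel" "u' \<in> borel_measurable borel"
    "AE p in lborel. fst p \<in> \<Omega> \<and> 0 \<le> snd p --> (AE s in lborel. snd p \<le> s -->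
       \<kappa> (fst p) (snd p) s = \<kappa>' (fst p, snd p, s) \<and> u (fst p, s) = u' (fst p, s))"
    "AE z in lborel. fst z \<in> \<Omega> \<and> 0 \<le> snd z --> u z = u' z"
    "\<forall>z. 0 \<le> \<kappa>' z \<and> \<kappa>' z \<le> k (snd z)"
proof -
  have S2: "\<Omega> \<times> {0::real..} \<in> sets borel" and S3: "\<Omega> \<times> {0::real..} \<times> {0::real..} \<in> sets borel"
    by (intro Times_borel; simp)+
  obtain u' where u': "u' \<in> borel_measurable borel" "AE z in lborel. z \<in> \<Omega> \<times> {0..} --> u z = u' z"
    using borel_version[OF S2 u] .
  obtain \<kappa>\<^sub>0 where \<kappa>\<^sub>0: "\<kappa>\<^sub>0 \<in> borel_measurable borel" "AE z in lborel. z \<in> \<Omega> \<times> {0..} \<times> {0..} -->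
      \<kappa> (fst z) (fst (snd z)) (snd (snd z)) = \<kappa>\<^sub>0 z"
    using borel_version[OF S3 \<kappa>_measurable] .
  \<comment> \<open>Truncation makes the bounds 0 and k hold everywhere and not only almost
    everywhere; it does not change the version where the kernel satisfies them.\<close>
  define \<kappa>' where "\<kappa>' z = min (max 0 (\<kappa>\<^sub>0 z)) (k (snd z))" for z
  have u'': "AE z in lborel. fst z \<in> \<Omega> \<and> 0 \<le> snd z --> u z = u' z"
    using u'(2) by (auto simp: mem_Times_iff elim!: eventually_mono)
  have "AE z in lborel. fst z \<in> \<Omega> \<and> 0 \<le> fst (snd z) \<and> fst (snd z) \<le> snd (snd z) -->
      \<kappa> (fst z) (fst (snd z)) (snd (snd z)) = \<kappa>' z \<and> u (fst z, snd (snd z)) = u' (fst z, snd (snd z))"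
    using \<kappa>\<^sub>0(2) \<kappa>_bounds AE_lborel_drop_middle[OF u'']
    by eventually_elim (auto simp: \<kappa>'_def mem_Times_iff)
  from AE_lborel_triple[OF this]
  have "AE p in lborel. fst p \<in> \<Omega> \<and> 0 \<le> snd p --> (AE s in lborel. snd p \<le> s -->
       \<kappa> (fst p) (snd p) s = \<kappa>' (fst p, snd p, s) \<and> u (fst p, s) = u' (fst p, s))"
    by (rule eventually_mono) (auto elim!: eventually_mono)
  moreover have "\<kappa>' \<in> borel_measurable borel"
  proof -
    note [measurable] = \<kappa>\<^sub>0(1) k_measurable
    have [measurable]: "snd \<in> borel_measurable (borel :: ('a \<times> real \<times> real) measure)"
      by (intro borel_measurable_continuous_onI continuous_intros)
    show ?thesis
      unfolding \<kappa>'_def by measurable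
  qed
  ultimately show thesis
    using that[of \<kappa>' u'] u'(1) u'' k_nonneg by (simp add: \<kappa>'_def)
qed

context
  fixes u :: "'a \<times> real \<Rightarrow> real" and \<kappa>' :: "'a \<times> real \<times> real \<Rightarrow> real" and u' :: "'a \<times> real \<Rightarrow> real"
  assumes \<kappa>': "\<kappa>' \<in> borel_measurable borel" and u': "u' \<in> borel_measurable borel"
    and eq: "AE p in lborel. fst p \<in> \<Omega> \<and> 0 \<le> snd p --> (AE s in lborel. snd p \<le> s -->
       \<kappa> (fst p) (snd p) s = \<kappa>' (fst p, snd p, s) \<and> u (fst p, s) = u' (fst p, s))"
begin

definition integrand :: "'a \<times> real \<Rightarrow> real \<Rightarrow> real" where
  "integrand p s = indicator {snd p..} s * (\<kappa>' (fst p, snd p, s) * u' (fst p, s))"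

lemma integrand_measurable: "(\<lambda>z. integrand (fst z) (snd z)) \<in> borel_measurable borel"
proof -
  have "(\<lambda>z :: ('a \<times> real) \<times> real. (fst (fst z), snd (fst z), snd z)) \<in> borel_measurable borel"
    and "(\<lambda>z :: ('a \<times> real) \<times> real. (fst (fst z), snd z)) \<in> borel_measurable borel"
    by (intro borel_measurable_continuous_onI continuous_intros)+
  note [measurable] = measurable_compose[OF this(1) \<kappa>'] measurable_compose[OF this(2) u']
  have "{z :: ('a \<times> real) \<times> real. snd (fst z) \<le> snd z} \<in> sets borel"
    by (intro borel_closed closed_Collect_le continuous_intros)
  then have [measurable]: "(\<lambda>z :: ('a \<times> real) \<times> real. indicator {snd (fst z)..} (snd z) :: real) \<in> borel_measurable borel"
    by (rule measurable_cong[THEN iffD1, rotated, OF borel_measurable_indicator]) (auto simp: indicator_def)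
  show ?thesis
    unfolding integrand_def by measurable
qed

lemma integrand_section: "integrand p \<in> borel_measurable borel"
proof -
  have "(\<lambda>s. (p, s)) \<in> borel_measurable borel"
    by (intro borel_measurable_continuous_onI continuous_intros)
  from measurable_compose[OF this integrand_measurable] show ?thesis
    by simp
qed

lemma integrand_eq:
  "AE p in lborel. fst p \<in> \<Omega> \<and> 0 \<le> snd p -->
    (AE s in lborel. indicator {snd p..} s * (\<kappa> (fst p) (snd p) s * u (fst p, s)) = integrand p s)"
  using eq by (rule eventually_mono) (auto simp: integrand_def indicator_def elim!: eventually_mono)

lemma gain_version:
  "AE p in lborel. fst p \<in> \<Omega> \<and> 0 \<le> snd p --> gain \<kappa> u p = (\<integral>s. integrand p s \<partial>lborel) \<and>
    abs_gain \<kappa> u p = (\<integral>\<^sup>+s. ennreal \<bar>integrand p s\<bar> \<partial>lborel) \<and>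
    (set_integrable lebesgue {snd p..} (\<lambda>s. \<kappa> (fst p) (snd p) s * u (fst p, s)) \<longleftrightarrow> integrable lborel (integrand p))"
  using integrand_eq
proof eventually_elim
  case (elim p)
  show ?case
    using lebesgue_integral_borel_version[OF integrand_section[of p], of "\<lambda>s. indicator {snd p..} s * (\<kappa> (fst p) (snd p) s * u (fst p, s))"]
      elim gain_eq[of \<kappa> u "fst p" "snd p"] by (auto simp: abs_gain_def set_integrable_def)
qed

lemma gain_integral_measurable: "(\<lambda>p. \<integral>s. integrand p s \<partial>lborel) \<in> borel_measurable borel"
  and abs_gain_integral_measurable: "(\<lambda>p. \<integral>\<^sup>+s. ennreal \<bar>integrand p s\<bar> \<partial>lborel) \<in> borel_measurable borel"
proof -
  have *: "(\<lambda>(p, s). integrand p s) \<in> borel_measurable (borel \<Otimes>\<^sub>M lborel)"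
    using integrand_measurable by (simp add: borel_prod[symmetric] case_prod_beta cong: measurable_cong_sets)
  show "(\<lambda>p. \<integral>s. integrand p s \<partial>lborel) \<in> borel_measurable borel"
    using lborel.borel_measurable_lebesgue_integral[OF *] .
  have "(\<lambda>(p, s). ennreal \<bar>integrand p s\<bar>) \<in> borel_measurable (borel \<Otimes>\<^sub>M lborel)"
    using * by (simp add: case_prod_beta)
  from lborel.borel_measurable_nn_integral[OF this]
  show "(\<lambda>p. \<integral>\<^sup>+s. ennreal \<bar>integrand p s\<bar> \<partial>lborel) \<in> borel_measurable borel" .
qed

end

lemma gain_measurable:
  assumes u: "u \<in> borel_measurable (lebesgue_on (\<Omega> \<times> {0..}))"
  shows "gain \<kappa> u \<in> borel_measurable (lebesgue_on (\<Omega> \<times> {0..}))"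
proof -
  obtain \<kappa>' u' where v: "\<kappa>' \<in> borel_measurable borel" "u' \<in> borel_measurable borel"
    "AE p in lborel. fst p \<in> \<Omega> \<and> 0 \<le> snd p --> (AE s in lborel. snd p \<le> s -->
       \<kappa> (fst p) (snd p) s = \<kappa>' (fst p, snd p, s) \<and> u (fst p, s) = u' (fst p, s))"
    and uu': "AE z in lborel. fst z \<in> \<Omega> \<and> 0 \<le> snd z --> u z = u' z"
    and \<kappa>'b: "\<forall>z. 0 \<le> \<kappa>' z \<and> \<kappa>' z \<le> k (snd z)"
    using kernel_version[OF u] .
  show ?thesis
  proof (rule borel_measurable_lebesgue_onI[OF _ gain_integral_measurable[OF v]])
    show "\<Omega> \<times> {0::real..} \<in> sets borel"
      by (rule Times_borel) auto
    show "AE p in lborel. p \<in> \<Omega> \<times> {0..} --> gain \<kappa> u p = (\<integral>s. integrand \<kappa>' u' p s \<partial>lborel)"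
      using gain_version[OF v] by (auto simp: mem_Times_iff elim!: eventually_mono)
  qed
qed

lemma gain_converges_abs:
  assumes u: "u \<in> borel_measurable (lebesgue_on (\<Omega> \<times> {0..}))"
  shows "AE p in lborel. fst p \<in> \<Omega> \<and> 0 \<le> snd p --> ennreal \<bar>gain \<kappa> u p\<bar> \<le> abs_gain \<kappa> u p \<and>
    (abs_gain \<kappa> u p < \<infinity> --> set_integrable lebesgue {snd p..} (\<lambda>s. \<kappa> (fst p) (snd p) s * u (fst p, s)))"
proof -
  obtain \<kappa>' u' where v: "\<kappa>' \<in> borel_measurable borel" "u' \<in> borel_measurable borel"
    "AE p in lborel. fst p \<in> \<Omega> \<and> 0 \<le> snd p --> (AE s in lborel. snd p \<le> s -->
       \<kappa> (fst p) (snd p) s = \<kappa>' (fst p, snd p, s) \<and> u (fst p, s) = u' (fst p, s))"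
    and uu': "AE z in lborel. fst z \<in> \<Omega> \<and> 0 \<le> snd z --> u z = u' z"
    and \<kappa>'b: "\<forall>z. 0 \<le> \<kappa>' z \<and> \<kappa>' z \<le> k (snd z)"
    using kernel_version[OF u] .
  show ?thesis
    using gain_version[OF v]
  proof eventually_elim
    case (elim p)
    have *: "integrable lborel (integrand \<kappa>' u' p)" if "(\<integral>\<^sup>+s. ennreal \<bar>integrand \<kappa>' u' p s\<bar> \<partial>lborel) < \<infinity>"
      using that integrand_section[OF v, of p] by (intro integrableI_bounded) auto
    have "ennreal \<bar>\<integral>s. integrand \<kappa>' u' p s \<partial>lborel\<bar> \<le> (\<integral>\<^sup>+s. ennreal \<bar>integrand \<kappa>' u' p s\<bar> \<partial>lborel)"
      using integral_norm_bound_ennreal[of lborel "integrand \<kappa>' u' p"] not_integrable_integral_eq[of lborel "integrand \<kappa>' u' p"]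
      by (cases "integrable lborel (integrand \<kappa>' u' p)") auto
    with elim * show ?case
      by auto
  qed
qed

end

text \<open>
  The bound \<open>\<Phi>\<close> of the fibre norms of the gain is proved separately for the two fibre spaces.
\<close>

locale gain_operator = transport_loss X \<Omega> r F G c \<alpha>\<^sub>1 \<alpha>\<^sub>2 M + dominated_kernel X \<Omega> r \<kappa> k
  for X :: "'a::euclidean_space fun_space" and \<Omega> r F G c \<alpha>\<^sub>1 \<alpha>\<^sub>2 M \<kappa> k +
  fixes q \<omega> :: real
  assumes mass: "AE s in lborel. 0 \<le> s -->
      (\<integral>\<^sup>+m. ennreal (k (m, s) * w m) * indicator {0..s} m \<partial>lborel) \<le> ennreal ((q * \<alpha>\<^sub>1 s + \<omega>) * w s)"
    and q: "0 \<le> q" "q < 1" and \<omega>: "0 \<le> \<omega>"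
    and fibre_bound_finite: "u \<in> BV ==> (AE m in \<M>. \<Phi> k u m < \<infinity>) ==>
      AE p in lborel. fst p \<in> \<Omega> \<and> 0 \<le> snd p --> abs_gain \<kappa> u p < \<infinity>"
    and fibre_bound: "u \<in> BV ==>
      AE m in \<M>. sect (gain \<kappa> u) m \<in> carr X --> ennreal (snorm X (sect (gain \<kappa> u) m)) \<le> \<Phi> k u m"
begin

text \<open>Tonelli on the triangle 0 \<le> m \<le> s: with s outside, the inner integral over the
  fragment masses m is exactly what \<open>mass\<close> bounds, and the two parts of this bound
  integrate to L and the norm.\<close>

lemma \<Phi>_integral:
  assumes u: "u \<in> DC"
  shows "(\<integral>\<^sup>+m. \<Phi> k u m * ennreal (w m) \<partial>\<M>) \<le> ennreal (q * L u + \<omega> * BN u)"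
    "(\<lambda>m. \<Phi> k u m) \<in> borel_measurable \<M>"
proof -
  have uV: "u \<in> BV"
    by (rule DC_D(1)[OF u])
  obtain n where n [measurable]: "n \<in> borel_measurable borel" and n0: "!!s. 0 \<le> n s"
    and n_eq: "AE s in lborel. 0 \<le> s --> snorm X (sect u s) = n s"
    using norm_version[OF uV] by blast
  note [measurable] = k_measurable
  have [measurable]: "w \<in> borel_measurable borel"
    unfolding w_def by measurable
  define h where "h m s = ennreal (k (m, s) * n s * w m) * (indicator {0..s} m)" for m s :: real
  have h_meas: "(\<lambda>(m, s). h m s) \<in> borel_measurable (lborel \<Otimes>\<^sub>M lborel)"
  proof -
    have "{z :: real \<times> real. 0 \<le> fst z \<and> fst z \<le> snd z} \<in> sets borel"
      by (intro borel_closed closed_Collect_conj closed_Collect_le continuous_intros)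
    then have "(\<lambda>z. ennreal (k z * n (snd z) * w (fst z)) * indicator {z. 0 \<le> fst z \<and> fst z \<le> snd z} z) \<in> borel_measurable (borel \<Otimes>\<^sub>M borel)"
      by (simp add: borel_prod)
        (intro borel_measurable_times_ennreal borel_measurable_indicator measurable_compose[OF _ measurable_ennreal]
          borel_measurable_times k_measurable measurable_compose[OF _ n] measurable_compose[OF _ \<open>w \<in> borel_measurable borel\<close>]
          borel_measurable_continuous_onI continuous_intros)
    moreover have "(\<lambda>(m, s). h m s) = (\<lambda>z. ennreal (k z * n (snd z) * w (fst z)) * indicator {z. 0 \<le> fst z \<and> fst z \<le> snd z} z)"
      by (auto simp: h_def fun_eq_iff indicator_def)
    ultimately show ?thesis
      by (simp cong: measurable_cong_sets)
  qed
  have \<Phi>_eq: "\<Phi> k u m = (\<integral>\<^sup>+s. ennreal (k (m, s) * n s) * indicator {m..} s \<partial>lborel)" if "0 \<le> m" for m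
    by (rule \<Phi>_version[OF n_eq that]) measurable
  have \<Phi>w: "\<Phi> k u m * ennreal (w m) = (\<integral>\<^sup>+s. h m s \<partial>lborel)" if "0 \<le> m" for m
  proof -
    have sec: "(\<lambda>s. ennreal (k (m, s) * n s) * indicator {m..} s) \<in> borel_measurable lborel"
      by measurable
    have "\<Phi> k u m * ennreal (w m) = (\<integral>\<^sup>+s. ennreal (k (m, s) * n s) * indicator {m..} s * ennreal (w m) \<partial>lborel)"
      unfolding \<Phi>_eq[OF that] using sec by (rule nn_integral_multc[symmetric])
    also have "\<dots> = (\<integral>\<^sup>+s. h m s \<partial>lborel)"
      using that k_nonneg n0 less_imp_le[OF w_pos]
      by (intro nn_integral_cong) (auto simp: h_def indicator_def ennreal_mult)
    finally show ?thesis .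
  qed
  have swap: "(\<integral>\<^sup>+m. (\<integral>\<^sup>+s. h m s \<partial>lborel) \<partial>lborel) = (\<integral>\<^sup>+s. (\<integral>\<^sup>+m. h m s \<partial>lborel) \<partial>lborel)"
    using lborel_pair.Fubini[OF h_meas] by simp
  have "(\<integral>\<^sup>+m. \<Phi> k u m * ennreal (w m) \<partial>\<M>) = (\<integral>\<^sup>+m. \<Phi> k u m * ennreal (w m) * indicator {0..} m \<partial>lebesgue)"
    by (simp add: nn_integral_restrict_space)
  also have "\<dots> = (\<integral>\<^sup>+m. (\<integral>\<^sup>+s. h m s \<partial>lborel) \<partial>lebesgue)"
  proof (rule nn_integral_cong)
    fix m :: real
    show "\<Phi> k u m * ennreal (w m) * indicator {0..} m = (\<integral>\<^sup>+s. h m s \<partial>lborel)"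
    proof (cases "0 \<le> m")
      case True
      then show ?thesis
        using \<Phi>w[OF True] by simp
    next
      case False
      then have "h m s = 0" for s
        by (simp add: h_def)
      then show ?thesis
        using False by simp
    qed
  qed
  also have "\<dots> = (\<integral>\<^sup>+s. (\<integral>\<^sup>+m. h m s \<partial>lborel) \<partial>lborel)"
    by (simp add: nn_integral_completion swap)
  also have "\<dots> \<le> (\<integral>\<^sup>+s. ennreal (q * (\<alpha>\<^sub>1 s * (snorm X (sect u s) * w s)) + \<omega> * (snorm X (sect u s) * w s)) * indicator {0..} s \<partial>lborel)"
  proof (rule nn_integral_mono_AE)
    show "AE s in lborel. (\<integral>\<^sup>+m. h m s \<partial>lborel) \<le>
        ennreal (q * (\<alpha>\<^sub>1 s * (snorm X (sect u s) * w s)) + \<omega> * (snorm X (sect u s) * w s)) * indicator {0..} s"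
      using mass n_eq
    proof eventually_elim
      case (elim s)
      show ?case
      proof (cases "0 \<le> s")
        case True
        have sec: "(\<lambda>m. ennreal (k (m, s) * w m) * indicator {0..s} m) \<in> borel_measurable lborel"
          by measurable
        have "(\<integral>\<^sup>+m. h m s \<partial>lborel) = (\<integral>\<^sup>+m. ennreal (n s) * (ennreal (k (m, s) * w m) * indicator {0..s} m) \<partial>lborel)"
          using k_nonneg n0 less_imp_le[OF w_pos]
          by (intro nn_integral_cong) (auto simp: h_def indicator_def ennreal_mult[symmetric] ac_simps)
        also have "\<dots> = ennreal (n s) * (\<integral>\<^sup>+m. ennreal (k (m, s) * w m) * indicator {0..s} m \<partial>lborel)"
          using sec by (rule nn_integral_cmult)
        also have "\<dots> \<le> ennreal (n s) * ennreal ((q * \<alpha>\<^sub>1 s + \<omega>) * w s)"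
          using elim True by (intro mult_left_mono) auto
        also have "\<dots> = ennreal (q * (\<alpha>\<^sub>1 s * (snorm X (sect u s) * w s)) + \<omega> * (snorm X (sect u s) * w s))"
          using elim True n0[of s] by (simp add: ennreal_mult'[symmetric] algebra_simps)
        finally show ?thesis
          using True by simp
      next
        case False
        then have "h m s = 0" for m
          by (simp add: h_def)
        then show ?thesis
          by simp
      qed
    qed
  qed
  also have "\<dots> = (\<integral>\<^sup>+s. ennreal (q * (\<alpha>\<^sub>1 s * (snorm X (sect u s) * w s)) + \<omega> * (snorm X (sect u s) * w s)) \<partial>\<M>)"
    by (simp add: nn_integral_restrict_space nn_integral_completion)
  also have "\<dots> = ennreal (\<integral>s. q * (\<alpha>\<^sub>1 s * (snorm X (sect u s) * w s)) + \<omega> * (snorm X (sect u s) * w s) \<partial>\<M>)"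
  proof (rule nn_integral_eq_integral)
    show "integrable \<M> (\<lambda>s. q * (\<alpha>\<^sub>1 s * (snorm X (sect u s) * w s)) + \<omega> * (snorm X (sect u s) * w s))"
      using L_integrable[OF u] BV_int[OF uV] by simp
    show "AE s in \<M>. 0 \<le> q * (\<alpha>\<^sub>1 s * (snorm X (sect u s) * w s)) + \<omega> * (snorm X (sect u s) * w s)"
      using \<alpha>_bounds norm_sect_nonneg[OF uV] by eventually_elim (use q \<omega> in auto)
  qed
  also have "(\<integral>s. q * (\<alpha>\<^sub>1 s * (snorm X (sect u s) * w s)) + \<omega> * (snorm X (sect u s) * w s) \<partial>\<M>) = q * L u + \<omega> * BN u"
    using L_integrable[OF u] BV_int[OF uV] by (simp add: L_def BN_def)
  finally show "(\<integral>\<^sup>+m. \<Phi> k u m * ennreal (w m) \<partial>\<M>) \<le> ennreal (q * L u + \<omega> * BN u)" .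
  have "(\<lambda>m. \<integral>\<^sup>+s. ennreal (k (m, s) * n s) * indicator {m..} s \<partial>lborel) \<in> borel_measurable borel"
  proof -
    have "(\<lambda>m. (\<integral>\<^sup>+s. h' m s \<partial>lborel)) \<in> borel_measurable borel"
      if "(\<lambda>(m, s). h' m s) \<in> borel_measurable (borel \<Otimes>\<^sub>M lborel)" for h' :: "real \<Rightarrow> real \<Rightarrow> ennreal"
      using lborel.borel_measurable_nn_integral[OF that] .
    moreover have "(\<lambda>(m, s). ennreal (k (m, s) * n s) * indicator {m..} s) \<in> borel_measurable (borel \<Otimes>\<^sub>M lborel)"
    proof -
      have "{z :: real \<times> real. fst z \<le> snd z} \<in> sets borel"
        by (intro borel_closed closed_Collect_le continuous_intros)
      then have "(\<lambda>z. ennreal (k z * n (snd z)) * indicator {z. fst z \<le> snd z} z) \<in> borel_measurable (borel \<Otimes>\<^sub>M borel)"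
        by (simp add: borel_prod)
          (intro borel_measurable_times_ennreal borel_measurable_indicator measurable_compose[OF _ measurable_ennreal]
            borel_measurable_times k_measurable measurable_compose[OF _ n] borel_measurable_continuous_onI continuous_intros)
      moreover have "(\<lambda>(m, s). ennreal (k (m, s) * n s) * indicator {m..} s) =
          (\<lambda>z. ennreal (k z * n (snd z)) * indicator {z. fst z \<le> snd z} z)"
        by (auto simp: fun_eq_iff indicator_def)
      ultimately show ?thesis
        by (simp cong: measurable_cong_sets)
    qed
    ultimately show ?thesis
      by blast
  qed
  then have "(\<lambda>m. \<integral>\<^sup>+s. ennreal (k (m, s) * n s) * indicator {m..} s \<partial>lborel) \<in> borel_measurable \<M>"
    by (intro measurable_restrict_space1 measurable_completion) simp
  then show "(\<lambda>m. \<Phi> k u m) \<in> borel_measurable \<M>"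
    by (rule measurable_cong[THEN iffD1, rotated]) (simp add: \<Phi>_eq)
qed

lemma \<Phi>_finite:
  assumes u: "u \<in> DC"
  shows "AE m in \<M>. \<Phi> k u m < \<infinity>"
proof -
  note [measurable] = \<Phi>_integral(2)[OF u]
  have "(\<integral>\<^sup>+m. \<Phi> k u m * ennreal (w m) \<partial>\<M>) \<noteq> \<infinity>"
    using \<Phi>_integral(1)[OF u] by (auto simp: top_unique)
  then have "AE m in \<M>. \<Phi> k u m * ennreal (w m) \<noteq> \<infinity>"
    by (intro nn_integral_PInf_AE) measurable
  then show ?thesis
    by eventually_elim (use w_pos in \<open>auto simp: ennreal_mult_eq_top_iff less_top[symmetric] ennreal_eq_0_iff not_le\<close>)
qed

lemma gain_AE_integrable:
  assumes u: "u \<in> DC"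
  shows "AE p in lborel. fst p \<in> \<Omega> \<and> 0 \<le> snd p -->
    set_integrable lebesgue {snd p..} (\<lambda>s. \<kappa> (fst p) (snd p) s * u (fst p, s))"
  using gain_converges_abs[OF BV_meas[OF DC_D(1)[OF u]]] fibre_bound_finite[OF DC_D(1)[OF u] \<Phi>_finite[OF u]]
  by eventually_elim auto

lemma gain_converges:
  assumes u: "u \<in> DC"
  shows "gain_converges \<Omega> \<kappa> u"
  unfolding gain_converges_def using gain_AE_integrable[OF u]
  by (simp add: AE_domain case_prod_beta)

lemma gain_le:
  assumes u: "u \<in> DC" and g: "gain \<kappa> u \<in> BV"
  shows "BN (gain \<kappa> u) \<le> q * L u + \<omega> * BN u"
proof -
  have "ennreal (BN (gain \<kappa> u)) = (\<integral>\<^sup>+m. ennreal (snorm X (sect (gain \<kappa> u) m) * w m) \<partial>\<M>)"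
    unfolding BN_def using BV_int[OF g] norm_sect_nonneg[OF g] by (rule nn_integral_eq_integral[symmetric])
  also have "\<dots> \<le> (\<integral>\<^sup>+m. \<Phi> k u m * ennreal (w m) \<partial>\<M>)"
  proof (rule nn_integral_mono_AE)
    show "AE m in \<M>. ennreal (snorm X (sect (gain \<kappa> u) m) * w m) \<le> \<Phi> k u m * ennreal (w m)"
      using fibre_bound[OF DC_D(1)[OF u]] BV_sect[OF g]
    proof eventually_elim
      case (elim m)
      then show ?case
        using N_nonneg[OF elim(2)] less_imp_le[OF w_pos] by (auto simp: ennreal_mult intro!: mult_right_mono)
    qed
  qed
  also have "\<dots> \<le> ennreal (q * L u + \<omega> * BN u)"
    by (rule \<Phi>_integral(1)[OF u])
  finally have "ennreal (BN (gain \<kappa> u)) \<le> ennreal (q * L u + \<omega> * BN u)" .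
  moreover have "0 \<le> q * L u + \<omega> * BN u"
    using q \<omega> L_nonneg[OF u] BN_nonneg[OF DC_D(1)[OF u]] by simp
  ultimately show ?thesis
    using ennreal_le_iff by blast
qed

lemma gain_lin:
  assumes u: "u \<in> DC" and v: "v \<in> DC" and g: "gain \<kappa> u \<in> BV" "gain \<kappa> v \<in> BV" "gain \<kappa> (x *\<^sub>R u + y *\<^sub>R v) \<in> BV"
  shows "BN (gain \<kappa> (x *\<^sub>R u + y *\<^sub>R v) - (x *\<^sub>R gain \<kappa> u + y *\<^sub>R gain \<kappa> v)) = 0"
proof (rule BN_zeroI)
  show "gain \<kappa> (x *\<^sub>R u + y *\<^sub>R v) - (x *\<^sub>R gain \<kappa> u + y *\<^sub>R gain \<kappa> v) \<in> BV"
    using g by simp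
  show "AE p in lborel. fst p \<in> \<Omega> \<and> 0 \<le> snd p -->
      (gain \<kappa> (x *\<^sub>R u + y *\<^sub>R v) - (x *\<^sub>R gain \<kappa> u + y *\<^sub>R gain \<kappa> v)) p = 0"
    using gain_AE_integrable[OF u] gain_AE_integrable[OF v]
  proof eventually_elim
    case (elim p)
    obtain z m where p: "p = (z, m)"
      by (cases p)
    show ?case
    proof
      assume "fst p \<in> \<Omega> \<and> 0 \<le> snd p"
      with elim have i: "set_integrable lebesgue {m..} (\<lambda>s. \<kappa> z m s * u (z, s))"
          "set_integrable lebesgue {m..} (\<lambda>s. \<kappa> z m s * v (z, s))"
        by (auto simp: p)
      have "gain \<kappa> (x *\<^sub>R u + y *\<^sub>R v) p = (LINT s:{m..}|lebesgue. x * (\<kappa> z m s * u (z, s)) + y * (\<kappa> z m s * v (z, s)))"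
        by (simp add: gain_def p algebra_simps)
      also have "\<dots> = x * gain \<kappa> u p + y * gain \<kappa> v p"
        using i by (simp add: gain_def p)
      finally show "(gain \<kappa> (x *\<^sub>R u + y *\<^sub>R v) - (x *\<^sub>R gain \<kappa> u + y *\<^sub>R gain \<kappa> v)) p = 0"
        by simp
    qed
  qed
qed

text \<open>Cone membership of u is known for almost every mass and then almost every x. It is first
  turned into a joint statement on the Borel version and then into one about almost every s for
  almost every (x, m), as the integral demands.\<close>

lemma gain_pos:
  assumes g: "gain \<kappa> u \<in> BV" and u: "u \<in> BP"
  shows "gain \<kappa> u \<in> BP"
proof -
  have uV: "u \<in> BV" and "AE m in \<M>. sect u m \<in> cone X"
    using u by (auto simp: BP_def)
  then have pos: "AE m in \<M>. AE x in lebesgue_on \<Omega>. 0 \<le> u (x, m)"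
    using cone_eq by (auto simp: sect_apply elim!: eventually_mono)
  obtain \<kappa>' u' where v: "\<kappa>' \<in> borel_measurable borel" "u' \<in> borel_measurable borel"
    "AE p in lborel. fst p \<in> \<Omega> \<and> 0 \<le> snd p --> (AE s in lborel. snd p \<le> s -->
       \<kappa> (fst p) (snd p) s = \<kappa>' (fst p, snd p, s) \<and> u (fst p, s) = u' (fst p, s))"
    and uu': "AE z in lborel. fst z \<in> \<Omega> \<and> 0 \<le> snd z --> u z = u' z"
    and \<kappa>'b: "\<forall>z. 0 \<le> \<kappa>' z \<and> \<kappa>' z \<le> k (snd z)"
    using kernel_version[OF BV_meas[OF uV]] .
  have \<kappa>'0: "0 \<le> \<kappa>' z" for z
    using \<kappa>'b by blast
  have "AE z in lborel. fst z \<in> \<Omega> \<and> 0 \<le> snd z --> 0 \<le> u' z"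
  proof -
    let ?R = "\<lambda>z. fst z \<in> \<Omega> \<and> 0 \<le> snd z --> 0 \<le> u' z"
    have "AE m in lborel. AE x in lborel. u (x, m) = u' (x, m) \<or> \<not> (x \<in> \<Omega> \<and> 0 \<le> m)"
      using AE_lborel_Pair(2)[OF uu'] by (auto elim!: eventually_mono)
    moreover have "AE m in lborel. AE x in lborel. x \<in> \<Omega> \<and> 0 \<le> m --> 0 \<le> u (x, m)"
      using pos by (auto simp: AE_half_line AE_lebesgue_on_iff elim!: eventually_mono)
    ultimately have sw: "AE m in lborel. AE x in lborel. ?R (x, m)"
    proof eventually_elim
      case (elim m)
      from elim(1,2) show ?case
        by eventually_elim auto
    qed
    have meas: "{z. ?R z} \<in> sets borel"
    proof -
      have "{z. ?R z} = - (\<Omega> \<times> {0..}) \<union> u' -` {0..}"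
        by auto
      moreover have "u' -` {0..} \<in> sets borel"
        using measurable_sets[OF v(2), of "{0..}"] by simp
      moreover have "\<Omega> \<times> {0::real..} \<in> sets borel"
        by (rule Times_borel) auto
      ultimately show ?thesis
        by auto
    qed
    show ?thesis
      using meas by (intro AE_lborel_PairI2 sw) (simp add: pred_def)
  qed
  from AE_lborel_triple[OF AE_lborel_drop_middle[OF this]]
  have u'0: "AE p in (lborel :: ('a \<times> real) measure). AE s in lborel. fst p \<in> \<Omega> \<and> 0 \<le> s --> 0 \<le> u' (fst p, s)"
    by simp
  have "AE p in lborel. fst p \<in> \<Omega> \<and> 0 \<le> snd p --> 0 \<le> gain \<kappa> u p"
    using gain_version[OF v] u'0
  proof eventually_elim
    case (elim p)
    show ?case
    proof
      assume p: "fst p \<in> \<Omega> \<and> 0 \<le> snd p"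
      have "AE s in lborel. 0 \<le> integrand \<kappa>' u' p s"
        using elim(2) by (rule eventually_mono) (use p \<kappa>'0 in \<open>auto simp: integrand_def[OF v] indicator_def\<close>)
      then show "0 \<le> gain \<kappa> u p"
        using elim(1) p by (auto intro: integral_nonneg_AE)
    qed
  qed
  then have "AE p in lebesgue_on (\<Omega> \<times> {0..}). 0 \<le> gain \<kappa> u p"
    by (simp add: AE_domain)
  then have "AE m in \<M>. AE x in lebesgue_on \<Omega>. 0 \<le> gain \<kappa> u (x, m)"
    by (rule AE_lebesgue_on_Times(2)[rotated 2]) auto
  then have "AE m in \<M>. sect (gain \<kappa> u) m \<in> cone X"
    using BV_sect[OF g] by eventually_elim (use cone_eq in \<open>auto simp: sect_apply\<close>)
  then show ?thesis
    using g by (simp add: BP_def)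
qed

text \<open>Fragments are no larger than their parents: if u vanishes above mass n, the integrand of
  the gain at m > n is zero. The identity holds for representatives, not merely up to null
  sets.\<close>

lemma Q_gain: "Q n (gain \<kappa> (Q n u)) = gain \<kappa> (Q n u)"
proof
  fix p :: "'a \<times> real"
  obtain x m where p: "p = (x, m)"
    by (cases p)
  have "gain \<kappa> (Q n u) (x, m) = 0" if "\<not> m \<le> n"
  proof -
    have z: "(\<lambda>s. indicator {m..} s * (\<kappa> x m s * Q n u (x, s))) = (\<lambda>s. 0)"
      using that by (auto simp: Q_def indicator_def fun_eq_iff)
    show ?thesis
      unfolding gain_eq z by simp
  qed
  then show "Q n (gain \<kappa> (Q n u)) p = gain \<kappa> (Q n u) p"
    by (auto simp: p Q_def indicator_def)
qed

theorem gain_generates: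
  assumes B_BV: "!!u v. (u, v) \<in> B.gen G ==> u \<in> DC ==> gain \<kappa> u \<in> BV"
  shows "\<exists>S. B.C0_sg S \<and>
    B.gen S = {(u, v). u \<in> DC \<and> v \<in> BV \<and> (\<exists>v\<^sub>0. (u, v\<^sub>0) \<in> B.gen G \<and> BN (v - (v\<^sub>0 - C u + gain \<kappa> u)) = 0)} \<and>
    (\<forall>t\<ge>0. \<forall>f\<in>BP. S t f \<in> BP)"
proof (rule perturbed_generates[OF q \<omega> B_BV gain_lin gain_le])
  show "BN (Q n (gain \<kappa> (Q n u)) - gain \<kappa> (Q n u)) = 0" for u n
    by (simp add: Q_gain)
qed (use gain_pos in blast)+

end

section \<open>The mass estimate\<close>

lemma integral_abs_lebesgue_on_subset:
  fixes f :: "real \<Rightarrow> real"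
  assumes f: "integrable (lebesgue_on B) f" and A: "A \<in> sets lebesgue" "B \<in> sets lebesgue" "A \<subseteq> B"
  shows "integrable (lebesgue_on A) f" "(\<integral>z. \<bar>f z\<bar> \<partial>lebesgue_on A) \<le> (\<integral>z. \<bar>f z\<bar> \<partial>lebesgue_on B)"
proof -
  have B: "set_integrable lebesgue B f"
    using f A(2) by (simp add: integrable_restrict_space set_integrable_def)
  then have fA: "set_integrable lebesgue A f"
    using A by (blast intro: set_integrable_subset)
  then show "integrable (lebesgue_on A) f"
    using A(1) by (simp add: integrable_restrict_space set_integrable_def)
  have "integrable lebesgue (\<lambda>z. indicator A z *\<^sub>R \<bar>f z\<bar>)" "integrable lebesgue (\<lambda>z. indicator B z *\<^sub>R \<bar>f z\<bar>)"
    using set_integrable_abs[OF fA] set_integrable_abs[OF B] by (simp_all add: set_integrable_def)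
  then have "(\<integral>z. indicator A z *\<^sub>R \<bar>f z\<bar> \<partial>lebesgue) \<le> (\<integral>z. indicator B z *\<^sub>R \<bar>f z\<bar> \<partial>lebesgue)"
    using A(3) by (intro integral_mono) (auto simp: indicator_def)
  then show "(\<integral>z. \<bar>f z\<bar> \<partial>lebesgue_on A) \<le> (\<integral>z. \<bar>f z\<bar> \<partial>lebesgue_on B)"
    using A(1,2) by (simp add: integral_restrict_space)
qed

lemma scaled_moment_le:
  fixes f f' :: "real \<Rightarrow> real"
  assumes s: "0 < s" and f' [measurable]: "f' \<in> borel_measurable borel" and f'0: "!!m. 0 \<le> f' m"
    and eq: "AE m in lborel. 0 \<le> m --> f m = f' m" and r: "0 \<le> r\<^sub>0" "r\<^sub>0 \<le> r"
    and int: "integrable (lebesgue_on {0..1}) (\<lambda>z. s * z powr r\<^sub>0 * f (z * s))"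
    and total: "(\<integral>z. \<bar>s * z powr r\<^sub>0 * f (z * s)\<bar> \<partial>lebesgue_on {0..1}) \<le> K"
    and d: "0 < d" "d < 1"
    and near: "(\<integral>z. \<bar>s * z powr r\<^sub>0 * f (z * s)\<bar> \<partial>lebesgue_on {1 - d..1}) \<le> \<epsilon>"
    and far: "(1 - d) powr (r - r\<^sub>0) * K \<le> \<epsilon>"
  shows "(\<integral>\<^sup>+m. ennreal (f' m * m powr r) * indicator {0..s} m \<partial>lborel) \<le> ennreal (2 * \<epsilon> * s powr r)"
proof -
  define g where "g z = s * z powr r\<^sub>0 * f (z * s)" for z
  define g' where "g' z = s * z powr r\<^sub>0 * f' (s * z)" for z
  have [measurable]: "g' \<in> borel_measurable borel"
    unfolding g'_def by measurable
  have g'0: "0 \<le> g' z" for z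
    using s f'0 by (simp add: g'_def)
  \<comment> \<open>Dilation by s > 0 preserves null sets, so the equality of f with its Borel
    version survives the substitution m = s z.\<close>
  have gg': "AE z in lborel. 0 \<le> z --> g z = g' z"
  proof -
    obtain N where N: "{m. \<not> (0 \<le> m --> f m = f' m)} \<subseteq> N" "N \<in> null_sets lborel"
      using eq unfolding eventually_ae_filter by auto
    then have [measurable]: "N \<in> sets borel"
      by auto
    have "AE m in lborel. m \<notin> N"
      by (rule AE_not_in[OF N(2)])
    then have "AE z in lborel. 0 + s * z \<notin> N"
      using s by (intro AE_borel_affine) auto
    then show ?thesis
    proof eventually_elim
      case (elim z)
      then have "s * z \<notin> N"
        by simp
      then have *: "0 \<le> s * z --> f (s * z) = f' (s * z)"
        using N(1) by blast
      show ?case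
      proof
        assume "0 \<le> z"
        then have "f (s * z) = f' (s * z)"
          using * s by simp
        then show "g z = g' z"
          unfolding g_def g'_def mult.commute[of z s] by simp
      qed
    qed
  qed
  have nn: "(\<integral>\<^sup>+z. ennreal (g' z) * indicator A z \<partial>lborel) = ennreal (\<integral>z. \<bar>g z\<bar> \<partial>lebesgue_on A)"
    if A: "A \<in> sets borel" "A \<subseteq> {0..1}" for A
  proof -
    have i: "integrable (lebesgue_on A) g"
      unfolding g_def[abs_def] by (rule integral_abs_lebesgue_on_subset(1)[OF int]) (use A in auto)
    have "ennreal (\<integral>z. \<bar>g z\<bar> \<partial>lebesgue_on A) = (\<integral>\<^sup>+z. ennreal \<bar>g z\<bar> \<partial>lebesgue_on A)"
      by (rule nn_integral_eq_integral[symmetric]) (use i in auto)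
    also have "\<dots> = (\<integral>\<^sup>+z. ennreal \<bar>g z\<bar> * indicator A z \<partial>lebesgue)"
      using A by (simp add: nn_integral_restrict_space)
    also have "\<dots> = (\<integral>\<^sup>+z. ennreal (g' z) * indicator A z \<partial>lebesgue)"
      using AE_completion[OF gg'] A(2) g'0 by (intro nn_integral_cong_AE) (auto simp: indicator_def elim!: eventually_mono)
    finally show ?thesis
      using A(1) by (simp add: nn_integral_completion)
  qed
  have K0: "0 \<le> \<epsilon>"
    by (rule order_trans[OF integral_nonneg_AE near]) simp
  have "(\<integral>\<^sup>+m. ennreal (f' m * m powr r) * indicator {0..s} m \<partial>lborel)
      = ennreal s * (\<integral>\<^sup>+z. ennreal (f' (s * z) * (s * z) powr r) * indicator {0..s} (s * z) \<partial>lborel)"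
    using nn_integral_real_affine[of "\<lambda>m. ennreal (f' m * m powr r) * indicator {0..s} m" s 0] s by simp
  also have "\<dots> = (\<integral>\<^sup>+z. ennreal s * (ennreal (f' (s * z) * (s * z) powr r) * indicator {0..s} (s * z)) \<partial>lborel)"
    by (rule nn_integral_cmult[symmetric]) measurable
  \<comment> \<open>The factor z^(r - \<open>r\<^sub>0\<close>) is at most 1 near z = 1 and at most
    (1 - d)^(r - \<open>r\<^sub>0\<close>) elsewhere. The second bound is then integrated over all
    of [0, 1], which only enlarges the right-hand side.\<close>
  also have "\<dots> \<le> (\<integral>\<^sup>+z. ennreal (s powr r * (1 - d) powr (r - r\<^sub>0)) * (ennreal (g' z) * indicator {0..1} z)
      + ennreal (s powr r) * (ennreal (g' z) * indicator {1 - d..1} z) \<partial>lborel)"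
  proof (rule nn_integral_mono)
    fix z :: real
    have z: "indicator {0..s} (s * z) = (indicator {0..1} z :: ennreal)"
      using s by (auto simp: indicator_def mult_le_cancel_left1 zero_le_mult_iff)
    have "s * (f' (s * z) * (s * z) powr r) \<le> s powr r * (1 - d) powr (r - r\<^sub>0) * g' z + (if 1 - d \<le> z then s powr r * g' z else 0)"
      if "0 \<le> z" "z \<le> 1"
    proof -
      \<comment> \<open>At z = 0 both sides vanish, since 0 powr r is 0 for every exponent,
        including 0.\<close>
      have e: "s * (f' (s * z) * (s * z) powr r) = s powr r * z powr (r - r\<^sub>0) * g' z"
      proof (cases "z = 0")
        case False
        then have "z powr r = z powr (r - r\<^sub>0) * z powr r\<^sub>0"
          by (simp add: powr_add[symmetric])
        then show ?thesis
          using s that by (simp add: g'_def powr_mult)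
      qed (simp add: g'_def)
      show ?thesis
      proof (cases "1 - d \<le> z")
        case True
        have "z powr (r - r\<^sub>0) \<le> 1 powr (r - r\<^sub>0)"
          using that r by (intro powr_mono2) auto
        then have "s powr r * z powr (r - r\<^sub>0) * g' z \<le> s powr r * 1 * g' z"
          using g'0 by (intro mult_right_mono mult_left_mono) auto
        moreover have "0 \<le> s powr r * (1 - d) powr (r - r\<^sub>0) * g' z"
          using g'0 by simp
        ultimately show ?thesis
          using True unfolding e by simp
      next
        case False
        have "z powr (r - r\<^sub>0) \<le> (1 - d) powr (r - r\<^sub>0)"
          using False that r by (intro powr_mono2) auto
        then have "s powr r * z powr (r - r\<^sub>0) * g' z \<le> s powr r * (1 - d) powr (r - r\<^sub>0) * g' z"
          using g'0 by (intro mult_right_mono mult_left_mono) auto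
        then show ?thesis
          using False unfolding e by simp
      qed
    qed
    then have "ennreal (s * (f' (s * z) * (s * z) powr r))
        \<le> ennreal (s powr r * (1 - d) powr (r - r\<^sub>0) * g' z) + ennreal (if 1 - d \<le> z then s powr r * g' z else 0)"
      if "0 \<le> z" "z \<le> 1"
      using that g'0[of z] by (simp add: ennreal_plus[symmetric] del: ennreal_plus)
    then show "ennreal s * (ennreal (f' (s * z) * (s * z) powr r) * indicator {0..s} (s * z))
        \<le> ennreal (s powr r * (1 - d) powr (r - r\<^sub>0)) * (ennreal (g' z) * indicator {0..1} z)
          + ennreal (s powr r) * (ennreal (g' z) * indicator {1 - d..1} z)"
      unfolding z using s d f'0[of "s * z"] g'0[of z]
      by (cases "0 \<le> z \<and> z \<le> 1") (auto simp: indicator_def ennreal_mult[symmetric] split: if_splits)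
  qed
  also have "\<dots> = (\<integral>\<^sup>+z. ennreal (s powr r * (1 - d) powr (r - r\<^sub>0)) * (ennreal (g' z) * indicator {0..1} z) \<partial>lborel)
      + (\<integral>\<^sup>+z. ennreal (s powr r) * (ennreal (g' z) * indicator {1 - d..1} z) \<partial>lborel)"
    by (rule nn_integral_add) measurable
  also have "\<dots> = ennreal (s powr r * (1 - d) powr (r - r\<^sub>0)) * (\<integral>\<^sup>+z. ennreal (g' z) * indicator {0..1} z \<partial>lborel)
      + ennreal (s powr r) * (\<integral>\<^sup>+z. ennreal (g' z) * indicator {1 - d..1} z \<partial>lborel)"
    by (intro arg_cong2[where f = "(+)"] nn_integral_cmult) measurable
  also have "\<dots> = ennreal (s powr r * (1 - d) powr (r - r\<^sub>0)) * ennreal (\<integral>z. \<bar>g z\<bar> \<partial>lebesgue_on {0..1})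
      + ennreal (s powr r) * ennreal (\<integral>z. \<bar>g z\<bar> \<partial>lebesgue_on {1 - d..1})"
    using d by (simp add: nn)
  also have "\<dots> = ennreal (s powr r * ((1 - d) powr (r - r\<^sub>0) * (\<integral>z. \<bar>g z\<bar> \<partial>lebesgue_on {0..1}))
      + s powr r * (\<integral>z. \<bar>g z\<bar> \<partial>lebesgue_on {1 - d..1}))"
    by (simp add: ennreal_mult[symmetric] ennreal_plus[symmetric] mult.assoc del: ennreal_plus)
  also have "\<dots> \<le> ennreal (2 * \<epsilon> * s powr r)"
  proof (rule ennreal_leI)
    have "(1 - d) powr (r - r\<^sub>0) * (\<integral>z. \<bar>g z\<bar> \<partial>lebesgue_on {0..1}) \<le> \<epsilon>"
      using mult_left_mono[OF total, of "(1 - d) powr (r - r\<^sub>0)"] far by (simp add: g_def)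
    then have "s powr r * ((1 - d) powr (r - r\<^sub>0) * (\<integral>z. \<bar>g z\<bar> \<partial>lebesgue_on {0..1})) \<le> s powr r * \<epsilon>"
      by (intro mult_left_mono) auto
    moreover have "s powr r * (\<integral>z. \<bar>g z\<bar> \<partial>lebesgue_on {1 - d..1}) \<le> s powr r * \<epsilon>"
      using near by (intro mult_left_mono) (auto simp: g_def)
    ultimately show "s powr r * ((1 - d) powr (r - r\<^sub>0) * (\<integral>z. \<bar>g z\<bar> \<partial>lebesgue_on {0..1}))
      + s powr r * (\<integral>z. \<bar>g z\<bar> \<partial>lebesgue_on {1 - d..1}) \<le> 2 * \<epsilon> * s powr r"
      by (simp add: algebra_simps)
  qed
  finally show ?thesis .
qed

text \<open>For large s each of three contributions is at most \<epsilon> s^r: the fragments of size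
  near s, those well below s, and the part of the weight without m^r. For bounded s everything is
  bounded by a constant, which becomes \<omega>. Note that the lower bound on r is fixed before
  \<omega>, which depends on r.\<close>

lemma mass_estimate:
  fixes \<beta> \<beta>' :: "real \<times> real \<Rightarrow> real" and \<alpha> :: "real \<Rightarrow> real"
  assumes \<beta>_l: "\<forall>s\<ge>0. (\<integral>\<^sup>+ m\<in>{0..s}. ennreal (\<beta> (m, s)) \<partial>lebesgue) \<le> ennreal (\<beta>\<^sub>0 * (1 + s powr l))"
    and equi: "equi_integrable ((\<lambda>s z. s * z powr r\<^sub>0 * \<beta> (z * s, s)) ` {s\<^sub>0..})"
    and "0 \<le> l" "0 \<le> r\<^sub>0" "0 \<le> M"
    and \<beta>': "\<beta>' \<in> borel_measurable borel" "!!z. 0 \<le> \<beta>' z"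
    and eq: "AE s in lborel. 0 \<le> s --> (AE m in lborel. 0 \<le> m --> \<beta> (m, s) = \<beta>' (m, s))"
    and \<alpha>: "AE s in lborel. 0 \<le> s --> 0 \<le> \<alpha> s \<and> \<alpha> s \<le> \<alpha>' s \<and> \<alpha>' s \<le> M * \<alpha> s"
    and loc: "!!R. \<exists>K. AE s in lborel. 0 \<le> s \<and> s \<le> R --> \<alpha>' s \<le> K"
  shows "\<exists>r\<^sub>1 > max l r\<^sub>0. \<forall>r\<ge>r\<^sub>1. \<exists>\<omega>\<ge>0. AE s in lborel. 0 \<le> s -->
    (\<integral>\<^sup>+m. ennreal (\<alpha>' s * \<beta>' (m, s) * (1 + m powr r)) * indicator {0..s} m \<partial>lborel)
      \<le> ennreal ((1 / 2 * \<alpha> s + \<omega>) * (1 + s powr r))"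
proof -
  let ?g = "\<lambda>s z. s * z powr r\<^sub>0 * \<beta> (z * s, s)"
  \<comment> \<open>The three contributions carry the factor \<open>\<alpha>'\<close>, at most M
    times \<alpha>, so 3 \<epsilon> M \<le> 1/2 yields the relative bound 1/2.\<close>
  define \<epsilon> where "\<epsilon> = 1 / (6 * (M + 1))"
  have \<epsilon>: "0 < \<epsilon>" "3 * \<epsilon> * M \<le> 1 / 2"
    using \<open>0 \<le> M\<close> by (auto simp: \<epsilon>_def field_simps)
  have int: "integrable (lebesgue_on {0..1}) (?g s)" if "s\<^sub>0 \<le> s" for s
    using equi that unfolding equi_integrable_def by auto
  obtain K\<^sub>0 where "\<forall>f\<in>?g ` {s\<^sub>0..}. (\<integral>z. \<bar>f z\<bar> \<partial>lebesgue_on {0..1}) \<le> K\<^sub>0"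
    using equi unfolding equi_integrable_def by blast
  then have K\<^sub>0: "(\<integral>z. \<bar>?g s z\<bar> \<partial>lebesgue_on {0..1}) \<le> K\<^sub>0" if "s\<^sub>0 \<le> s" for s
    using that by auto
  obtain \<delta> where \<delta>: "0 < \<delta>" "!!\<Theta>. \<Theta> \<in> sets lebesgue ==> \<Theta> \<subseteq> {0..1} ==> measure lebesgue \<Theta> < \<delta> ==>
      (SUP f\<in>?g ` {s\<^sub>0..}. \<integral>z. \<bar>f z\<bar> \<partial>lebesgue_on \<Theta>) < \<epsilon>"
    using equi[unfolded equi_integrable_def, THEN conjunct2, THEN conjunct2, rule_format, OF \<epsilon>(1)] by blast
  \<comment> \<open>The interval [1 - d, 1] has measure d < \<delta>; d < 1 keeps it inside [0, 1]
    and away from 0.\<close>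
  define d where "d = min (\<delta> / 2) (1 / 2)"
  have d: "0 < d" "d < 1" "d < \<delta>"
    using \<delta>(1) by (auto simp: d_def min_def)
  have near: "(\<integral>z. \<bar>?g s z\<bar> \<partial>lebesgue_on {1 - d..1}) \<le> \<epsilon>" if "s\<^sub>0 \<le> s" for s
  proof -
    \<comment> \<open>A supremum of reals bounds its members only if the set is bounded above; the
      uniform bound on the integrals over [0, 1] provides this.\<close>
    have "bdd_above ((\<lambda>f. \<integral>z. \<bar>f z\<bar> \<partial>lebesgue_on {1 - d..1}) ` ?g ` {s\<^sub>0..})"
    proof (rule bdd_aboveI)
      fix y assume "y \<in> (\<lambda>f. \<integral>z. \<bar>f z\<bar> \<partial>lebesgue_on {1 - d..1}) ` ?g ` {s\<^sub>0..}"
      then obtain s where s: "s\<^sub>0 \<le> s" "y = (\<integral>z. \<bar>?g s z\<bar> \<partial>lebesgue_on {1 - d..1})"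
        by auto
      have "y \<le> (\<integral>z. \<bar>?g s z\<bar> \<partial>lebesgue_on {0..1})"
        unfolding s(2) using d by (intro integral_abs_lebesgue_on_subset(2)[OF int[OF s(1)]]) auto
      then show "y \<le> K\<^sub>0"
        using K\<^sub>0[OF s(1)] by simp
    qed
    then have "(\<integral>z. \<bar>?g s z\<bar> \<partial>lebesgue_on {1 - d..1}) \<le> (SUP f\<in>?g ` {s\<^sub>0..}. \<integral>z. \<bar>f z\<bar> \<partial>lebesgue_on {1 - d..1})"
      by (rule cSUP_upper[rotated]) (use that in auto)
    also have "\<dots> < \<epsilon>"
      using d by (intro \<delta>(2)) (auto simp: measure_completion)
    finally show ?thesis
      by simp
  qed
  define K where "K = max 1 K\<^sub>0"
  have K: "1 \<le> K" "!!s. s\<^sub>0 \<le> s ==> (\<integral>z. \<bar>?g s z\<bar> \<partial>lebesgue_on {0..1}) \<le> K"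
    using K\<^sub>0 by (auto simp: K_def intro: max.coboundedI2)
  \<comment> \<open>Once r - \<open>r\<^sub>0\<close> is at least n, the fragments below (1 - d) s
    contribute at most \<epsilon> s^r.\<close>
  obtain n where n: "(1 - d) ^ n < \<epsilon> / K"
    using real_arch_pow_inv[of "\<epsilon> / K" "1 - d"] \<epsilon>(1) K(1) d by auto
  have far: "(1 - d) powr \<rho> * K \<le> \<epsilon>" if "real n \<le> \<rho>" for \<rho>
  proof -
    have "(1 - d) powr \<rho> \<le> (1 - d) powr real n"
      using that d by (intro powr_mono') auto
    also have "\<dots> = (1 - d) ^ n"
      using d by (simp add: powr_realpow)
    finally have "(1 - d) powr \<rho> * K \<le> (1 - d) ^ n * K"
      using K(1) by (intro mult_right_mono) auto
    moreover have "(1 - d) ^ n * K \<le> \<epsilon>"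
      using n K(1) by (simp add: field_simps)
    ultimately show ?thesis
      by linarith
  qed
  define \<beta>\<^sub>1 where "\<beta>\<^sub>1 = max \<beta>\<^sub>0 0"
  have \<beta>\<^sub>1: "0 \<le> \<beta>\<^sub>1" "\<beta>\<^sub>0 \<le> \<beta>\<^sub>1"
    by (auto simp: \<beta>\<^sub>1_def)
  show ?thesis
  \<comment> \<open>The summand n makes r - \<open>r\<^sub>0\<close> \<ge> n. The summand 1 makes r
    \<ge> l + 1, so that s^r exceeds s^l by a factor s and outgrows the number of fragments.\<close>
  proof (rule exI[of _ "max l r\<^sub>0 + 1 + real n"], intro conjI allI impI)
    show "max l r\<^sub>0 < max l r\<^sub>0 + 1 + real n"
      by linarith
    fix r assume r: "max l r\<^sub>0 + 1 + real n \<le> r"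
    then have rl: "l + 1 \<le> r" "r\<^sub>0 \<le> r" "real n \<le> r - r\<^sub>0" "0 \<le> r"
      using \<open>0 \<le> l\<close> by (auto simp: max_def split: if_splits)
    \<comment> \<open>Beyond S the equi-integrable family is available, 1 + s^l is at most 2 s^l,
      and the spare factor s outweighs 2 \<open>\<beta>\<^sub>1\<close> / \<epsilon>.\<close>
    define S where "S = max (max s\<^sub>0 1) (2 * \<beta>\<^sub>1 / \<epsilon>)"
    obtain K\<^sub>2 where K\<^sub>2: "AE s in lborel. 0 \<le> s \<and> s \<le> S --> \<alpha>' s \<le> K\<^sub>2"
      using loc by blast
    \<comment> \<open>A bound for the whole left-hand side when s < S: the local bound of the rate,
      the largest weight, and the largest number of fragments.\<close>
    define \<omega> where "\<omega> = max K\<^sub>2 0 * (1 + S powr r) * (\<beta>\<^sub>1 * (1 + S powr l))"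
    have \<omega>: "0 \<le> \<omega>"
      unfolding \<omega>_def using \<beta>\<^sub>1 by (intro mult_nonneg_nonneg) (auto intro: add_nonneg_nonneg)
    have "AE s in lborel. 0 \<le> s -->
      (\<integral>\<^sup>+m. ennreal (\<alpha>' s * \<beta>' (m, s) * (1 + m powr r)) * indicator {0..s} m \<partial>lborel)
        \<le> ennreal ((1 / 2 * \<alpha> s + \<omega>) * (1 + s powr r))"
      using eq \<alpha> K\<^sub>2
    proof (eventually_elim, intro impI, goal_cases ae)
      case (ae s)
      note elim = ae(1-3) ae(7-)
      then have \<alpha>s: "0 \<le> \<alpha> s" "\<alpha> s \<le> \<alpha>' s" "\<alpha>' s \<le> M * \<alpha> s" "0 \<le> \<alpha>' s"
        by auto
      have pos: "0 \<le> \<alpha> s * s powr r" "0 \<le> \<omega> * s powr r"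
        using \<alpha>s(1) \<omega> by simp_all
      have expand: "(1 / 2 * \<alpha> s + \<omega>) * (1 + s powr r) = \<alpha> s / 2 + \<alpha> s * s powr r / 2 + \<omega> + \<omega> * s powr r"
        by (simp add: field_simps)
      have eqs: "AE m in lborel. 0 \<le> m --> \<beta> (m, s) = \<beta>' (m, s)"
        using elim by simp
      have sec: "(\<lambda>m. (m, s)) \<in> borel_measurable borel"
        by (intro borel_measurable_continuous_onI continuous_intros)
      have [measurable]: "(\<lambda>m. \<beta>' (m, s)) \<in> borel_measurable borel"
        using measurable_compose[OF sec \<beta>'(1)] .
      have "(\<integral>\<^sup>+m. ennreal (\<beta>' (m, s)) * indicator {0..s} m \<partial>lborel) = (\<integral>\<^sup>+m. ennreal (\<beta>' (m, s)) * indicator {0..s} m \<partial>lebesgue)"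
        by (simp add: nn_integral_completion)
      also have "\<dots> = (\<integral>\<^sup>+ m\<in>{0..s}. ennreal (\<beta> (m, s)) \<partial>lebesgue)"
        using AE_completion[OF eqs] by (intro nn_integral_cong_AE) (auto simp: indicator_def elim!: eventually_mono)
      also have "\<dots> \<le> ennreal (\<beta>\<^sub>1 * (1 + s powr l))"
        using \<beta>_l elim \<beta>\<^sub>1(2) by (intro order_trans[OF \<beta>_l[rule_format] ennreal_leI] mult_right_mono) (auto intro: add_nonneg_nonneg)
      finally have I0: "(\<integral>\<^sup>+m. ennreal (\<beta>' (m, s)) * indicator {0..s} m \<partial>lborel) \<le> ennreal (\<beta>\<^sub>1 * (1 + s powr l))" .
      show "(\<integral>\<^sup>+m. ennreal (\<alpha>' s * \<beta>' (m, s) * (1 + m powr r)) * indicator {0..s} m \<partial>lborel)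
          \<le> ennreal ((1 / 2 * \<alpha> s + \<omega>) * (1 + s powr r))"
      proof (cases "S \<le> s")
        case True
        then have s: "1 \<le> s" "s\<^sub>0 \<le> s" "2 * \<beta>\<^sub>1 \<le> \<epsilon> * s"
          using \<epsilon>(1) by (auto simp: S_def field_simps)
        have I1: "(\<integral>\<^sup>+m. ennreal (\<beta>' (m, s) * m powr r) * indicator {0..s} m \<partial>lborel) \<le> ennreal (2 * \<epsilon> * s powr r)"
          using s rl \<open>0 \<le> r\<^sub>0\<close> \<beta>'(2) eqs int[OF s(2)] K(2)[OF s(2)] d near[OF s(2)] far[OF rl(3)]
          by (intro scaled_moment_le[where f = "\<lambda>m. \<beta> (m, s)" and K = K and d = d and r\<^sub>0 = r\<^sub>0]) auto
        have "\<beta>\<^sub>1 * (1 + s powr l) \<le> \<beta>\<^sub>1 * (2 * s powr l)"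
          using ge_one_powr_ge_zero[OF s(1) \<open>0 \<le> l\<close>] \<beta>\<^sub>1 by (intro mult_left_mono) auto
        also have "\<dots> \<le> (\<epsilon> * s) * s powr l"
          using mult_right_mono[OF s(3), of "s powr l"] by (simp add: algebra_simps)
        also have "\<dots> = \<epsilon> * s powr (l + 1)"
          using s(1) by (simp add: powr_add)
        also have "\<dots> \<le> \<epsilon> * s powr r"
          using \<epsilon>(1) rl s(1) by (intro mult_left_mono powr_mono) auto
        finally have I0': "\<beta>\<^sub>1 * (1 + s powr l) \<le> \<epsilon> * s powr r" .
        have "(\<integral>\<^sup>+m. ennreal (\<alpha>' s * \<beta>' (m, s) * (1 + m powr r)) * indicator {0..s} m \<partial>lborel)
          = (\<integral>\<^sup>+m. ennreal (\<alpha>' s) * (ennreal (\<beta>' (m, s)) * indicator {0..s} m + ennreal (\<beta>' (m, s) * m powr r) * indicator {0..s} m) \<partial>lborel)"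
          using \<alpha>s \<beta>'(2) by (intro nn_integral_cong)
            (auto simp: indicator_def ennreal_mult[symmetric] ennreal_plus[symmetric] algebra_simps simp del: ennreal_plus)
        also have "\<dots> = ennreal (\<alpha>' s) * (\<integral>\<^sup>+m. ennreal (\<beta>' (m, s)) * indicator {0..s} m + ennreal (\<beta>' (m, s) * m powr r) * indicator {0..s} m \<partial>lborel)"
          by (rule nn_integral_cmult) measurable
        also have "(\<integral>\<^sup>+m. ennreal (\<beta>' (m, s)) * indicator {0..s} m + ennreal (\<beta>' (m, s) * m powr r) * indicator {0..s} m \<partial>lborel)
          = (\<integral>\<^sup>+m. ennreal (\<beta>' (m, s)) * indicator {0..s} m \<partial>lborel) + (\<integral>\<^sup>+m. ennreal (\<beta>' (m, s) * m powr r) * indicator {0..s} m \<partial>lborel)"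
          by (rule nn_integral_add) measurable
        also have "ennreal (\<alpha>' s) * \<dots> \<le> ennreal (\<alpha>' s) * (ennreal (\<epsilon> * s powr r) + ennreal (2 * \<epsilon> * s powr r))"
          using I0 I1 ennreal_leI[OF I0'] by (intro mult_left_mono add_mono) (auto intro: order_trans)
        also have "\<dots> = ennreal (\<alpha>' s * (3 * \<epsilon> * s powr r))"
          using \<alpha>s \<epsilon>(1) by (simp add: ennreal_mult[symmetric] ennreal_plus[symmetric] del: ennreal_plus)
        also have "\<dots> \<le> ennreal ((1 / 2 * \<alpha> s + \<omega>) * (1 + s powr r))"
        proof (rule ennreal_leI)
          have "\<alpha>' s * (3 * \<epsilon> * s powr r) \<le> (M * \<alpha> s) * (3 * \<epsilon> * s powr r)"
            using \<alpha>s \<epsilon>(1) by (intro mult_right_mono) auto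
          also have "\<dots> = (3 * \<epsilon> * M) * (\<alpha> s * s powr r)"
            by simp
          also have "\<dots> \<le> 1 / 2 * (\<alpha> s * s powr r)"
            using \<epsilon>(2) \<alpha>s by (intro mult_right_mono) auto
          also have "\<dots> \<le> (1 / 2 * \<alpha> s + \<omega>) * (1 + s powr r)"
            using \<alpha>s(1) \<omega> pos unfolding expand by linarith
          finally show "\<alpha>' s * (3 * \<epsilon> * s powr r) \<le> (1 / 2 * \<alpha> s + \<omega>) * (1 + s powr r)" .
        qed
        finally show ?thesis .
      next
        case False
        have "(\<integral>\<^sup>+m. ennreal (\<alpha>' s * \<beta>' (m, s) * (1 + m powr r)) * indicator {0..s} m \<partial>lborel)
          \<le> (\<integral>\<^sup>+m. ennreal (\<alpha>' s * (1 + S powr r)) * (ennreal (\<beta>' (m, s)) * indicator {0..s} m) \<partial>lborel)"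
        proof (rule nn_integral_mono)
          fix m :: real
          have "\<alpha>' s * \<beta>' (m, s) * (1 + m powr r) \<le> \<alpha>' s * \<beta>' (m, s) * (1 + S powr r)" if "0 \<le> m" "m \<le> s"
            using that False rl(4) \<alpha>s \<beta>'(2) by (intro mult_left_mono add_mono powr_mono2) auto
          then show "ennreal (\<alpha>' s * \<beta>' (m, s) * (1 + m powr r)) * indicator {0..s} m
              \<le> ennreal (\<alpha>' s * (1 + S powr r)) * (ennreal (\<beta>' (m, s)) * indicator {0..s} m)"
            using \<alpha>s \<beta>'(2) by (auto simp: indicator_def ennreal_mult[symmetric] add_nonneg_nonneg mult.assoc mult.left_commute mult.commute intro!: ennreal_leI)
        qed
        also have "\<dots> = ennreal (\<alpha>' s * (1 + S powr r)) * (\<integral>\<^sup>+m. ennreal (\<beta>' (m, s)) * indicator {0..s} m \<partial>lborel)"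
          by (rule nn_integral_cmult) measurable
        also have "\<dots> \<le> ennreal (max K\<^sub>2 0 * (1 + S powr r)) * ennreal (\<beta>\<^sub>1 * (1 + S powr l))"
        proof (rule mult_mono)
          show "ennreal (\<alpha>' s * (1 + S powr r)) \<le> ennreal (max K\<^sub>2 0 * (1 + S powr r))"
            using elim False by (intro ennreal_leI mult_right_mono) (auto intro: add_nonneg_nonneg)
          have "\<beta>\<^sub>1 * (1 + s powr l) \<le> \<beta>\<^sub>1 * (1 + S powr l)"
            using elim False \<beta>\<^sub>1 \<open>0 \<le> l\<close> by (intro mult_left_mono add_mono powr_mono2) auto
          then show "(\<integral>\<^sup>+m. ennreal (\<beta>' (m, s)) * indicator {0..s} m \<partial>lborel) \<le> ennreal (\<beta>\<^sub>1 * (1 + S powr l))"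
            using I0 by (auto intro: order_trans ennreal_leI)
        qed auto
        also have "\<dots> = ennreal \<omega>"
          unfolding \<omega>_def using \<beta>\<^sub>1 by (subst ennreal_mult[symmetric]) (auto intro!: mult_nonneg_nonneg add_nonneg_nonneg)
        also have "\<dots> \<le> ennreal ((1 / 2 * \<alpha> s + \<omega>) * (1 + s powr r))"
          using \<alpha>s(1) \<omega> pos unfolding expand by (intro ennreal_leI) linarith
        finally show ?thesis .
      qed
    qed
    then show "\<exists>\<omega>\<ge>0. AE s in lborel. 0 \<le> s -->
      (\<integral>\<^sup>+m. ennreal (\<alpha>' s * \<beta>' (m, s) * (1 + m powr r)) * indicator {0..s} m \<partial>lborel)
        \<le> ennreal ((1 / 2 * \<alpha> s + \<omega>) * (1 + s powr r))"
      using \<omega> by blast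
  qed
qed

section \<open>The gain operator on the fibre spaces\<close>

lemma AE_section_measurable:
  fixes u :: "'a::euclidean_space \<times> real \<Rightarrow> real"
  assumes \<Omega>: "\<Omega> \<in> sets borel" and u: "u \<in> borel_measurable (lebesgue_on (\<Omega> \<times> {0..}))"
  shows "AE m in lebesgue_on {0..}. sect u m \<in> borel_measurable (lebesgue_on \<Omega>)"
proof -
  have S: "\<Omega> \<times> {0::real..} \<in> sets borel"
    by (rule Times_borel[OF \<Omega>]) auto
  obtain u' where u': "u' \<in> borel_measurable borel" "AE z in lborel. z \<in> \<Omega> \<times> {0..} --> u z = u' z"
    using borel_version[OF S u] .
  from AE_lborel_Pair(2)[OF u'(2)]
  have "AE m in lborel. m \<in> {0..} --> sect u m \<in> borel_measurable (lebesgue_on \<Omega>)"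
  proof (eventually_elim, intro impI, goal_cases ae)
    case (ae m)
    note elim = ae(1) ae(3-)
    have "(\<lambda>x. (x, m)) \<in> borel_measurable borel"
      by (intro borel_measurable_continuous_onI continuous_intros)
    from measurable_compose[OF this u'(1)] show ?case
      by (rule borel_measurable_lebesgue_onI[OF \<Omega>]) (use elim in \<open>auto simp: sect_apply elim!: eventually_mono\<close>)
  qed
  then show ?thesis
    by (simp add: AE_lebesgue_on_iff)
qed

context gain_operator
begin

lemma gain_BV:
  assumes u: "u \<in> DC" and SM: "SM (sect (gain \<kappa> u))"
  shows "gain \<kappa> u \<in> BV"
proof -
  have "integrable \<M> (\<lambda>m. snorm X (sect (gain \<kappa> u) m) * w m)"
  proof (rule integrableI_bounded)
    show "(\<lambda>m. snorm X (sect (gain \<kappa> u) m) * w m) \<in> borel_measurable \<M>"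
      using SM_norm[OF SM] w_measurable by (intro borel_measurable_times)
    have "(\<integral>\<^sup>+m. ennreal (norm (snorm X (sect (gain \<kappa> u) m) * w m)) \<partial>\<M>) \<le> (\<integral>\<^sup>+m. \<Phi> k u m * ennreal (w m) \<partial>\<M>)"
    proof (rule nn_integral_mono_AE)
      show "AE m in \<M>. ennreal (norm (snorm X (sect (gain \<kappa> u) m) * w m)) \<le> \<Phi> k u m * ennreal (w m)"
        using fibre_bound[OF DC_D(1)[OF u]] SM_carr[OF SM]
      proof eventually_elim
        case (elim m)
        then show ?case
          using N_nonneg[OF elim(2)] less_imp_le[OF w_pos] by (auto simp: ennreal_mult abs_mult intro!: mult_right_mono)
      qed
    qed
    also have "\<dots> \<le> ennreal (q * L u + \<omega> * BN u)"
      by (rule \<Phi>_integral(1)[OF u])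
    finally show "(\<integral>\<^sup>+m. ennreal (norm (snorm X (sect (gain \<kappa> u) m) * w m)) \<partial>\<M>) < \<infinity>"
      by (rule le_less_trans) simp
  qed
  then show ?thesis
    using gain_measurable[OF BV_meas[OF DC_D(1)[OF u]]] SM by (simp add: BV_iff)
qed

end

section \<open>Fibre bounds of the gain for integrable functions\<close>

locale L1_kernel = dominated_kernel "L1_space \<Omega>" \<Omega> r \<kappa> k
  for \<Omega> :: "'a::euclidean_space set" and r \<kappa> k
begin

text \<open>Tonelli in (x, s) at fixed m: the majorant k does not depend on x, so the inner integral
  over x is at most k(m, s) times the L_1 norm of the fibre at s. The Borel function A stands in for
  \<open>abs_gain\<close> so that this makes sense.\<close>

lemma abs_gain_L1:
  assumes u: "u \<in> BV"
  obtains A where "A \<in> borel_measurable borel" "AE p in lborel. fst p \<in> \<Omega> \<and> 0 \<le> snd p --> abs_gain \<kappa> u p = A p"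
    "AE m in lborel. 0 \<le> m --> (\<integral>\<^sup>+x. A (x, m) * indicator \<Omega> x \<partial>lborel) \<le> \<Phi> k u m"
proof -
  note [measurable] = \<Omega>_borel
  obtain \<kappa>' u' where v: "\<kappa>' \<in> borel_measurable borel" "u' \<in> borel_measurable borel"
    "AE p in lborel. fst p \<in> \<Omega> \<and> 0 \<le> snd p --> (AE s in lborel. snd p \<le> s -->
       \<kappa> (fst p) (snd p) s = \<kappa>' (fst p, snd p, s) \<and> u (fst p, s) = u' (fst p, s))"
    and uu': "AE z in lborel. fst z \<in> \<Omega> \<and> 0 \<le> snd z --> u z = u' z"
    and \<kappa>'b: "\<forall>z. 0 \<le> \<kappa>' z \<and> \<kappa>' z \<le> k (snd z)"
    using kernel_version[OF BV_meas[OF u]] .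
  have \<kappa>'0: "0 \<le> \<kappa>' z" and \<kappa>'k: "\<kappa>' z \<le> k (snd z)" for z
    using \<kappa>'b by blast+
  obtain n where n [measurable]: "n \<in> borel_measurable borel" and n0: "!!s. 0 \<le> n s"
    and n_eq: "AE s in lborel. 0 \<le> s --> snorm (L1_space \<Omega>) (sect u s) = n s"
    using norm_version[OF u] by blast
  define A where "A p = (\<integral>\<^sup>+s. ennreal \<bar>integrand \<kappa>' u' p s\<bar> \<partial>lborel)" for p
  have u'_sec: "(\<lambda>x. u' (x, s)) \<in> borel_measurable borel" for s
  proof -
    have "(\<lambda>x. (x, s)) \<in> borel_measurable (borel :: 'a measure)"
      by (intro borel_measurable_continuous_onI continuous_intros)
    from measurable_compose[OF this v(2)] show ?thesis .
  qed
  have norm_eq: "AE s in lborel. 0 \<le> s --> (\<integral>\<^sup>+x. ennreal \<bar>u' (x, s)\<bar> * indicator \<Omega> x \<partial>lborel) = ennreal (n s)"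
  proof -
    have "AE s in lborel. AE x in lborel. x \<in> \<Omega> \<and> 0 \<le> s --> u (x, s) = u' (x, s)"
      using AE_lborel_Pair(2)[OF uu'] by simp
    moreover have "AE s in lborel. 0 \<le> s --> sect u s \<in> carr (L1_space \<Omega>)"
      using BV_sect[OF u] by (simp add: AE_half_line)
    ultimately show ?thesis
      using n_eq
    proof (eventually_elim, intro impI, goal_cases ae)
      case (ae s)
      note elim = ae(1-3) ae(7-)
      have i: "integrable (lebesgue_on \<Omega>) (sect u s)"
        using elim by (simp add: L1_space_def)
      note [measurable] = u'_sec[of s]
      have "ennreal (n s) = ennreal (\<integral>x. \<bar>sect u s x\<bar> \<partial>lebesgue_on \<Omega>)"
        using elim by (simp add: L1_space_def)
      also have "\<dots> = (\<integral>\<^sup>+x. ennreal \<bar>sect u s x\<bar> \<partial>lebesgue_on \<Omega>)"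
        by (rule nn_integral_eq_integral[symmetric]) (use i in auto)
      also have "\<dots> = (\<integral>\<^sup>+x. ennreal \<bar>sect u s x\<bar> * indicator \<Omega> x \<partial>lebesgue)"
        by (simp add: nn_integral_restrict_space)
      also have "\<dots> = (\<integral>\<^sup>+x. ennreal \<bar>u' (x, s)\<bar> * indicator \<Omega> x \<partial>lebesgue)"
        using AE_completion[OF elim(1)] \<open>0 \<le> s\<close>
        by (intro nn_integral_cong_AE) (auto simp: sect_apply indicator_def elim!: eventually_mono)
      also have "\<dots> = (\<integral>\<^sup>+x. ennreal \<bar>u' (x, s)\<bar> * indicator \<Omega> x \<partial>lborel)"
        by (rule nn_integral_completion) measurable
      finally show ?case
        by simp
    qed
  qed
  have bound: "(\<integral>\<^sup>+x. A (x, m) * indicator \<Omega> x \<partial>lborel) \<le> \<Phi> k u m" if m: "0 \<le> m" for m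
  proof -
    define H where "H x s = ennreal \<bar>integrand \<kappa>' u' (x, m) s\<bar> * indicator \<Omega> x" for x s
    have H_meas: "(\<lambda>(x, s). H x s) \<in> borel_measurable (lborel \<Otimes>\<^sub>M lborel)"
    proof -
      have "(\<lambda>z :: 'a \<times> real. ((fst z, m), snd z)) \<in> borel_measurable borel"
        by (intro borel_measurable_continuous_onI continuous_intros)
      from measurable_compose[OF this integrand_measurable[OF v]]
      have I: "(\<lambda>z. integrand \<kappa>' u' (fst z, m) (snd z)) \<in> borel_measurable borel"
        by simp
      have "(fst :: 'a \<times> real \<Rightarrow> 'a) \<in> borel_measurable borel"
        by (intro borel_measurable_continuous_onI continuous_intros)
      from measurable_compose[OF this borel_measurable_indicator[OF \<Omega>_borel]]
      have J: "(\<lambda>z :: 'a \<times> real. indicator \<Omega> (fst z) :: ennreal) \<in> borel_measurable borel"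
        by simp
      have "(\<lambda>z. H (fst z) (snd z)) \<in> borel_measurable borel"
        unfolding H_def using I J by measurable
      then show ?thesis
        by (simp add: lborel_prod case_prod_beta)
    qed
    have "(\<integral>\<^sup>+x. A (x, m) * indicator \<Omega> x \<partial>lborel) = (\<integral>\<^sup>+x. (\<integral>\<^sup>+s. H x s \<partial>lborel) \<partial>lborel)"
      unfolding A_def H_def using integrand_section[OF v]
      by (intro nn_integral_cong nn_integral_multc[symmetric]) measurable
    also have "\<dots> = (\<integral>\<^sup>+s. (\<integral>\<^sup>+x. H x s \<partial>lborel) \<partial>lborel)"
      using lborel_pair.Fubini[OF H_meas] by simp
    also have "\<dots> \<le> (\<integral>\<^sup>+s. ennreal (k (m, s) * n s) * indicator {m..} s \<partial>lborel)"
    proof (rule nn_integral_mono_AE)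
      show "AE s in lborel. (\<integral>\<^sup>+x. H x s \<partial>lborel) \<le> ennreal (k (m, s) * n s) * indicator {m..} s"
        using norm_eq
      proof eventually_elim
        case (elim s)
        show ?case
        proof (cases "m \<le> s")
          case True
          note [measurable] = u'_sec[of s]
          have "(\<integral>\<^sup>+x. H x s \<partial>lborel) \<le> (\<integral>\<^sup>+x. ennreal (k (m, s)) * (ennreal \<bar>u' (x, s)\<bar> * indicator \<Omega> x) \<partial>lborel)"
          proof (rule nn_integral_mono)
            fix x
            have "\<bar>\<kappa>' (x, m, s) * u' (x, s)\<bar> \<le> k (m, s) * \<bar>u' (x, s)\<bar>"
              unfolding abs_mult using \<kappa>'0[of "(x, m, s)"] \<kappa>'k[of "(x, m, s)"] by (intro mult_right_mono) auto
            then show "H x s \<le> ennreal (k (m, s)) * (ennreal \<bar>u' (x, s)\<bar> * indicator \<Omega> x)"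
              using True k_nonneg[of "(m, s)"]
              by (auto simp: H_def integrand_def[OF v] indicator_def ennreal_mult[symmetric] intro!: ennreal_leI)
          qed
          also have "\<dots> = ennreal (k (m, s)) * (\<integral>\<^sup>+x. ennreal \<bar>u' (x, s)\<bar> * indicator \<Omega> x \<partial>lborel)"
            by (rule nn_integral_cmult) measurable
          also have "\<dots> = ennreal (k (m, s) * n s)"
            using elim True m k_nonneg n0 by (simp add: ennreal_mult)
          finally show ?thesis
            using True by simp
        next
          case False
          then have "H x s = 0" for x
            by (simp add: H_def integrand_def[OF v])
          then show ?thesis
            by simp
        qed
      qed
    qed
    also have "\<dots> = \<Phi> k u m"
      by (rule \<Phi>_version[OF n_eq m n k_measurable, symmetric])
    finally show ?thesis .
  qed
  have "AE p in lborel. fst p \<in> \<Omega> \<and> 0 \<le> snd p --> abs_gain \<kappa> u p = A p"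
    using gain_version[OF v] by (auto simp: A_def elim!: eventually_mono)
  moreover have "A \<in> borel_measurable borel"
    using abs_gain_integral_measurable[OF v] by (simp add: A_def[abs_def])
  ultimately show thesis
    using bound by (intro that[of A]) auto
qed

text \<open>A finite integral over x forces finiteness for almost every x; the statement is then
  joined over the masses.\<close>

lemma fibre_bound_finite_L1:
  assumes u: "u \<in> BV" and fin: "AE m in \<M>. \<Phi> k u m < \<infinity>"
  shows "AE p in lborel. fst p \<in> \<Omega> \<and> 0 \<le> snd p --> abs_gain \<kappa> u p < \<infinity>"
proof -
  note [measurable] = \<Omega>_borel
  obtain A where A: "A \<in> borel_measurable borel" "AE p in lborel. fst p \<in> \<Omega> \<and> 0 \<le> snd p --> abs_gain \<kappa> u p = A p"
    "AE m in lborel. 0 \<le> m --> (\<integral>\<^sup>+x. A (x, m) * indicator \<Omega> x \<partial>lborel) \<le> \<Phi> k u m"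
    using abs_gain_L1[OF u] .
  have "AE m in lborel. 0 \<le> m --> \<Phi> k u m < \<infinity>"
    using fin by (simp add: AE_half_line)
  with A(3) have "AE m in lborel. AE x in lborel. x \<in> \<Omega> \<and> 0 \<le> m --> A (x, m) < \<infinity>"
  proof eventually_elim
    case (elim m)
    show ?case
    proof (cases "0 \<le> m")
      case True
      have "(\<lambda>x. (x, m)) \<in> borel_measurable (borel :: 'a measure)"
        by (intro borel_measurable_continuous_onI continuous_intros)
      note [measurable] = measurable_compose[OF this A(1)]
      have "(\<integral>\<^sup>+x. A (x, m) * indicator \<Omega> x \<partial>lborel) \<noteq> \<infinity>"
        using elim True by auto
      then have "AE x in lborel. A (x, m) * indicator \<Omega> x \<noteq> \<infinity>"
        by (intro nn_integral_PInf_AE) measurable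
      then show ?thesis
        by eventually_elim (auto simp: less_top)
    qed simp
  qed
  then have "AE p in lborel. fst p \<in> \<Omega> \<and> 0 \<le> snd p --> A p < \<infinity>"
  proof (intro AE_lborel_PairI2)
    have "{p. fst p \<in> \<Omega> \<and> 0 \<le> snd p --> A p < \<infinity>} = - (\<Omega> \<times> {0..}) \<union> A -` {..<\<infinity>}"
      by auto
    moreover have "A -` {..<\<infinity>} \<in> sets borel"
      using measurable_sets[OF A(1), of "{..<\<infinity>}"] by simp
    moreover have "\<Omega> \<times> {0::real..} \<in> sets borel"
      by (rule Times_borel) auto
    ultimately show "Measurable.pred borel (\<lambda>p. fst p \<in> \<Omega> \<and> 0 \<le> snd p --> A p < \<infinity>)"
      by (auto simp: pred_def)
  qed simp
  with A(2) show ?thesis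
    by eventually_elim auto
qed

lemma gain_nn_integral_L1:
  assumes u: "u \<in> BV"
  shows "AE m in \<M>. (\<integral>\<^sup>+x. ennreal \<bar>gain \<kappa> u (x, m)\<bar> \<partial>lebesgue_on \<Omega>) \<le> \<Phi> k u m"
proof -
  note [measurable] = \<Omega>_borel
  obtain A where A: "A \<in> borel_measurable borel" "AE p in lborel. fst p \<in> \<Omega> \<and> 0 \<le> snd p --> abs_gain \<kappa> u p = A p"
    "AE m in lborel. 0 \<le> m --> (\<integral>\<^sup>+x. A (x, m) * indicator \<Omega> x \<partial>lborel) \<le> \<Phi> k u m"
    using abs_gain_L1[OF u] .
  have "AE p in lborel. fst p \<in> \<Omega> \<and> 0 \<le> snd p --> ennreal \<bar>gain \<kappa> u p\<bar> \<le> A p"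
    using gain_converges_abs[OF BV_meas[OF u]] A(2) by eventually_elim auto
  from AE_lborel_Pair(2)[OF this] A(3)
  have "AE m in lborel. 0 \<le> m --> (\<integral>\<^sup>+x. ennreal \<bar>gain \<kappa> u (x, m)\<bar> \<partial>lebesgue_on \<Omega>) \<le> \<Phi> k u m"
  proof (eventually_elim, intro impI, goal_cases ae)
    case (ae m)
    note elim = ae(1-2) ae(5-)
    have "(\<lambda>x. (x, m)) \<in> borel_measurable (borel :: 'a measure)"
      by (intro borel_measurable_continuous_onI continuous_intros)
    note [measurable] = measurable_compose[OF this A(1)]
    have "(\<integral>\<^sup>+x. ennreal \<bar>gain \<kappa> u (x, m)\<bar> \<partial>lebesgue_on \<Omega>) = (\<integral>\<^sup>+x. ennreal \<bar>gain \<kappa> u (x, m)\<bar> * indicator \<Omega> x \<partial>lebesgue)"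
      by (simp add: nn_integral_restrict_space)
    also have "\<dots> \<le> (\<integral>\<^sup>+x. A (x, m) * indicator \<Omega> x \<partial>lebesgue)"
      using AE_completion[OF elim(1)] elim(3)
      by (intro nn_integral_mono_AE) (auto simp: indicator_def elim!: eventually_mono)
    also have "\<dots> = (\<integral>\<^sup>+x. A (x, m) * indicator \<Omega> x \<partial>lborel)"
      by (rule nn_integral_completion) measurable
    also have "\<dots> \<le> \<Phi> k u m"
      using elim by simp
    finally show ?case .
  qed
  then show ?thesis
    by (simp add: AE_half_line)
qed

lemma fibre_bound_L1:
  assumes u: "u \<in> BV"
  shows "AE m in \<M>. sect (gain \<kappa> u) m \<in> carr (L1_space \<Omega>) -->
    ennreal (snorm (L1_space \<Omega>) (sect (gain \<kappa> u) m)) \<le> \<Phi> k u m"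
  using gain_nn_integral_L1[OF u]
proof (eventually_elim, intro impI, goal_cases ae)
  case (ae m)
  note elim = ae(1) ae(3-)
  then have i: "integrable (lebesgue_on \<Omega>) (sect (gain \<kappa> u) m)"
    by (simp add: L1_space_def)
  have snorm: "snorm (L1_space \<Omega>) f = (\<integral>x. \<bar>f x\<bar> \<partial>lebesgue_on \<Omega>)" for f
    by (simp add: L1_space_def)
  have "ennreal (\<integral>x. \<bar>sect (gain \<kappa> u) m x\<bar> \<partial>lebesgue_on \<Omega>) = (\<integral>\<^sup>+x. ennreal \<bar>sect (gain \<kappa> u) m x\<bar> \<partial>lebesgue_on \<Omega>)"
    by (rule nn_integral_eq_integral[symmetric]) (use i in auto)
  then show ?case
    using elim unfolding snorm by (simp add: sect_apply)
qed

lemma gain_SM_L1: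
  assumes u: "u \<in> BV" and fin: "AE m in \<M>. \<Phi> k u m < \<infinity>"
  shows "SM (sect (gain \<kappa> u))"
proof (rule L1_strongly_measurable[OF open_\<Omega> gain_measurable[OF BV_meas[OF u]]])
  show "AE m in \<M>. integrable (lebesgue_on \<Omega>) (sect (gain \<kappa> u) m)"
    using gain_nn_integral_L1[OF u] fin AE_section_measurable[OF \<Omega>_borel gain_measurable[OF BV_meas[OF u]]]
  proof eventually_elim
    case (elim m)
    then show ?case
      by (intro integrableI_bounded) (auto simp: sect_apply intro: le_less_trans)
  qed
qed

end

section \<open>Fibre bounds of the gain for continuous functions\<close>

locale C0_kernel = dominated_kernel "C0_space \<Omega>" \<Omega> r \<kappa> k
  for \<Omega> :: "'a::euclidean_space set" and r \<kappa> k +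
  assumes regular: "regular_domain \<Omega>"
begin

text \<open>The values of u at (x, s) are at most the supremum norm of the fibre at s, so the bound
  is the same for almost all x and no integration in x takes place.\<close>

lemma abs_gain_C0:
  assumes u: "u \<in> BV"
  shows "AE p in lborel. fst p \<in> \<Omega> \<and> 0 \<le> snd p --> abs_gain \<kappa> u p \<le> \<Phi> k u (snd p)"
proof -
  obtain \<kappa>' u' where v: "\<kappa>' \<in> borel_measurable borel" "u' \<in> borel_measurable borel"
    "AE p in lborel. fst p \<in> \<Omega> \<and> 0 \<le> snd p --> (AE s in lborel. snd p \<le> s -->
       \<kappa> (fst p) (snd p) s = \<kappa>' (fst p, snd p, s) \<and> u (fst p, s) = u' (fst p, s))"
    and uu': "AE z in lborel. fst z \<in> \<Omega> \<and> 0 \<le> snd z --> u z = u' z"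
    and \<kappa>'b: "\<forall>z. 0 \<le> \<kappa>' z \<and> \<kappa>' z \<le> k (snd z)"
    using kernel_version[OF BV_meas[OF u]] .
  have \<kappa>'0: "0 \<le> \<kappa>' z" and \<kappa>'k: "\<kappa>' z \<le> k (snd z)" for z
    using \<kappa>'b by blast+
  have carr: "AE s in lborel. 0 \<le> s --> sect u s \<in> C0_carrier \<Omega>"
    using BV_sect[OF u] by (simp add: AE_half_line C0_space_def)
  show ?thesis
    using v(3)
  proof (eventually_elim, intro impI, goal_cases ae)
    case (ae p)
    note elim = ae(1) ae(3-)
    then have "AE s in lborel. snd p \<le> s --> \<kappa> (fst p) (snd p) s = \<kappa>' (fst p, snd p, s) \<and> u (fst p, s) = u' (fst p, s)"
      by simp
    with carr have "AE s in lborel. ennreal \<bar>indicator {snd p..} s * (\<kappa> (fst p) (snd p) s * u (fst p, s))\<bar>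
        \<le> ennreal (k (snd p, s) * sup_norm \<Omega> (sect u s)) * indicator {snd p..} s"
    proof eventually_elim
      case s: (elim s)
      show ?case
      proof (cases "snd p \<le> s")
        case True
        have "\<bar>u (fst p, s)\<bar> \<le> sup_norm \<Omega> (sect u s)"
          using sup_norm_upper[OF regular, of "sect u s" "fst p"] s True elim by (simp add: sect_apply)
        then have "\<bar>\<kappa> (fst p) (snd p) s * u (fst p, s)\<bar> \<le> k (snd p, s) * sup_norm \<Omega> (sect u s)"
          unfolding abs_mult using s True \<kappa>'0[of "(fst p, snd p, s)"] \<kappa>'k[of "(fst p, snd p, s)"]
          by (intro mult_mono) auto
        then show ?thesis
          using True by (simp add: ennreal_leI)
      qed simp
    qed
    from AE_completion[OF this] show ?case
      unfolding abs_gain_def \<Phi>_def by (intro nn_integral_mono_AE) (simp add: C0_space_def)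
  qed
qed

lemma fibre_bound_finite_C0:
  assumes u: "u \<in> BV" and fin: "AE m in \<M>. \<Phi> k u m < \<infinity>"
  shows "AE p in lborel. fst p \<in> \<Omega> \<and> 0 \<le> snd p --> abs_gain \<kappa> u p < \<infinity>"
proof -
  have "AE m in lborel. 0 \<le> m --> \<Phi> k u m < \<infinity>"
    using fin by (simp add: AE_half_line)
  from AE_lborel_snd[OF this] abs_gain_C0[OF u] show ?thesis
    by eventually_elim (auto intro: le_less_trans)
qed

text \<open>The bound on the values holds for almost every x; if the fibre of the gain is continuous
  it extends to every x and thus to the supremum. For an infinite bound there is nothing to
  show.\<close>

lemma fibre_bound_C0:
  assumes u: "u \<in> BV"
  shows "AE m in \<M>. sect (gain \<kappa> u) m \<in> carr (C0_space \<Omega>) -->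
    ennreal (snorm (C0_space \<Omega>) (sect (gain \<kappa> u) m)) \<le> \<Phi> k u m"
proof -
  have "AE p in lborel. fst p \<in> \<Omega> \<and> 0 \<le> snd p --> ennreal \<bar>gain \<kappa> u p\<bar> \<le> \<Phi> k u (snd p)"
    using gain_converges_abs[OF BV_meas[OF u]] abs_gain_C0[OF u] by eventually_elim (auto intro: order_trans)
  from AE_lborel_Pair(2)[OF this]
  have "AE m in lborel. 0 \<le> m --> sect (gain \<kappa> u) m \<in> carr (C0_space \<Omega>) -->
    ennreal (snorm (C0_space \<Omega>) (sect (gain \<kappa> u) m)) \<le> \<Phi> k u m"
  proof (eventually_elim, intro impI, goal_cases ae)
    case (ae m)
    note elim = ae(1) ae(3-)
    show ?case
    proof (cases "\<Phi> k u m")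
      case (real K)
      have "continuous_on \<Omega> (sect (gain \<kappa> u) m)"
        using elim by (intro C0_carrier_continuous) (simp add: C0_space_def)
      then have cont: "continuous_on \<Omega> (\<lambda>x. K - \<bar>sect (gain \<kappa> u) m x\<bar>)"
        by (intro continuous_intros)
      have "AE x in lborel. x \<in> \<Omega> --> 0 \<le> K - \<bar>sect (gain \<kappa> u) m x\<bar>"
        using elim(1) by (rule eventually_mono) (use real elim(2) in \<open>auto simp: sect_apply ennreal_le_iff\<close>)
      then have "AE x in lebesgue_on \<Omega>. 0 \<le> K - \<bar>sect (gain \<kappa> u) m x\<bar>"
        by (simp add: AE_lebesgue_on_iff)
      from continuous_AE_nonneg[OF open_\<Omega> cont this] have "sup_norm \<Omega> (sect (gain \<kappa> u) m) \<le> K"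
        using real(1) by (intro sup_norm_least[OF regular]) auto
      then show ?thesis
        using real by (simp add: C0_space_def ennreal_leI)
    qed simp
  qed
  then show ?thesis
    by (simp add: AE_half_line)
qed

end

context C0_kernel
begin

text \<open>
  Approximation by simple functions of the mass reduces the claim to finite sums of products of a
  function of \<open>m\<close> and a fixed element of the fibre space, because the kernel does not depend on \<open>x\<close>.
\<close>

lemma gain_SM_C0:
  assumes u: "u \<in> BV" and fin: "AE m in \<M>. \<Phi> k u m < \<infinity>"
    and \<kappa>_eq: "AE m in \<M>. AE s in lborel. m \<le> s --> (\<forall>x. \<kappa> x m s = k (m, s))"
  shows "SM (sect (gain \<kappa> u))"
proof -
  let ?N = "sup_norm \<Omega>" and ?C = "C0_carrier \<Omega>"
  have X: "carr (C0_space \<Omega>) = ?C" "snorm (C0_space \<Omega>) = ?N"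
    by (simp_all add: C0_space_def)
  note V = V_diff[unfolded X] and NN = N_nonneg[unfolded X]
  have nonneg_s: "AE s in \<M>. 0 \<le> s"
    by (rule AE_nonneg_mass)
  obtain \<sigma> where \<sigma>: "!!j. simple_in (\<sigma> j)" "AE s in \<M>. (\<lambda>j. ?N (sect u s - \<sigma> j s)) \<longlonglongrightarrow> 0"
    using BV_SM[OF u] by (auto simp: SM_iff X)
  have u_carr: "AE s in \<M>. sect u s \<in> ?C"
    using BV_sect[OF u] by (simp add: X)
  have u_meas: "(\<lambda>s. ?N (sect u s)) \<in> borel_measurable \<M>"
    using SM_norm_measurable[OF BV_SM[OF u]] by (simp add: X)
  \<comment> \<open>Where the approximant exceeds twice the norm of u it is replaced by 0, so that 2
    times the norm of u dominates all approximants. Values of norm 0 are also replaced, so that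
    every nonzero value that remains has positive norm; this is used for the integrability in
    \<open>K_int\<close>.\<close>
  define A where "A j = {s \<in> space \<M>. 0 < ?N (\<sigma> j s) \<and> ?N (\<sigma> j s) \<le> 2 * ?N (sect u s)}" for j
  define \<tau> where "\<tau> j s = (if s \<in> A j then \<sigma> j s else 0)" for j s
  have A_meas: "A j \<in> sets \<M>" for j
  proof -
    have [measurable]: "(\<lambda>s. ?N (\<sigma> j s)) \<in> borel_measurable \<M>"
      using SM_norm_measurable[OF simple_in_SM[OF \<sigma>(1)[of j]]] by (simp add: X)
    note [measurable] = u_meas
    show ?thesis
      unfolding A_def by measurable
  qed
  have \<tau>_simple: "simple_in (\<tau> j)" for j
  proof -
    have "simple_function \<M> (\<sigma> j)" "\<sigma> j ` {0..} \<subseteq> ?C"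
      using \<sigma>(1)[of j] by (auto simp: simple_in_def X)
    moreover have "simple_function \<M> (\<tau> j)"
      unfolding \<tau>_def by (rule simple_function_If_set[OF calculation(1) simple_function_const]) (use A_meas[of j] in \<open>auto intro: sets.Int\<close>)
    ultimately show ?thesis
      using C0_carrier_zero[OF regular] by (auto simp: simple_in_def X \<tau>_def)
  qed
  have \<tau>C: "\<tau> j s \<in> ?C" if "0 \<le> s" for j s
    using simple_in_carr[OF \<tau>_simple that] by (simp add: X)
  have N0: "?N 0 = 0"
    using N_zero by (simp add: X)
  have \<tau>_le: "?N (\<tau> j s) \<le> 2 * ?N (sect u s)" if "sect u s \<in> ?C" for j s
    using NN[OF that] by (auto simp: \<tau>_def A_def N0)
  have \<tau>_diff: "?N (sect u s - \<tau> j s) \<le> 3 * ?N (sect u s)" if "0 \<le> s" "sect u s \<in> ?C" for j s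
    using N_diff_le[unfolded X, OF that(2) \<tau>C[OF that(1)], of j] \<tau>_le[OF that(2), of j] by linarith
  have \<tau>_lim: "AE s in \<M>. (\<lambda>j. ?N (sect u s - \<tau> j s)) \<longlonglongrightarrow> 0"
    using \<sigma>(2) u_carr nonneg_s
  proof eventually_elim
    case (elim s)
    then have s: "0 \<le> s" and C: "sect u s \<in> ?C"
      by auto
    show ?case
    proof (cases "?N (sect u s) = 0")
      case True
      then have "?N (sect u s - \<tau> j s) = 0" for j
        using \<tau>_diff[OF s C, of j] NN[OF V[OF C \<tau>C[OF s]], of j] by simp
      then show ?thesis
        by simp
    next
      case False
      then have pos: "0 < ?N (sect u s)"
        using NN[OF C] by simp
      have \<sigma>C: "\<sigma> j s \<in> ?C" for j
        using simple_in_carr[OF \<sigma>(1) s] by (simp add: X)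
      have "(\<lambda>j. ?N (\<sigma> j s - sect u s)) \<longlonglongrightarrow> 0"
        using elim(1) N_commute[unfolded X, OF \<sigma>C C] by simp
      from tendsto_N[unfolded X, OF \<sigma>C C this] have l: "(\<lambda>j. ?N (\<sigma> j s)) \<longlonglongrightarrow> ?N (sect u s)" .
      have "\<forall>\<^sub>F j in sequentially. 0 < ?N (\<sigma> j s) \<and> ?N (\<sigma> j s) < 2 * ?N (sect u s)"
        using order_tendstoD[OF l] pos by (intro eventually_conj) auto
      then have "\<forall>\<^sub>F j in sequentially. ?N (sect u s - \<sigma> j s) = ?N (sect u s - \<tau> j s)"
        by eventually_elim (use s in \<open>auto simp: \<tau>_def A_def\<close>)
      from Lim_transform_eventually[OF elim(1) this] show ?thesis .
    qed
  qed
  define F where "F j = \<tau> j ` {0..} - {0}" for j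
  have F_fin: "finite (F j)" for j
    using \<tau>_simple[of j] simple_functionD(1)[of \<M> "\<tau> j"] by (simp add: simple_in_def F_def)
  have FC: "f \<in> ?C" if "f \<in> F j" for f j
    using that \<tau>C by (auto simp: F_def)
  have "\<forall>j f. \<exists>h. h \<in> borel_measurable borel \<and> (AE s in lborel. s \<in> {0..} --> indicator {s. \<tau> j s = f} s = (h s :: real))"
  proof (intro allI)
    fix j f
    have "\<tau> j -` {f} \<inter> space \<M> \<in> sets \<M>"
      using \<tau>_simple[of j] by (intro simple_functionD(2)) (simp add: simple_in_def)
    then have "(indicator (\<tau> j -` {f} \<inter> space \<M>) :: real \<Rightarrow> real) \<in> borel_measurable \<M>"
      by (rule borel_measurable_indicator)
    then have "(indicator {s. \<tau> j s = f} :: real \<Rightarrow> real) \<in> borel_measurable \<M>"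
      by (rule measurable_cong[THEN iffD1, rotated]) (auto simp: indicator_def)
    from borel_version[OF half_line_borel this]
    show "\<exists>h. h \<in> borel_measurable borel \<and> (AE s in lborel. s \<in> {0..} --> indicator {s. \<tau> j s = f} s = (h s :: real))"
      by blast
  qed
  then obtain h where h: "!!j f. h j f \<in> borel_measurable borel"
    "!!j f. AE s in lborel. s \<in> {0..} --> indicator {s. \<tau> j s = f} s = (h j f s :: real)"
    by metis
  \<comment> \<open>The gain of the indicator of the masses where the approximant takes the value f.
    By linearity the gain of the approximant is the finite sum of \<open>K j f m\<close> times f, an
    element of the fibre space.\<close>
  define K where "K j f m = (\<integral>s. indicator {m..} s * (k (m, s) * h j f s) \<partial>lborel)" for j f m
  have K_meas: "K j f \<in> borel_measurable \<M>" for j f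
  proof -
    have "{z :: real \<times> real. fst z \<le> snd z} \<in> sets borel"
      by (intro borel_closed closed_Collect_le continuous_intros)
    then have "(\<lambda>z. indicator {z. fst z \<le> snd z} z * (k z * h j f (snd z))) \<in> borel_measurable (borel :: (real \<times> real) measure)"
      by (intro borel_measurable_times borel_measurable_indicator k_measurable measurable_compose[OF _ h(1)]
          borel_measurable_continuous_onI continuous_intros)
    moreover have "(\<lambda>z. indicator {z. fst z \<le> snd z} z * (k z * h j f (snd z))) =
        (\<lambda>(m, s). indicator {m..} s * (k (m, s) * h j f s))"
      by (auto simp: fun_eq_iff indicator_def)
    ultimately have "(\<lambda>(m, s). indicator {m..} s * (k (m, s) * h j f s)) \<in> borel_measurable (borel \<Otimes>\<^sub>M lborel)"
      by (simp add: borel_prod[symmetric] cong: measurable_cong_sets)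
    from lborel.borel_measurable_lebesgue_integral[OF this] have "K j f \<in> borel_measurable borel"
      by (simp add: K_def[abs_def])
    then show ?thesis
      by (intro measurable_restrict_space1 measurable_completion) simp
  qed
  define g where "g j m = (\<lambda>x. \<Sum>f\<in>F j. K j f m * f x)" for j m
  have g_SM: "SM (g j) \<and> (\<forall>m. g j m \<in> ?C)" for j
  proof -
    have "SM (\<lambda>m x. \<Sum>f\<in>Y. K j f m * f x) \<and> (\<forall>m. (\<lambda>x. \<Sum>f\<in>Y. K j f m * f x) \<in> ?C)" if "finite Y" "Y \<subseteq> ?C" for Y
      using that
    proof (induction rule: finite_induct)
      case empty
      have "SM (\<lambda>_. 0)"
        by (rule simple_in_SM) (use C0_carrier_zero[OF regular] in \<open>simp add: simple_in_def image_subset_iff X\<close>)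
      then show ?case
        using C0_carrier_zero[OF regular] by (simp add: zero_fun_def)
    next
      case (insert f Y)
      have eq: "(\<lambda>x. \<Sum>f\<in>insert f Y. K j f m * f x) = 1 *\<^sub>R (K j f m *\<^sub>R f) + 1 *\<^sub>R (\<lambda>x. \<Sum>f\<in>Y. K j f m * f x)" for m
        using insert(1,2) by (simp add: fun_eq_iff)
      have fC: "f \<in> ?C" and Y: "SM (\<lambda>m x. \<Sum>f\<in>Y. K j f m * f x)" "!!m. (\<lambda>x. \<Sum>f\<in>Y. K j f m * f x) \<in> ?C"
        using insert by auto
      have "SM (\<lambda>_. f)"
        by (rule simple_in_SM) (use fC in \<open>simp add: simple_in_def image_subset_iff X\<close>)
      from SM_scale[OF this K_meas] have S: "SM (\<lambda>m. K j f m *\<^sub>R f)" .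
      have "(\<lambda>x. \<Sum>f\<in>insert f Y. K j f m * f x) \<in> ?C" for m
        unfolding eq using C0_carrier_lin[OF regular fC Y(2)[of m], of "K j f m" 1] by simp
      moreover have "SM (\<lambda>m x. \<Sum>f\<in>insert f Y. K j f m * f x)"
        unfolding eq by (rule SM_lin[OF S Y(1)])
      ultimately show ?case
        by blast
    qed
    from this[OF F_fin, of j] FC show ?thesis
      unfolding g_def[abs_def] by blast
  qed
  have main: "AE m in \<M>. sect (gain \<kappa> u) m \<in> ?C \<and> (\<lambda>j. ?N (g j m - sect (gain \<kappa> u) m)) \<longlonglongrightarrow> 0"
    using fin \<kappa>_eq nonneg_s
  proof eventually_elim
    case (elim m)
    then have m: "0 \<le> m"
      by simp
    have k_sec: "(\<lambda>s. k (m, s)) \<in> borel_measurable borel"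
    proof -
      have "(\<lambda>s. (m, s)) \<in> borel_measurable borel"
        by (intro borel_measurable_continuous_onI continuous_intros)
      from measurable_compose[OF this k_measurable] show ?thesis .
    qed
    have meas: "(\<lambda>s. indicator {m..} s * (k (m, s) * \<phi> s)) \<in> borel_measurable lebesgue"
      if "\<phi> \<in> borel_measurable \<M>" for \<phi> :: "real \<Rightarrow> real"
    proof -
      have [measurable]: "(\<lambda>s. if s \<in> {0..} then \<phi> s else 0) \<in> borel_measurable lebesgue"
        using that by (intro borel_measurable_if_I) auto
      have [measurable]: "(\<lambda>s. k (m, s)) \<in> borel_measurable lebesgue" "(indicator {m..} :: real \<Rightarrow> real) \<in> borel_measurable lebesgue"
        using k_sec by (intro measurable_completion; simp)+
      have "(\<lambda>s. indicator {m..} s * (k (m, s) * (if s \<in> {0..} then \<phi> s else 0))) \<in> borel_measurable lebesgue"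
        by measurable
      moreover have "(\<lambda>s. indicator {m..} s * (k (m, s) * (if s \<in> {0..} then \<phi> s else 0))) = (\<lambda>s. indicator {m..} s * (k (m, s) * \<phi> s))"
        using m by (auto simp: fun_eq_iff indicator_def)
      ultimately show ?thesis
        by simp
    qed
    have AE_m: "AE s in lebesgue. m \<le> s --> R s" if "AE s in \<M>. R s" for R
    proof -
      have "AE s in lborel. 0 \<le> s --> R s"
        using that by (simp add: AE_half_line)
      from AE_completion[OF this] show ?thesis
        by eventually_elim (use m in auto)
    qed
    let ?J = "\<lambda>s. indicator {m..} s * (k (m, s) * ?N (sect u s))"
    have J: "integrable lebesgue ?J"
    proof (rule integrableI_bounded[OF meas[OF u_meas]])
      have "(\<integral>\<^sup>+s. ennreal (norm (?J s)) \<partial>lebesgue) = \<Phi> k u m"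
        unfolding \<Phi>_def
      proof (rule nn_integral_cong_AE)
        show "AE s in lebesgue. ennreal (norm (?J s)) = ennreal (k (m, s) * snorm (C0_space \<Omega>) (sect u s)) * indicator {m..} s"
          using AE_m[OF u_carr] by eventually_elim (use NN k_nonneg in \<open>auto simp: X indicator_def\<close>)
      qed
      then show "(\<integral>\<^sup>+s. ennreal (norm (?J s)) \<partial>lebesgue) < \<infinity>"
        using elim by simp
    qed
    have dom: "integrable lebesgue (\<lambda>s. indicator {m..} s * (k (m, s) * \<phi> s))"
      if \<phi>: "\<phi> \<in> borel_measurable \<M>" and le: "AE s in \<M>. \<bar>\<phi> s\<bar> \<le> c * ?N (sect u s)" for \<phi> :: "real \<Rightarrow> real" and c
    proof (rule Bochner_Integration.integrable_bound[OF _ meas[OF \<phi>]])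
      show "integrable lebesgue (\<lambda>s. c * ?J s)"
        using J by simp
      show "AE s in lebesgue. norm (indicator {m..} s * (k (m, s) * \<phi> s)) \<le> norm (c * ?J s)"
        using AE_m[OF le]
      proof eventually_elim
        case (elim s)
        show ?case
        proof (cases "m \<le> s")
          case True
          have "k (m, s) * \<bar>\<phi> s\<bar> \<le> k (m, s) * (c * ?N (sect u s))"
            using elim True k_nonneg by (intro mult_left_mono) auto
          also have "\<dots> \<le> \<bar>c * (k (m, s) * ?N (sect u s))\<bar>"
            by (simp add: mult.left_commute)
          finally show ?thesis
            using True k_nonneg[of "(m, s)"] by (simp add: abs_mult)
        qed simp
      qed
    qed
    have \<tau>_meas: "(\<lambda>s. \<tau> j s x) \<in> borel_measurable \<M>" for j x
    proof -
      have "simple_function \<M> (\<lambda>s. (\<lambda>f. f x) (\<tau> j s))"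
        using simple_function_compose1[of \<M> "\<tau> j" "\<lambda>f. f x"] \<tau>_simple[of j] by (simp add: simple_in_def)
      then show ?thesis
        by (intro borel_measurable_simple_function) simp
    qed
    have up: "\<bar>f x\<bar> \<le> ?N f" if "f \<in> ?C" "x \<in> \<Omega>" for f x
      using sup_norm_upper[OF regular that] .
    have ux_lim: "AE s in \<M>. (\<lambda>j. \<tau> j s x) \<longlonglongrightarrow> u (x, s)" if x: "x \<in> \<Omega>" for x
      using \<tau>_lim u_carr nonneg_s
    proof eventually_elim
      case (elim s)
      have "norm (\<tau> j s x - u (x, s)) \<le> ?N (sect u s - \<tau> j s)" for j
        using up[OF V[OF elim(2) \<tau>C[OF elim(3)]] x, of j] by (simp add: sect_apply abs_minus_commute)
      then have "(\<lambda>j. \<tau> j s x - u (x, s)) \<longlonglongrightarrow> 0"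
        by (intro Lim_null_comparison[OF always_eventually elim(1)]) blast
      then show ?case
        by (simp add: LIM_zero_iff)
    qed
    \<comment> \<open>Measurability in s for every x in the domain, not just almost every x, because
      convergence in the supremum norm is convergence at each x.\<close>
    have ux_meas: "(\<lambda>s. u (x, s)) \<in> borel_measurable \<M>" if x: "x \<in> \<Omega>" for x
      by (rule borel_measurable_lebesgue_on_AE_limit[OF half_line_borel \<tau>_meas ux_lim[OF x]])
    have d_meas: "(\<lambda>s. ?N (sect u s - \<tau> j s)) \<in> borel_measurable \<M>" for j
      using SM_norm_measurable[OF SM_diff[OF BV_SM[OF u] simple_in_SM[OF \<tau>_simple]], of j] by (simp add: X)
    have d_le: "AE s in \<M>. \<bar>?N (sect u s - \<tau> j s)\<bar> \<le> 3 * ?N (sect u s)" for j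
      using u_carr nonneg_s
    proof eventually_elim
      case (elim s)
      then show ?case
        using \<tau>_diff[of s j] NN[OF V[OF elim(1) \<tau>C[OF elim(2)]], of j] by simp
    qed
    \<comment> \<open>Bounds the error of the gain at every x simultaneously, which gives uniform
      convergence.\<close>
    define e where "e j = (\<integral>s. indicator {m..} s * (k (m, s) * ?N (sect u s - \<tau> j s)) \<partial>lebesgue)" for j
    have e_lim: "e \<longlonglongrightarrow> 0"
    proof -
      have "(\<lambda>j. \<integral>s. indicator {m..} s * (k (m, s) * ?N (sect u s - \<tau> j s)) \<partial>lebesgue) \<longlonglongrightarrow> (\<integral>s. 0 \<partial>(lebesgue :: real measure))"
      proof (rule integral_dominated_convergence[where w = "\<lambda>s. 3 * ?J s"])
        show "integrable lebesgue (\<lambda>s. 3 * ?J s)"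
          using J by simp
        show "(\<lambda>s. indicator {m..} s * (k (m, s) * ?N (sect u s - \<tau> j s))) \<in> borel_measurable lebesgue" for j
          by (rule meas[OF d_meas])
        show "AE s in lebesgue. (\<lambda>j. indicator {m..} s * (k (m, s) * ?N (sect u s - \<tau> j s))) \<longlonglongrightarrow> 0"
          using AE_m[OF \<tau>_lim]
        proof eventually_elim
          case (elim s)
          show ?case
          proof (cases "m \<le> s")
            case True
            then show ?thesis
              using tendsto_mult_right_zero[of "\<lambda>j. ?N (sect u s - \<tau> j s)" sequentially "k (m, s)"] elim by simp
          qed simp
        qed
        show "AE s in lebesgue. norm (indicator {m..} s * (k (m, s) * ?N (sect u s - \<tau> j s))) \<le> 3 * ?J s" for j
          using AE_m[OF d_le[of j]]
        proof eventually_elim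
          case (elim s)
          show ?case
          proof (cases "m \<le> s")
            case True
            have "k (m, s) * \<bar>?N (sect u s - \<tau> j s)\<bar> \<le> k (m, s) * (3 * ?N (sect u s))"
              using elim True k_nonneg by (intro mult_left_mono) auto
            then show ?thesis
              using True k_nonneg[of "(m, s)"] by (simp add: abs_mult)
          qed simp
        qed
      qed simp
      then show ?thesis
        by (simp add: e_def[abs_def])
    qed
    have ind_meas: "(indicator {s. \<tau> j s = f} :: real \<Rightarrow> real) \<in> borel_measurable \<M>" for j f
      by (rule borel_measurable_lebesgue_onI[OF half_line_borel h])
    have K_eq: "K j f m = (\<integral>s. indicator {m..} s * (k (m, s) * indicator {s. \<tau> j s = f} s) \<partial>lebesgue)" for j f
    proof -
      have "AE s in lborel. indicator {m..} s * (k (m, s) * indicator {s. \<tau> j s = f} s) = indicator {m..} s * (k (m, s) * h j f s)"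
        using h(2)[of j f] by eventually_elim (use m in \<open>auto simp: indicator_def\<close>)
      from lebesgue_integral_borel_version(1)[OF _ this] show ?thesis
        using k_sec h(1)[of j f] by (simp add: K_def)
    qed
    \<comment> \<open>Where the approximant equals f, the norm of u is at least half the norm of f,
      so the indicator is dominated by a multiple of the norm of u.\<close>
    have K_int: "integrable lebesgue (\<lambda>s. indicator {m..} s * (k (m, s) * indicator {s. \<tau> j s = f} s))" if f: "f \<in> F j" for j f
    proof (rule dom[OF ind_meas])
      obtain s\<^sub>0 where s\<^sub>0: "0 \<le> s\<^sub>0" "f = \<tau> j s\<^sub>0" "f \<noteq> 0"
        using f by (auto simp: F_def)
      then have fpos: "0 < ?N f"
        by (auto simp: \<tau>_def A_def split: if_splits)
      show "AE s in \<M>. \<bar>indicator {s. \<tau> j s = f} s\<bar> \<le> (2 / ?N f) * ?N (sect u s)"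
        using u_carr
      proof eventually_elim
        case (elim s)
        show ?case
          using \<tau>_le[OF elim, of j] fpos NN[OF elim] by (auto simp: indicator_def field_simps)
      qed
    qed
    have g_eq: "g j m x = (\<integral>s. indicator {m..} s * (k (m, s) * \<tau> j s x) \<partial>lebesgue)" for j x
    proof -
      have "g j m x = (\<Sum>f\<in>F j. \<integral>s. indicator {m..} s * (k (m, s) * indicator {s. \<tau> j s = f} s) * f x \<partial>lebesgue)"
        unfolding g_def K_eq by simp
      also have "\<dots> = (\<integral>s. (\<Sum>f\<in>F j. indicator {m..} s * (k (m, s) * indicator {s. \<tau> j s = f} s) * f x) \<partial>lebesgue)"
        by (rule Bochner_Integration.integral_sum[symmetric]) (intro integrable_mult_left K_int)
      also have "\<dots> = (\<integral>s. indicator {m..} s * (k (m, s) * \<tau> j s x) \<partial>lebesgue)"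
      proof (rule Bochner_Integration.integral_cong[OF refl])
        fix s
        show "(\<Sum>f\<in>F j. indicator {m..} s * (k (m, s) * indicator {s. \<tau> j s = f} s) * f x) = indicator {m..} s * (k (m, s) * \<tau> j s x)"
        proof (cases "m \<le> s")
          case True
          then have "0 \<le> s"
            using m by simp
          have "(\<Sum>f\<in>F j. indicator {m..} s * (k (m, s) * indicator {s. \<tau> j s = f} s) * f x)
              = (\<Sum>f\<in>F j. if f = \<tau> j s then k (m, s) * f x else 0)"
            using True by (intro sum.cong) (auto simp: indicator_def)
          also have "\<dots> = (if \<tau> j s \<in> F j then k (m, s) * \<tau> j s x else 0)"
            using F_fin by (simp add: sum.delta)
          also have "\<dots> = k (m, s) * \<tau> j s x"
            using \<open>0 \<le> s\<close> by (auto simp: F_def)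
          finally show ?thesis
            using True by simp
        qed simp
      qed
      finally show ?thesis .
    qed
    \<comment> \<open>The hypothesis replaces the kernel by k for all x at once, so the exceptional
      masses do not depend on x and the formula holds at each x in the domain.\<close>
    have gain_k: "gain \<kappa> u (x, m) = (\<integral>s. indicator {m..} s * (k (m, s) * u (x, s)) \<partial>lebesgue)" if x: "x \<in> \<Omega>" for x
    proof -
      have eq: "AE s in lborel. indicator {m..} s * (\<kappa> x m s * u (x, s)) = indicator {m..} s * (k (m, s) * u (x, s))"
        using elim(2) by eventually_elim (auto simp: indicator_def)
      have m2: "(\<lambda>s. indicator {m..} s * (k (m, s) * u (x, s))) \<in> borel_measurable lebesgue"
        by (rule meas[OF ux_meas[OF x]])
      have "(\<lambda>s. indicator {m..} s * (\<kappa> x m s * u (x, s))) \<in> borel_measurable (lebesgue_on UNIV)"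
      proof (rule borel_measurable_lebesgue_on_cong_AE)
        show U: "UNIV \<in> sets (borel :: real measure)"
          by simp
        show "(\<lambda>s. indicator {m..} s * (k (m, s) * u (x, s))) \<in> borel_measurable (lebesgue_on UNIV)"
          using m2 by simp
        show "AE s in lebesgue_on UNIV. indicator {m..} s * (\<kappa> x m s * u (x, s)) = indicator {m..} s * (k (m, s) * u (x, s))"
          by (rule AE_lebesgue_on_iff[OF U, THEN iffD2]) (rule eventually_mono[OF eq], blast)
      qed
      then have "(\<lambda>s. indicator {m..} s * (\<kappa> x m s * u (x, s))) \<in> borel_measurable lebesgue"
        by simp
      then show ?thesis
        unfolding gain_eq by (rule integral_cong_AE[OF _ m2 AE_completion[OF eq]])
    qed
    have close: "\<bar>g j m x - gain \<kappa> u (x, m)\<bar> \<le> e j" if x: "x \<in> \<Omega>" for j x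
    proof -
      have i1: "integrable lebesgue (\<lambda>s. indicator {m..} s * (k (m, s) * \<tau> j s x))"
      proof (rule dom[OF \<tau>_meas])
        show "AE s in \<M>. \<bar>\<tau> j s x\<bar> \<le> 2 * ?N (sect u s)"
          using u_carr nonneg_s by eventually_elim (use up[OF \<tau>C x] \<tau>_le in \<open>blast intro: order_trans\<close>)
      qed
      have i2: "integrable lebesgue (\<lambda>s. indicator {m..} s * (k (m, s) * u (x, s)))"
      proof (rule dom[OF ux_meas[OF x]])
        show "AE s in \<M>. \<bar>u (x, s)\<bar> \<le> 1 * ?N (sect u s)"
          using u_carr by eventually_elim (use up[OF _ x] in \<open>fastforce simp: sect_apply\<close>)
      qed
      have "g j m x - gain \<kappa> u (x, m) = (\<integral>s. indicator {m..} s * (k (m, s) * \<tau> j s x) - indicator {m..} s * (k (m, s) * u (x, s)) \<partial>lebesgue)"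
        unfolding g_eq gain_k[OF x] using i1 i2 by simp
      also have "\<bar>\<dots>\<bar> \<le> e j"
        unfolding e_def
      proof (rule order_trans[OF integral_abs_bound integral_mono_AE])
        show "integrable lebesgue (\<lambda>s. \<bar>indicator {m..} s * (k (m, s) * \<tau> j s x) - indicator {m..} s * (k (m, s) * u (x, s))\<bar>)"
          using i1 i2 by simp
        show "integrable lebesgue (\<lambda>s. indicator {m..} s * (k (m, s) * ?N (sect u s - \<tau> j s)))"
          by (rule dom[OF d_meas d_le])
        show "AE s in lebesgue. \<bar>indicator {m..} s * (k (m, s) * \<tau> j s x) - indicator {m..} s * (k (m, s) * u (x, s))\<bar>
            \<le> indicator {m..} s * (k (m, s) * ?N (sect u s - \<tau> j s))"
          using AE_m[OF u_carr]
        proof eventually_elim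
          case (elim s)
          show ?case
          proof (cases "m \<le> s")
            case True
            then have "0 \<le> s"
              using m by simp
            have "\<bar>\<tau> j s x - u (x, s)\<bar> \<le> ?N (sect u s - \<tau> j s)"
              using up[OF V[OF elim[rule_format, OF True] \<tau>C[OF \<open>0 \<le> s\<close>]] x, of j] by (simp add: sect_apply abs_minus_commute)
            then have "k (m, s) * \<bar>\<tau> j s x - u (x, s)\<bar> \<le> k (m, s) * ?N (sect u s - \<tau> j s)"
              using k_nonneg by (intro mult_left_mono) auto
            moreover have "\<bar>k (m, s) * \<tau> j s x - k (m, s) * u (x, s)\<bar> = k (m, s) * \<bar>\<tau> j s x - u (x, s)\<bar>"
              using k_nonneg[of "(m, s)"] by (simp add: right_diff_distrib[symmetric] abs_mult)
            ultimately show ?thesis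
              using True by simp
          qed simp
        qed
      qed
      finally show ?thesis .
    qed
    have gC: "g j m \<in> ?C" for j
      using g_SM by blast
    have e0: "0 \<le> e j" for j
      unfolding e_def
    proof (rule integral_nonneg_AE)
      show "AE s in lebesgue. 0 \<le> indicator {m..} s * (k (m, s) * ?N (sect u s - \<tau> j s))"
        using AE_m[OF u_carr] AE_m[OF nonneg_s]
        by eventually_elim (use NN[OF V[OF _ \<tau>C]] k_nonneg in \<open>auto simp: indicator_def\<close>)
    qed
    have "Cauchy_V g'" if "g' = (\<lambda>j. g j m)" for g'
      unfolding Cauchy_V_def that
    proof (intro allI impI)
      fix \<epsilon> :: real
      assume "0 < \<epsilon>"
      then obtain M where M: "!!j. M \<le> j ==> e j < \<epsilon> / 2"
        using order_tendstoD(2)[OF e_lim, of "\<epsilon> / 2"] by (auto simp: eventually_sequentially)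
      have "?N (g j m - g M m) < \<epsilon>" if "M \<le> j" for j
      proof -
        have "?N (g j m - g M m) \<le> e j + e M"
        proof (rule sup_norm_least[OF regular])
          fix x
          assume "x \<in> \<Omega>"
          from close[OF this, of j] close[OF this, of M] show "\<bar>(g j m - g M m) x\<bar> \<le> e j + e M"
            by simp
        qed (use e0 in simp)
        also have "\<dots> < \<epsilon>"
          using M[OF that] M[of M] by simp
        finally show ?thesis .
      qed
      then show "\<exists>M. \<forall>j\<ge>M. snorm (C0_space \<Omega>) (g j m - g M m) < \<epsilon>"
        by (auto simp: X)
    qed
    then obtain v where v: "v \<in> ?C" "(\<lambda>j. ?N (g j m - v)) \<longlonglongrightarrow> 0"
      using Cauchy_V_convergent[of "\<lambda>j. g j m"] gC by (auto simp: X)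
    have v_eq: "v x = gain \<kappa> u (x, m)" if x: "x \<in> \<Omega>" for x
    proof (rule LIMSEQ_unique)
      have "norm (g j m x - v x) \<le> ?N (g j m - v)" for j
        using up[OF V[OF gC v(1)] x, of j] by simp
      then have "(\<lambda>j. g j m x - v x) \<longlonglongrightarrow> 0"
        by (intro Lim_null_comparison[OF always_eventually v(2)]) blast
      then show "(\<lambda>j. g j m x) \<longlonglongrightarrow> v x"
        by (simp add: LIM_zero_iff)
      have "norm (g j m x - gain \<kappa> u (x, m)) \<le> e j" for j
        using close[OF x] by simp
      then have "(\<lambda>j. g j m x - gain \<kappa> u (x, m)) \<longlonglongrightarrow> 0"
        by (intro Lim_null_comparison[OF always_eventually e_lim]) blast
      then show "(\<lambda>j. g j m x) \<longlonglongrightarrow> gain \<kappa> u (x, m)"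
        by (simp add: LIM_zero_iff)
    qed
    \<comment> \<open>The limit v equals the gain on the domain. For a bounded domain values
      elsewhere do not affect membership; otherwise the domain is the whole space and v is the
      gain.\<close>
    have C: "sect (gain \<kappa> u) m \<in> ?C"
    proof (cases "bounded \<Omega>")
      case True
      then show ?thesis
        using v(1) v_eq by (auto simp: C0_carrier_def sect_apply)
    next
      case False
      then have "sect (gain \<kappa> u) m = v"
        using v_eq regular by (auto simp: regular_domain_def sect_apply fun_eq_iff)
      then show ?thesis
        using v(1) by simp
    qed
    have "?N (g j m - sect (gain \<kappa> u) m) \<le> e j" for j
      using close e0 by (intro sup_norm_least[OF regular]) (auto simp: sect_apply)
    then have "(\<lambda>j. ?N (g j m - sect (gain \<kappa> u) m)) \<longlonglongrightarrow> 0"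
      using NN[OF V[OF gC C]] by (intro tendsto_sandwich[OF _ _ tendsto_const e_lim]) auto
    with C show ?case
      by blast
  qed
  show ?thesis
  proof (rule SM_limit[of g])
    show "SM (g j)" for j
      using g_SM by blast
    show "AE m in \<M>. sect (gain \<kappa> u) m \<in> carr (C0_space \<Omega>)"
      using main by (auto simp: X elim: eventually_mono)
    show "AE m in \<M>. (\<lambda>j. snorm (C0_space \<Omega>) (g j m - sect (gain \<kappa> u) m)) \<longlonglongrightarrow> 0"
      using main by (auto simp: X elim: eventually_mono)
  qed
qed

end

section \<open>Transfer to the fragmentation operators\<close>

lemma C0_semigroup_iff:
  assumes "ordered_seminormed (carr X) (snorm X) (cone X)"
  shows "C0_semigroup X G \<longleftrightarrow> ordered_seminormed.C0_sg (carr X) (snorm X) G"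
proof -
  interpret ordered_seminormed "carr X" "snorm X" "cone X"
    by (rule assms)
  have e: "eqv X f g \<longleftrightarrow> f - g \<in> carr X \<and> snorm X (f - g) = 0" for f g
    by (simp add: eqv_def fun_diff_def)
  have lin: "(\<lambda>y. c * f y + d * g y) = c *\<^sub>R f + d *\<^sub>R g" for c d :: real and f g :: "'a \<Rightarrow> real"
    by (simp add: fun_eq_iff)
  have diff: "(\<lambda>y. f y - g y) = f - g" for f g :: "'a \<Rightarrow> real"
    by (simp add: fun_eq_iff)
  show ?thesis
    unfolding C0_semigroup_def C0_sg_def lin diff e
    by (intro iffI; elim conjE; intro conjI) (assumption | simp)+
qed

lemma generator_eq:
  assumes "ordered_seminormed (carr X) (snorm X) (cone X)"
  shows "generator X G = ordered_seminormed.gen (carr X) (snorm X) G"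
proof -
  interpret ordered_seminormed "carr X" "snorm X" "cone X"
    by (rule assms)
  have "(\<lambda>y. (G t f y - f y) / t - g y) = (1 / t) *\<^sub>R (G t f - f) - g" for f g t
    by (simp add: fun_eq_iff)
  then show ?thesis
    unfolding generator_def gen_def by simp
qed

context bochner
begin

lemma bochner_space_eq:
  "carr (bochner_space \<Omega> X r) = BV" "snorm (bochner_space \<Omega> X r) = BN" "cone (bochner_space \<Omega> X r) = BP"
  by (simp_all add: bochner_space_def BP_def BN_def[abs_def] w_def sect_def[abs_def])

lemma bochner_ordered_seminormed:
  "ordered_seminormed (carr (bochner_space \<Omega> X r)) (snorm (bochner_space \<Omega> X r)) (cone (bochner_space \<Omega> X r))"
  unfolding bochner_space_eq by unfold_locales

lemma bochner_C0_semigroup_iff: "C0_semigroup (bochner_space \<Omega> X r) G \<longleftrightarrow> B.C0_sg G"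
  using C0_semigroup_iff[OF bochner_ordered_seminormed] by (simp only: bochner_space_eq)

lemma bochner_generator_eq: "generator (bochner_space \<Omega> X r) G = B.gen G"
  using generator_eq[OF bochner_ordered_seminormed] by (simp only: bochner_space_eq)

end

text \<open>The graph in the theorem also demands convergence of the gain integral and membership of
  its value. Both hold on the domain of transport with loss, so the graph is the generator found
  before and its domain is all of \<open>T_dom\<close>.\<close>

lemma (in gain_operator) frag_op_generates:
  assumes X: "X = X_space \<Omega> i"
    and T0: "T0_op \<Omega> i r T D = B.gen G" and dom: "mult_dom \<Omega> i r c = mult_dom \<Omega> i r a"
    and B_BV: "!!u. u \<in> T_dom \<Omega> i r T D a ==> u \<in> DC ==> gain \<kappa> u \<in> BV"
  shows "generates_positive (XX_space \<Omega> i r) (frag_op \<Omega> i r T D c \<kappa>) (T_dom \<Omega> i r T D a)"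
proof -
  have XX: "XX_space \<Omega> i r = bochner_space \<Omega> X r"
    by (simp add: XX_space_def X)
  have md: "mult_dom \<Omega> i r c = DC"
    by (simp add: mult_dom_def XX bochner_space_eq DC_def C_def)
  then have TD: "T_dom \<Omega> i r T D a = Domain (B.gen G) \<inter> DC"
    using dom by (simp add: T_dom_def T0)
  have gBV: "gain \<kappa> u \<in> BV" if "(u, v) \<in> B.gen G" "u \<in> DC" for u v
    using B_BV[of u] that by (auto simp: TD)
  have "\<exists>S. B.C0_sg S \<and>
    B.gen S = {(u, v). u \<in> DC \<and> v \<in> BV \<and> (\<exists>v\<^sub>0. (u, v\<^sub>0) \<in> B.gen G \<and> BN (v - (v\<^sub>0 - C u + gain \<kappa> u)) = 0)} \<and>
    (\<forall>t\<ge>0. \<forall>f\<in>BP. S t f \<in> BP)"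
    by (rule gain_generates) (rule gBV)
  then obtain S where S: "B.C0_sg S"
    "B.gen S = {(u, v). u \<in> DC \<and> v \<in> BV \<and> (\<exists>v\<^sub>0. (u, v\<^sub>0) \<in> B.gen G \<and> BN (v - (v\<^sub>0 - C u + gain \<kappa> u)) = 0)}"
    "\<forall>t\<ge>0. \<forall>f\<in>BP. S t f \<in> BP"
    by blast
  have e: "eqv (XX_space \<Omega> i r) v (\<lambda>y. v\<^sub>0 y - c y * u y + gain \<kappa> u y) \<longleftrightarrow> BN (v - (v\<^sub>0 - C u + gain \<kappa> u)) = 0"
    if "u \<in> DC" "v \<in> BV" "(u, v\<^sub>0) \<in> B.gen G" for u v v\<^sub>0
  proof -
    have "(\<lambda>y. v y - (v\<^sub>0 y - c y * u y + gain \<kappa> u y)) = v - (v\<^sub>0 - C u + gain \<kappa> u)"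
      by (simp add: fun_eq_iff C_def)
    moreover have "v\<^sub>0 \<in> BV"
      using that(3) by (simp add: B.gen_def)
    then have "v - (v\<^sub>0 - C u + gain \<kappa> u) \<in> BV"
      using gBV[OF that(3,1)] DC_D[OF that(1)] that(2) by simp
    ultimately show ?thesis
      by (simp add: eqv_def XX bochner_space_eq)
  qed
  have op: "frag_op \<Omega> i r T D c \<kappa> = B.gen S"
  proof -
    have "(u, v) \<in> frag_op \<Omega> i r T D c \<kappa> \<longleftrightarrow> (u, v) \<in> B.gen S" for u v
      unfolding frag_op_def S(2) mem_Collect_eq case_prod_conv md T0
      using e gain_converges by (auto simp: XX bochner_space_eq)
    then show ?thesis
      by auto
  qed
  have "Domain (B.gen S) = T_dom \<Omega> i r T D a"
  proof (intro equalityI subsetI)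
    fix u
    assume "u \<in> T_dom \<Omega> i r T D a"
    then obtain v\<^sub>0 where v\<^sub>0: "(u, v\<^sub>0) \<in> B.gen G" "u \<in> DC"
      by (auto simp: TD)
    then have "v\<^sub>0 - C u + gain \<kappa> u \<in> BV"
      using gBV[OF v\<^sub>0] DC_D[OF v\<^sub>0(2)] by (simp add: B.gen_def)
    with v\<^sub>0 have "(u, v\<^sub>0 - C u + gain \<kappa> u) \<in> B.gen S"
      unfolding S(2) by auto
    then show "u \<in> Domain (B.gen S)"
      by blast
  qed (auto simp: S(2) TD)
  then show ?thesis
    unfolding generates_positive_def generates_def op XX bochner_C0_semigroup_iff bochner_generator_eq
    using S(1,3) by (intro exI[of _ S]) (auto simp: positive_sg_def bochner_space_eq)
qed

text \<open>A nonempty open set is not null. This extracts inequalities between functions of the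
  mass alone from the bounds on the rate, which involve x.\<close>

lemma AE_const:
  assumes "open \<Omega>" "\<Omega> \<noteq> {}" "AE x in lebesgue_on \<Omega>. R"
  shows R
proof (rule ccontr)
  assume "\<not> R"
  obtain x where "x \<in> \<Omega>"
    using assms(2) by blast
  have "AE x in lebesgue_on \<Omega>. 0 \<le> (- 1 :: real)"
    using assms(3) by (rule eventually_mono) (use \<open>\<not> R\<close> in simp)
  from continuous_AE_nonneg[OF assms(1) continuous_on_const this \<open>x \<in> \<Omega>\<close>] show False
    by simp
qed

text \<open>The only property not read off from the hypotheses is that c times a cut-off function
  stays in the space. The coefficient \<open>\<alpha>\<^sub>1\<close> is bounded up to the cutoff,
  so the function is in the domain of multiplication by \<open>\<alpha>\<^sub>1\<close>, and the
  inclusion of domains transfers this to c.\<close>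

lemma transport_generator:
  assumes fs: "fibre_space (X_space \<Omega> i) \<Omega>" and r: "0 \<le> r" and tr: "transport_assms \<Omega> i T D G\<^sub>0"
    and \<alpha>: "\<alpha>\<^sub>1 \<in> borel_measurable (lebesgue_on {0..})" "\<alpha>\<^sub>2 \<in> borel_measurable (lebesgue_on {0..})"
      "AE m in lebesgue_on {0..}. 0 \<le> \<alpha>\<^sub>1 m \<and> \<alpha>\<^sub>1 m \<le> \<alpha>\<^sub>2 m \<and> \<alpha>\<^sub>2 m \<le> M * \<alpha>\<^sub>1 m"
      "!!n. \<exists>K. AE m in lebesgue_on {0..}. m \<le> real n --> \<alpha>\<^sub>2 m \<le> K"
    and M: "0 \<le> M"
    and c: "AE m in lebesgue_on {0..}. AE x in lebesgue_on \<Omega>. \<alpha>\<^sub>1 m \<le> c (x, m) \<and> c (x, m) \<le> \<alpha>\<^sub>2 m"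
    and dom: "mult_dom \<Omega> i r (\<lambda>(x, m). \<alpha>\<^sub>1 m) \<subseteq> mult_dom \<Omega> i r c"
  obtains G where "transport_loss (X_space \<Omega> i) \<Omega> r G\<^sub>0 G c \<alpha>\<^sub>1 \<alpha>\<^sub>2 M"
    "T0_op \<Omega> i r T D = generator (XX_space \<Omega> i r) G"
proof -
  interpret bochner "X_space \<Omega> i" \<Omega> r
    using fs r by (intro bochner.intro bochner_axioms.intro)
  have XX: "XX_space \<Omega> i r = bochner_space \<Omega> (X_space \<Omega> i) r"
    by (simp add: XX_space_def)
  obtain G where G: "generates (XX_space \<Omega> i r) (T0_op \<Omega> i r T D) (Domain (T0_op \<Omega> i r T D)) G"
    "substochastic (XX_space \<Omega> i r) G"
    using tr r unfolding transport_assms_def by blast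
  have G\<^sub>0: "generates (X_space \<Omega> i) (fibre_op (X_space \<Omega> i) T D m) (D m) (G\<^sub>0 m)" "substochastic (X_space \<Omega> i) (G\<^sub>0 m)"
    if "0 \<le> m" for m
    using tr that unfolding transport_assms_def by blast+
  have os: "ordered_seminormed (carr (X_space \<Omega> i)) (snorm (X_space \<Omega> i)) (cone (X_space \<Omega> i))"
    by unfold_locales
  have T0: "T0_op \<Omega> i r T D = B.gen G"
    using G(1) by (simp add: generates_def XX bochner_generator_eq)
  have "transport_loss (X_space \<Omega> i) \<Omega> r G\<^sub>0 G c \<alpha>\<^sub>1 \<alpha>\<^sub>2 M"
  proof (intro transport_loss.intro transport_loss_axioms.intro)
    show "bochner (X_space \<Omega> i) \<Omega> r"
      by unfold_locales
    show "contraction_sg (G\<^sub>0 m)" if "0 \<le> m" for m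
      using G\<^sub>0(2)[OF that] by (simp add: substochastic_def contraction_sg_def C0_semigroup_iff[OF os])
    show "B.contraction_sg G"
      using G(2) by (simp add: substochastic_def B.contraction_sg_def XX bochner_C0_semigroup_iff bochner_space_eq)
    show "G t u \<in> BP" if "0 \<le> t" "u \<in> BP" for t u
      using G(2) that by (simp add: substochastic_def positive_sg_def XX bochner_space_eq)
    have f: "fibre_op (X_space \<Omega> i) T D m = gen (G\<^sub>0 m)" if "0 \<le> m" for m
      using G\<^sub>0(1)[OF that] by (simp add: generates_def generator_eq[OF os])
    have "(AE m in \<M>. (sect u m, sect v m) \<in> fibre_op (X_space \<Omega> i) T D m) \<longleftrightarrow> (AE m in \<M>. (sect u m, sect v m) \<in> gen (G\<^sub>0 m))" for u v
      using f by (simp add: AE_half_line cong: imp_cong)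
    then show "B.gen G = {(u, v). u \<in> BV \<and> v \<in> BV \<and> (AE m in \<M>. (sect u m, sect v m) \<in> gen (G\<^sub>0 m))}"
      unfolding T0[symmetric] T0_op_def XX bochner_space_eq by (simp add: sect_def)
    show "(\<lambda>y. c y * Q n u y) \<in> BV" if u: "u \<in> BV" for u n
    proof -
      obtain K where K: "AE m in \<M>. m \<le> real n --> \<alpha>\<^sub>2 m \<le> K"
        using \<alpha>(4) by blast
      have QV: "Q n u \<in> BV"
        by (rule Q_BV[OF u])
      have "(\<lambda>y. \<alpha>\<^sub>1 (snd y) * Q n u y) \<in> BV"
      proof (rule BV_mult[OF QV \<alpha>(1)])
        show "integrable \<M> (\<lambda>m. K * (snorm (X_space \<Omega> i) (sect (Q n u) m) * w m))"
          using BV_int[OF QV] by simp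
        show "AE m in \<M>. \<bar>\<alpha>\<^sub>1 m\<bar> * (snorm (X_space \<Omega> i) (sect (Q n u) m) * w m) \<le> K * (snorm (X_space \<Omega> i) (sect (Q n u) m) * w m)"
          using K \<alpha>(3) BV_sect[OF u]
        proof eventually_elim
          case (elim m)
          show ?case
          proof (cases "m \<le> real n")
            case True
            then show ?thesis
              using elim N_nonneg[OF elim(3)] w_pos[of m] by (intro mult_right_mono) (auto simp: sect_Q)
          qed (simp add: sect_Q)
        qed
      qed
      then have "Q n u \<in> mult_dom \<Omega> i r (\<lambda>(x, m). \<alpha>\<^sub>1 m)"
        using QV by (simp add: mult_dom_def XX bochner_space_eq case_prod_beta)
      then show ?thesis
        using dom by (auto simp: mult_dom_def XX bochner_space_eq)
    qed
  qed (use \<alpha> M c in blast)+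
  then show thesis
    using T0 by (intro that) (simp_all add: XX bochner_generator_eq)
qed

text \<open>Both inclusions are the pointwise comparison of a with \<open>\<alpha>\<^sub>1\<close>,
  passed on to the norms of the fibres. Strong measurability of a u is automatic in L_1.\<close>

lemma mult_dom_L1:
  assumes op: "open \<Omega>" and r: "0 \<le> r" and a: "a \<in> borel_measurable (lebesgue_on (\<Omega> \<times> {0..}))"
    and \<alpha>: "\<alpha>\<^sub>1 \<in> borel_measurable (lebesgue_on {0..})" and M: "0 \<le> M"
    and le: "AE m in lebesgue_on {0..}. AE x in lebesgue_on \<Omega>. 0 \<le> \<alpha>\<^sub>1 m \<and> \<alpha>\<^sub>1 m \<le> a (x, m) \<and> a (x, m) \<le> M * \<alpha>\<^sub>1 m"
  shows "mult_dom \<Omega> 1 r (\<lambda>(x, m). \<alpha>\<^sub>1 m) = mult_dom \<Omega> 1 r a"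
proof -
  interpret bochner "L1_space \<Omega>" \<Omega> r
    using L1_fibre_space[OF op] r by (intro bochner.intro bochner_axioms.intro)
  have md: "mult_dom \<Omega> 1 r c = {u \<in> BV. (\<lambda>y. c y * u y) \<in> BV}" for c
    by (simp add: mult_dom_def XX_space_def X_space_def bochner_space_eq)
  have "(\<lambda>y. a y * u y) \<in> BV" if u: "u \<in> BV" and \<alpha>u: "(\<lambda>y. \<alpha>\<^sub>1 (snd y) * u y) \<in> BV" for u
  proof -
    let ?v = "\<lambda>y. \<alpha>\<^sub>1 (snd y) * u y" and ?w = "\<lambda>y. a y * u y"
    note [measurable] = a BV_meas[OF u]
    have meas: "?w \<in> borel_measurable (lebesgue_on (\<Omega> \<times> {0..}))"
      by measurable
    have bd: "AE m in \<M>. AE x in lebesgue_on \<Omega>. \<bar>sect ?w m x\<bar> \<le> M * \<bar>sect ?v m x\<bar>"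
      using le
    proof eventually_elim
      case (elim m)
      then show ?case
      proof eventually_elim
        case (elim x)
        then have "\<bar>a (x, m)\<bar> * \<bar>u (x, m)\<bar> \<le> (M * \<alpha>\<^sub>1 m) * \<bar>u (x, m)\<bar>"
          by (intro mult_right_mono) auto
        then show ?case
          using elim by (simp add: sect_apply abs_mult)
      qed
    qed
    have int: "AE m in \<M>. integrable (lebesgue_on \<Omega>) (sect ?w m)"
      using bd BV_sect[OF \<alpha>u] AE_section_measurable[OF \<Omega>_borel meas]
    proof eventually_elim
      case (elim m)
      then have "integrable (lebesgue_on \<Omega>) (\<lambda>x. M * \<bar>sect ?v m x\<bar>)"
        by (simp add: L1_space_def)
      then show ?case
        by (rule Bochner_Integration.integrable_bound[OF _ elim(3)]) (use elim(1) M in \<open>auto simp: abs_mult elim!: eventually_mono\<close>)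
    qed
    show ?thesis
    proof (rule BV_dominated[OF meas L1_strongly_measurable[OF op meas int]])
      show "integrable \<M> (\<lambda>m. M * (snorm (L1_space \<Omega>) (sect ?v m) * w m))"
        using BV_int[OF \<alpha>u] by simp
      show "AE m in \<M>. snorm (L1_space \<Omega>) (sect ?w m) * w m \<le> M * (snorm (L1_space \<Omega>) (sect ?v m) * w m)"
        using bd int BV_sect[OF \<alpha>u]
      proof eventually_elim
        case (elim m)
        have "snorm (L1_space \<Omega>) (sect ?w m) \<le> M * snorm (L1_space \<Omega>) (sect ?v m)"
          by (rule snorm_bound[OF _ elim(3) M elim(1)]) (use elim(2) in \<open>simp add: L1_space_def\<close>)
        then show ?case
          using w_pos[of m] by (simp add: mult.assoc[symmetric])
      qed
    qed
  qed
  moreover have "(\<lambda>y. \<alpha>\<^sub>1 (snd y) * u y) \<in> BV" if u: "u \<in> BV" and au: "(\<lambda>y. a y * u y) \<in> BV" for u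
  proof (rule BV_mult[OF u \<alpha> BV_int[OF au]])
    show "AE m in \<M>. \<bar>\<alpha>\<^sub>1 m\<bar> * (snorm (L1_space \<Omega>) (sect u m) * w m) \<le> snorm (L1_space \<Omega>) (sect (\<lambda>y. a y * u y) m) * w m"
      using le BV_sect[OF u] BV_sect[OF au]
    proof eventually_elim
      case (elim m)
      have "snorm (L1_space \<Omega>) (\<alpha>\<^sub>1 m *\<^sub>R sect u m) \<le> 1 * snorm (L1_space \<Omega>) (sect (\<lambda>y. a y * u y) m)"
      proof (rule snorm_bound[OF _ elim(3)])
        show "AE x in lebesgue_on \<Omega>. \<bar>(\<alpha>\<^sub>1 m *\<^sub>R sect u m) x\<bar> \<le> 1 * \<bar>sect (\<lambda>y. a y * u y) m x\<bar>"
          using elim(1) by (rule eventually_mono) (auto simp: sect_apply abs_mult intro!: mult_right_mono)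
      qed (use elim(2) in simp_all)
      then show ?case
        unfolding N_scale[OF elim(2)] using w_pos[of m] by (simp add: mult.assoc[symmetric])
    qed
  qed
  ultimately show ?thesis
    unfolding md by (auto simp: case_prod_beta)
qed

text \<open>A simple function of the mass with values in the continuous functions is a finite sum of
  products of an indicator in m and a continuous function of x, hence jointly measurable.
  Convergence in the supremum norm makes a the pointwise limit of such sums at almost every
  mass.\<close>

lemma Linf_loc_Cb_measurable:
  fixes a :: "'a::euclidean_space \<times> real \<Rightarrow> real"
  assumes op: "open \<Omega>" and a: "Linf_loc_Cb \<Omega> a"
  shows "a \<in> borel_measurable (lebesgue_on (\<Omega> \<times> {0..}))"
proof -
  have S: "\<Omega> \<in> sets borel" "\<Omega> \<times> {0::real..} \<in> sets borel"
    using op by (auto intro!: Times_borel)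
  have "strongly_measurable (Cb_space \<Omega>) (\<lambda>m x. a (x, m))"
    using a by (simp add: Linf_loc_Cb_def)
  then obtain \<sigma> where aC: "AE m in lebesgue_on {0..}. (\<lambda>x. a (x, m)) \<in> carr (Cb_space \<Omega>)"
    and \<sigma>: "!!k. simple_function (lebesgue_on {0..}) (\<sigma> k)" "!!k. \<sigma> k ` {0..} \<subseteq> carr (Cb_space \<Omega>)"
    and lim: "AE m in lebesgue_on {0..}. (\<lambda>k. sup_norm \<Omega> (\<lambda>x. a (x, m) - \<sigma> k m x)) \<longlonglongrightarrow> 0"
    unfolding strongly_measurable_def by (auto simp: Cb_space_def)
  have up: "\<bar>f x\<bar> \<le> sup_norm \<Omega> f" if b: "bounded (f ` \<Omega>)" and x: "x \<in> \<Omega>" for f x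
  proof -
    obtain K where "\<forall>y\<in>f ` \<Omega>. norm y \<le> K"
      using b unfolding bounded_iff by blast
    then have "bdd_above (insert 0 ((\<lambda>x. \<bar>f x\<bar>) ` \<Omega>))"
      by (intro bdd_aboveI[of _ "max 0 K"]) (auto simp: le_max_iff_disj)
    then show ?thesis
      unfolding sup_norm_def using x by (intro cSup_upper) auto
  qed
  have conv: "AE m in lebesgue_on {0..}. \<forall>x\<in>\<Omega>. (\<lambda>k. \<sigma> k m x) \<longlonglongrightarrow> a (x, m)"
  proof -
    have "AE m in lebesgue_on {0..}. 0 \<le> m"
      by (rule AE_I2) simp
    with aC lim show ?thesis
    proof eventually_elim
      case (elim m)
      show ?case
      proof
        fix x
        assume x: "x \<in> \<Omega>"
        have "norm (\<sigma> k m x - a (x, m)) \<le> sup_norm \<Omega> (\<lambda>x. a (x, m) - \<sigma> k m x)" for k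
        proof -
          have "bounded ((\<lambda>x. a (x, m)) ` \<Omega>)" "bounded (\<sigma> k m ` \<Omega>)"
            using elim \<sigma>(2)[of k] by (auto simp: Cb_space_def)
          from bounded_minus_comp[OF this] have "bounded ((\<lambda>x. a (x, m) - \<sigma> k m x) ` \<Omega>)" .
          from up[OF this x] show ?thesis
            by (simp add: abs_minus_commute)
        qed
        then have "(\<lambda>k. \<sigma> k m x - a (x, m)) \<longlonglongrightarrow> 0"
          by (intro Lim_null_comparison[OF always_eventually elim(2)]) blast
        then show "(\<lambda>k. \<sigma> k m x) \<longlonglongrightarrow> a (x, m)"
          by (simp add: LIM_zero_iff)
      qed
    qed
  qed
  have "(\<lambda>z. \<sigma> k (snd z) (fst z)) \<in> borel_measurable (lebesgue_on (\<Omega> \<times> {0..}))" for k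
  proof -
    let ?F = "\<sigma> k ` {0..}"
    have fin: "finite ?F"
      using simple_functionD(1)[OF \<sigma>(1)[of k]] by simp
    have "(\<lambda>z. \<Sum>f\<in>?F. indicator (\<sigma> k -` {f} \<inter> space (lebesgue_on {0..})) (snd z) * f (fst z)) \<in> borel_measurable (lebesgue_on (\<Omega> \<times> {0..}))"
    proof (intro borel_measurable_sum borel_measurable_times)
      fix f
      assume f: "f \<in> ?F"
      show "(\<lambda>z. indicator (\<sigma> k -` {f} \<inter> space (lebesgue_on {0..})) (snd z) :: real) \<in> borel_measurable (lebesgue_on (\<Omega> \<times> {0..}))"
        by (rule measurable_lebesgue_on_snd[OF S(1) _ borel_measurable_indicator[OF simple_functionD(2)[OF \<sigma>(1)]]]) simp
      have "continuous_on \<Omega> f"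
        using f \<sigma>(2)[of k] by (auto simp: Cb_space_def)
      then have "f \<in> borel_measurable (lebesgue_on \<Omega>)"
        using op by (intro continuous_imp_measurable_on_sets_lebesgue) auto
      then show "(\<lambda>z. f (fst z)) \<in> borel_measurable (lebesgue_on (\<Omega> \<times> {0::real..}))"
        by (intro measurable_lebesgue_on_fst[OF S(1)]) auto
    qed
    moreover have "(\<Sum>f\<in>?F. indicator (\<sigma> k -` {f} \<inter> space (lebesgue_on {0..})) (snd z) * f (fst z)) = \<sigma> k (snd z) (fst z)"
      if "z \<in> space (lebesgue_on (\<Omega> \<times> {0..}))" for z
    proof -
      have z: "0 \<le> snd z"
        using that by auto
      have "(\<Sum>f\<in>?F. indicator (\<sigma> k -` {f} \<inter> space (lebesgue_on {0..})) (snd z) * f (fst z))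
          = (\<Sum>f\<in>?F. if f = \<sigma> k (snd z) then f (fst z) else 0)"
        using z by (intro sum.cong) (auto simp: indicator_def)
      then show ?thesis
        using fin z by (simp add: sum.delta)
    qed
    ultimately show ?thesis
      by (rule measurable_cong[THEN iffD1, rotated])
  qed
  then show ?thesis
  proof (rule borel_measurable_lebesgue_on_AE_limit[OF S(2)])
    have "AE m in lborel. 0 \<le> m --> (\<forall>x\<in>\<Omega>. (\<lambda>k. \<sigma> k m x) \<longlonglongrightarrow> a (x, m))"
      using conv by (simp add: AE_lebesgue_on_iff)
    from AE_lborel_snd[OF this]
    have "AE z in lborel. z \<in> \<Omega> \<times> {0..} --> (\<lambda>k. \<sigma> k (snd z) (fst z)) \<longlonglongrightarrow> a z"
      by (rule eventually_mono) auto
    then show "AE z in lebesgue_on (\<Omega> \<times> {0..}). (\<lambda>k. \<sigma> k (snd z) (fst z)) \<longlonglongrightarrow> a z"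
      using S(2) by (simp add: AE_lebesgue_on_iff)
  qed
qed

lemma measurable_drop_middle:
  fixes a :: "'a::euclidean_space \<times> real \<Rightarrow> real"
  assumes \<Omega>: "\<Omega> \<in> sets borel" and a: "a \<in> borel_measurable (lebesgue_on (\<Omega> \<times> {0..}))"
  shows "(\<lambda>z. a (fst z, snd (snd z))) \<in> borel_measurable (lebesgue_on (\<Omega> \<times> {0::real..} \<times> {0::real..}))"
proof -
  have S: "\<Omega> \<times> {0::real..} \<in> sets borel" "\<Omega> \<times> {0::real..} \<times> {0::real..} \<in> sets borel"
    using \<Omega> by (auto intro!: Times_borel)
  obtain a' where a': "a' \<in> borel_measurable borel" "AE z in lborel. z \<in> \<Omega> \<times> {0..} --> a z = a' z"
    using borel_version[OF S(1) a] .
  have "(\<lambda>z :: 'a \<times> real \<times> real. (fst z, snd (snd z))) \<in> borel_measurable borel"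
    by (intro borel_measurable_continuous_onI continuous_intros)
  from measurable_compose[OF this a'(1)] show ?thesis
  proof (rule borel_measurable_lebesgue_onI[OF S(2)])
    show "AE z in lborel. z \<in> \<Omega> \<times> {0::real..} \<times> {0::real..} --> a (fst z, snd (snd z)) = a' (fst z, snd (snd z))"
      using AE_lborel_drop_middle[OF a'(2)] by (rule eventually_mono) auto
  qed
qed

section \<open>The degenerate case of an empty domain\<close>

definition trivial_space :: "'a fun_space \<Rightarrow> bool" where
  "trivial_space X \<longleftrightarrow> carr X = UNIV \<and> snorm X = (\<lambda>_. 0) \<and> cone X = UNIV"

lemma trivial_generator: "trivial_space X ==> generator X G = UNIV"
  by (auto simp: trivial_space_def generator_def)

lemma trivial_X_space: "trivial_space (X_space {} i)"
proof -
  have "integrable (lebesgue_on {}) f" for f :: "'a \<Rightarrow> real"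
    by (simp add: integrable_restrict_space)
  moreover have "(\<integral>x. \<bar>f x\<bar> \<partial>lebesgue_on {}) = 0" for f :: "'a \<Rightarrow> real"
    by (simp add: integral_restrict_space)
  moreover have "AE x in lebesgue_on {}. 0 \<le> f x" for f :: "'a \<Rightarrow> real"
    by (rule AE_I2) simp
  ultimately show ?thesis
    by (auto simp: trivial_space_def X_space_def L1_space_def C0_space_def C0_carrier_def sup_norm_def)
qed

lemma trivial_XX_space: "trivial_space (XX_space ({} :: 'a::euclidean_space set) i r)"
proof -
  let ?X = "X_space ({} :: 'a set) i"
  have X: "carr ?X = UNIV" "snorm ?X = (\<lambda>_. 0)" "cone ?X = UNIV"
    using trivial_X_space[of i] by (auto simp: trivial_space_def)
  have "strongly_measurable ?X v" for v
    unfolding strongly_measurable_def X by (auto intro!: exI[of _ "\<lambda>_ _ _. 0"])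
  moreover have "u \<in> borel_measurable (lebesgue_on {})" for u :: "'a \<times> real \<Rightarrow> real"
    by (rule measurableI) (auto simp: sets_restrict_space)
  ultimately show ?thesis
    by (auto simp: trivial_space_def XX_space_def bochner_space_def bochner_carrier_def X)
qed

text \<open>Every function is in the carrier and has seminorm 0, so all graphs are the full
  relation, and the identity semigroup has this relation as its generator.\<close>

lemma trivial_generates_positive:
  assumes tr: "transport_assms ({} :: 'a::euclidean_space set) i T D G\<^sub>0"
  shows "generates_positive (XX_space {} i r) (frag_op {} i r T D c \<kappa>) (T_dom {} i r T D a)"
proof -
  let ?XX = "XX_space ({} :: 'a set) i r"
  have XX: "carr ?XX = UNIV" "snorm ?XX = (\<lambda>_. 0)" "cone ?XX = UNIV"
    using trivial_XX_space[of i r] by (auto simp: trivial_space_def)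
  have f: "fibre_op (X_space {} i) T D m = UNIV" if "0 \<le> m" for m
  proof -
    have "generates (X_space {} i) (fibre_op (X_space {} i) T D m) (D m) (G\<^sub>0 m)"
      using tr[unfolded transport_assms_def, THEN conjunct1] that by simp
    then show ?thesis
      by (simp add: generates_def trivial_generator[OF trivial_X_space])
  qed
  have "AE m in lebesgue_on {0..}. (\<lambda>x. u (x, m), \<lambda>x. v (x, m)) \<in> fibre_op (X_space {} i) T D m"
    for u v :: "'a \<times> real \<Rightarrow> real"
    by (rule AE_I2) (simp add: f)
  then have T0: "T0_op {} i r T D = UNIV"
    by (simp add: T0_op_def XX)
  have D: "Domain (UNIV :: ('a \<times> real \<Rightarrow> real) rel) = UNIV"
    by auto
  have md: "mult_dom ({} :: 'a set) i r c = UNIV" for c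
    by (auto simp: mult_dom_def XX)
  have "gain_converges {} \<kappa> u" for u
    unfolding gain_converges_def by (rule AE_I2) auto
  then have "frag_op {} i r T D c \<kappa> = UNIV"
    by (auto simp: frag_op_def md XX T0 eqv_def)
  moreover have "T_dom {} i r T D a = UNIV"
    by (simp add: T_dom_def T0 md D)
  moreover have "C0_semigroup ?XX (\<lambda>_ f. f)"
    by (simp add: C0_semigroup_def eqv_def XX)
  moreover have "generator ?XX (\<lambda>_ f. f) = UNIV"
    by (rule trivial_generator[OF trivial_XX_space])
  ultimately show ?thesis
    unfolding generates_positive_def generates_def positive_sg_def by (intro exI[of _ "\<lambda>_ f. f"]) (simp add: D)
qed

text \<open>The exponent \<open>r\<^sub>1\<close> comes from the mass estimate, which sees only
  \<beta> and the bounds of the rate; hence one \<open>r\<^sub>1\<close> serves the majorising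
  operator and all dominated kernels b.\<close>

lemma fragmentation_generates:
  fixes \<Omega> :: "'a::euclidean_space set"
  assumes i: "i \<in> {0, 1}" and dom: "regular_domain \<Omega>" and ne: "\<Omega> \<noteq> {}"
    and rate: "rate_assms \<Omega> i a \<alpha>\<^sub>1 \<alpha>\<^sub>2" and tr: "transport_assms \<Omega> i T D G\<^sub>0"
    and maj: "majorant_assms \<beta>" and l: "0 \<le> l" and r\<^sub>0: "0 \<le> r\<^sub>0"
    and \<beta>_l: "\<forall>s\<ge>0. (\<integral>\<^sup>+ m\<in>{0..s}. ennreal (\<beta> (m, s)) \<partial>lebesgue) \<le> ennreal (\<beta>\<^sub>0 * (1 + s powr l))"
    and equi: "equi_integrable ((\<lambda>s z. s * z powr r\<^sub>0 * \<beta> (z * s, s)) ` {s\<^sub>0..})"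
  shows "\<exists>r\<^sub>1 > max l r\<^sub>0. \<forall>r\<ge>r\<^sub>1.
    generates_positive (XX_space \<Omega> i r) (frakK_op \<Omega> i r T D \<alpha>\<^sub>1 \<alpha>\<^sub>2 \<beta>) (T_dom \<Omega> i r T D a) \<and>
    (\<forall>b. fragmentation_assms \<Omega> b \<and>
      (AE (x, m, s) in lebesgue_on (\<Omega> \<times> {0..} \<times> {0..}). m \<le> s --> b (x, m, s) \<le> \<beta> (m, s)) \<and>
      gain_admissible \<Omega> i r T D a b -->
      generates_positive (XX_space \<Omega> i r) (K_op \<Omega> i r T D a b) (T_dom \<Omega> i r T D a))"
proof -
  have op: "open \<Omega>" and \<Omega>b: "\<Omega> \<in> sets borel"
    using dom by (auto simp: regular_domain_def)
  have S2: "\<Omega> \<times> {0::real..} \<in> sets borel" and S3: "\<Omega> \<times> {0::real..} \<times> {0::real..} \<in> sets borel"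
    and Q2: "{0::real..} \<times> {0::real..} \<in> sets borel"
    using \<Omega>b by (auto intro!: Times_borel)
  have h: "{0::real..} \<in> sets borel"
    by simp
  have fs: "fibre_space (X_space \<Omega> i) \<Omega>"
    using C0_fibre_space[OF dom] L1_fibre_space[OF op] by (simp add: X_space_def)
  have \<alpha>m: "\<alpha>\<^sub>1 \<in> borel_measurable (lebesgue_on {0..})" "\<alpha>\<^sub>2 \<in> borel_measurable (lebesgue_on {0..})"
    and \<alpha>\<^sub>2_loc: "Linf_loc {0..} \<alpha>\<^sub>2"
    using rate by (auto simp: rate_assms_def Linf_loc_def)
  obtain M where M: "0 < M" and "AE (x, m) in lebesgue_on (\<Omega> \<times> {0..}).
      0 \<le> a (x, m) \<and> \<alpha>\<^sub>1 m \<le> a (x, m) \<and> a (x, m) \<le> \<alpha>\<^sub>2 m \<and> \<alpha>\<^sub>2 m \<le> M * \<alpha>\<^sub>1 m"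
    using rate unfolding rate_assms_def by blast
  then have aAE: "AE z in lebesgue_on (\<Omega> \<times> {0..}).
      0 \<le> a z \<and> \<alpha>\<^sub>1 (snd z) \<le> a z \<and> a z \<le> \<alpha>\<^sub>2 (snd z) \<and> \<alpha>\<^sub>2 (snd z) \<le> M * \<alpha>\<^sub>1 (snd z)"
    by (simp add: case_prod_beta)
  have aAE2: "AE m in lebesgue_on {0..}. AE x in lebesgue_on \<Omega>.
      0 \<le> a (x, m) \<and> \<alpha>\<^sub>1 m \<le> a (x, m) \<and> a (x, m) \<le> \<alpha>\<^sub>2 m \<and> \<alpha>\<^sub>2 m \<le> M * \<alpha>\<^sub>1 m"
    using AE_lebesgue_on_Times(2)[OF \<Omega>b _ aAE] by simp
  \<comment> \<open>Nonnegativity of \<open>\<alpha>\<^sub>1\<close> is hidden in the chain 0 \<le>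
    a \<le> \<open>\<alpha>\<^sub>2\<close> \<le> M \<open>\<alpha>\<^sub>1\<close> with M >
    0.\<close>
  have \<alpha>b: "AE m in lebesgue_on {0..}. 0 \<le> \<alpha>\<^sub>1 m \<and> \<alpha>\<^sub>1 m \<le> \<alpha>\<^sub>2 m \<and> \<alpha>\<^sub>2 m \<le> M * \<alpha>\<^sub>1 m"
    using aAE2
  proof eventually_elim
    case (elim m)
    have "AE x in lebesgue_on \<Omega>. 0 \<le> \<alpha>\<^sub>1 m \<and> \<alpha>\<^sub>1 m \<le> \<alpha>\<^sub>2 m \<and> \<alpha>\<^sub>2 m \<le> M * \<alpha>\<^sub>1 m"
      using elim
    proof eventually_elim
      case (elim x)
      then have "0 \<le> M * \<alpha>\<^sub>1 m"
        by linarith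
      then show ?case
        using elim M by (auto simp: zero_le_mult_iff)
    qed
    then show ?case
      by (rule AE_const[OF op ne])
  qed
  have \<alpha>K: "\<exists>K. AE s in lborel. 0 \<le> s \<and> s \<le> R --> \<alpha>\<^sub>2 s \<le> K" for R
  proof -
    have "compact {0..R} \<and> {0..R} \<subseteq> {0::real..}"
      by auto
    then obtain K where "AE y in lebesgue_on {0..R}. \<bar>\<alpha>\<^sub>2 y\<bar> \<le> K"
      using \<alpha>\<^sub>2_loc unfolding Linf_loc_def by blast
    then have "AE y in lborel. y \<in> {0..R} --> \<bar>\<alpha>\<^sub>2 y\<bar> \<le> K"
      by (simp add: AE_lebesgue_on_iff)
    then have "AE s in lborel. 0 \<le> s \<and> s \<le> R --> \<alpha>\<^sub>2 s \<le> K"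
      by (rule eventually_mono) auto
    then show ?thesis
      by blast
  qed
  have \<alpha>loc: "\<exists>K. AE m in lebesgue_on {0..}. m \<le> real n --> \<alpha>\<^sub>2 m \<le> K" for n
  proof -
    obtain K where "AE s in lborel. 0 \<le> s \<and> s \<le> real n --> \<alpha>\<^sub>2 s \<le> K"
      using \<alpha>K by blast
    then have "AE m in lebesgue_on {0..}. m \<le> real n --> \<alpha>\<^sub>2 m \<le> K"
      by (simp add: AE_lebesgue_on_iff) (auto elim: eventually_mono)
    then show ?thesis
      by blast
  qed
  have a_meas: "a \<in> borel_measurable (lebesgue_on (\<Omega> \<times> {0..}))"
    using rate Linf_loc_Cb_measurable[OF op, of a] by (auto simp: rate_assms_def Linf_loc_def split: if_splits)
  have mdom: "mult_dom \<Omega> i r (\<lambda>(x, m). \<alpha>\<^sub>1 m) = mult_dom \<Omega> i r a" if "0 \<le> r" for r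
  proof (cases "i = 0")
    case True
    then show ?thesis
      using rate that by (auto simp: rate_assms_def)
  next
    case False
    then have i1: "i = 1"
      using i by simp
    have "AE m in lebesgue_on {0..}. AE x in lebesgue_on \<Omega>. 0 \<le> \<alpha>\<^sub>1 m \<and> \<alpha>\<^sub>1 m \<le> a (x, m) \<and> a (x, m) \<le> M * \<alpha>\<^sub>1 m"
      using aAE2 \<alpha>b
    proof eventually_elim
      case (elim m)
      from elim(1) show ?case
        by (rule eventually_mono) (use elim(2) in auto)
    qed
    from mult_dom_L1[OF op that a_meas \<alpha>m(1) _ this] show ?thesis
      using M unfolding i1 by simp
  qed
  have \<beta>m: "\<beta> \<in> borel_measurable (lebesgue_on ({0..} \<times> {0..}))"
    and \<beta>0: "!!m s. 0 \<le> m ==> 0 \<le> s ==> 0 \<le> \<beta> (m, s)"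
    using maj by (auto simp: majorant_assms_def)
  obtain \<beta>'' where \<beta>'': "\<beta>'' \<in> borel_measurable borel" "AE z in lborel. z \<in> {0..} \<times> {0..} --> \<beta> z = \<beta>'' z"
    using borel_version[OF Q2 \<beta>m] .
  \<comment> \<open>The Borel version is cut at 0 to be nonnegative everywhere; this agrees with
    \<beta> almost everywhere on the quadrant.\<close>
  define \<beta>' where "\<beta>' z = max 0 (\<beta>'' z)" for z
  have \<beta>': "\<beta>' \<in> borel_measurable borel" "!!z. 0 \<le> \<beta>' z"
    using \<beta>''(1) by (auto simp: \<beta>'_def[abs_def])
  have \<beta>_eq: "AE z in lborel. 0 \<le> fst z \<and> 0 \<le> snd z --> \<beta> z = \<beta>' z"
    using \<beta>''(2)
  proof eventually_elim
    case (elim z)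
    then show ?case
      using \<beta>0[of "fst z" "snd z"] by (auto simp: \<beta>'_def mem_Times_iff)
  qed
  obtain \<alpha>'' where \<alpha>'': "\<alpha>'' \<in> borel_measurable borel" "AE s in lborel. s \<in> {0..} --> \<alpha>\<^sub>2 s = \<alpha>'' s"
    using borel_version[OF h \<alpha>m(2)] .
  define \<alpha>' where "\<alpha>' s = max 0 (\<alpha>'' s)" for s
  have \<alpha>': "\<alpha>' \<in> borel_measurable borel" "!!s. 0 \<le> \<alpha>' s"
    using \<alpha>''(1) by (auto simp: \<alpha>'_def[abs_def])
  have \<alpha>b': "AE s in lborel. 0 \<le> s --> 0 \<le> \<alpha>\<^sub>1 s \<and> \<alpha>\<^sub>1 s \<le> \<alpha>\<^sub>2 s \<and> \<alpha>\<^sub>2 s \<le> M * \<alpha>\<^sub>1 s"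
    by (rule eventually_mono[OF AE_lebesgue_on_iff[OF h, THEN iffD1, OF \<alpha>b]]) simp
  have \<alpha>_eq: "AE s in lborel. 0 \<le> s --> \<alpha>\<^sub>2 s = \<alpha>' s"
    using \<alpha>''(2) \<alpha>b' by eventually_elim (auto simp: \<alpha>'_def)
  define k where "k z = \<alpha>' (snd z) * \<beta>' z" for z
  have k_meas: "k \<in> borel_measurable borel"
  proof -
    have "(snd :: real \<times> real \<Rightarrow> real) \<in> borel_measurable borel"
      by (intro borel_measurable_continuous_onI continuous_intros)
    from measurable_compose[OF this \<alpha>'(1)] \<beta>'(1) show ?thesis
      unfolding k_def[abs_def] by (intro borel_measurable_times)
  qed
  have k0: "0 \<le> k z" for z
    using \<alpha>'(2) \<beta>'(2) by (simp add: k_def)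
  have k_eq: "AE z in lborel. 0 \<le> fst z \<and> 0 \<le> snd z --> \<alpha>\<^sub>2 (snd z) * \<beta> z = k z"
    using \<beta>_eq AE_lborel_snd[OF \<alpha>_eq] by eventually_elim (auto simp: k_def)
  have "\<exists>r\<^sub>1 > max l r\<^sub>0. \<forall>r\<ge>r\<^sub>1. \<exists>\<omega>\<ge>0. AE s in lborel. 0 \<le> s -->
    (\<integral>\<^sup>+m. ennreal (\<alpha>' s * \<beta>' (m, s) * (1 + m powr r)) * indicator {0..s} m \<partial>lborel)
      \<le> ennreal ((1 / 2 * \<alpha>\<^sub>1 s + \<omega>) * (1 + s powr r))"
  proof (rule mass_estimate[OF \<beta>_l equi l r\<^sub>0 less_imp_le[OF M] \<beta>'])
    show "AE s in lborel. 0 \<le> s --> (AE m in lborel. 0 \<le> m --> \<beta> (m, s) = \<beta>' (m, s))"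
      using AE_lborel_Pair(2)[OF \<beta>_eq]
    proof eventually_elim
      case (elim s)
      show ?case
      proof
        assume "0 \<le> s"
        from elim show "AE m in lborel. 0 \<le> m --> \<beta> (m, s) = \<beta>' (m, s)"
          by (rule eventually_mono) (use \<open>0 \<le> s\<close> in auto)
      qed
    qed
    show "AE s in lborel. 0 \<le> s --> 0 \<le> \<alpha>\<^sub>1 s \<and> \<alpha>\<^sub>1 s \<le> \<alpha>' s \<and> \<alpha>' s \<le> M * \<alpha>\<^sub>1 s"
      using \<alpha>b' \<alpha>_eq by eventually_elim auto
    show "\<exists>K. AE s in lborel. 0 \<le> s \<and> s \<le> R --> \<alpha>' s \<le> K" for R
    proof -
      obtain K where "AE s in lborel. 0 \<le> s \<and> s \<le> R --> \<alpha>\<^sub>2 s \<le> K"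
        using \<alpha>K by blast
      then have "AE s in lborel. 0 \<le> s \<and> s \<le> R --> \<alpha>' s \<le> K"
        using \<alpha>_eq by eventually_elim auto
      then show ?thesis
        by blast
    qed
  qed
  then obtain r\<^sub>1 where r\<^sub>1: "max l r\<^sub>0 < r\<^sub>1" and mass: "!!r. r\<^sub>1 \<le> r ==> \<exists>\<omega>\<ge>0. AE s in lborel. 0 \<le> s -->
    (\<integral>\<^sup>+m. ennreal (\<alpha>' s * \<beta>' (m, s) * (1 + m powr r)) * indicator {0..s} m \<partial>lborel)
      \<le> ennreal ((1 / 2 * \<alpha>\<^sub>1 s + \<omega>) * (1 + s powr r))"
    by blast
  \<comment> \<open>One statement for both operators. For i = 0 the last hypothesis offers two
    reasons for the gain to stay in the space: it is assumed, or the kernel does not depend on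
    x.\<close>
  have gen: "generates_positive (XX_space \<Omega> i r) (frag_op \<Omega> i r T D c \<kappa>) (T_dom \<Omega> i r T D a)"
    if r: "r\<^sub>1 \<le> r"
      and c: "AE m in lebesgue_on {0..}. AE x in lebesgue_on \<Omega>. \<alpha>\<^sub>1 m \<le> c (x, m) \<and> c (x, m) \<le> \<alpha>\<^sub>2 m"
      and c_dom: "mult_dom \<Omega> i r c = mult_dom \<Omega> i r a"
      and \<kappa>m: "(\<lambda>z. \<kappa> (fst z) (fst (snd z)) (snd (snd z))) \<in> borel_measurable (lebesgue_on (\<Omega> \<times> {0..} \<times> {0..}))"
      and \<kappa>b: "AE z in lborel. fst z \<in> \<Omega> \<and> 0 \<le> fst (snd z) \<and> fst (snd z) \<le> snd (snd z) -->
        0 \<le> \<kappa> (fst z) (fst (snd z)) (snd (snd z)) \<and> \<kappa> (fst z) (fst (snd z)) (snd (snd z)) \<le> k (snd z)"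
      and C0: "i = 0 ==> (\<forall>u\<in>T_dom \<Omega> i r T D a. gain \<kappa> u \<in> carr (XX_space \<Omega> i r)) \<or>
        (AE m in lebesgue_on {0..}. AE s in lborel. m \<le> s --> (\<forall>x. \<kappa> x m s = k (m, s)))"
    for r c \<kappa>
  proof -
    have r_nonneg: "0 \<le> r"
      using r r\<^sub>1 l by linarith
    obtain G where G: "transport_loss (X_space \<Omega> i) \<Omega> r G\<^sub>0 G c \<alpha>\<^sub>1 \<alpha>\<^sub>2 M"
      "T0_op \<Omega> i r T D = generator (XX_space \<Omega> i r) G"
      using transport_generator[OF fs r_nonneg tr \<alpha>m \<alpha>b \<alpha>loc less_imp_le[OF M] c] mdom[OF r_nonneg] c_dom by blast
    interpret TL: transport_loss "X_space \<Omega> i" \<Omega> r G\<^sub>0 G c \<alpha>\<^sub>1 \<alpha>\<^sub>2 M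
      by (rule G(1))
    have DK: "dominated_kernel (X_space \<Omega> i) \<Omega> r \<kappa> k"
      using \<kappa>m \<kappa>b k_meas k0 by (intro dominated_kernel.intro dominated_kernel_axioms.intro TL.bochner_axioms)
    interpret DK: dominated_kernel "X_space \<Omega> i" \<Omega> r \<kappa> k
      by (rule DK)
    obtain \<omega> where \<omega>: "0 \<le> \<omega>" "AE s in lborel. 0 \<le> s -->
      (\<integral>\<^sup>+m. ennreal (\<alpha>' s * \<beta>' (m, s) * (1 + m powr r)) * indicator {0..s} m \<partial>lborel)
        \<le> ennreal ((1 / 2 * \<alpha>\<^sub>1 s + \<omega>) * (1 + s powr r))"
      using mass[OF r] by blast
    have L1: "L1_kernel \<Omega> r \<kappa> k" if "i \<noteq> 0"
      using DK that by (simp add: X_space_def L1_kernel_def)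
    have CK: "C0_kernel \<Omega> r \<kappa> k" if "i = 0"
      using DK that dom by (simp add: X_space_def C0_kernel_def C0_kernel_axioms_def)
    \<comment> \<open>The relative bound 1/2 is the one produced by the mass estimate; the fibre
      bounds are chosen according to i.\<close>
    have GO: "gain_operator (X_space \<Omega> i) \<Omega> r G\<^sub>0 G c \<alpha>\<^sub>1 \<alpha>\<^sub>2 M \<kappa> k (1 / 2) \<omega>"
    proof (intro gain_operator.intro gain_operator_axioms.intro G(1) DK \<omega>(1))
      show "AE s in lborel. 0 \<le> s -->
          (\<integral>\<^sup>+m. ennreal (k (m, s) * TL.w m) * indicator {0..s} m \<partial>lborel) \<le> ennreal ((1 / 2 * \<alpha>\<^sub>1 s + \<omega>) * TL.w s)"
        using \<omega>(2) by (simp add: k_def TL.w_def)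
      show "AE p in lborel. fst p \<in> \<Omega> \<and> 0 \<le> snd p --> TL.abs_gain \<kappa> u p < \<infinity>"
        if "u \<in> TL.BV" "AE m in TL.\<M>. TL.\<Phi> k u m < \<infinity>" for u
        using L1_kernel.fibre_bound_finite_L1[OF L1] C0_kernel.fibre_bound_finite_C0[OF CK] that
        by (cases "i = 0") (simp_all add: X_space_def)
      show "AE m in TL.\<M>. sect (gain \<kappa> u) m \<in> carr (X_space \<Omega> i) -->
          ennreal (snorm (X_space \<Omega> i) (sect (gain \<kappa> u) m)) \<le> TL.\<Phi> k u m"
        if "u \<in> TL.BV" for u
        using L1_kernel.fibre_bound_L1[OF L1] C0_kernel.fibre_bound_C0[OF CK] that
        by (cases "i = 0") (simp_all add: X_space_def)
    qed simp_all
    interpret GO: gain_operator "X_space \<Omega> i" \<Omega> r G\<^sub>0 G c \<alpha>\<^sub>1 \<alpha>\<^sub>2 M \<kappa> k "1 / 2" \<omega>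
      by (rule GO)
    show ?thesis
    proof (rule GO.frag_op_generates[OF refl _ c_dom])
      show "T0_op \<Omega> i r T D = TL.B.gen G"
        using G(2) by (simp add: XX_space_def TL.bochner_generator_eq)
      fix u
      assume u: "u \<in> T_dom \<Omega> i r T D a" "u \<in> TL.DC"
      have uV: "u \<in> TL.BV" and fin: "AE m in TL.\<M>. TL.\<Phi> k u m < \<infinity>"
        using TL.DC_D(1)[OF u(2)] GO.\<Phi>_finite[OF u(2)] by auto
      show "gain \<kappa> u \<in> TL.BV"
      proof (cases "i = 0")
        case False
        have "fibre_space.SM (L1_space \<Omega>) (sect (gain \<kappa> u))"
          using L1_kernel.gain_SM_L1[OF L1[OF False]] uV fin False by (simp add: X_space_def)
        then show ?thesis
          using GO.gain_BV[OF u(2)] False by (simp add: X_space_def)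
      next
        case True
        from C0[OF True] show ?thesis
        proof
          assume "\<forall>u\<in>T_dom \<Omega> i r T D a. gain \<kappa> u \<in> carr (XX_space \<Omega> i r)"
          then show ?thesis
            using u(1) by (simp add: XX_space_def TL.bochner_space_eq)
        next
          assume e: "AE m in lebesgue_on {0..}. AE s in lborel. m \<le> s --> (\<forall>x. \<kappa> x m s = k (m, s))"
          have "fibre_space.SM (C0_space \<Omega>) (sect (gain \<kappa> u))"
            using C0_kernel.gain_SM_C0[OF CK[OF True] _ _ e] uV fin True by (simp add: X_space_def)
          then show ?thesis
            using GO.gain_BV[OF u(2)] True by (simp add: X_space_def)
        qed
      qed
    qed
  qed
  \<comment> \<open>The kernel of the majorising operator is independent of x, which is the second
    of the two reasons.\<close>
  have frak: "generates_positive (XX_space \<Omega> i r) (frakK_op \<Omega> i r T D \<alpha>\<^sub>1 \<alpha>\<^sub>2 \<beta>) (T_dom \<Omega> i r T D a)" if r: "r\<^sub>1 \<le> r" for r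
    unfolding frakK_op_def
  proof (rule gen[OF r])
    show "AE m in lebesgue_on {0..}. AE x in lebesgue_on \<Omega>. \<alpha>\<^sub>1 m \<le> (case (x, m) of (x, m) \<Rightarrow> \<alpha>\<^sub>1 m) \<and> (case (x, m) of (x, m) \<Rightarrow> \<alpha>\<^sub>1 m) \<le> \<alpha>\<^sub>2 m"
      using \<alpha>b by eventually_elim auto
    show "mult_dom \<Omega> i r (\<lambda>(x, m). \<alpha>\<^sub>1 m) = mult_dom \<Omega> i r a"
      using mdom r r\<^sub>1 l by simp
    have "(\<lambda>z. \<alpha>\<^sub>2 (snd z)) \<in> borel_measurable (lebesgue_on ({0::real..} \<times> {0..}))"
      by (rule measurable_lebesgue_on_snd[OF h h \<alpha>m(2)])
    then have "(\<lambda>z. \<alpha>\<^sub>2 (snd z) * \<beta> z) \<in> borel_measurable (lebesgue_on ({0..} \<times> {0..}))"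
      using \<beta>m by (rule borel_measurable_times)
    from measurable_lebesgue_on_snd[OF \<Omega>b Q2 this]
    show "(\<lambda>z. \<alpha>\<^sub>2 (snd (snd z)) * \<beta> (fst (snd z), snd (snd z))) \<in> borel_measurable (lebesgue_on (\<Omega> \<times> {0..} \<times> {0..}))"
      by simp
    show "AE z in lborel. fst z \<in> \<Omega> \<and> 0 \<le> fst (snd z) \<and> fst (snd z) \<le> snd (snd z) -->
        0 \<le> \<alpha>\<^sub>2 (snd (snd z)) * \<beta> (fst (snd z), snd (snd z)) \<and> \<alpha>\<^sub>2 (snd (snd z)) * \<beta> (fst (snd z), snd (snd z)) \<le> k (snd z)"
      using AE_lborel_snd[OF k_eq, where ?'a = 'a] by eventually_elim (use k0 in auto)
    have "AE m in lborel. m \<in> {0..} --> (AE s in lborel. m \<le> s --> (\<forall>x::'a. \<alpha>\<^sub>2 s * \<beta> (m, s) = k (m, s)))"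
      using AE_lborel_Pair(1)[OF k_eq]
    proof eventually_elim
      case (elim m)
      show ?case
      proof
        assume "m \<in> {0..}"
        from elim show "AE s in lborel. m \<le> s --> (\<forall>x::'a. \<alpha>\<^sub>2 s * \<beta> (m, s) = k (m, s))"
          by (rule eventually_mono) (use \<open>m \<in> {0..}\<close> in auto)
      qed
    qed
    then have "AE m in lebesgue_on {0..}. AE s in lborel. m \<le> s --> (\<forall>x::'a. \<alpha>\<^sub>2 s * \<beta> (m, s) = k (m, s))"
      using AE_lebesgue_on_iff[OF h] by blast
    then show "(\<forall>u\<in>T_dom \<Omega> i r T D a. gain (\<lambda>x m s. \<alpha>\<^sub>2 s * \<beta> (m, s)) u \<in> carr (XX_space \<Omega> i r)) \<or>
        (AE m in lebesgue_on {0..}. AE s in lborel. m \<le> s --> (\<forall>x::'a. \<alpha>\<^sub>2 s * \<beta> (m, s) = k (m, s)))"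
      by (rule disjI2)
  qed
  \<comment> \<open>The kernel is b a, between 0 and the common majorant k since b \<le> \<beta> and
    a \<le> \<open>\<alpha>\<^sub>2\<close>. For i = 0 the gain stays in the space by
    \<open>gain_admissible\<close>.\<close>
  have K: "generates_positive (XX_space \<Omega> i r) (K_op \<Omega> i r T D a b) (T_dom \<Omega> i r T D a)"
    if r: "r\<^sub>1 \<le> r" and b: "fragmentation_assms \<Omega> b"
      and bb: "AE (x, m, s) in lebesgue_on (\<Omega> \<times> {0..} \<times> {0..}). m \<le> s --> b (x, m, s) \<le> \<beta> (m, s)"
      and adm: "gain_admissible \<Omega> i r T D a b" for r b
    unfolding K_op_def
  proof (rule gen[OF r _ refl])
    show "AE m in lebesgue_on {0..}. AE x in lebesgue_on \<Omega>. \<alpha>\<^sub>1 m \<le> a (x, m) \<and> a (x, m) \<le> \<alpha>\<^sub>2 m"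
      using aAE2 by eventually_elim (auto elim: eventually_mono)
    have "(\<lambda>z. b z * a (fst z, snd (snd z))) \<in> borel_measurable (lebesgue_on (\<Omega> \<times> {0..} \<times> {0..}))"
      using b measurable_drop_middle[OF \<Omega>b a_meas] unfolding fragmentation_assms_def by (intro borel_measurable_times) auto
    then show "(\<lambda>z. b (fst z, fst (snd z), snd (snd z)) * a (fst z, snd (snd z))) \<in> borel_measurable (lebesgue_on (\<Omega> \<times> {0..} \<times> {0..}))"
      by simp
    have "AE z in lborel. z \<in> \<Omega> \<times> {0..} --> 0 \<le> a z \<and> a z \<le> \<alpha>\<^sub>2 (snd z)"
      using aAE S2 by (simp add: AE_lebesgue_on_iff) (auto elim: eventually_mono)
    from AE_lborel_drop_middle[OF this]
    have a3: "AE z in (lborel :: ('a \<times> real \<times> real) measure). fst z \<in> \<Omega> \<and> 0 \<le> snd (snd z) -->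
        0 \<le> a (fst z, snd (snd z)) \<and> a (fst z, snd (snd z)) \<le> \<alpha>\<^sub>2 (snd (snd z))"
      by (rule eventually_mono) auto
    have "AE z in lebesgue_on (\<Omega> \<times> {0..} \<times> {0..}). fst (snd z) \<le> snd (snd z) --> b z \<le> \<beta> (snd z)"
      using bb by (simp add: case_prod_beta)
    then have b3: "AE z in lborel. z \<in> \<Omega> \<times> {0..} \<times> {0..} --> fst (snd z) \<le> snd (snd z) --> b z \<le> \<beta> (snd z)"
      by (rule AE_lebesgue_on_iff[OF S3, THEN iffD1])
    show "AE z in lborel. fst z \<in> \<Omega> \<and> 0 \<le> fst (snd z) \<and> fst (snd z) \<le> snd (snd z) -->
        0 \<le> b (fst z, fst (snd z), snd (snd z)) * a (fst z, snd (snd z)) \<and>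
        b (fst z, fst (snd z), snd (snd z)) * a (fst z, snd (snd z)) \<le> k (snd z)"
      using a3 b3 AE_lborel_snd[OF k_eq, where ?'a = 'a]
    proof eventually_elim
      case (elim z)
      show ?case
      proof
        assume z: "fst z \<in> \<Omega> \<and> 0 \<le> fst (snd z) \<and> fst (snd z) \<le> snd (snd z)"
        then have s: "0 \<le> snd (snd z)"
          by linarith
        have b0: "0 \<le> b z"
          using b z s unfolding fragmentation_assms_def by (metis prod.collapse)
        have ba: "0 \<le> a (fst z, snd (snd z))" "a (fst z, snd (snd z)) \<le> \<alpha>\<^sub>2 (snd (snd z))"
          using elim(1) z s by auto
        have bl: "b z \<le> \<beta> (snd z)"
          using elim(2) z s by (auto simp: mem_Times_iff)
        have "b z * a (fst z, snd (snd z)) \<le> \<beta> (snd z) * \<alpha>\<^sub>2 (snd (snd z))"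
          using b0 ba bl by (intro mult_mono) auto
        also have "\<dots> = k (snd z)"
          using elim(3) z s by (simp add: mult.commute)
        finally show "0 \<le> b (fst z, fst (snd z), snd (snd z)) * a (fst z, snd (snd z)) \<and>
            b (fst z, fst (snd z), snd (snd z)) * a (fst z, snd (snd z)) \<le> k (snd z)"
          using b0 ba by simp
      qed
    qed
    show "i = 0 ==> (\<forall>u\<in>T_dom \<Omega> i r T D a. gain (\<lambda>x m s. b (x, m, s) * a (x, s)) u \<in> carr (XX_space \<Omega> i r)) \<or>
        (AE m in lebesgue_on {0..}. AE s in lborel. m \<le> s --> (\<forall>x. b (x, m, s) * a (x, s) = k (m, s)))"
      using adm by (simp add: gain_admissible_def)
  qed
  show ?thesis
    using r\<^sub>1 frak K by (intro exI[of _ r\<^sub>1]) blast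
qed

theorem corollary3p4:
  fixes \<Omega> :: "(real ^ 'n) set" and i :: nat
    and a :: "(real ^ 'n) \<times> real \<Rightarrow> real" and \<alpha>\<^sub>1 \<alpha>\<^sub>2 :: "real \<Rightarrow> real"
    and T :: "real \<Rightarrow> (real ^ 'n \<Rightarrow> real) \<Rightarrow> (real ^ 'n \<Rightarrow> real)"
    and D :: "real \<Rightarrow> (real ^ 'n \<Rightarrow> real) set"
    and G\<^sub>0 :: "real \<Rightarrow> real \<Rightarrow> (real ^ 'n \<Rightarrow> real) \<Rightarrow> (real ^ 'n \<Rightarrow> real)"
    and b :: "(real ^ 'n) \<times> real \<times> real \<Rightarrow> real" and \<beta> :: "real \<times> real \<Rightarrow> real"
    and b\<^sub>0 \<beta>\<^sub>0 l r\<^sub>0 s\<^sub>0 :: real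
  assumes "i \<in> {0, 1}"
    and "admissible_domain \<Omega>"
    and "rate_assms \<Omega> i a \<alpha>\<^sub>1 \<alpha>\<^sub>2"
    and "transport_assms \<Omega> i T D G\<^sub>0"
    and "fragmentation_assms \<Omega> b"
    and "majorant_assms \<beta>"
    and "b\<^sub>0 \<ge> 1" and "l \<ge> 0"
    and "AE (x, s) in lebesgue_on (\<Omega> \<times> {0..}).
           (\<integral>\<^sup>+ m\<in>{0..s}. ennreal (b (x, m, s)) \<partial>lebesgue) \<le> ennreal (b\<^sub>0 * (1 + s powr l))"
    and "\<forall>s\<ge>0. (\<integral>\<^sup>+ m\<in>{0..s}. ennreal (\<beta> (m, s)) \<partial>lebesgue) \<le> ennreal (\<beta>\<^sub>0 * (1 + s powr l))"
    and "r\<^sub>0 \<ge> 0" and "s\<^sub>0 \<ge> 0"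
    and "equi_integrable ((\<lambda>s z. s * z powr r\<^sub>0 * \<beta> (z * s, s)) ` {s\<^sub>0..})"
    and "\<forall>m\<ge>0. \<forall>m'\<ge>0. D m = D m' \<and> (\<forall>f\<in>D m. eqv (X_space \<Omega> i) (T m f) (T m' f))"
  shows "\<exists>r\<^sub>1 > max l r\<^sub>0. \<forall>r \<ge> r\<^sub>1.
           generates_positive (XX_space \<Omega> i r) (frakK_op \<Omega> i r T D \<alpha>\<^sub>1 \<alpha>\<^sub>2 \<beta>) (T_dom \<Omega> i r T D a) \<and>
           ((AE (x, m, s) in lebesgue_on (\<Omega> \<times> {0..} \<times> {0..}). m \<le> s \<longrightarrow> b (x, m, s) \<le> \<beta> (m, s)) \<and>
              gain_admissible \<Omega> i r T D a b \<longrightarrow>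
            generates_positive (XX_space \<Omega> i r) (K_op \<Omega> i r T D a b) (T_dom \<Omega> i r T D a))"
proof -
  have dom: "regular_domain \<Omega>"
    using assms(2) by (auto simp: admissible_domain_def regular_domain_def)
  show ?thesis
  \<comment> \<open>The empty set is open, bounded and has empty frontier, so it is admissible.
    Bounds on the rate that hold for almost every (x, m) are then void and say nothing about the
    sign of \<open>\<alpha>\<^sub>1\<close>, which is why this case is separated.\<close>
  proof (cases "\<Omega> = {}")
    case True
    have "transport_assms {} i T D G\<^sub>0"
      using assms(4) True by simp
    from trivial_generates_positive[OF this] show ?thesis
      unfolding True K_op_def frakK_op_def by (intro exI[of _ "max l r\<^sub>0 + 1"]) simp
  next
    case False
    from fragmentation_generates[OF assms(1) dom False assms(3,4,6,8,11,10,13)]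
    show ?thesis
      using assms(5) by blast
  qed
qed

end
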